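(* Let $\mathcal{A}$ be an AB4-category, let $X:\Box^{op}\to \mathrm{Set}$ be a cubical set, and let $F:(\Box/X)^{op}\to\mathcal{A}$ be a contravariant system of objects in $\mathcal{A}$ on $X$. Then $H_n(X,F)\cong \varinjlim^{(\Box/X)^{op}}_n F$ for all $n\geq 0$.
   Context: **AB4-category.** An Abelian category with all small coproducts in which coproducts are exact (Grothendieck's axioms AB3, AB4). **Satellites of the colimit.** For a small category $\mathscr{C}$ and an AB4-category $\mathcal{A}$, $\varinjlim^{\mathscr{C}}_n:\mathcal{A}^{\mathscr{C}}\to\mathcal{A}$, $n\ge 0$, denote the left satellites (universal homological $\partial$-functor) of $\varinjlim^{\mathscr{C}}:\mathcal{A}^{\mathscr{C}}\to\mathcal{A}$. It is known that they exist and that $\varinjlim^{\mathscr{C}}_nF$ is naturally isomorphic to the $n$-th homology of the chain complex $C_n(\mathscr{C},F)=\bigoplus_{c_0\to\cdots\to c_n}F(c_0)$ with $d_n=\sum_{i=0}^n(-1)^id_n^i$, where $d_n^i$ omits $c_i$ from the sequence (composing morphisms when $0<i<n$), with $F(c_0\to c_1)$ applied for $i=0$. **Cube category.** $\Box$ has objects $\mathbb{I}^n=\{0,1\}^n$, $n\ge 0$ (with the product order); its morphisms are all compositions of the maps $\delta_i^{k,\varepsilon}:\mathbb{I}^{k-1}\to\mathbb{I}^k$, $\delta_i^{k,\varepsilon}(x_1,\dots,x_{k-1})=(x_1,\dots,x_{i-1},\varepsilon,x_i,\dots,x_{k-1})$ and $\sigma_i^k:\mathbb{I}^k\to\mathbb{I}^{k-1}$,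 $\sigma^k_i(x_1,\dots,x_k)=(x_1,\dots,x_{i-1},x_{i+1},\dots,x_k)$ ($k\ge1$, $1\le i\le k$, $\varepsilon\in\{0,1\}$) (and identities). A cubical set is a functor $X:\Box^{op}\to\mathrm{Set}$, $X_n=X(\mathbb{I}^n)$. **Category $\Box/X$.** Objects: elements $x\in\coprod_n X_n$ (equivalently morphisms $\tilde x:\Box^n\to X$ from representable cubical sets $\Box^n=\Box(-,\mathbb{I}^n)$). For $y\in X_m$, $x\in X_n$, morphisms $y\to x$ are the $\alpha\in\Box(\mathbb{I}^m,\mathbb{I}^n)$ with $X(\alpha)(x)=y$. So a functor $F:(\Box/X)^{op}\to\mathcal{A}$ gives morphisms $F(\alpha):F(x)\to F(X(\alpha)x)$. **Homology $H_n(X,F)$.** Put $C_n(X,F)=\bigoplus_{x\in X_n}F(x)$ with coproduct injections $in_x$. Define $d_i^{n,\varepsilon}:C_n(X,F)\to C_{n-1}(X,F)$ by $d_i^{n,\varepsilon}\circ in_x=in_{X(\delta_i^{n,\varepsilon})x}\circ F(\delta_i^{n,\varepsilon})$, and $s_i^n:C_{n-1}(X,F)\to C_n(X,F)$ by $s_i^n\circ in_x=in_{X(\sigma_i^n)x}\circ F(\sigma_i^n)$. (This is the cubical object equal to the left Kan extension of $F$ along the forgetful functor $(\Box/X)^{op}\to\Box^{op}$.) Let $C^{N}_n(X,F)=\mathrm{Coker}\big((s_1^n,\dots,s_n^n):C_{n-1}(X,F)^{\oplus n}\to C_n(X,F)\big)$, with differentials $d_n^N$ induced by $d_n=\sum_{i=1}^n(-1)^i(d_i^{n,0}-d_i^{n,1})$.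 Then $H_n(X,F)$ is the $n$-th homology object of the complex $C^N_*(X,F)$. *)

theory Defs
  imports "HOL-Algebra.FiniteProduct"
begin

section \<open>Categories, functors, colimits\<close>

record ('o, 'm) cat =
  Obj :: "'o set"
  Arr :: "'m set"
  Dom :: "'m \<Rightarrow> 'o"
  Cod :: "'m \<Rightarrow> 'o"
  Ide :: "'o \<Rightarrow> 'm"
  Cmp :: "'m \<Rightarrow> 'm \<Rightarrow> 'm"  \<comment> \<open>\<open>Cmp C g f\<close> is the composite \<open>g \<circ> f\<close>, meaningful if \<open>Cod C f = Dom C g\<close>\<close>

definition Hom :: "('o, 'm, 'z) cat_scheme \<Rightarrow> 'o \<Rightarrow> 'o \<Rightarrow> 'm set" where
  "Hom C a b = {f \<in> Arr C. Dom C f = a \<and> Cod C f = b}"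

locale category =
  fixes C :: "('o, 'm, 'z) cat_scheme"
  assumes Dom_Obj: "f \<in> Arr C \<Longrightarrow> Dom C f \<in> Obj C"
    and Cod_Obj: "f \<in> Arr C \<Longrightarrow> Cod C f \<in> Obj C"
    and Ide_Hom: "a \<in> Obj C \<Longrightarrow> Ide C a \<in> Hom C a a"
    and Cmp_Hom: "f \<in> Hom C a b \<Longrightarrow> g \<in> Hom C b c \<Longrightarrow> Cmp C g f \<in> Hom C a c"
    and Cmp_Ide: "f \<in> Hom C a b \<Longrightarrow> Cmp C f (Ide C a) = f"
    and Ide_Cmp: "f \<in> Hom C a b \<Longrightarrow> Cmp C (Ide C b) f = f"
    and Cmp_assoc: "f \<in> Hom C a b \<Longrightarrow> g \<in> Hom C b c \<Longrightarrow> h \<in> Hom C c d \<Longrightarrow>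
          Cmp C h (Cmp C g f) = Cmp C (Cmp C h g) f"

definition opc :: "('o, 'm, 'z) cat_scheme \<Rightarrow> ('o, 'm, 'z) cat_scheme" where
  "opc C = C\<lparr>Dom := Cod C, Cod := Dom C, Cmp := (\<lambda>g f. Cmp C f g)\<rparr>"

definition isomorphic :: "('o, 'm, 'z) cat_scheme \<Rightarrow> 'o \<Rightarrow> 'o \<Rightarrow> bool" where
  "isomorphic C a b \<longleftrightarrow> a \<in> Obj C \<and> b \<in> Obj C \<and>
     (\<exists>f\<in>Hom C a b. \<exists>g\<in>Hom C b a. Cmp C g f = Ide C a \<and> Cmp C f g = Ide C b)"

definition is_mono :: "('o, 'm, 'z) cat_scheme \<Rightarrow> 'm \<Rightarrow> bool" where
  "is_mono C f \<longleftrightarrow> f \<in> Arr C \<and>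
     (\<forall>u\<in>Arr C. \<forall>v\<in>Arr C. Dom C u = Dom C v \<and> Cod C u = Dom C f \<and> Cod C v = Dom C f \<and>
        Cmp C f u = Cmp C f v \<longrightarrow> u = v)"

definition is_epi :: "('o, 'm, 'z) cat_scheme \<Rightarrow> 'm \<Rightarrow> bool" where
  "is_epi C f \<longleftrightarrow> f \<in> Arr C \<and>
     (\<forall>u\<in>Arr C. \<forall>v\<in>Arr C. Cod C u = Cod C v \<and> Dom C u = Cod C f \<and> Dom C v = Cod C f \<and>
        Cmp C u f = Cmp C v f \<longrightarrow> u = v)"

text \<open>Functors and natural transformations are taken extensional (\<^term>\<open>undefined\<close> off the
  objects and arrows of the source), so that equality in the functor category is equality of
  functors on the source category.\<close>

record ('c, 'f, 'o, 'm) fct =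
  fob :: "'c \<Rightarrow> 'o"
  far :: "'f \<Rightarrow> 'm"

definition is_functor ::
  "('c, 'f, 'y) cat_scheme \<Rightarrow> ('o, 'm, 'z) cat_scheme \<Rightarrow> ('c, 'f, 'o, 'm) fct \<Rightarrow> bool" where
  "is_functor C A F \<longleftrightarrow>
     fob F \<in> extensional (Obj C) \<and> far F \<in> extensional (Arr C) \<and>
     (\<forall>c\<in>Obj C. fob F c \<in> Obj A) \<and>
     (\<forall>f\<in>Arr C. far F f \<in> Hom A (fob F (Dom C f)) (fob F (Cod C f))) \<and>
     (\<forall>c\<in>Obj C. far F (Ide C c) = Ide A (fob F c)) \<and>
     (\<forall>f\<in>Arr C. \<forall>g\<in>Arr C. Cod C f = Dom C g \<longrightarrow>
        far F (Cmp C g f) = Cmp A (far F g) (far F f))"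

definition is_nat_trans ::
  "('c, 'f, 'y) cat_scheme \<Rightarrow> ('o, 'm, 'z) cat_scheme \<Rightarrow>
   ('c, 'f, 'o, 'm) fct \<Rightarrow> ('c, 'f, 'o, 'm) fct \<Rightarrow> ('c \<Rightarrow> 'm) \<Rightarrow> bool" where
  "is_nat_trans C A F G \<tau> \<longleftrightarrow> is_functor C A F \<and> is_functor C A G \<and>
     \<tau> \<in> extensional (Obj C) \<and>
     (\<forall>c\<in>Obj C. \<tau> c \<in> Hom A (fob F c) (fob G c)) \<and>
     (\<forall>f\<in>Arr C. Cmp A (far G f) (\<tau> (Dom C f)) = Cmp A (\<tau> (Cod C f)) (far F f))"

definition is_cocone ::
  "('c, 'f, 'y) cat_scheme \<Rightarrow> ('o, 'm, 'z) cat_scheme \<Rightarrow> ('c, 'f, 'o, 'm) fct \<Rightarrow>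
   'o \<Rightarrow> ('c \<Rightarrow> 'm) \<Rightarrow> bool" where
  "is_cocone C A F L \<eta> \<longleftrightarrow> L \<in> Obj A \<and>
     (\<forall>c\<in>Obj C. \<eta> c \<in> Hom A (fob F c) L) \<and>
     (\<forall>f\<in>Arr C. Cmp A (\<eta> (Cod C f)) (far F f) = \<eta> (Dom C f))"

definition is_colimit ::
  "('c, 'f, 'y) cat_scheme \<Rightarrow> ('o, 'm, 'z) cat_scheme \<Rightarrow> ('c, 'f, 'o, 'm) fct \<Rightarrow>
   'o \<Rightarrow> ('c \<Rightarrow> 'm) \<Rightarrow> bool" where
  "is_colimit C A F L \<eta> \<longleftrightarrow> is_cocone C A F L \<eta> \<and>
     (\<forall>M \<mu>. is_cocone C A F M \<mu> \<longrightarrow>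
        (\<exists>!h. h \<in> Hom A L M \<and> (\<forall>c\<in>Obj C. Cmp A h (\<eta> c) = \<mu> c)))"

definition is_coproduct ::
  "('o, 'm, 'z) cat_scheme \<Rightarrow> 'i set \<Rightarrow> ('i \<Rightarrow> 'o) \<Rightarrow> 'o \<Rightarrow> ('i \<Rightarrow> 'm) \<Rightarrow> bool" where
  "is_coproduct A I D P inc \<longleftrightarrow> P \<in> Obj A \<and> (\<forall>i\<in>I. inc i \<in> Hom A (D i) P) \<and>
     (\<forall>Q\<in>Obj A. \<forall>f. (\<forall>i\<in>I. f i \<in> Hom A (D i) Q) \<longrightarrow>
        (\<exists>!h. h \<in> Hom A P Q \<and> (\<forall>i\<in>I. Cmp A h (inc i) = f i)))"

text \<open>A chosen coproduct; meaningful whenever a coproduct exists.\<close>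

definition coprod_choice ::
  "('o, 'm, 'z) cat_scheme \<Rightarrow> 'i set \<Rightarrow> ('i \<Rightarrow> 'o) \<Rightarrow> 'o \<times> ('i \<Rightarrow> 'm)" where
  "coprod_choice A I D = (SOME p. is_coproduct A I D (fst p) (snd p))"

definition coprod :: "('o, 'm, 'z) cat_scheme \<Rightarrow> 'i set \<Rightarrow> ('i \<Rightarrow> 'o) \<Rightarrow> 'o" where
  "coprod A I D = fst (coprod_choice A I D)"

definition coprod_in :: "('o, 'm, 'z) cat_scheme \<Rightarrow> 'i set \<Rightarrow> ('i \<Rightarrow> 'o) \<Rightarrow> 'i \<Rightarrow> 'm" where
  "coprod_in A I D = snd (coprod_choice A I D)"

text \<open>The morphism \<open>(f\<^sub>i)\<^sub>i : \<Coprod>D\<^sub>i \<rightarrow> Q\<close>.\<close>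

definition copair ::
  "('o, 'm, 'z) cat_scheme \<Rightarrow> 'i set \<Rightarrow> ('i \<Rightarrow> 'o) \<Rightarrow> 'o \<Rightarrow> ('i \<Rightarrow> 'm) \<Rightarrow> 'm" where
  "copair A I D Q f =
     (THE h. h \<in> Hom A (coprod A I D) Q \<and> (\<forall>i\<in>I. Cmp A h (coprod_in A I D i) = f i))"

definition coprod_map ::
  "('o, 'm, 'z) cat_scheme \<Rightarrow> 'i set \<Rightarrow> ('i \<Rightarrow> 'o) \<Rightarrow> ('i \<Rightarrow> 'o) \<Rightarrow> ('i \<Rightarrow> 'm) \<Rightarrow> 'm" where
  "coprod_map A I D E f =
     copair A I D (coprod A I E) (\<lambda>i. Cmp A (coprod_in A I E i) (f i))"


section \<open>Abelian categories and AB4\<close>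

record ('o, 'm) pcat = "('o, 'm) cat" +
  Add :: "'m \<Rightarrow> 'm \<Rightarrow> 'm"
  Zer :: "'o \<Rightarrow> 'o \<Rightarrow> 'm"

definition hom_group :: "('o, 'm, 'z) pcat_scheme \<Rightarrow> 'o \<Rightarrow> 'o \<Rightarrow> 'm monoid" where
  "hom_group A a b = \<lparr>carrier = Hom A a b, mult = Add A, one = Zer A a b\<rparr>"

locale preadditive = category A
  for A :: "('o, 'm, 'z) pcat_scheme" +
  assumes hom_group: "a \<in> Obj A \<Longrightarrow> b \<in> Obj A \<Longrightarrow> comm_group (hom_group A a b)"
    and Cmp_Add_left: "f \<in> Hom A a b \<Longrightarrow> g \<in> Hom A b c \<Longrightarrow> h \<in> Hom A b c \<Longrightarrow>
          Cmp A (Add A g h) f = Add A (Cmp A g f) (Cmp A h f)"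
    and Cmp_Add_right: "f \<in> Hom A a b \<Longrightarrow> g \<in> Hom A a b \<Longrightarrow> h \<in> Hom A b c \<Longrightarrow>
          Cmp A h (Add A f g) = Add A (Cmp A h f) (Cmp A h g)"

definition is_zero_object :: "('o, 'm, 'z) cat_scheme \<Rightarrow> 'o \<Rightarrow> bool" where
  "is_zero_object A z \<longleftrightarrow> z \<in> Obj A \<and>
     (\<forall>a\<in>Obj A. (\<exists>!f. f \<in> Hom A z a) \<and> (\<exists>!f. f \<in> Hom A a z))"

definition zero_object :: "('o, 'm, 'z) cat_scheme \<Rightarrow> 'o" where
  "zero_object A = (SOME z. is_zero_object A z)"

definition is_biproduct ::
  "('o, 'm, 'z) pcat_scheme \<Rightarrow> 'o \<Rightarrow> 'o \<Rightarrow> 'o \<Rightarrow> 'm \<Rightarrow> 'm \<Rightarrow> 'm \<Rightarrow> 'm \<Rightarrow> bool" where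
  "is_biproduct A a b s i j p q \<longleftrightarrow>
     i \<in> Hom A a s \<and> j \<in> Hom A b s \<and> p \<in> Hom A s a \<and> q \<in> Hom A s b \<and>
     Cmp A p i = Ide A a \<and> Cmp A q j = Ide A b \<and>
     Cmp A q i = Zer A a b \<and> Cmp A p j = Zer A b a \<and>
     Add A (Cmp A i p) (Cmp A j q) = Ide A s"

definition is_kernel :: "('o, 'm, 'z) pcat_scheme \<Rightarrow> 'm \<Rightarrow> 'm \<Rightarrow> bool" where
  "is_kernel A g k \<longleftrightarrow> g \<in> Arr A \<and> k \<in> Arr A \<and> Cod A k = Dom A g \<and>
     Cmp A g k = Zer A (Dom A k) (Cod A g) \<and>
     (\<forall>h\<in>Arr A. Cod A h = Dom A g \<and> Cmp A g h = Zer A (Dom A h) (Cod A g) \<longrightarrow>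
        (\<exists>!u. u \<in> Hom A (Dom A h) (Dom A k) \<and> Cmp A k u = h))"

definition is_cokernel :: "('o, 'm, 'z) pcat_scheme \<Rightarrow> 'm \<Rightarrow> 'm \<Rightarrow> bool" where
  "is_cokernel A f q \<longleftrightarrow> f \<in> Arr A \<and> q \<in> Arr A \<and> Dom A q = Cod A f \<and>
     Cmp A q f = Zer A (Dom A f) (Cod A q) \<and>
     (\<forall>h\<in>Arr A. Dom A h = Cod A f \<and> Cmp A h f = Zer A (Dom A f) (Cod A h) \<longrightarrow>
        (\<exists>!u. u \<in> Hom A (Cod A q) (Cod A h) \<and> Cmp A u q = h))"

text \<open>\<open>0 \<rightarrow> a \<rightarrow> b \<rightarrow> c \<rightarrow> 0\<close>, given by \<open>f : a \<rightarrow> b\<close> and \<open>g : b \<rightarrow> c\<close>.\<close>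

definition short_exact :: "('o, 'm, 'z) pcat_scheme \<Rightarrow> 'm \<Rightarrow> 'm \<Rightarrow> bool" where
  "short_exact A f g \<longleftrightarrow> is_kernel A g f \<and> is_cokernel A f g"

text \<open>Exactness of \<open>a \<rightarrow> b \<rightarrow> c\<close> at \<open>b\<close>: the image of \<open>f\<close>, i.e. the kernel of its cokernel,
  is the kernel of \<open>g\<close>.\<close>

definition exact_at :: "('o, 'm, 'z) pcat_scheme \<Rightarrow> 'm \<Rightarrow> 'm \<Rightarrow> bool" where
  "exact_at A f g \<longleftrightarrow> Cod A f = Dom A g \<and>
     (\<exists>q i. is_cokernel A f q \<and> is_kernel A q i \<and> is_kernel A g i)"

locale abelian_category = preadditive A
  for A :: "('o, 'm, 'z) pcat_scheme" +
  assumes ex_zero_object: "\<exists>z. is_zero_object A z"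
    and ex_biproduct: "a \<in> Obj A \<Longrightarrow> b \<in> Obj A \<Longrightarrow> \<exists>s i j p q. is_biproduct A a b s i j p q"
    and ex_kernel: "f \<in> Arr A \<Longrightarrow> \<exists>k. is_kernel A f k"
    and ex_cokernel: "f \<in> Arr A \<Longrightarrow> \<exists>q. is_cokernel A f q"
    and mono_is_kernel: "is_mono A f \<Longrightarrow> \<exists>g. is_kernel A g f"
    and epi_is_cokernel: "is_epi A f \<Longrightarrow> \<exists>g. is_cokernel A g f"

text \<open>HOL has no type of all small sets.  Smallness is relative to the type \<open>'s\<close>, passed as
  \<^term>\<open>TYPE('s)\<close>: small coproducts are those indexed by subsets of \<open>'s\<close> (up to reindexing, by
  sets of cardinality at most that of \<open>'s\<close>).  Such coproducts are required to exist (AB3)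
  and to be exact (AB4).\<close>

definition AB4_category :: "('o, 'm, 'z) pcat_scheme \<Rightarrow> 's itself \<Rightarrow> bool" where
  "AB4_category A (_ :: 's itself) \<longleftrightarrow> abelian_category A \<and>
     (\<forall>(I :: 's set) D. (\<forall>i\<in>I. D i \<in> Obj A) \<longrightarrow> (\<exists>P inc. is_coproduct A I D P inc)) \<and>
     (\<forall>(I :: 's set) D D' D'' f g.
        (\<forall>i\<in>I. f i \<in> Hom A (D i) (D' i) \<and> g i \<in> Hom A (D' i) (D'' i) \<and>
               short_exact A (f i) (g i)) \<longrightarrow>
        short_exact A (coprod_map A I D D' f) (coprod_map A I D' D'' g))"

definition kernel_choice :: "('o, 'm, 'z) pcat_scheme \<Rightarrow> 'm \<Rightarrow> 'm" where
  "kernel_choice A g = (SOME k. is_kernel A g k)"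

definition cokernel_choice :: "('o, 'm, 'z) pcat_scheme \<Rightarrow> 'm \<Rightarrow> 'm" where
  "cokernel_choice A f = (SOME q. is_cokernel A f q)"

text \<open>Homology of \<open>a \<rightarrow> b \<rightarrow> c\<close> at \<open>b\<close> (where \<open>g f = 0\<close>): the cokernel object of the morphism
  \<open>a \<rightarrow> Ker g\<close> induced by \<open>f\<close>.\<close>

definition homology_object :: "('o, 'm, 'z) pcat_scheme \<Rightarrow> 'm \<Rightarrow> 'm \<Rightarrow> 'o" where
  "homology_object A f g =
     (let k = kernel_choice A g;
          f' = (THE u. u \<in> Hom A (Dom A f) (Dom A k) \<and> Cmp A k u = f)
      in Cod A (cokernel_choice A f'))"


section \<open>Functor categories and satellites\<close>

text \<open>An arrow of the functor category is \<open>(F, G, \<tau>)\<close> with \<open>\<tau>\<close> a transformation from \<open>F\<close> to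
  \<open>G\<close>.  The additive structure is pointwise.\<close>

definition Fun ::
  "('c, 'f, 'y) cat_scheme \<Rightarrow> ('o, 'm, 'z) pcat_scheme \<Rightarrow>
   (('c, 'f, 'o, 'm) fct,
    ('c, 'f, 'o, 'm) fct \<times> ('c, 'f, 'o, 'm) fct \<times> ('c \<Rightarrow> 'm)) pcat" where
  "Fun C A = \<lparr>
     Obj = {F. is_functor C A F},
     Arr = {(F, G, \<tau>). is_nat_trans C A F G \<tau>},
     Dom = (\<lambda>(F, G, \<tau>). F),
     Cod = (\<lambda>(F, G, \<tau>). G),
     Ide = (\<lambda>F. (F, F, \<lambda>c\<in>Obj C. Ide A (fob F c))),
     Cmp = (\<lambda>(G, H, \<sigma>) (F, G', \<tau>). (F, H, \<lambda>c\<in>Obj C. Cmp A (\<sigma> c) (\<tau> c))),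
     Add = (\<lambda>(F, G, \<sigma>) (F', G', \<tau>). (F, G, \<lambda>c\<in>Obj C. Add A (\<sigma> c) (\<tau> c))),
     Zer = (\<lambda>F G. (F, G, \<lambda>c\<in>Obj C. Zer A (fob F c) (fob G c)))\<rparr>"

text \<open>\<open>L\<close> is a functor \<open>A\<^sup>C \<rightarrow> A\<close> of colimits; it is determined up to natural isomorphism.\<close>

definition is_colimit_functor ::
  "('c, 'f, 'y) cat_scheme \<Rightarrow> ('o, 'm, 'z) pcat_scheme \<Rightarrow>
   (('c, 'f, 'o, 'm) fct,
    ('c, 'f, 'o, 'm) fct \<times> ('c, 'f, 'o, 'm) fct \<times> ('c \<Rightarrow> 'm), 'o, 'm) fct \<Rightarrow> bool" where
  "is_colimit_functor C A L \<longleftrightarrow> is_functor (Fun C A) A L \<and>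
     (\<exists>\<eta>. (\<forall>F\<in>Obj (Fun C A). is_colimit C A F (fob L F) (\<eta> F)) \<and>
          (\<forall>F G \<tau>. (F, G, \<tau>) \<in> Arr (Fun C A) \<longrightarrow>
             (\<forall>c\<in>Obj C. Cmp A (far L (F, G, \<tau>)) (\<eta> F c) = Cmp A (\<eta> G c) (\<tau> c))))"

definition is_additive ::
  "('b, 'k, 'y) pcat_scheme \<Rightarrow> ('o, 'm, 'z) pcat_scheme \<Rightarrow> ('b, 'k, 'o, 'm) fct \<Rightarrow> bool" where
  "is_additive B A T \<longleftrightarrow>
     (\<forall>f\<in>Arr B. \<forall>g\<in>Arr B. Dom B f = Dom B g \<and> Cod B f = Cod B g \<longrightarrow>
        far T (Add B f g) = Add A (far T f) (far T g))"

text \<open>For a short exact sequence \<open>(f, g)\<close> from \<open>a\<close> to \<open>c\<close>, \<open>\<delta> n f g\<close> is the connecting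
  morphism \<open>T\<^sub>n\<^sub>+\<^sub>1 c \<rightarrow> T\<^sub>n a\<close>.\<close>

definition is_homological_delta_functor ::
  "('b, 'k, 'y) pcat_scheme \<Rightarrow> ('o, 'm, 'z) pcat_scheme \<Rightarrow>
   (nat \<Rightarrow> ('b, 'k, 'o, 'm) fct) \<Rightarrow> (nat \<Rightarrow> 'k \<Rightarrow> 'k \<Rightarrow> 'm) \<Rightarrow> bool" where
  "is_homological_delta_functor B A T \<delta> \<longleftrightarrow>
     (\<forall>n. is_functor B A (T n) \<and> is_additive B A (T n)) \<and>
     (\<forall>n f g. short_exact B f g \<longrightarrow>
        \<delta> n f g \<in> Hom A (fob (T (Suc n)) (Cod B g)) (fob (T n) (Dom B f))) \<and>
     (\<forall>n f g f' g' u v w. short_exact B f g \<and> short_exact B f' g' \<and>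
        u \<in> Hom B (Dom B f) (Dom B f') \<and> v \<in> Hom B (Cod B f) (Cod B f') \<and>
        w \<in> Hom B (Cod B g) (Cod B g') \<and>
        Cmp B v f = Cmp B f' u \<and> Cmp B w g = Cmp B g' v \<longrightarrow>
        Cmp A (far (T n) u) (\<delta> n f g) = Cmp A (\<delta> n f' g') (far (T (Suc n)) w)) \<and>
     (\<forall>f g. short_exact B f g \<longrightarrow>
        (\<forall>n. exact_at A (far (T n) f) (far (T n) g) \<and>
             exact_at A (far (T (Suc n)) g) (\<delta> n f g) \<and>
             exact_at A (\<delta> n f g) (far (T n) f)) \<and>
        is_epi A (far (T 0) g))"

definition is_delta_morphism ::
  "('b, 'k, 'y) pcat_scheme \<Rightarrow> ('o, 'm, 'z) pcat_scheme \<Rightarrow>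
   (nat \<Rightarrow> ('b, 'k, 'o, 'm) fct) \<Rightarrow> (nat \<Rightarrow> 'k \<Rightarrow> 'k \<Rightarrow> 'm) \<Rightarrow>
   (nat \<Rightarrow> ('b, 'k, 'o, 'm) fct) \<Rightarrow> (nat \<Rightarrow> 'k \<Rightarrow> 'k \<Rightarrow> 'm) \<Rightarrow>
   (nat \<Rightarrow> 'b \<Rightarrow> 'm) \<Rightarrow> bool" where
  "is_delta_morphism B A S \<delta>S T \<delta>T \<phi> \<longleftrightarrow>
     (\<forall>n. is_nat_trans B A (S n) (T n) (\<phi> n)) \<and>
     (\<forall>n f g. short_exact B f g \<longrightarrow>
        Cmp A (\<delta>T n f g) (\<phi> (Suc n) (Cod B g)) = Cmp A (\<phi> n (Dom B f)) (\<delta>S n f g))"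

definition is_universal_delta_functor ::
  "('b, 'k, 'y) pcat_scheme \<Rightarrow> ('o, 'm, 'z) pcat_scheme \<Rightarrow>
   (nat \<Rightarrow> ('b, 'k, 'o, 'm) fct) \<Rightarrow> (nat \<Rightarrow> 'k \<Rightarrow> 'k \<Rightarrow> 'm) \<Rightarrow> bool" where
  "is_universal_delta_functor B A T \<delta>T \<longleftrightarrow> is_homological_delta_functor B A T \<delta>T \<and>
     (\<forall>S \<delta>S \<psi>. is_homological_delta_functor B A S \<delta>S \<and> is_nat_trans B A (S 0) (T 0) \<psi> \<longrightarrow>
        (\<exists>!\<phi>. is_delta_morphism B A S \<delta>S T \<delta>T \<phi> \<and> \<phi> 0 = \<psi>))"

definition are_left_satellites ::
  "('b, 'k, 'y) pcat_scheme \<Rightarrow> ('o, 'm, 'z) pcat_scheme \<Rightarrow> ('b, 'k, 'o, 'm) fct \<Rightarrow>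
   (nat \<Rightarrow> ('b, 'k, 'o, 'm) fct) \<Rightarrow> (nat \<Rightarrow> 'k \<Rightarrow> 'k \<Rightarrow> 'm) \<Rightarrow> bool" where
  "are_left_satellites B A L T \<delta> \<longleftrightarrow> is_universal_delta_functor B A T \<delta> \<and> T 0 = L"


section \<open>The cube category and cubical sets\<close>

text \<open>The object \<open>{0,1}\<^sup>n\<close> is represented by \<open>n\<close>; its points are the boolean lists of length \<open>n\<close>.
  A map \<open>{0,1}\<^sup>m \<rightarrow> {0,1}\<^sup>n\<close> is a triple \<open>(m, n, f)\<close>, with \<open>f\<close> \<^term>\<open>undefined\<close> off \<open>{0,1}\<^sup>m\<close>.\<close>

type_synonym cube_map = "nat \<times> nat \<times> (bool list \<Rightarrow> bool list)"

definition cube :: "nat \<Rightarrow> bool list set" where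
  "cube n = {xs. length xs = n}"

definition face :: "nat \<Rightarrow> nat \<Rightarrow> bool \<Rightarrow> cube_map" where
  "face k i \<epsilon> = (k - 1, k, \<lambda>xs\<in>cube (k - 1). take (i - 1) xs @ \<epsilon> # drop (i - 1) xs)"

definition degen :: "nat \<Rightarrow> nat \<Rightarrow> cube_map" where
  "degen k i = (k, k - 1, \<lambda>xs\<in>cube k. take (i - 1) xs @ drop i xs)"

definition cube_id :: "nat \<Rightarrow> cube_map" where
  "cube_id n = (n, n, \<lambda>xs\<in>cube n. xs)"

definition cube_comp :: "cube_map \<Rightarrow> cube_map \<Rightarrow> cube_map" where
  "cube_comp = (\<lambda>(m', n, g) (l, m, f). (l, n, compose (cube l) g f))"

inductive_set cube_maps :: "cube_map set" where
  id: "cube_id n \<in> cube_maps"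
| face: "1 \<le> i \<Longrightarrow> i \<le> k \<Longrightarrow> face k i \<epsilon> \<in> cube_maps"
| degen: "1 \<le> i \<Longrightarrow> i \<le> k \<Longrightarrow> degen k i \<in> cube_maps"
| comp: "(l, m, f) \<in> cube_maps \<Longrightarrow> (m, n, g) \<in> cube_maps \<Longrightarrow>
          cube_comp (m, n, g) (l, m, f) \<in> cube_maps"

definition Box :: "(nat, cube_map) cat" where
  "Box = \<lparr>Obj = UNIV, Arr = cube_maps, Dom = fst, Cod = fst \<circ> snd,
          Ide = cube_id, Cmp = cube_comp\<rparr>"

record 's cset =
  cells :: "nat \<Rightarrow> 's set"
  act :: "cube_map \<Rightarrow> 's \<Rightarrow> 's"  \<comment> \<open>for \<open>\<alpha> : m \<rightarrow> n\<close> in the cube category, \<open>act X \<alpha> : X\<^sub>n \<rightarrow> X\<^sub>m\<close>\<close>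

definition is_cubical_set :: "'s cset \<Rightarrow> bool" where
  "is_cubical_set X \<longleftrightarrow>
     (\<forall>\<alpha>\<in>Arr Box. act X \<alpha> \<in> cells X (Cod Box \<alpha>) \<rightarrow> cells X (Dom Box \<alpha>)) \<and>
     (\<forall>n. \<forall>x\<in>cells X n. act X (Ide Box n) x = x) \<and>
     (\<forall>\<alpha>\<in>Arr Box. \<forall>\<beta>\<in>Arr Box. Cod Box \<alpha> = Dom Box \<beta> \<longrightarrow>
        (\<forall>x\<in>cells X (Cod Box \<beta>). act X (Cmp Box \<beta> \<alpha>) x = act X \<alpha> (act X \<beta> x)))"

text \<open>The category of elements of \<open>X\<close>.  The element \<open>x \<in> X\<^sub>n\<close> is tagged as \<open>(n, x)\<close>, since the
  sets \<open>X\<^sub>n\<close> need not be disjoint.  The triple \<open>(y, \<alpha>, x)\<close> is the morphism \<open>\<alpha> : y \<rightarrow> x\<close>, where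
  \<open>X(\<alpha>)(x) = y\<close>.\<close>

definition elts ::
  "'s cset \<Rightarrow> (nat \<times> 's, (nat \<times> 's) \<times> cube_map \<times> (nat \<times> 's)) cat" where
  "elts X = \<lparr>
     Obj = {(n, x). x \<in> cells X n},
     Arr = {((m, y), \<alpha>, (n, x)). \<alpha> \<in> Hom Box m n \<and> x \<in> cells X n \<and> y = act X \<alpha> x},
     Dom = (\<lambda>(y, \<alpha>, x). y),
     Cod = (\<lambda>(y, \<alpha>, x). x),
     Ide = (\<lambda>(n, x). ((n, x), Ide Box n, (n, x))),
     Cmp = (\<lambda>(y', \<beta>, z) (x, \<alpha>, y). (x, Cmp Box \<beta> \<alpha>, z))\<rparr>"

definition lift :: "'s cset \<Rightarrow> cube_map \<Rightarrow> 's \<Rightarrow> (nat \<times> 's) \<times> cube_map \<times> (nat \<times> 's)" where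
  "lift X \<alpha> x = ((Dom Box \<alpha>, act X \<alpha> x), \<alpha>, (Cod Box \<alpha>, x))"


section \<open>Homology of a cubical set with coefficients\<close>

type_synonym ('s, 'o, 'm) csystem =
  "(nat \<times> 's, (nat \<times> 's) \<times> cube_map \<times> (nat \<times> 's), 'o, 'm) fct"

definition chain :: "('o, 'm, 'z) pcat_scheme \<Rightarrow> 's cset \<Rightarrow> ('s, 'o, 'm) csystem \<Rightarrow> nat \<Rightarrow> 'o" where
  "chain A X F n = coprod A (cells X n) (\<lambda>x. fob F (n, x))"

definition chain_in ::
  "('o, 'm, 'z) pcat_scheme \<Rightarrow> 's cset \<Rightarrow> ('s, 'o, 'm) csystem \<Rightarrow> nat \<Rightarrow> 's \<Rightarrow> 'm" where
  "chain_in A X F n = coprod_in A (cells X n) (\<lambda>x. fob F (n, x))"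

text \<open>For \<open>\<alpha> : m \<rightarrow> n\<close>, the morphism \<open>C\<^sub>n(X,F) \<rightarrow> C\<^sub>m(X,F)\<close> with \<open>in\<^sub>x\<close> going to
  \<open>in\<^sub>X\<^sub>(\<^sub>\<alpha>\<^sub>)\<^sub>x \<circ> F(\<alpha>)\<close>.\<close>

definition chain_map ::
  "('o, 'm, 'z) pcat_scheme \<Rightarrow> 's cset \<Rightarrow> ('s, 'o, 'm) csystem \<Rightarrow> cube_map \<Rightarrow> 'm" where
  "chain_map A X F \<alpha> =
     copair A (cells X (Cod Box \<alpha>)) (\<lambda>x. fob F (Cod Box \<alpha>, x)) (chain A X F (Dom Box \<alpha>))
       (\<lambda>x. Cmp A (chain_in A X F (Dom Box \<alpha>) (act X \<alpha> x)) (far F (lift X \<alpha> x)))"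

text \<open>\<open>\<Sum>\<^sub>i (-1)\<^sup>i (d\<^sub>i\<^sup>0 - d\<^sub>i\<^sup>1)\<close>; the abelian group of morphisms is written
  multiplicatively.\<close>

definition boundary ::
  "('o, 'm, 'z) pcat_scheme \<Rightarrow> 's cset \<Rightarrow> ('s, 'o, 'm) csystem \<Rightarrow> nat \<Rightarrow> 'm" where
  "boundary A X F n =
     (let G = hom_group A (chain A X F n) (chain A X F (n - 1)) in
      \<Otimes>\<^bsub>G\<^esub>i\<in>{1..n}. (chain_map A X F (face n i False) \<otimes>\<^bsub>G\<^esub>
                     inv\<^bsub>G\<^esub> (chain_map A X F (face n i True))) [^]\<^bsub>G\<^esub> ((-1::int) ^ i))"

text \<open>The projection \<open>C\<^sub>n \<rightarrow> C\<^sup>N\<^sub>n\<close>.  For \<open>n = 0\<close> the source of the map that is factored out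
  is an empty coproduct.\<close>

definition norm_proj ::
  "('o, 'm, 'z) pcat_scheme \<Rightarrow> 's cset \<Rightarrow> ('s, 'o, 'm) csystem \<Rightarrow> nat \<Rightarrow> 'm" where
  "norm_proj A X F n =
     cokernel_choice A (copair A {1..n} (\<lambda>_. chain A X F (n - 1)) (chain A X F n)
       (\<lambda>i. chain_map A X F (degen n i)))"

definition norm_chain ::
  "('o, 'm, 'z) pcat_scheme \<Rightarrow> 's cset \<Rightarrow> ('s, 'o, 'm) csystem \<Rightarrow> nat \<Rightarrow> 'o" where
  "norm_chain A X F n = Cod A (norm_proj A X F n)"

definition norm_boundary ::
  "('o, 'm, 'z) pcat_scheme \<Rightarrow> 's cset \<Rightarrow> ('s, 'o, 'm) csystem \<Rightarrow> nat \<Rightarrow> 'm" where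
  "norm_boundary A X F n =
     (if n = 0 then Zer A (norm_chain A X F 0) (zero_object A)
      else (THE h. h \<in> Hom A (norm_chain A X F n) (norm_chain A X F (n - 1)) \<and>
              Cmp A h (norm_proj A X F n) =
              Cmp A (norm_proj A X F (n - 1)) (boundary A X F n)))"

definition cubical_homology ::
  "('o, 'm, 'z) pcat_scheme \<Rightarrow> 's cset \<Rightarrow> ('s, 'o, 'm) csystem \<Rightarrow> nat \<Rightarrow> 'o" where
  "cubical_homology A X F n =
     homology_object A (norm_boundary A X F (Suc n)) (norm_boundary A X F n)"

end

theory Submission
  imports Defs "HOL-Algebra.Free_Abelian_Groups" "HOL-Library.Countable"
begin

text \<open>
  Let \<open>C = (\<box>/X)\<^sup>o\<^sup>p\<close>.  Every \<open>F : C \<rightarrow> A\<close> is a quotient of \<open>(P F)(c) = \<Coprod> F(c')\<close>, the coproduct over all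
  arrows \<open>c' \<rightarrow> c\<close>; write \<open>\<epsilon> : P F \<rightarrow> F\<close> and \<open>K = Ker \<epsilon>\<close>.  Both sides of the isomorphism vanish on \<open>P F\<close> in
  positive degrees, so a long exact sequence describes both in degree \<open>n + 1\<close> at \<open>F\<close> by degree \<open>n\<close> at \<open>K\<close>
  and \<open>P F\<close>, and induction reduces everything to degree \<open>0\<close>.

  For the satellites the vanishing comes from universality: the transformations \<open>T\<^sub>n(\<epsilon>)\<close> form a
  morphism of \<open>\<partial>\<close>-functors \<open>T P \<rightarrow> T\<close>, as does the family that agrees with it in degree \<open>0\<close> and is zero
  in positive degrees.  So \<open>T\<^sub>n(\<epsilon>) = 0\<close> for \<open>n > 0\<close>, while \<open>\<epsilon>\<close> splits on the functors \<open>P F\<close>.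

  The normalized cubical chains are exact in \<open>F\<close> because they are a natural direct summand of the
  coproducts \<open>C\<^sub>n(X,F)\<close>, which are exact by AB4.  On \<open>P F\<close> they split as a coproduct of normalized chains of
  standard cubes with coefficients in the objects \<open>F(x)\<close>, and standard cubes are contractible modulo
  degenerate chains.  In degree \<open>0\<close> the homology is the colimit since the vertices of every cube are
  connected by edges.
\<close>

section \<open>Categories\<close>

text \<open>\<open>A\<close> is not assumed to have projectives, and the satellites are known only
  through their universal property, so \<open>Pf\<close> takes over the role of a projective cover.
  What makes it usable is that it is functorial and exact by AB4: \<open>T\<close> composed with
  \<open>Pf\<close> is again a homological \<partial>-functor, to which universality applies.
  Cubical homology is never made into a \<partial>-functor. Its object in degree n + 1 at
  \<open>F\<close> is identified with the kernel of the arrow that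
  \<open>K \<rightarrow> Pf F\<close> induces between cokernels of differentials. For n > 0 that
  kernel is also the object in degree n at \<open>K\<close>; for n = 0 the cokernels are colimits,
  and the satellite in degree 1 is the same kernel. Hence only objects up to isomorphism pass
  through the induction, and naturality of the comparison matters in degree 0 alone. Dividing by
  degenerate cubes is forced: without it the chains of a point have homology in every degree. Since
  there are no connections, a variable coordinate cannot be moved to 0; its faces make up for this
  modulo degenerate maps.\<close>

lemma Hom_iff: "f \<in> Hom C a b \<longleftrightarrow> f \<in> Arr C \<and> Dom C f = a \<and> Cod C f = b"
  by (simp add: Hom_def)

context category
begin

lemma Obj_Dom [simp]: "f \<in> Arr C \<Longrightarrow> Dom C f \<in> Obj C"
  and Obj_Cod [simp]: "f \<in> Arr C \<Longrightarrow> Cod C f \<in> Obj C"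
  by (rule Dom_Obj Cod_Obj; assumption)+

lemma Arr_Ide [simp]: "a \<in> Obj C \<Longrightarrow> Ide C a \<in> Arr C"
  and Dom_Ide [simp]: "a \<in> Obj C \<Longrightarrow> Dom C (Ide C a) = a"
  and Cod_Ide [simp]: "a \<in> Obj C \<Longrightarrow> Cod C (Ide C a) = a"
  using Ide_Hom by (auto simp: Hom_iff)

lemma Arr_Cmp [simp]: "f \<in> Arr C \<Longrightarrow> g \<in> Arr C \<Longrightarrow> Cod C f = Dom C g \<Longrightarrow> Cmp C g f \<in> Arr C"
  and Dom_Cmp [simp]: "f \<in> Arr C \<Longrightarrow> g \<in> Arr C \<Longrightarrow> Cod C f = Dom C g \<Longrightarrow> Dom C (Cmp C g f) = Dom C f"
  and Cod_Cmp [simp]: "f \<in> Arr C \<Longrightarrow> g \<in> Arr C \<Longrightarrow> Cod C f = Dom C g \<Longrightarrow> Cod C (Cmp C g f) = Cod C g"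
  using Cmp_Hom[of f "Dom C f" "Cod C f" g "Cod C g"] by (auto simp: Hom_iff)

lemma Cmp_Ide_right [simp]: "f \<in> Arr C \<Longrightarrow> a = Dom C f \<Longrightarrow> Cmp C f (Ide C a) = f"
  and Cmp_Ide_left [simp]: "f \<in> Arr C \<Longrightarrow> a = Cod C f \<Longrightarrow> Cmp C (Ide C a) f = f"
  using Cmp_Ide Ide_Cmp by (auto simp: Hom_iff)

lemma assoc [simp]: "f \<in> Arr C \<Longrightarrow> g \<in> Arr C \<Longrightarrow> h \<in> Arr C \<Longrightarrow> Cod C f = Dom C g \<Longrightarrow> Cod C g = Dom C h \<Longrightarrow>
    Cmp C (Cmp C h g) f = Cmp C h (Cmp C g f)"
  using Cmp_assoc[of f "Dom C f" "Cod C f" g "Cod C g" h "Cod C h"] by (auto simp: Hom_iff)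

text \<open>The simplifier associates composites to the right, which hides the left side of \<open>g f = k\<close> in
  \<open>g (f x)\<close>; hence this form.\<close>

lemma Cmp_eq_extend: "Cmp C g f = k \<Longrightarrow> x \<in> Arr C \<Longrightarrow> f \<in> Arr C \<Longrightarrow> g \<in> Arr C \<Longrightarrow>
    Cod C x = Dom C f \<Longrightarrow> Cod C f = Dom C g \<Longrightarrow> Cmp C g (Cmp C f x) = Cmp C k x"
  by (metis assoc)

lemma mono_cancel: "is_mono C m \<Longrightarrow> u \<in> Arr C \<Longrightarrow> v \<in> Arr C \<Longrightarrow> Dom C u = Dom C v \<Longrightarrow>
    Cod C u = Dom C m \<Longrightarrow> Cod C v = Dom C m \<Longrightarrow> Cmp C m u = Cmp C m v \<Longrightarrow> u = v"
  by (auto simp: is_mono_def)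

lemma epi_cancel: "is_epi C e \<Longrightarrow> u \<in> Arr C \<Longrightarrow> v \<in> Arr C \<Longrightarrow> Cod C u = Cod C v \<Longrightarrow>
    Dom C u = Cod C e \<Longrightarrow> Dom C v = Cod C e \<Longrightarrow> Cmp C u e = Cmp C v e \<Longrightarrow> u = v"
  by (auto simp: is_epi_def)

lemma mono_Arr: "is_mono C m \<Longrightarrow> m \<in> Arr C" by (simp add: is_mono_def)
lemma epi_Arr: "is_epi C m \<Longrightarrow> m \<in> Arr C" by (simp add: is_epi_def)

lemma epi_Ide: "a \<in> Obj C \<Longrightarrow> is_epi C (Ide C a)"
  unfolding is_epi_def by (metis Arr_Ide Cmp_Ide_right Cod_Ide)

lemma epi_Cmp: "is_epi C f \<Longrightarrow> is_epi C g \<Longrightarrow> Cod C f = Dom C g \<Longrightarrow> is_epi C (Cmp C g f)"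
proof -
  assume f: "is_epi C f" and g: "is_epi C g" and c: "Cod C f = Dom C g"
  have a: "f \<in> Arr C" "g \<in> Arr C" using f g by (auto simp: is_epi_def)
  show ?thesis unfolding is_epi_def
  proof (intro conjI ballI impI)
    fix u v assume "u \<in> Arr C" "v \<in> Arr C" "Cod C u = Cod C v \<and> Dom C u = Cod C (Cmp C g f) \<and>
       Dom C v = Cod C (Cmp C g f) \<and> Cmp C u (Cmp C g f) = Cmp C v (Cmp C g f)"
    then show "u = v" using a c
      by (intro epi_cancel[OF g, of u v] epi_cancel[OF f, of "Cmp C u g" "Cmp C v g"]) simp_all
  qed (use a c in auto)
qed

lemma epi_left:
  assumes a: "g \<in> Arr C" "f \<in> Arr C" "Cod C f = Dom C g" and e: "is_epi C (Cmp C g f)"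
  shows "is_epi C g"
  unfolding is_epi_def
proof (intro conjI ballI impI)
  fix u v assume u: "u \<in> Arr C" "v \<in> Arr C"
       "Cod C u = Cod C v \<and> Dom C u = Cod C g \<and> Dom C v = Cod C g \<and> Cmp C u g = Cmp C v g"
  have "Cmp C u (Cmp C g f) = Cmp C v (Cmp C g f)"
    using a u assoc[of f g u] assoc[of f g v] by simp
  then show "u = v" using a u by (intro epi_cancel[OF e, of u v]) simp_all
qed (rule a)

lemma isomorphicI:
  assumes "f \<in> Arr C" "g \<in> Arr C" "Dom C f = a" "Cod C f = b" "Dom C g = b" "Cod C g = a"
    "Cmp C g f = Ide C a" "Cmp C f g = Ide C b"
  shows "isomorphic C a b"
proof -
  have "a \<in> Obj C" "b \<in> Obj C" using assms(1,3,4) Dom_Obj[of f] Cod_Obj[of f] by simp_all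
  moreover have "f \<in> Hom C a b" "g \<in> Hom C b a" using assms by (simp_all add: Hom_def)
  ultimately show ?thesis using assms(7,8) unfolding isomorphic_def by blast
qed

lemma iso_sym: "isomorphic C a b \<Longrightarrow> isomorphic C b a"
  by (auto simp: isomorphic_def)

lemma iso_trans: assumes "isomorphic C a b" "isomorphic C b c" shows "isomorphic C a c"
proof -
  obtain f g where f: "f \<in> Hom C a b" "g \<in> Hom C b a" "Cmp C g f = Ide C a" "Cmp C f g = Ide C b"
    using assms(1) by (auto simp: isomorphic_def)
  obtain h k where h: "h \<in> Hom C b c" "k \<in> Hom C c b" "Cmp C k h = Ide C b" "Cmp C h k = Ide C c"
    using assms(2) by (auto simp: isomorphic_def)
  have "Cmp C h f \<in> Hom C a c" "Cmp C g k \<in> Hom C c a" using f h by (auto simp: Hom_iff)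
  moreover have "Cmp C (Cmp C g k) (Cmp C h f) = Ide C a"
    using f h Cmp_eq_extend[OF h(3), of f] by (auto simp: Hom_iff)
  moreover have "Cmp C (Cmp C h f) (Cmp C g k) = Ide C c"
    using f h Cmp_eq_extend[OF f(4), of k] by (auto simp: Hom_iff)
  ultimately show ?thesis using assms unfolding isomorphic_def by blast
qed

end

lemma category_opc: "category C \<Longrightarrow> category (opc C)"
  unfolding category_def opc_def Hom_def by auto

section \<open>Preadditive categories\<close>

definition Neg :: "('o, 'm, 'z) pcat_scheme \<Rightarrow> 'm \<Rightarrow> 'm" where
  "Neg A f = inv\<^bsub>hom_group A (Dom A f) (Cod A f)\<^esub> f"

definition Sub :: "('o, 'm, 'z) pcat_scheme \<Rightarrow> 'm \<Rightarrow> 'm \<Rightarrow> 'm" where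
  "Sub A f g = Add A f (Neg A g)"

text \<open>The endpoints stay implicit, so that a vanishing composite can be carried through a
  diagram chase without naming objects.\<close>

definition is_zero :: "('o, 'm, 'z) pcat_scheme \<Rightarrow> 'm \<Rightarrow> bool" where
  "is_zero A f \<longleftrightarrow> f = Zer A (Dom A f) (Cod A f)"

context preadditive
begin

lemma hom_group_simps [simp]:
  "carrier (hom_group A a b) = Hom A a b" "mult (hom_group A a b) = Add A"
  "one (hom_group A a b) = Zer A a b"
  by (simp_all add: hom_group_def)

lemma hom_comm_group: "a \<in> Obj A \<Longrightarrow> b \<in> Obj A \<Longrightarrow> comm_group (hom_group A a b)"
  by (rule hom_group)

lemma Arr_Zer [simp]: "a \<in> Obj A \<Longrightarrow> b \<in> Obj A \<Longrightarrow> Zer A a b \<in> Arr A"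
  and Dom_Zer [simp]: "a \<in> Obj A \<Longrightarrow> b \<in> Obj A \<Longrightarrow> Dom A (Zer A a b) = a"
  and Cod_Zer [simp]: "a \<in> Obj A \<Longrightarrow> b \<in> Obj A \<Longrightarrow> Cod A (Zer A a b) = b"
proof -
  assume ab: "a \<in> Obj A" "b \<in> Obj A"
  interpret G: comm_group "hom_group A a b" by (rule hom_comm_group[OF ab])
  show "Zer A a b \<in> Arr A" "Dom A (Zer A a b) = a" "Cod A (Zer A a b) = b"
    using G.one_closed by (auto simp: Hom_iff)
qed

lemma Arr_Add [simp]: "f \<in> Arr A \<Longrightarrow> g \<in> Arr A \<Longrightarrow> Dom A f = Dom A g \<Longrightarrow> Cod A f = Cod A g \<Longrightarrow> Add A f g \<in> Arr A"
  and Dom_Add [simp]: "f \<in> Arr A \<Longrightarrow> g \<in> Arr A \<Longrightarrow> Dom A f = Dom A g \<Longrightarrow> Cod A f = Cod A g \<Longrightarrow> Dom A (Add A f g) = Dom A g"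
  and Cod_Add [simp]: "f \<in> Arr A \<Longrightarrow> g \<in> Arr A \<Longrightarrow> Dom A f = Dom A g \<Longrightarrow> Cod A f = Cod A g \<Longrightarrow> Cod A (Add A f g) = Cod A g"
proof -
  assume ab: "f \<in> Arr A" "g \<in> Arr A" "Dom A f = Dom A g" "Cod A f = Cod A g"
  interpret G: comm_group "hom_group A (Dom A g) (Cod A g)" by (rule hom_comm_group) (use ab in auto)
  show "Add A f g \<in> Arr A" "Dom A (Add A f g) = Dom A g" "Cod A (Add A f g) = Cod A g"
    using G.m_closed[of f g] ab by (auto simp: Hom_iff)
qed

lemma Arr_Neg [simp]: "f \<in> Arr A \<Longrightarrow> Neg A f \<in> Arr A"
  and Dom_Neg [simp]: "f \<in> Arr A \<Longrightarrow> Dom A (Neg A f) = Dom A f"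
  and Cod_Neg [simp]: "f \<in> Arr A \<Longrightarrow> Cod A (Neg A f) = Cod A f"
  and Add_Neg [simp]: "f \<in> Arr A \<Longrightarrow> Add A f (Neg A f) = Zer A (Dom A f) (Cod A f)"
  and Neg_Add [simp]: "f \<in> Arr A \<Longrightarrow> Add A (Neg A f) f = Zer A (Dom A f) (Cod A f)"
proof -
  assume f: "f \<in> Arr A"
  interpret G: comm_group "hom_group A (Dom A f) (Cod A f)" by (rule hom_comm_group) (use f in auto)
  show "Neg A f \<in> Arr A" "Dom A (Neg A f) = Dom A f" "Cod A (Neg A f) = Cod A f"
    "Add A f (Neg A f) = Zer A (Dom A f) (Cod A f)"  "Add A (Neg A f) f = Zer A (Dom A f) (Cod A f)"
    using G.inv_closed[of f] G.r_inv[of f] G.l_inv[of f] f unfolding Neg_def by (auto simp: Hom_iff)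
qed

lemma Add_assoc: "f \<in> Arr A \<Longrightarrow> g \<in> Arr A \<Longrightarrow> h \<in> Arr A \<Longrightarrow> Dom A f = Dom A g \<Longrightarrow> Cod A f = Cod A g \<Longrightarrow>
   Dom A g = Dom A h \<Longrightarrow> Cod A g = Cod A h \<Longrightarrow> Add A (Add A f g) h = Add A f (Add A g h)"
proof -
  assume ab: "f \<in> Arr A" "g \<in> Arr A" "h \<in> Arr A" "Dom A f = Dom A g" "Cod A f = Cod A g"
   "Dom A g = Dom A h" "Cod A g = Cod A h"
  interpret G: comm_group "hom_group A (Dom A g) (Cod A g)" by (rule hom_comm_group) (use ab in auto)
  show ?thesis using G.m_assoc[of f g h] ab by (auto simp: Hom_iff)
qed

lemma Add_Zer_right [simp]: "f \<in> Arr A \<Longrightarrow> a = Dom A f \<Longrightarrow> b = Cod A f \<Longrightarrow> Add A f (Zer A a b) = f"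
  and Add_Zer_left [simp]: "f \<in> Arr A \<Longrightarrow> a = Dom A f \<Longrightarrow> b = Cod A f \<Longrightarrow> Add A (Zer A a b) f = f"
proof -
  assume ab: "f \<in> Arr A" "a = Dom A f" "b = Cod A f"
  interpret G: comm_group "hom_group A (Dom A f) (Cod A f)" by (rule hom_comm_group) (use ab in auto)
  show "Add A f (Zer A a b) = f" "Add A (Zer A a b) f = f" using G.r_one[of f] G.l_one[of f] ab by (auto simp: Hom_iff)
qed

lemma Add_cancel: "f \<in> Arr A \<Longrightarrow> g \<in> Arr A \<Longrightarrow> h \<in> Arr A \<Longrightarrow> Dom A f = Dom A g \<Longrightarrow> Cod A f = Cod A g \<Longrightarrow>
   Dom A h = Dom A g \<Longrightarrow> Cod A h = Cod A g \<Longrightarrow> Add A f g = Add A f h \<longleftrightarrow> g = h"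
proof -
  assume ab: "f \<in> Arr A" "g \<in> Arr A" "h \<in> Arr A" "Dom A f = Dom A g" "Cod A f = Cod A g"
   "Dom A h = Dom A g" "Cod A h = Cod A g"
  interpret G: comm_group "hom_group A (Dom A g) (Cod A g)" by (rule hom_comm_group) (use ab in auto)
  show ?thesis using G.Units_l_cancel[of f g h] ab by (auto simp: Hom_iff)
qed

lemma Cmp_AddL: "f \<in> Arr A \<Longrightarrow> g \<in> Arr A \<Longrightarrow> h \<in> Arr A \<Longrightarrow> Cod A f = Dom A g \<Longrightarrow> Dom A h = Dom A g \<Longrightarrow>
    Cod A h = Cod A g \<Longrightarrow> Cmp A (Add A g h) f = Add A (Cmp A g f) (Cmp A h f)"
  by (rule Cmp_Add_left[of f "Dom A f" "Cod A f" g "Cod A g" h]) (auto simp: Hom_iff)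

lemma Cmp_AddR: "f \<in> Arr A \<Longrightarrow> g \<in> Arr A \<Longrightarrow> h \<in> Arr A \<Longrightarrow> Cod A f = Dom A h \<Longrightarrow> Dom A f = Dom A g \<Longrightarrow>
    Cod A f = Cod A g \<Longrightarrow> Cmp A h (Add A f g) = Add A (Cmp A h f) (Cmp A h g)"
  by (rule Cmp_Add_right[of f "Dom A f" "Cod A f" g h "Cod A h"]) (auto simp: Hom_iff)

lemma Cmp_Zer_right [simp]: "f \<in> Arr A \<Longrightarrow> a \<in> Obj A \<Longrightarrow> b = Dom A f \<Longrightarrow> Cmp A f (Zer A a b) = Zer A a (Cod A f)"
proof -
  assume f: "f \<in> Arr A" "a \<in> Obj A" "b = Dom A f"
  let ?z = "Zer A a (Dom A f)"
  \<comment> \<open>The composite equals its own double, because zero does; cancelling one copy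
    leaves zero.\<close>
  have "Add A (Cmp A f ?z) (Cmp A f ?z) = Add A (Cmp A f ?z) (Zer A a (Cod A f))"
    using f by (simp flip: Cmp_AddR)
  then show ?thesis using f by (subst (asm) Add_cancel) auto
qed

lemma Cmp_Zer_left [simp]: "f \<in> Arr A \<Longrightarrow> b \<in> Obj A \<Longrightarrow> a = Cod A f \<Longrightarrow> Cmp A (Zer A a b) f = Zer A (Dom A f) b"
proof -
  assume f: "f \<in> Arr A" "b \<in> Obj A" "a = Cod A f"
  let ?z = "Zer A (Cod A f) b"
  have "Add A (Cmp A ?z f) (Cmp A ?z f) = Add A (Cmp A ?z f) (Zer A (Dom A f) b)"
    using f by (simp flip: Cmp_AddL)
  then show ?thesis using f by (subst (asm) Add_cancel) auto
qed

lemma Neg_unique: "f \<in> Arr A \<Longrightarrow> g \<in> Arr A \<Longrightarrow> Dom A f = Dom A g \<Longrightarrow> Cod A f = Cod A g \<Longrightarrow>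
    Add A f g = Zer A (Dom A f) (Cod A f) \<Longrightarrow> g = Neg A f"
  using Add_cancel[of f "g" "Neg A f"] by simp

lemma Cmp_Neg_right [simp]: "f \<in> Arr A \<Longrightarrow> h \<in> Arr A \<Longrightarrow> Cod A f = Dom A h \<Longrightarrow> Cmp A h (Neg A f) = Neg A (Cmp A h f)"
  by (rule Neg_unique) (auto simp flip: Cmp_AddR)

lemma Cmp_Neg_left [simp]: "f \<in> Arr A \<Longrightarrow> h \<in> Arr A \<Longrightarrow> Cod A f = Dom A h \<Longrightarrow> Cmp A (Neg A h) f = Neg A (Cmp A h f)"
  by (rule Neg_unique) (auto simp flip: Cmp_AddL)

lemma Neg_Zer [simp]: "a \<in> Obj A \<Longrightarrow> b \<in> Obj A \<Longrightarrow> Neg A (Zer A a b) = Zer A a b"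
  by (rule sym, rule Neg_unique) auto

lemma Arr_Sub [simp]: "f \<in> Arr A \<Longrightarrow> g \<in> Arr A \<Longrightarrow> Dom A f = Dom A g \<Longrightarrow> Cod A f = Cod A g \<Longrightarrow> Sub A f g \<in> Arr A"
  and Dom_Sub [simp]: "f \<in> Arr A \<Longrightarrow> g \<in> Arr A \<Longrightarrow> Dom A f = Dom A g \<Longrightarrow> Cod A f = Cod A g \<Longrightarrow> Dom A (Sub A f g) = Dom A g"
  and Cod_Sub [simp]: "f \<in> Arr A \<Longrightarrow> g \<in> Arr A \<Longrightarrow> Dom A f = Dom A g \<Longrightarrow> Cod A f = Cod A g \<Longrightarrow> Cod A (Sub A f g) = Cod A g"
  and Cmp_Sub_right: "f \<in> Arr A \<Longrightarrow> g \<in> Arr A \<Longrightarrow> Dom A f = Dom A g \<Longrightarrow> Cod A f = Cod A g \<Longrightarrow> h \<in> Arr A \<Longrightarrow> Dom A h = Cod A g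
     \<Longrightarrow> Cmp A h (Sub A f g) = Sub A (Cmp A h f) (Cmp A h g)"
  and Cmp_Sub_left: "f \<in> Arr A \<Longrightarrow> g \<in> Arr A \<Longrightarrow> Dom A f = Dom A g \<Longrightarrow> Cod A f = Cod A g \<Longrightarrow> h \<in> Arr A \<Longrightarrow> Cod A h = Dom A g
     \<Longrightarrow> Cmp A (Sub A f g) h = Sub A (Cmp A f h) (Cmp A g h)"
  by (auto simp: Sub_def Cmp_AddL Cmp_AddR)

lemma Sub_self [simp]: "f \<in> Arr A \<Longrightarrow> Sub A f f = Zer A (Dom A f) (Cod A f)"
  by (simp add: Sub_def)

lemma Sub_add_cancel: "f \<in> Arr A \<Longrightarrow> g \<in> Arr A \<Longrightarrow> Dom A f = Dom A g \<Longrightarrow> Cod A f = Cod A g \<Longrightarrow>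
    Add A (Sub A f g) g = f"
  by (simp add: Sub_def Add_assoc)

lemma Sub_eq_Zer:
  assumes "f \<in> Arr A" "g \<in> Arr A" "Dom A f = Dom A g" "Cod A f = Cod A g"
  shows "Sub A f g = Zer A (Dom A f) (Cod A f) \<longleftrightarrow> f = g"
proof
  assume "Sub A f g = Zer A (Dom A f) (Cod A f)"
  then show "f = g" using Sub_add_cancel[OF assms] assms by simp
qed (use assms in simp)

section \<open>Vanishing arrows, monomorphisms and epimorphisms\<close>

lemma is_zeroI: "f = Zer A (Dom A f) (Cod A f) \<Longrightarrow> is_zero A f"
  unfolding is_zero_def by assumption

lemma is_zero_Zer [simp]: "a \<in> Obj A \<Longrightarrow> b \<in> Obj A \<Longrightarrow> is_zero A (Zer A a b)"
  by (simp add: is_zero_def)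

lemma is_zero_Cmp_left:
  assumes "is_zero A g" "f \<in> Arr A" "g \<in> Arr A" "Cod A f = Dom A g"
  shows "is_zero A (Cmp A g f)"
proof -
  have "Cmp A g f = Zer A (Dom A f) (Cod A g)"
    using Cmp_Zer_left[of f "Cod A g" "Dom A g"] assms unfolding is_zero_def by (metis Obj_Cod)
  then show ?thesis using assms(2-) is_zero_Zer by (metis Obj_Cod Obj_Dom)
qed

lemma is_zero_Cmp_right:
  assumes "is_zero A f" "f \<in> Arr A" "g \<in> Arr A" "Cod A f = Dom A g"
  shows "is_zero A (Cmp A g f)"
proof -
  have "Cmp A g f = Zer A (Dom A f) (Cod A g)"
    using Cmp_Zer_right[of g "Dom A f" "Cod A f"] assms unfolding is_zero_def by (metis Obj_Dom)
  then show ?thesis using assms(2-) is_zero_Zer by (metis Obj_Cod Obj_Dom)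
qed

lemma is_zero_Sub: "f \<in> Arr A \<Longrightarrow> g \<in> Arr A \<Longrightarrow> Dom A f = Dom A g \<Longrightarrow> Cod A f = Cod A g \<Longrightarrow>
    is_zero A (Sub A f g) \<longleftrightarrow> f = g"
  using Sub_eq_Zer[of f g] by (simp add: is_zero_def)

lemma zero_eq: "is_zero A f \<Longrightarrow> is_zero A g \<Longrightarrow> Dom A f = Dom A g \<Longrightarrow> Cod A f = Cod A g \<Longrightarrow> f = g"
  by (metis is_zero_def)

text \<open>Subtraction turns the cancellation of two arrows into the vanishing of one.\<close>

lemma monoI:
  assumes f: "f \<in> Arr A"
    and h: "\<And>u. u \<in> Arr A \<Longrightarrow> Cod A u = Dom A f \<Longrightarrow> is_zero A (Cmp A f u) \<Longrightarrow> is_zero A u"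
  shows "is_mono A f"
  unfolding is_mono_def
proof (intro conjI ballI impI)
  fix u v assume a: "u \<in> Arr A" "v \<in> Arr A" and b: "Dom A u = Dom A v \<and> Cod A u = Dom A f \<and>
      Cod A v = Dom A f \<and> Cmp A f u = Cmp A f v"
  then have "is_zero A (Cmp A f (Sub A u v))" using f by (simp add: Cmp_Sub_right)
  then have "is_zero A (Sub A u v)" using a b f by (intro h[of "Sub A u v"]) simp_all
  then show "u = v" using a b by (simp add: is_zero_Sub)
qed (rule f)

lemma epiI:
  assumes f: "f \<in> Arr A"
    and h: "\<And>u. u \<in> Arr A \<Longrightarrow> Dom A u = Cod A f \<Longrightarrow> is_zero A (Cmp A u f) \<Longrightarrow> is_zero A u"
  shows "is_epi A f"
  unfolding is_epi_def
proof (intro conjI ballI impI)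
  fix u v assume a: "u \<in> Arr A" "v \<in> Arr A" and b: "Cod A u = Cod A v \<and> Dom A u = Cod A f \<and>
      Dom A v = Cod A f \<and> Cmp A u f = Cmp A v f"
  then have "is_zero A (Cmp A (Sub A u v) f)" using f by (simp add: Cmp_Sub_left)
  then have "is_zero A (Sub A u v)" using a b f by (intro h[of "Sub A u v"]) simp_all
  then show "u = v" using a b by (simp add: is_zero_Sub)
qed (rule f)

lemma mono_zero:
  assumes "is_mono A m" "u \<in> Arr A" "Cod A u = Dom A m"
  shows "is_zero A (Cmp A m u) \<longleftrightarrow> is_zero A u"
proof
  have m: "m \<in> Arr A" using assms(1) by (rule mono_Arr)
  show "is_zero A (Cmp A m u)" if "is_zero A u" using that assms m by (intro is_zero_Cmp_right) simp_all
  assume z: "is_zero A (Cmp A m u)"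
  have "Cmp A m u = Cmp A m (Zer A (Dom A u) (Cod A u))"
    by (rule zero_eq[OF z]) (use m assms in simp_all)
  then have "u = Zer A (Dom A u) (Cod A u)"
    by (intro mono_cancel[OF assms(1), of u "Zer A (Dom A u) (Cod A u)"]) (use m assms in simp_all)
  then show "is_zero A u" by (rule is_zeroI)
qed

lemma epi_zero:
  assumes "is_epi A m" "u \<in> Arr A" "Dom A u = Cod A m"
  shows "is_zero A (Cmp A u m) \<longleftrightarrow> is_zero A u"
proof
  have m: "m \<in> Arr A" using assms(1) by (rule epi_Arr)
  show "is_zero A (Cmp A u m)" if "is_zero A u" using that assms m by (intro is_zero_Cmp_left) simp_all
  assume z: "is_zero A (Cmp A u m)"
  have "Cmp A u m = Cmp A (Zer A (Dom A u) (Cod A u)) m"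
    by (rule zero_eq[OF z]) (use m assms in simp_all)
  then have "u = Zer A (Dom A u) (Cod A u)"
    by (intro epi_cancel[OF assms(1), of u "Zer A (Dom A u) (Cod A u)"]) (use m assms in simp_all)
  then show "is_zero A u" by (rule is_zeroI)
qed

end

section \<open>Abelian categories\<close>

context preadditive
begin

section \<open>Kernels and cokernels in a preadditive category\<close>

lemma kernelD:
  assumes "is_kernel A g k"
  shows "g \<in> Arr A" "k \<in> Arr A" "Cod A k = Dom A g" "is_zero A (Cmp A g k)" "is_mono A k"
proof -
  show g: "g \<in> Arr A" "k \<in> Arr A" "Cod A k = Dom A g" "is_zero A (Cmp A g k)"
    using assms by (auto simp: is_kernel_def is_zero_def)
  have z: "Cmp A g k = Zer A (Dom A k) (Cod A g)" using assms by (auto simp: is_kernel_def)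
  show "is_mono A k"
    unfolding is_mono_def
  proof (intro conjI ballI impI)
    fix u v assume u: "u \<in> Arr A" "v \<in> Arr A" "Dom A u = Dom A v \<and> Cod A u = Dom A k \<and> Cod A v = Dom A k \<and>
        Cmp A k u = Cmp A k v"
    have "Cmp A k u \<in> Arr A \<and> Cod A (Cmp A k u) = Dom A g \<and>
          Cmp A g (Cmp A k u) = Zer A (Dom A (Cmp A k u)) (Cod A g)"
      using u g Cmp_eq_extend[OF z, of u] by simp
    then have "\<exists>!w. w \<in> Hom A (Dom A (Cmp A k u)) (Dom A k) \<and> Cmp A k w = Cmp A k u"
      using assms unfolding is_kernel_def by blast
    moreover have "u \<in> Hom A (Dom A (Cmp A k u)) (Dom A k) \<and> Cmp A k u = Cmp A k u"
      "v \<in> Hom A (Dom A (Cmp A k u)) (Dom A k) \<and> Cmp A k v = Cmp A k u"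
      using u g by (auto simp: Hom_iff)
    ultimately show "u = v" by blast
  qed (rule g)
qed

lemma kernel_lift:
  assumes "is_kernel A g k" "h \<in> Arr A" "Cod A h = Dom A g" "is_zero A (Cmp A g h)"
  obtains u where "u \<in> Arr A" "Dom A u = Dom A h" "Cod A u = Dom A k" "Cmp A k u = h"
proof -
  have "Cmp A g h = Zer A (Dom A h) (Cod A g)" using assms kernelD(1)[OF assms(1)] by (simp add: is_zero_def)
  then have "\<exists>!u. u \<in> Hom A (Dom A h) (Dom A k) \<and> Cmp A k u = h"
    using assms unfolding is_kernel_def by blast
  then show ?thesis using that by (auto simp: Hom_iff)
qed

lemma kernelI:
  assumes "g \<in> Arr A" "k \<in> Arr A" "Cod A k = Dom A g" "is_zero A (Cmp A g k)" "is_mono A k"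
    and "\<And>h. h \<in> Arr A \<Longrightarrow> Cod A h = Dom A g \<Longrightarrow> is_zero A (Cmp A g h) \<Longrightarrow>
          \<exists>u. u \<in> Arr A \<and> Dom A u = Dom A h \<and> Cod A u = Dom A k \<and> Cmp A k u = h"
  shows "is_kernel A g k"
  unfolding is_kernel_def
proof (intro conjI ballI impI)
  show "Cmp A g k = Zer A (Dom A k) (Cod A g)" using assms by (simp add: is_zero_def)
  fix h assume h: "h \<in> Arr A" "Cod A h = Dom A g \<and> Cmp A g h = Zer A (Dom A h) (Cod A g)"
  then have "is_zero A (Cmp A g h)" using assms(1) by (intro is_zeroI) simp
  then obtain u where u: "u \<in> Arr A \<and> Dom A u = Dom A h \<and> Cod A u = Dom A k \<and> Cmp A k u = h"
    using assms(6) h by blast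
  show "\<exists>!u. u \<in> Hom A (Dom A h) (Dom A k) \<and> Cmp A k u = h"
  proof (rule ex1I[of _ u])
    show "u \<in> Hom A (Dom A h) (Dom A k) \<and> Cmp A k u = h" using u by (auto simp: Hom_iff)
    fix v assume "v \<in> Hom A (Dom A h) (Dom A k) \<and> Cmp A k v = h"
    then show "v = u" using u by (intro mono_cancel[OF assms(5), of v u]) (auto simp: Hom_iff)
  qed
qed (use assms in auto)

lemma cokernelD:
  assumes "is_cokernel A f q"
  shows "f \<in> Arr A" "q \<in> Arr A" "Dom A q = Cod A f" "is_zero A (Cmp A q f)" "is_epi A q"
proof -
  show g: "f \<in> Arr A" "q \<in> Arr A" "Dom A q = Cod A f" "is_zero A (Cmp A q f)"
    using assms by (auto simp: is_cokernel_def is_zero_def)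
  show "is_epi A q"
    unfolding is_epi_def
  proof (intro conjI ballI impI)
    fix u v assume u: "u \<in> Arr A" "v \<in> Arr A" "Cod A u = Cod A v \<and> Dom A u = Cod A q \<and> Dom A v = Cod A q \<and>
        Cmp A u q = Cmp A v q"
    have "is_zero A (Cmp A (Cmp A u q) f)"
      using u(1,3) g by (subst assoc) (auto intro!: is_zero_Cmp_right[OF g(4)])
    then have "Cmp A u q \<in> Arr A \<and> Dom A (Cmp A u q) = Cod A f \<and>
          Cmp A (Cmp A u q) f = Zer A (Dom A f) (Cod A (Cmp A u q))"
      using u g by (simp add: is_zero_def)
    then have "\<exists>!w. w \<in> Hom A (Cod A q) (Cod A (Cmp A u q)) \<and> Cmp A w q = Cmp A u q"
      using assms unfolding is_cokernel_def by blast
    moreover have "u \<in> Hom A (Cod A q) (Cod A (Cmp A u q)) \<and> Cmp A u q = Cmp A u q"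
      "v \<in> Hom A (Cod A q) (Cod A (Cmp A u q)) \<and> Cmp A v q = Cmp A u q"
      using u g by (auto simp: Hom_iff)
    ultimately show "u = v" by blast
  qed (rule g)
qed

lemma cokernel_desc:
  assumes "is_cokernel A f q" "h \<in> Arr A" "Dom A h = Cod A f" "is_zero A (Cmp A h f)"
  obtains u where "u \<in> Arr A" "Dom A u = Cod A q" "Cod A u = Cod A h" "Cmp A u q = h"
proof -
  have "Cmp A h f = Zer A (Dom A f) (Cod A h)" using assms cokernelD(1)[OF assms(1)] by (simp add: is_zero_def)
  then have "\<exists>!u. u \<in> Hom A (Cod A q) (Cod A h) \<and> Cmp A u q = h"
    using assms unfolding is_cokernel_def by blast
  then show ?thesis using that by (auto simp: Hom_iff)
qed

lemma cokernelI:
  assumes "f \<in> Arr A" "q \<in> Arr A" "Dom A q = Cod A f" "is_zero A (Cmp A q f)" "is_epi A q"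
    and "\<And>h. h \<in> Arr A \<Longrightarrow> Dom A h = Cod A f \<Longrightarrow> is_zero A (Cmp A h f) \<Longrightarrow>
          \<exists>u. u \<in> Arr A \<and> Dom A u = Cod A q \<and> Cod A u = Cod A h \<and> Cmp A u q = h"
  shows "is_cokernel A f q"
  unfolding is_cokernel_def
proof (intro conjI ballI impI)
  show "Cmp A q f = Zer A (Dom A f) (Cod A q)" using assms by (simp add: is_zero_def)
  fix h assume h: "h \<in> Arr A" "Dom A h = Cod A f \<and> Cmp A h f = Zer A (Dom A f) (Cod A h)"
  then have "is_zero A (Cmp A h f)" using assms(1) by (intro is_zeroI) simp
  then obtain u where u: "u \<in> Arr A \<and> Dom A u = Cod A q \<and> Cod A u = Cod A h \<and> Cmp A u q = h"
    using assms(6) h by blast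
  show "\<exists>!u. u \<in> Hom A (Cod A q) (Cod A h) \<and> Cmp A u q = h"
  proof (rule ex1I[of _ u])
    show "u \<in> Hom A (Cod A q) (Cod A h) \<and> Cmp A u q = h" using u by (auto simp: Hom_iff)
    fix v assume "v \<in> Hom A (Cod A q) (Cod A h) \<and> Cmp A v q = h"
    then show "v = u" using u by (intro epi_cancel[OF assms(5), of v u]) (auto simp: Hom_iff)
  qed
qed (use assms in auto)

lemma kernel_iso:
  assumes k: "is_kernel A g k" and k': "is_kernel A g k'"
  shows "isomorphic A (Dom A k) (Dom A k')"
proof -
  note d = kernelD[OF k] and d' = kernelD[OF k']
  obtain u where u: "u \<in> Arr A" "Dom A u = Dom A k" "Cod A u = Dom A k'" "Cmp A k' u = k"
    using kernel_lift[OF k', of k] d by auto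
  obtain v where v: "v \<in> Arr A" "Dom A v = Dom A k'" "Cod A v = Dom A k" "Cmp A k v = k'"
    using kernel_lift[OF k, of k'] d' by auto
  have "Cmp A v u = Ide A (Dom A k)"
    by (rule mono_cancel[OF d(5)]) (use u v d Cmp_eq_extend[OF v(4), of u] in simp_all)
  moreover have "Cmp A u v = Ide A (Dom A k')"
    by (rule mono_cancel[OF d'(5)]) (use u v d' Cmp_eq_extend[OF u(4), of v] in simp_all)
  ultimately show ?thesis by (intro isomorphicI[of u v]) (use u v d(2) d'(2) in simp_all)
qed

end

text \<open>Here \<open>x\<close> is read as a generalized element of its codomain, which may be replaced by its
  pullback along an epimorphism.  This allows diagram chases.\<close>

definition in_image :: "('o, 'm, 'z) pcat_scheme \<Rightarrow> 'm \<Rightarrow> 'm \<Rightarrow> bool" where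
  "in_image A f x \<longleftrightarrow> (\<exists>p y. is_epi A p \<and> Cod A p = Dom A x \<and> y \<in> Arr A \<and> Dom A y = Dom A p \<and>
     Cod A y = Dom A f \<and> Cmp A f y = Cmp A x p)"

definition exact_pair :: "('o, 'm, 'z) pcat_scheme \<Rightarrow> 'm \<Rightarrow> 'm \<Rightarrow> bool" where
  "exact_pair A f g \<longleftrightarrow> f \<in> Arr A \<and> g \<in> Arr A \<and> Cod A f = Dom A g \<and> is_zero A (Cmp A g f) \<and>
     (\<forall>x\<in>Arr A. Cod A x = Dom A g \<and> is_zero A (Cmp A g x) \<longrightarrow> in_image A f x)"

lemma in_imageI: "is_epi A p \<Longrightarrow> Cod A p = Dom A x \<Longrightarrow> y \<in> Arr A \<Longrightarrow> Dom A y = Dom A p \<Longrightarrow>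
     Cod A y = Dom A f \<Longrightarrow> Cmp A f y = Cmp A x p \<Longrightarrow> in_image A f x"
  by (auto simp: in_image_def)

lemma in_imageE: assumes "in_image A f x"
  obtains p y where "is_epi A p" "p \<in> Arr A" "Cod A p = Dom A x" "y \<in> Arr A" "Dom A y = Dom A p"
     "Cod A y = Dom A f" "Cmp A f y = Cmp A x p"
  using assms by (auto simp: in_image_def is_epi_def)

context abelian_category
begin

section \<open>Images, lifting along epimorphisms and exactness\<close>

lemma kernel_choice: "f \<in> Arr A \<Longrightarrow> is_kernel A f (kernel_choice A f)"
  unfolding kernel_choice_def by (rule someI_ex) (rule ex_kernel)

lemma cokernel_choice: "f \<in> Arr A \<Longrightarrow> is_cokernel A f (cokernel_choice A f)"
  unfolding cokernel_choice_def by (rule someI_ex) (rule ex_cokernel)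

text \<open>The monomorphism is a kernel of some g. Since g kills m, it factors through the cokernel
  q, so whatever q kills is killed by g and lifts to m.\<close>

lemma mono_kernel_of_cokernel:
  assumes m: "is_mono A m" and q: "is_cokernel A m q"
  shows "is_kernel A q m"
proof -
  obtain g where g: "is_kernel A g m" using mono_is_kernel[OF m] by blast
  note dg = kernelD[OF g] and dq = cokernelD[OF q]
  obtain t where t: "t \<in> Arr A" "Dom A t = Cod A q" "Cod A t = Cod A g" "Cmp A t q = g"
    using cokernel_desc[OF q, of g] dg by auto
  show ?thesis
  proof (rule kernelI)
    fix h assume h: "h \<in> Arr A" "Cod A h = Dom A q" "is_zero A (Cmp A q h)"
    have "is_zero A (Cmp A g h)"
      using is_zero_Cmp_right[OF h(3), of t] h t dq Cmp_eq_extend[OF t(4), of h] by simp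
    then show "\<exists>u. u \<in> Arr A \<and> Dom A u = Dom A h \<and> Cod A u = Dom A m \<and> Cmp A m u = h"
      using kernel_lift[OF g, of h] h dg dq by metis
  qed (use dg dq in auto)
qed

lemma epi_cokernel_of_kernel:
  assumes e: "is_epi A e" and k: "is_kernel A e k"
  shows "is_cokernel A k e"
proof -
  obtain g where g: "is_cokernel A g e" using epi_is_cokernel[OF e] by blast
  note dg = cokernelD[OF g] and dk = kernelD[OF k]
  obtain t where t: "t \<in> Arr A" "Dom A t = Dom A g" "Cod A t = Dom A k" "Cmp A k t = g"
    using kernel_lift[OF k, of g] dg by auto
  show ?thesis
  proof (rule cokernelI)
    fix h assume h: "h \<in> Arr A" "Dom A h = Cod A k" "is_zero A (Cmp A h k)"
    have "is_zero A (Cmp A h g)"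
      using is_zero_Cmp_left[OF h(3), of t] h t dk by simp
    then show "\<exists>u. u \<in> Arr A \<and> Dom A u = Cod A e \<and> Cod A u = Cod A h \<and> Cmp A u e = h"
      using cokernel_desc[OF g, of h] h dg dk by metis
  qed (use dg dk in auto)
qed

text \<open>The factor e is epi because m is the smallest subobject through which f factors: if h
  kills e, then f already factors through the part of m killed by h, and that part must be all of
  m.\<close>

lemma image_factorization:
  assumes f: "f \<in> Arr A" and q: "is_cokernel A f q" and m: "is_kernel A q m"
  obtains e where "is_epi A e" "e \<in> Arr A" "Dom A e = Dom A f" "Cod A e = Dom A m" "Cmp A m e = f"
proof -
  note dq = cokernelD[OF q] and dm = kernelD[OF m]
  obtain e where e: "e \<in> Arr A" "Dom A e = Dom A f" "Cod A e = Dom A m" "Cmp A m e = f"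
    using kernel_lift[OF m f] dq by auto
  have "is_epi A e"
  proof (rule epiI[OF e(1)])
    fix h assume h: "h \<in> Arr A" "Dom A h = Cod A e" and z: "is_zero A (Cmp A h e)"
    note k = kernel_choice[OF h(1)]
    define k where "k = kernel_choice A h"
    have k: "is_kernel A h k" unfolding k_def by (rule kernel_choice[OF h(1)])
    note dk = kernelD[OF k]
    obtain e' where e': "e' \<in> Arr A" "Dom A e' = Dom A e" "Cod A e' = Dom A k" "Cmp A k e' = e"
      using kernel_lift[OF k e(1)] h z by auto
    define mk where "mk = Cmp A m k"
    have mk: "mk \<in> Arr A" "Dom A mk = Dom A k" "Cod A mk = Cod A m" using dm dk h e by (auto simp: mk_def)
    have "is_mono A mk"
    proof (rule monoI[OF mk(1)])
      fix u assume u: "u \<in> Arr A" "Cod A u = Dom A mk" "is_zero A (Cmp A mk u)"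
      then have "is_zero A (Cmp A m (Cmp A k u))" using dm dk h e mk by (simp add: mk_def)
      then show "is_zero A u" using mono_zero[OF dm(5), of "Cmp A k u"] mono_zero[OF dk(5), of u] u dm dk h e mk by simp
    qed
    then obtain g where g: "is_kernel A g mk" using mono_is_kernel by blast
    note dg = kernelD[OF g]
    have mke: "Cmp A mk e' = f" using dm dk h e e' by (simp add: mk_def)
    have "is_zero A (Cmp A g f)"
      using is_zero_Cmp_left[OF dg(4), of e'] dg e' mk mke by simp
    then obtain g' where g': "g' \<in> Arr A" "Dom A g' = Cod A q" "Cod A g' = Cod A g" "Cmp A g' q = g"
      using cokernel_desc[OF q, of g] dg mk dm dq by auto
    \<comment> \<open>Minimality of the image: g kills f, hence factors through q, hence kills
      m.\<close>
    have "is_zero A (Cmp A g m)"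
      using is_zero_Cmp_right[OF dm(4), of g'] g' dm Cmp_eq_extend[OF g'(4), of m] by simp
    then obtain t where t: "t \<in> Arr A" "Dom A t = Dom A m" "Cod A t = Dom A mk" "Cmp A mk t = m"
      using kernel_lift[OF g, of m] dm dg mk by auto
    \<comment> \<open>So k has the right inverse t, and h k = 0 forces h = 0.\<close>
    have "Cmp A m (Cmp A k t) = Cmp A m (Ide A (Dom A m))"
      using t mk dm dk h e by (simp add: mk_def)
    then have kt: "Cmp A k t = Ide A (Dom A m)"
      by (rule mono_cancel[OF dm(5), rotated -1]) (use t mk dm dk h e in simp_all)
    have "is_zero A (Cmp A h (Cmp A k t))"
      using is_zero_Cmp_left[OF dk(4), of t] t mk dk h by simp
    then show "is_zero A h" using kt h e by simp
  qed
  then show ?thesis using e that by blast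
qed

text \<open>The pullback of \<open>f\<close> along \<open>g\<close> is the kernel of \<open>f p - g q\<close> on the biproduct.\<close>

lemma epi_in_image:
  assumes f: "is_epi A f" and g: "g \<in> Arr A" "Cod A g = Cod A f"
  shows "in_image A f g"
proof -
  have f': "f \<in> Arr A" using f by (rule epi_Arr)
  obtain s i j p q where b: "is_biproduct A (Dom A f) (Dom A g) s i j p q"
    using ex_biproduct[of "Dom A f" "Dom A g"] f' g by auto
  then have a: "i \<in> Arr A" "j \<in> Arr A" "p \<in> Arr A" "q \<in> Arr A" "Dom A i = Dom A f" "Cod A i = s"
    "Dom A j = Dom A g" "Cod A j = s" "Dom A p = s" "Cod A p = Dom A f" "Dom A q = s" "Cod A q = Dom A g"
    and e: "Cmp A p i = Ide A (Dom A f)" "Cmp A q j = Ide A (Dom A g)" "Cmp A q i = Zer A (Dom A f) (Dom A g)"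
     "Cmp A p j = Zer A (Dom A g) (Dom A f)"
    by (auto simp: is_biproduct_def Hom_iff)
  define d where "d = Sub A (Cmp A f p) (Cmp A g q)"
  have d: "d \<in> Arr A" "Dom A d = s" "Cod A d = Cod A f" using a f' g by (auto simp: d_def)
  have di: "Cmp A d i = f" using a f' g e by (simp add: d_def Cmp_Sub_left) (simp add: Sub_def)
  have "is_epi A d" using epi_left[of d i] d di a f by simp
  define k where "k = kernel_choice A d"
  have k: "is_kernel A d k" unfolding k_def by (rule kernel_choice[OF d(1)])
  note dk = kernelD[OF k]
  have "is_zero A (Cmp A d k)" by (rule dk)
  then have eq: "Cmp A f (Cmp A p k) = Cmp A g (Cmp A q k)"
    using a f' g dk d Sub_eq_Zer[of "Cmp A f (Cmp A p k)" "Cmp A g (Cmp A q k)"]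
    by (simp add: d_def Cmp_Sub_left is_zero_def)
  \<comment> \<open>If h kills q k, then h q vanishes on the kernel of the epimorphism d and so
    equals t d. Restricted along i this reads t f = h q i = 0, whence t = 0 and h q = 0; restricting
    along j gives h = 0.\<close>
  have "is_epi A (Cmp A q k)"
  proof (rule epiI)
    fix h assume h: "h \<in> Arr A" "Dom A h = Cod A (Cmp A q k)" "is_zero A (Cmp A h (Cmp A q k))"
    have h': "Dom A h = Dom A g" using h a dk d by simp
    obtain t where t: "t \<in> Arr A" "Dom A t = Cod A f" "Cod A t = Cod A h" "Cmp A t d = Cmp A h q"
      using cokernel_desc[OF epi_cokernel_of_kernel[OF \<open>is_epi A d\<close> k], of "Cmp A h q"] h h' a dk d by auto
    have "Cmp A t f = Cmp A h (Cmp A q i)"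
      using t d di a h h' Cmp_eq_extend[OF t(4), of i] by simp
    then have "is_zero A (Cmp A t f)" using e h h' f' g by simp
    then have "is_zero A t" using epi_zero[OF f, of t] t by simp
    then have "is_zero A (Cmp A h q)" using is_zero_Cmp_left[of t d] t d by simp
    then have "is_zero A (Cmp A (Cmp A h q) j)" by (rule is_zero_Cmp_left) (use h h' a in auto)
    then show "is_zero A h" using h h' a e by simp
  qed (use a dk d in simp)
  then show ?thesis
    by (rule in_imageI[where y="Cmp A p k"]) (use a dk d g f' eq in simp_all)
qed

text \<open>The kernel of q is the image of f, and the epimorphism from the domain of f onto it
  lifts any element after passing to an epimorphism. This lets cokernels be tested on generalized
  elements.\<close>

lemma cokernel_in_image:
  assumes q: "is_cokernel A f q" and u: "u \<in> Arr A" "Cod A u = Cod A f"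
  shows "is_zero A (Cmp A q u) \<longleftrightarrow> in_image A f u"
proof
  note dq = cokernelD[OF q]
  { assume z: "is_zero A (Cmp A q u)"
    define m where "m = kernel_choice A q"
    have m: "is_kernel A q m" unfolding m_def by (rule kernel_choice) (rule dq)
    note dm = kernelD[OF m]
    obtain e where e: "is_epi A e" "e \<in> Arr A" "Dom A e = Dom A f" "Cod A e = Dom A m" "Cmp A m e = f"
      using image_factorization[OF dq(1) q m] by auto
    obtain u' where u': "u' \<in> Arr A" "Dom A u' = Dom A u" "Cod A u' = Dom A m" "Cmp A m u' = u"
      using kernel_lift[OF m u(1)] z u dq by auto
    obtain p y where p: "is_epi A p" "p \<in> Arr A" "Cod A p = Dom A u'" "y \<in> Arr A" "Dom A y = Dom A p"
     "Cod A y = Dom A e" "Cmp A e y = Cmp A u' p"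
      using in_imageE[OF epi_in_image[OF e(1), of u']] u' e by metis
    have "Cmp A f y = Cmp A u p"
      using Cmp_eq_extend[OF e(5), of y] Cmp_eq_extend[OF u'(4), of p] p e u' dm by simp
    then show "in_image A f u" using p u' e by (intro in_imageI[of A p u y f]) auto }
  { assume "in_image A f u"
    then obtain p y where p: "is_epi A p" "p \<in> Arr A" "Cod A p = Dom A u" "y \<in> Arr A" "Dom A y = Dom A p"
      "Cod A y = Dom A f" "Cmp A f y = Cmp A u p"
      by (rule in_imageE)
    have "is_zero A (Cmp A (Cmp A q f) y)"
      by (rule is_zero_Cmp_left) (use dq p in auto)
    then have "is_zero A (Cmp A (Cmp A q u) p)" using dq p u by simp
    then show "is_zero A (Cmp A q u)" using epi_zero[OF p(1), of "Cmp A q u"] dq p u by simp }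
qed

text \<open>The long exact sequences of the satellites are stated through images and kernels; the
  chases need them on generalized elements.\<close>

lemma exact_at_pair:
  assumes "exact_at A f g"
  shows "exact_pair A f g"
proof -
  obtain q i where q: "is_cokernel A f q" and i: "is_kernel A q i" "is_kernel A g i"
    using assms by (auto simp: exact_at_def)
  note dq = cokernelD[OF q] and di = kernelD[OF i(1)] and dg = kernelD[OF i(2)]
  obtain e where e: "is_epi A e" "e \<in> Arr A" "Dom A e = Dom A f" "Cod A e = Dom A i" "Cmp A i e = f"
    using image_factorization[OF dq(1) q i(1)] by auto
  show ?thesis unfolding exact_pair_def
  proof (intro conjI ballI impI)
    show "is_zero A (Cmp A g f)"
      using is_zero_Cmp_left[OF dg(4), of e] e dg by simp
    fix x assume x: "x \<in> Arr A" "Cod A x = Dom A g \<and> is_zero A (Cmp A g x)"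
    then obtain v where v: "v \<in> Arr A" "Dom A v = Dom A x" "Cod A v = Dom A i" "Cmp A i v = x"
      using kernel_lift[OF i(2), of x] by auto
    have "is_zero A (Cmp A q x)"
      using is_zero_Cmp_left[OF di(4), of v] v di by simp
    then show "in_image A f x" using cokernel_in_image[OF q, of x] x dq dg di by simp
  qed (use dq dg di in auto)
qed

lemma kernel_exact_pair: "is_kernel A g f \<Longrightarrow> exact_pair A f g"
  unfolding exact_pair_def
proof (intro conjI ballI impI)
  assume k: "is_kernel A g f"
  fix x assume x: "x \<in> Arr A" "Cod A x = Dom A g \<and> is_zero A (Cmp A g x)"
  then obtain v where v: "v \<in> Arr A" "Dom A v = Dom A x" "Cod A v = Dom A f" "Cmp A f v = x"
    using kernel_lift[OF k, of x] by auto
  then show "in_image A f x" using x by (intro in_imageI[of A "Ide A (Dom A x)" x v]) (auto intro: epi_Ide)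
qed (auto dest: kernelD)

text \<open>A cycle h lies in the image of f, so the cokernel of f kills it; a monomorphism being
  the kernel of its cokernel, h lifts.\<close>

lemma exact_mono_kernel:
  assumes e: "exact_pair A f g" and m: "is_mono A f"
  shows "is_kernel A g f"
proof -
  have a: "f \<in> Arr A" "g \<in> Arr A" "Cod A f = Dom A g" using e by (auto simp: exact_pair_def)
  define q where "q = cokernel_choice A f"
  have q: "is_cokernel A f q" unfolding q_def by (rule cokernel_choice[OF a(1)])
  show ?thesis
  proof (rule kernelI)
    fix h assume h: "h \<in> Arr A" "Cod A h = Dom A g" "is_zero A (Cmp A g h)"
    then have "in_image A f h" using e by (auto simp: exact_pair_def)
    then have "is_zero A (Cmp A q h)" using cokernel_in_image[OF q, of h] h a by simp
    then show "\<exists>u. u \<in> Arr A \<and> Dom A u = Dom A h \<and> Cod A u = Dom A f \<and> Cmp A f u = h"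
      using kernel_lift[OF mono_kernel_of_cokernel[OF m q] h(1)] h a cokernelD[OF q] by metis
  qed (use a m e in \<open>auto simp: exact_pair_def\<close>)
qed

text \<open>An epimorphism is the cokernel of its kernel, so its codomain is determined by the
  elements it kills. Each isomorphism with a homology object below arises by exhibiting both sides
  as quotients of one object.\<close>

lemma epis_same_kernel_iso:
  assumes e: "is_epi A e" "is_epi A e'" "Dom A e = Dom A e'"
    and z: "\<And>u. u \<in> Arr A \<Longrightarrow> Cod A u = Dom A e \<Longrightarrow> is_zero A (Cmp A e u) \<longleftrightarrow> is_zero A (Cmp A e' u)"
  shows "isomorphic A (Cod A e) (Cod A e')"
proof -
  have a: "e \<in> Arr A" "e' \<in> Arr A" using e by (auto dest: epi_Arr)
  define k where "k = kernel_choice A e"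
  define k' where "k' = kernel_choice A e'"
  have k: "is_kernel A e k" "is_kernel A e' k'" unfolding k_def k'_def by (auto intro: kernel_choice a)
  note d = kernelD[OF k(1)] and d' = kernelD[OF k(2)]
  obtain h where h: "h \<in> Arr A" "Dom A h = Cod A e" "Cod A h = Cod A e'" "Cmp A h e = e'"
    using cokernel_desc[OF epi_cokernel_of_kernel[OF e(1) k(1)], of e'] z[of k] d e a by auto
  obtain h' where h': "h' \<in> Arr A" "Dom A h' = Cod A e'" "Cod A h' = Cod A e" "Cmp A h' e' = e"
    using cokernel_desc[OF epi_cokernel_of_kernel[OF e(2) k(2)], of e] z[of k'] d' e a by auto
  have "Cmp A h' h = Ide A (Cod A e)"
    by (rule epi_cancel[OF e(1)]) (use h h' a in simp_all)
  moreover have "Cmp A h h' = Ide A (Cod A e')"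
    by (rule epi_cancel[OF e(2)]) (use h h' a in simp_all)
  ultimately show ?thesis by (intro isomorphicI[of h h']) (use h h' a in simp_all)
qed

text \<open>Surjectivity need only be tested on the universal element, the identity of the
  codomain.\<close>

lemma epiI_element:
  assumes "e \<in> Arr A" and "in_image A e (Ide A (Cod A e))"
  shows "is_epi A e"
proof -
  obtain p y where p: "is_epi A p" "p \<in> Arr A" "Cod A p = Dom A (Ide A (Cod A e))" "y \<in> Arr A" "Dom A y = Dom A p"
     "Cod A y = Dom A e" "Cmp A e y = Cmp A (Ide A (Cod A e)) p"
    using in_imageE[OF assms(2)] by metis
  then show ?thesis using epi_left[of e y] assms by simp
qed

text \<open>Replaces the choices inside \<open>homology_object\<close> by what a chase uses: a
  quotient of the cycles in which exactly the boundaries vanish.\<close>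

lemma homology_object:
  assumes a: "f \<in> Arr A" "g \<in> Arr A" "Cod A f = Dom A g" and z: "is_zero A (Cmp A g f)"
  obtains k \<pi> where "is_kernel A g k" "is_epi A \<pi>" "Dom A \<pi> = Dom A k" "Cod A \<pi> = homology_object A f g"
    "\<And>u. u \<in> Arr A \<Longrightarrow> Cod A u = Dom A k \<Longrightarrow> is_zero A (Cmp A \<pi> u) \<longleftrightarrow> in_image A f (Cmp A k u)"
proof -
  define k where "k = kernel_choice A g"
  have k: "is_kernel A g k" unfolding k_def by (rule kernel_choice[OF a(2)])
  note dk = kernelD[OF k]
  define f' where "f' = (THE u. u \<in> Hom A (Dom A f) (Dom A k) \<and> Cmp A k u = f)"
  obtain u where u: "u \<in> Arr A" "Dom A u = Dom A f" "Cod A u = Dom A k" "Cmp A k u = f"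
    using kernel_lift[OF k a(1)] a z by auto
  \<comment> \<open>The definite description inside \<open>homology_object\<close> is justified
    because \<open>k\<close> is monic.\<close>
  have "f' = u" unfolding f'_def
    by (rule the_equality) (use u dk in \<open>auto simp: Hom_iff intro!: mono_cancel[OF dk(5)]\<close>)
  then have f': "f' \<in> Arr A" "Dom A f' = Dom A f" "Cod A f' = Dom A k" "Cmp A k f' = f" using u by auto
  define \<pi> where "\<pi> = cokernel_choice A f'"
  have pi: "is_cokernel A f' \<pi>" unfolding \<pi>_def by (rule cokernel_choice[OF f'(1)])
  note dpi = cokernelD[OF pi]
  have H: "Cod A \<pi> = homology_object A f g"
    by (simp add: homology_object_def Let_def \<pi>_def f'_def k_def)
  show ?thesis
  proof (rule that[OF k dpi(5) _ H])
    show "Dom A \<pi> = Dom A k" using dpi f' by simp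
    fix u assume u: "u \<in> Arr A" "Cod A u = Dom A k"
    have "is_zero A (Cmp A \<pi> u) \<longleftrightarrow> in_image A f' u"
      by (rule cokernel_in_image[OF pi u(1)]) (use u f' in simp)
    also have "\<dots> \<longleftrightarrow> in_image A f (Cmp A k u)"
    proof
      assume "in_image A f' u"
      then obtain p y where p: "is_epi A p" "p \<in> Arr A" "Cod A p = Dom A u" "y \<in> Arr A" "Dom A y = Dom A p"
        "Cod A y = Dom A f'" "Cmp A f' y = Cmp A u p" by (rule in_imageE)
      then show "in_image A f (Cmp A k u)"
        by (intro in_imageI[of A p _ y]) (use u f' dk Cmp_eq_extend[OF f'(4), of y] in simp_all)
    next
      assume "in_image A f (Cmp A k u)"
      then obtain p y where p: "is_epi A p" "p \<in> Arr A" "Cod A p = Dom A (Cmp A k u)" "y \<in> Arr A" "Dom A y = Dom A p"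
        "Cod A y = Dom A f" "Cmp A f y = Cmp A (Cmp A k u) p" by (rule in_imageE)
      have "Cmp A f' y = Cmp A u p"
        by (rule mono_cancel[OF dk(5)]) (use u f' dk p Cmp_eq_extend[OF f'(4), of y] in simp_all)
      then show "in_image A f' u"
        by (intro in_imageI[of A p _ y]) (use p u f' dk in simp_all)
    qed
    finally show "is_zero A (Cmp A \<pi> u) \<longleftrightarrow> in_image A f (Cmp A k u)" .
  qed
qed

end

section \<open>Dimension shifting\<close>

context abelian_category
begin

lemma zero_extend: "is_zero A (Cmp A g f) \<Longrightarrow> x \<in> Arr A \<Longrightarrow> f \<in> Arr A \<Longrightarrow> g \<in> Arr A \<Longrightarrow>
    Cod A x = Dom A f \<Longrightarrow> Cod A f = Dom A g \<Longrightarrow> is_zero A (Cmp A g (Cmp A f x))"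
  using is_zero_Cmp_left[of "Cmp A g f" x] by simp

lemma in_image_zero:
  assumes "in_image A f x" "is_zero A (Cmp A g f)" "f \<in> Arr A" "g \<in> Arr A" "Cod A f = Dom A g"
    "x \<in> Arr A" "Cod A x = Cod A f"
  shows "is_zero A (Cmp A g x)"
proof -
  obtain p y where p: "is_epi A p" "p \<in> Arr A" "Cod A p = Dom A x" "y \<in> Arr A" "Dom A y = Dom A p"
     "Cod A y = Dom A f" "Cmp A f y = Cmp A x p"
    using assms(1) by (rule in_imageE)
  have "is_zero A (Cmp A g (Cmp A f y))" by (rule zero_extend[OF assms(2)]) (use assms p in simp_all)
  then show ?thesis using epi_zero[OF p(1), of "Cmp A g x"] p assms by simp
qed

text \<open>Both objects are quotients of \<open>W = Ker (b\<^sub>1 \<rightarrow> b\<^sub>0 \<rightarrow> c\<^sub>0)\<close>, and the two epimorphisms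
  have the same kernel.\<close>

lemma connecting_iso:
  assumes f1: "f1 \<in> Hom A a1 b1" and f0: "f0 \<in> Hom A a0 b0"
    and g2: "g2 \<in> Hom A b2 c2" and g1: "g1 \<in> Hom A b1 c1" and g0: "g0 \<in> Hom A b0 c0"
    and da: "da \<in> Hom A a1 a0"
    and db2: "db2 \<in> Hom A b2 b1" and db1: "db1 \<in> Hom A b1 b0"
    and dc2: "dc2 \<in> Hom A c2 c1" and dc1: "dc1 \<in> Hom A c1 c0"
    and c1: "Cmp A db1 f1 = Cmp A f0 da" and c2: "Cmp A dc1 g1 = Cmp A g0 db1"
    and c3: "Cmp A dc2 g2 = Cmp A g1 db2"
    and e2: "is_epi A g2" and e1: "is_epi A g1" and x1: "exact_pair A f1 g1" and k0: "is_kernel A g0 f0"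
    and xb: "exact_pair A db2 db1" and zc: "is_zero A (Cmp A dc1 dc2)"
    and q': "is_cokernel A da q'" and q: "is_cokernel A db1 q"
    and m: "m \<in> Hom A (Cod A q') (Cod A q)" "Cmp A m q' = Cmp A q f0"
    and \<kappa>: "is_kernel A m \<kappa>"
  shows "isomorphic A (homology_object A dc2 dc1) (Dom A \<kappa>)"
proof -
  have arr: "f1 \<in> Arr A" "f0 \<in> Arr A" "g2 \<in> Arr A" "g1 \<in> Arr A" "g0 \<in> Arr A" "da \<in> Arr A" "db2 \<in> Arr A"
    "db1 \<in> Arr A" "dc2 \<in> Arr A" "dc1 \<in> Arr A" "m \<in> Arr A" "q' \<in> Arr A" "q \<in> Arr A" "\<kappa> \<in> Arr A"
    using f1 f0 g2 g1 g0 da db2 db1 dc2 dc1 m cokernelD(2)[OF q'] cokernelD(2)[OF q] kernelD(2)[OF \<kappa>]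
    by (simp_all add: Hom_iff)
  have dc: "Dom A f1 = a1" "Cod A f1 = b1" "Dom A f0 = a0" "Cod A f0 = b0" "Dom A g2 = b2" "Cod A g2 = c2"
    "Dom A g1 = b1" "Cod A g1 = c1" "Dom A g0 = b0" "Cod A g0 = c0" "Dom A da = a1" "Cod A da = a0"
    "Dom A db2 = b2" "Cod A db2 = b1" "Dom A db1 = b1" "Cod A db1 = b0"
    "Dom A dc2 = c2" "Cod A dc2 = c1" "Dom A dc1 = c1" "Cod A dc1 = c0"
    "Dom A q' = a0" "Dom A q = b0" "Dom A m = Cod A q'" "Cod A m = Cod A q" "Cod A \<kappa> = Cod A q'"
    using f1 f0 g2 g1 g0 da db2 db1 dc2 dc1 m cokernelD(3)[OF q'] cokernelD(3)[OF q] kernelD(3)[OF \<kappa>]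
    by (simp_all add: Hom_iff)
  have "Cod A f1 \<in> Obj A" "Cod A f0 \<in> Obj A" "Cod A g1 \<in> Obj A" using arr by simp_all
  then have "b1 \<in> Obj A" "b0 \<in> Obj A" "c1 \<in> Obj A" unfolding dc .
  note arr = arr this
  note S = Cmp_eq_extend[OF c1] Cmp_eq_extend[OF c2] Cmp_eq_extend[OF c3] Cmp_eq_extend[OF m(2)]
    c1 c2 c3 m(2) arr dc
  note m\<kappa> = kernelD(5)[OF \<kappa>] and mf0 = kernelD(5)[OF k0]
  have zdb: "is_zero A (Cmp A db1 db2)" using xb by (simp add: exact_pair_def)
  have zgf1: "is_zero A (Cmp A g1 f1)" using x1 by (simp add: exact_pair_def)
  define w where "w = kernel_choice A (Cmp A g0 db1)"
  have w: "is_kernel A (Cmp A g0 db1) w" unfolding w_def by (rule kernel_choice) (simp add: arr dc)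
  have dw: "w \<in> Arr A" "Cod A w = b1" "is_zero A (Cmp A g0 (Cmp A db1 w))"
    using kernelD[OF w] by (simp_all add: arr dc)
  note mw = kernelD(5)[OF w]
  obtain k \<pi> where k: "is_kernel A dc1 k" and epi_pi: "is_epi A \<pi>" and pi: "Dom A \<pi> = Dom A k"
      "Cod A \<pi> = homology_object A dc2 dc1"
    and pz: "\<And>u. u \<in> Arr A \<Longrightarrow> Cod A u = Dom A k \<Longrightarrow> is_zero A (Cmp A \<pi> u) \<longleftrightarrow> in_image A dc2 (Cmp A k u)"
    using homology_object[of dc2 dc1] zc arr dc by auto
  have piA: "\<pi> \<in> Arr A" using epi_pi by (rule epi_Arr)
  have kk: "k \<in> Arr A" "Cod A k = c1" using kernelD(2,3)[OF k] dc by simp_all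
  note mk = kernelD(5)[OF k] and zk = kernelD(4)[OF k]
  \<comment> \<open>Elements of \<open>w\<close> are chains of the middle complex whose image in c
    is a cycle. So g1 sends them to cycles, while their boundary is killed by g0 and comes from an
    element t of a0.\<close>
  obtain u1 where u1: "u1 \<in> Arr A" "Dom A u1 = Dom A w" "Cod A u1 = Dom A k" "Cmp A k u1 = Cmp A g1 w"
    using kernel_lift[OF k, of "Cmp A g1 w"] dw by (auto simp: S)
  obtain t where t: "t \<in> Arr A" "Dom A t = Dom A w" "Cod A t = a0" "Cmp A f0 t = Cmp A db1 w"
    using kernel_lift[OF k0, of "Cmp A db1 w"] dw by (auto simp: S)
  have "is_zero A (Cmp A q (Cmp A db1 w))"
    by (rule zero_extend[OF cokernelD(4)[OF q]]) (simp_all add: arr dc dw)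
  then have "is_zero A (Cmp A m (Cmp A q' t))" using t dw by (simp add: S)
  then obtain v where v: "v \<in> Arr A" "Dom A v = Dom A w" "Cod A v = Dom A \<kappa>" "Cmp A \<kappa> v = Cmp A q' t"
    using kernel_lift[OF \<kappa>, of "Cmp A q' t"] t arr dc by auto
  have ho: "homology_object A dc2 dc1 \<in> Obj A" using Obj_Cod[OF piA] pi by simp
  note T = ho u1 t v dw kk piA pi Cmp_eq_extend[OF u1(4)] Cmp_eq_extend[OF t(4)] Cmp_eq_extend[OF v(4)]
  \<comment> \<open>A cycle of c lifts along g1 to an element of b1, and the lift belongs to
    \<open>w\<close> because dc1 kills the cycle.\<close>
  have "is_epi A (Cmp A \<pi> u1)"
  proof (rule epiI_element)
    show "Cmp A \<pi> u1 \<in> Arr A" using T by simp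
    obtain p z where p: "is_epi A p" "p \<in> Arr A" "Cod A p = Cod A \<pi>" "z \<in> Arr A" "Dom A z = Dom A p"
     "Cod A z = Dom A k" "Cmp A \<pi> z = p"
      using in_imageE[OF epi_in_image[OF epi_pi, of "Ide A (Cod A \<pi>)"]] T
      by (metis Arr_Ide Cmp_Ide_left Cod_Ide Dom_Ide Obj_Cod)
    obtain p' s where p': "is_epi A p'" "p' \<in> Arr A" "Cod A p' = Dom A p" "s \<in> Arr A" "Dom A s = Dom A p'"
     "Cod A s = b1" "Cmp A g1 s = Cmp A k (Cmp A z p')"
      using in_imageE[OF epi_in_image[OF e1, of "Cmp A k z"]] p T dc by auto
    have "is_zero A (Cmp A dc1 (Cmp A k (Cmp A z p')))"
      by (rule zero_extend[OF zk]) (use p p' T arr dc in simp_all)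
    then have "is_zero A (Cmp A g0 (Cmp A db1 s))"
      using Cmp_eq_extend[OF c2, of s] p' arr dc by simp
    then obtain y where y: "y \<in> Arr A" "Dom A y = Dom A s" "Cod A y = Dom A w" "Cmp A w y = s"
      using kernel_lift[OF w p'(4)] p' arr dc by auto
    have "Cmp A u1 y = Cmp A z p'"
      by (rule mono_cancel[OF mk]) (use y p p' T arr dc in simp_all)
    then have "Cmp A (Cmp A \<pi> u1) y = Cmp A p p'"
      using y p p' T Cmp_eq_extend[OF p(7), of p'] by simp
    then show "in_image A (Cmp A \<pi> u1) (Ide A (Cod A (Cmp A \<pi> u1)))"
      by (intro in_imageI[of A "Cmp A p p'" _ y]) (use y p p' T in \<open>simp_all add: epi_Cmp\<close>)
  qed
  \<comment> \<open>An element of the kernel of m is represented by some z in a0 for which f0 z is a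
    boundary db1 y. Then y belongs to \<open>w\<close>, and v sends it back to the given
    element.\<close>
  moreover have "is_epi A v"
  proof (rule epiI_element)
    have q'epi: "is_epi A q'" using cokernelD[OF q'] by simp
    obtain p z where p: "is_epi A p" "p \<in> Arr A" "Cod A p = Dom A \<kappa>" "z \<in> Arr A" "Dom A z = Dom A p"
     "Cod A z = a0" "Cmp A q' z = Cmp A \<kappa> p"
      using in_imageE[OF epi_in_image[OF q'epi, of \<kappa>]] arr dc by metis
    have "is_zero A (Cmp A m (Cmp A \<kappa> p))"
      by (rule zero_extend[OF kernelD(4)[OF \<kappa>]]) (use p arr dc in simp_all)
    then have "is_zero A (Cmp A q (Cmp A f0 z))"
      using Cmp_eq_extend[OF m(2), of z] p arr dc by simp
    then have "in_image A db1 (Cmp A f0 z)"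
      using cokernel_in_image[OF q, of "Cmp A f0 z"] p arr dc by simp
    then obtain p' y where p': "is_epi A p'" "p' \<in> Arr A" "Cod A p' = Dom A p" "y \<in> Arr A" "Dom A y = Dom A p'"
      "Cod A y = b1" "Cmp A db1 y = Cmp A f0 (Cmp A z p')"
      by (rule in_imageE) (use p arr dc in simp)
    have "is_zero A (Cmp A g0 (Cmp A f0 (Cmp A z p')))"
      by (rule zero_extend[OF kernelD(4)[OF k0]]) (use p p' arr dc in simp_all)
    then obtain y' where y': "y' \<in> Arr A" "Dom A y' = Dom A y" "Cod A y' = Dom A w" "Cmp A w y' = y"
      using kernel_lift[OF w, of y] p' arr dc by auto
    have ty: "Cmp A t y' = Cmp A z p'"
      by (rule mono_cancel[OF mf0]) (use y' p p' T arr dc in simp_all)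
    have "Cmp A v y' = Cmp A p p'"
      by (rule mono_cancel[OF m\<kappa>]) (use y' p p' T arr dc ty Cmp_eq_extend[OF p(7), of p'] in simp_all)
    then show "in_image A v (Ide A (Cod A v))"
      by (intro in_imageI[of A "Cmp A p p'" _ y']) (use y' p p' T arr in \<open>simp_all add: epi_Cmp\<close>)
  qed (rule v)
  ultimately have "isomorphic A (Cod A (Cmp A \<pi> u1)) (Cod A v)"
  proof (rule epis_same_kernel_iso)
    fix u assume u: "u \<in> Arr A" "Cod A u = Dom A (Cmp A \<pi> u1)"
    have u': "Cod A u = Dom A w" using u T by simp
    have "is_zero A (Cmp A (Cmp A \<pi> u1) u) \<longleftrightarrow> in_image A dc2 (Cmp A g1 (Cmp A w u))"
      using pz[of "Cmp A u1 u"] u u' T arr dc by simp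
    \<comment> \<open>Both conditions say that, after an epimorphism, the element of
      \<open>w\<close> is a sum of some f1 s and some db2 z. In one direction s is supplied by
      exactness of f1 and g1, in the other z is supplied by exactness of db2 and db1.\<close>
    also have "\<dots> \<longleftrightarrow> in_image A da (Cmp A t u)"
    proof
      assume "in_image A dc2 (Cmp A g1 (Cmp A w u))"
      then obtain p y where p: "is_epi A p" "p \<in> Arr A" "Cod A p = Dom A u" "y \<in> Arr A" "Dom A y = Dom A p"
        "Cod A y = c2" "Cmp A dc2 y = Cmp A g1 (Cmp A w (Cmp A u p))"
        by (rule in_imageE) (use u u' T arr dc in simp)
      obtain p' z where p': "is_epi A p'" "p' \<in> Arr A" "Cod A p' = Dom A p" "z \<in> Arr A" "Dom A z = Dom A p'"
        "Cod A z = b2" "Cmp A g2 z = Cmp A y p'"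
        using in_imageE[OF epi_in_image[OF e2, of y]] p arr dc by metis
      define r where "r = Sub A (Cmp A w (Cmp A u (Cmp A p p'))) (Cmp A db2 z)"
      have r: "r \<in> Arr A" "Dom A r = Dom A p'" "Cod A r = b1"
        unfolding r_def using p p' u u' T arr dc by simp_all
      have "Cmp A g1 (Cmp A db2 z) = Cmp A g1 (Cmp A w (Cmp A u (Cmp A p p')))"
        using Cmp_eq_extend[OF c3, of z] Cmp_eq_extend[OF p(7), of p'] p p' u u' T arr dc by simp
      then have "is_zero A (Cmp A g1 r)"
        unfolding r_def using p p' u u' T arr dc by (simp add: Cmp_Sub_right)
      then have "in_image A f1 r" using x1 r dc by (simp add: exact_pair_def)
      then obtain p'' s where s: "is_epi A p''" "p'' \<in> Arr A" "Cod A p'' = Dom A p'" "s \<in> Arr A" "Dom A s = Dom A p''"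
        "Cod A s = a1" "Cmp A f1 s = Cmp A r p''"
        by (rule in_imageE) (use r dc in simp)
      have "is_zero A (Cmp A db1 (Cmp A db2 (Cmp A z p'')))"
        by (rule zero_extend[OF zdb]) (use p' s arr dc in simp_all)
      then have z: "Cmp A db1 (Cmp A db2 (Cmp A z p'')) = Zer A (Dom A p'') b0"
        using p' s arr dc by (simp add: is_zero_def)
      have "Cmp A db1 (Cmp A r p'') = Cmp A db1 (Cmp A w (Cmp A u (Cmp A p (Cmp A p' p''))))"
        unfolding r_def using p p' s u u' T arr dc z by (simp add: Cmp_Sub_right Cmp_Sub_left) (simp add: Sub_def)
      then have "Cmp A f0 (Cmp A da s) = Cmp A f0 (Cmp A t (Cmp A u (Cmp A p (Cmp A p' p''))))"
        using Cmp_eq_extend[OF c1, of s] s p p' u u' T arr dc by simp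
      then have "Cmp A da s = Cmp A t (Cmp A u (Cmp A p (Cmp A p' p'')))"
        by (rule mono_cancel[OF mf0, rotated -1]) (use s p p' u u' T arr dc in simp_all)
      then show "in_image A da (Cmp A t u)"
        by (intro in_imageI[of A "Cmp A p (Cmp A p' p'')" _ s]) (use s p p' u u' T arr dc in \<open>simp_all add: epi_Cmp\<close>)
    next
      assume "in_image A da (Cmp A t u)"
      then obtain p y where p: "is_epi A p" "p \<in> Arr A" "Cod A p = Dom A u" "y \<in> Arr A" "Dom A y = Dom A p"
        "Cod A y = a1" "Cmp A da y = Cmp A t (Cmp A u p)"
        by (rule in_imageE) (use u u' T arr dc in simp)
      define r where "r = Sub A (Cmp A w (Cmp A u p)) (Cmp A f1 y)"
      have r: "r \<in> Arr A" "Dom A r = Dom A p" "Cod A r = b1"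
        unfolding r_def using p u u' T arr dc by simp_all
      have "Cmp A db1 (Cmp A f1 y) = Cmp A db1 (Cmp A w (Cmp A u p))"
        using Cmp_eq_extend[OF c1, of y] p u u' T arr dc by simp
      then have "is_zero A (Cmp A db1 r)"
        unfolding r_def using p u u' T arr dc by (simp add: Cmp_Sub_right)
      then have "in_image A db2 r" using xb r dc by (simp add: exact_pair_def)
      then obtain p' s where s: "is_epi A p'" "p' \<in> Arr A" "Cod A p' = Dom A p" "s \<in> Arr A" "Dom A s = Dom A p'"
        "Cod A s = b2" "Cmp A db2 s = Cmp A r p'"
        by (rule in_imageE) (use r dc in simp)
      have "is_zero A (Cmp A g1 (Cmp A f1 (Cmp A y p')))"
        by (rule zero_extend[OF zgf1]) (use p s arr dc in simp_all)
      then have z: "Cmp A g1 (Cmp A f1 (Cmp A y p')) = Zer A (Dom A p') c1"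
        using p s arr dc by (simp add: is_zero_def)
      have "Cmp A g1 (Cmp A r p') = Cmp A g1 (Cmp A w (Cmp A u (Cmp A p p')))"
        unfolding r_def using p s u u' T arr dc z by (simp add: Cmp_Sub_right Cmp_Sub_left) (simp add: Sub_def)
      then have "Cmp A dc2 (Cmp A g2 s) = Cmp A g1 (Cmp A w (Cmp A u (Cmp A p p')))"
        using Cmp_eq_extend[OF c3, of s] s arr dc by simp
      then show "in_image A dc2 (Cmp A g1 (Cmp A w u))"
        by (intro in_imageI[of A "Cmp A p p'" _ "Cmp A g2 s"]) (use s p u u' T arr dc in \<open>simp_all add: epi_Cmp\<close>)
    qed
    also have "\<dots> \<longleftrightarrow> is_zero A (Cmp A q' (Cmp A t u))"
      by (rule cokernel_in_image[OF q', symmetric]) (use u u' T arr dc in simp_all)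
    also have "\<dots> \<longleftrightarrow> is_zero A (Cmp A v u)"
      using mono_zero[OF m\<kappa>, of "Cmp A v u"] u u' T arr dc by simp
    finally show "is_zero A (Cmp A (Cmp A \<pi> u1) u) \<longleftrightarrow> is_zero A (Cmp A v u)" .
  qed (use T in simp)
  then show ?thesis using T by simp
qed

text \<open>Exactness of the complex b does the work. A cycle of a becomes a boundary in b, so its
  class dies under m. Conversely, if the class of z dies, then f1 z is a boundary, so f0 da1 z = 0
  and z is a cycle since f0 is monic. Hence the cycles map onto the kernel of m, and what goes to
  zero are the boundaries.\<close>

lemma homology_iso_kernel:
  assumes f1: "f1 \<in> Hom A a1 b1" and f0: "f0 \<in> Hom A a0 b0"
    and da2: "da2 \<in> Hom A a2 a1" and da1: "da1 \<in> Hom A a1 a0"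
    and db2: "db2 \<in> Hom A b2 b1" and db1: "db1 \<in> Hom A b1 b0"
    and c1: "Cmp A db1 f1 = Cmp A f0 da1"
    and k0: "is_mono A f0" and za: "is_zero A (Cmp A da1 da2)"
    and xb: "exact_pair A db2 db1"
    and q': "is_cokernel A da2 q'" and q: "is_cokernel A db2 q"
    and m: "m \<in> Hom A (Cod A q') (Cod A q)" "Cmp A m q' = Cmp A q f1"
    and \<kappa>: "is_kernel A m \<kappa>"
  shows "isomorphic A (homology_object A da2 da1) (Dom A \<kappa>)"
proof -
  have arr: "f1 \<in> Arr A" "f0 \<in> Arr A" "da2 \<in> Arr A" "da1 \<in> Arr A" "db2 \<in> Arr A"
    "db1 \<in> Arr A" "m \<in> Arr A" "q' \<in> Arr A" "q \<in> Arr A" "\<kappa> \<in> Arr A"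
    using f1 f0 da1 da2 db2 db1 m cokernelD(2)[OF q'] cokernelD(2)[OF q] kernelD(2)[OF \<kappa>]
    by (simp_all add: Hom_iff)
  have dc: "Dom A f1 = a1" "Cod A f1 = b1" "Dom A f0 = a0" "Cod A f0 = b0" 
    "Dom A da1 = a1" "Cod A da1 = a0" "Dom A da2 = a2" "Cod A da2 = a1"
    "Dom A db2 = b2" "Cod A db2 = b1" "Dom A db1 = b1" "Cod A db1 = b0"
    "Dom A q' = a1" "Dom A q = b1" "Dom A m = Cod A q'" "Cod A m = Cod A q" "Cod A \<kappa> = Cod A q'"
    using f1 f0 da1 da2 db2 db1 m cokernelD(3)[OF q'] cokernelD(3)[OF q] kernelD(3)[OF \<kappa>]
    by (simp_all add: Hom_iff)
  note m\<kappa> = kernelD(5)[OF \<kappa>]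
  have zdb: "is_zero A (Cmp A db1 db2)" using xb by (simp add: exact_pair_def)
  obtain k \<pi> where k: "is_kernel A da1 k" and epi_pi: "is_epi A \<pi>" and pi: "Dom A \<pi> = Dom A k"
      "Cod A \<pi> = homology_object A da2 da1"
    and pz: "\<And>u. u \<in> Arr A \<Longrightarrow> Cod A u = Dom A k \<Longrightarrow> is_zero A (Cmp A \<pi> u) \<longleftrightarrow> in_image A da2 (Cmp A k u)"
    using homology_object[of da2 da1] za arr dc by auto
  have piA: "\<pi> \<in> Arr A" using epi_pi by (rule epi_Arr)
  have kk: "k \<in> Arr A" "Cod A k = a1" using kernelD(2,3)[OF k] dc by simp_all
  have "is_zero A (Cmp A f0 (Cmp A da1 k))"
    by (rule is_zero_Cmp_right[OF kernelD(4)[OF k]]) (use arr dc kk in simp_all)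
  then have "is_zero A (Cmp A db1 (Cmp A f1 k))"
    using Cmp_eq_extend[OF c1, of k] arr dc kk by simp
  then have "in_image A db2 (Cmp A f1 k)" using xb arr dc kk by (simp add: exact_pair_def)
  then have "is_zero A (Cmp A q (Cmp A f1 k))"
    using cokernel_in_image[OF q, of "Cmp A f1 k"] arr dc kk by simp
  then have "is_zero A (Cmp A m (Cmp A q' k))"
    using Cmp_eq_extend[OF m(2), of k] arr dc kk by simp
  then obtain v where v: "v \<in> Arr A" "Dom A v = Dom A k" "Cod A v = Dom A \<kappa>" "Cmp A \<kappa> v = Cmp A q' k"
    using kernel_lift[OF \<kappa>, of "Cmp A q' k"] kk arr dc by auto
  note T = v kk piA pi Cmp_eq_extend[OF v(4)]
  have "is_epi A v"
  proof (rule epiI_element)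
    have q'epi: "is_epi A q'" using cokernelD[OF q'] by simp
    obtain p z where p: "is_epi A p" "p \<in> Arr A" "Cod A p = Dom A \<kappa>" "z \<in> Arr A" "Dom A z = Dom A p"
     "Cod A z = a1" "Cmp A q' z = Cmp A \<kappa> p"
      using in_imageE[OF epi_in_image[OF q'epi, of \<kappa>]] arr dc by metis
    have "is_zero A (Cmp A m (Cmp A \<kappa> p))"
      by (rule zero_extend[OF kernelD(4)[OF \<kappa>]]) (use p arr dc in simp_all)
    then have "is_zero A (Cmp A q (Cmp A f1 z))"
      using Cmp_eq_extend[OF m(2), of z] p arr dc by simp
    then have "in_image A db2 (Cmp A f1 z)"
      using cokernel_in_image[OF q, of "Cmp A f1 z"] p arr dc by simp
    then have "is_zero A (Cmp A db1 (Cmp A f1 z))"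
      by (rule in_image_zero) (use zdb p arr dc in simp_all)
    then have "is_zero A (Cmp A f0 (Cmp A da1 z))"
      using Cmp_eq_extend[OF c1, of z] p arr dc by simp
    then have "is_zero A (Cmp A da1 z)" using mono_zero[OF k0, of "Cmp A da1 z"] p arr dc by simp
    then obtain y where y: "y \<in> Arr A" "Dom A y = Dom A z" "Cod A y = Dom A k" "Cmp A k y = z"
      using kernel_lift[OF k, of z] p arr dc by auto
    have "Cmp A v y = p"
      by (rule mono_cancel[OF m\<kappa>]) (use y p T arr dc in simp_all)
    then show "in_image A v (Ide A (Cod A v))"
      by (intro in_imageI[of A p _ y]) (use y p T arr in simp_all)
  qed (rule v)
  then have "isomorphic A (Cod A \<pi>) (Cod A v)"
  proof (rule epis_same_kernel_iso[OF epi_pi])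
    fix u assume u: "u \<in> Arr A" "Cod A u = Dom A \<pi>"
    have "is_zero A (Cmp A \<pi> u) \<longleftrightarrow> in_image A da2 (Cmp A k u)"
      by (rule pz) (use u T in simp_all)
    also have "\<dots> \<longleftrightarrow> is_zero A (Cmp A q' (Cmp A k u))"
      by (rule cokernel_in_image[OF q', symmetric]) (use u T arr dc in simp_all)
    also have "\<dots> \<longleftrightarrow> is_zero A (Cmp A v u)"
      using mono_zero[OF m\<kappa>, of "Cmp A v u"] u T arr dc by simp
    finally show "is_zero A (Cmp A \<pi> u) \<longleftrightarrow> is_zero A (Cmp A v u)" .
  qed (use T in simp)
  then show ?thesis using T by simp
qed

end

section \<open>Small coproducts\<close>

text \<open>An index set need not lie in the type 's; an injection into it is enough to transport
  coproducts.\<close>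

definition small :: "'s itself \<Rightarrow> 'i set \<Rightarrow> bool" where
  "small (_ :: 's itself) I \<longleftrightarrow> (\<exists>c :: 'i \<Rightarrow> 's. inj_on c I)"

lemma small_self: "small (s :: 's itself) (I :: 's set)"
  unfolding small_def by (rule exI[of _ id]) simp

lemma small_nat: "infinite (UNIV :: 's set) \<Longrightarrow> small (s :: 's itself) (I :: nat set)"
  unfolding small_def using infinite_countable_subset[of "UNIV :: 's set"] by (blast intro: inj_on_subset)

lemma is_coproductD:
  assumes "is_coproduct A I D P inc" "Q \<in> Obj A" "\<forall>i\<in>I. f i \<in> Hom A (D i) Q"
  shows "\<exists>!h. h \<in> Hom A P Q \<and> (\<forall>i\<in>I. Cmp A h (inc i) = f i)"
proof -
  have "\<forall>f. (\<forall>i\<in>I. f i \<in> Hom A (D i) Q) \<longrightarrow> (\<exists>!h. h \<in> Hom A P Q \<and> (\<forall>i\<in>I. Cmp A h (inc i) = f i))"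
    using assms(1,2) unfolding is_coproduct_def by (elim conjE) (erule bspec)
  then show ?thesis using assms(3) by (elim allE[of _ f] mp)
qed

text \<open>Infinitude makes sets of natural numbers small, and with them the finite families of
  degeneracies; it also makes the arrows of the category of elements a small set.\<close>

locale AB4 = abelian_category A for A :: "('o, 'm, 'z) pcat_scheme" +
  fixes s :: "'s itself"
  assumes AB4: "AB4_category A s" and infinite: "infinite (UNIV :: 's set)"
begin

definition fam :: "'i set \<Rightarrow> ('i \<Rightarrow> 'o) \<Rightarrow> bool" where
  "fam I D \<longleftrightarrow> small s I \<and> (\<forall>i\<in>I. D i \<in> Obj A)"

lemma fam_self: "(\<And>i. i \<in> I \<Longrightarrow> D i \<in> Obj A) \<Longrightarrow> fam (I :: 's set) D"
  by (simp add: fam_def small_self)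

text \<open>Reindexing along an injection into 's reduces to the index sets that the axiom
  covers.\<close>

lemma coproduct_exists:
  fixes I :: "'i set"
  assumes "fam I D" shows "\<exists>P inc. is_coproduct A I D P inc"
proof -
  obtain c :: "'i \<Rightarrow> 's" where c: "inj_on c I" using assms by (auto simp: fam_def small_def)
  have "\<forall>i\<in>c ` I. (D \<circ> inv_into I c) i \<in> Obj A" using assms c by (auto simp: fam_def)
  then obtain P inc where P: "is_coproduct A (c ` I) (D \<circ> inv_into I c) P inc"
    using AB4 unfolding AB4_category_def by metis
  have "is_coproduct A I D P (inc \<circ> c)"
    unfolding is_coproduct_def
  proof (intro conjI ballI allI impI)
    show "P \<in> Obj A" using P by (simp add: is_coproduct_def)
    show "(inc \<circ> c) i \<in> Hom A (D i) P" if "i \<in> I" for i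
      using P that c by (auto simp: is_coproduct_def)
    fix Q f assume Q: "Q \<in> Obj A" and f: "\<forall>i\<in>I. f i \<in> Hom A (D i) Q"
    have "\<forall>i\<in>c ` I. (f \<circ> inv_into I c) i \<in> Hom A ((D \<circ> inv_into I c) i) Q"
      using f c by auto
    then have "\<exists>!h. h \<in> Hom A P Q \<and> (\<forall>i\<in>c ` I. Cmp A h (inc i) = (f \<circ> inv_into I c) i)"
      by (rule is_coproductD[OF P Q])
    then show "\<exists>!h. h \<in> Hom A P Q \<and> (\<forall>i\<in>I. Cmp A h ((inc \<circ> c) i) = f i)"
      using c by simp
  qed
  then show ?thesis by blast
qed

lemma coprod_is_coproduct: "fam I D \<Longrightarrow> is_coproduct A I D (coprod A I D) (coprod_in A I D)"
  unfolding coprod_def coprod_in_def coprod_choice_def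
  by (rule someI_ex[where P="\<lambda>p. is_coproduct A I D (fst p) (snd p)"]) (use coproduct_exists in auto)

lemma coprod_Obj: "fam I D \<Longrightarrow> coprod A I D \<in> Obj A"
  using coprod_is_coproduct[of I D] by (simp add: is_coproduct_def)

lemma coprod_in:
  assumes "fam I D" "i \<in> I"
  shows "coprod_in A I D i \<in> Arr A" "Dom A (coprod_in A I D i) = D i" "Cod A (coprod_in A I D i) = coprod A I D"
  using coprod_is_coproduct[OF assms(1)] assms(2) by (simp_all add: is_coproduct_def Hom_iff)

lemma coprod_ext:
  assumes I: "fam I D" and u: "u \<in> Arr A" "v \<in> Arr A" "Dom A u = coprod A I D" "Dom A v = coprod A I D"
    "Cod A u = Cod A v" and eq: "\<And>i. i \<in> I \<Longrightarrow> Cmp A u (coprod_in A I D i) = Cmp A v (coprod_in A I D i)"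
  shows "u = v"
proof -
  have "\<forall>i\<in>I. Cmp A v (coprod_in A I D i) \<in> Hom A (D i) (Cod A v)"
    using u coprod_in[OF I] by (simp add: Hom_iff)
  then have "\<exists>!h. h \<in> Hom A (coprod A I D) (Cod A v) \<and> (\<forall>i\<in>I. Cmp A h (coprod_in A I D i) = Cmp A v (coprod_in A I D i))"
    by (rule is_coproductD[OF coprod_is_coproduct[OF I] Obj_Cod[OF u(2)]])
  moreover have "u \<in> Hom A (coprod A I D) (Cod A v)" "v \<in> Hom A (coprod A I D) (Cod A v)"
    using u by (simp_all add: Hom_iff)
  ultimately show ?thesis using eq by blast
qed

lemma coprod_zero:
  assumes I: "fam I D" and u: "u \<in> Arr A" "Dom A u = coprod A I D"
    and z: "\<And>i. i \<in> I \<Longrightarrow> is_zero A (Cmp A u (coprod_in A I D i))"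
  shows "is_zero A u"
proof (rule is_zeroI, rule coprod_ext[OF I])
  fix i assume i: "i \<in> I"
  show "Cmp A u (coprod_in A I D i) = Cmp A (Zer A (Dom A u) (Cod A u)) (coprod_in A I D i)"
    by (rule zero_eq[OF z[OF i]]) (use u coprod_in[OF I i] I in \<open>simp_all add: fam_def i\<close>)
qed (use u coprod_Obj[OF I] in simp_all)

lemma copair:
  assumes I: "fam I D" and Q: "Q \<in> Obj A"
    and f: "\<forall>i\<in>I. f i \<in> Hom A (D i) Q"
  shows "copair A I D Q f \<in> Arr A" "Dom A (copair A I D Q f) = coprod A I D" "Cod A (copair A I D Q f) = Q"
    "i \<in> I \<Longrightarrow> Cmp A (copair A I D Q f) (coprod_in A I D i) = f i"
proof -
  have "\<exists>!h. h \<in> Hom A (coprod A I D) Q \<and> (\<forall>i\<in>I. Cmp A h (coprod_in A I D i) = f i)"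
    by (rule is_coproductD[OF coprod_is_coproduct[OF I] Q f])
  from theI'[OF this] show "copair A I D Q f \<in> Arr A" "Dom A (copair A I D Q f) = coprod A I D" "Cod A (copair A I D Q f) = Q"
    "i \<in> I \<Longrightarrow> Cmp A (copair A I D Q f) (coprod_in A I D i) = f i"
    unfolding copair_def by (simp_all add: Hom_iff)
qed

lemma coprod_map:
  assumes I: "fam I D" "fam I E"
    and f: "\<forall>i\<in>I. f i \<in> Hom A (D i) (E i)"
  shows "coprod_map A I D E f \<in> Arr A" "Dom A (coprod_map A I D E f) = coprod A I D"
    "Cod A (coprod_map A I D E f) = coprod A I E"
    "i \<in> I \<Longrightarrow> Cmp A (coprod_map A I D E f) (coprod_in A I D i) = Cmp A (coprod_in A I E i) (f i)"
  unfolding coprod_map_def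
  by (rule copair[OF I(1) coprod_Obj[OF I(2)]]; use f coprod_in[OF I(2)] in \<open>simp add: Hom_iff\<close>)+

section \<open>Exactness of coproducts over small index sets\<close>

lemma coprod_map_epi:
  assumes I: "fam I D" "fam I E"
    and f: "\<And>i. i \<in> I \<Longrightarrow> is_epi A (f i)" "\<And>i. i \<in> I \<Longrightarrow> Dom A (f i) = D i" "\<And>i. i \<in> I \<Longrightarrow> Cod A (f i) = E i"
  shows "is_epi A (coprod_map A I D E f)"
proof -
  have fA: "f i \<in> Arr A" if "i \<in> I" for i using f(1)[OF that] by (rule epi_Arr)
  have "\<forall>i\<in>I. f i \<in> Hom A (D i) (E i)" using fA f by (simp add: Hom_iff)
  note chain_trans = coprod_map[OF I this]
  show ?thesis
  proof (rule epiI)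
    fix u assume u: "u \<in> Arr A" "Dom A u = Cod A (coprod_map A I D E f)" "is_zero A (Cmp A u (coprod_map A I D E f))"
    show "is_zero A u"
    proof (rule coprod_zero[OF I(2) u(1)])
      show "Dom A u = coprod A I E" using u chain_trans by simp
      fix i assume i: "i \<in> I"
      have "is_zero A (Cmp A u (Cmp A (coprod_map A I D E f) (coprod_in A I D i)))"
        by (rule zero_extend[OF u(3)]) (use u chain_trans coprod_in[OF I(1) i] in simp_all)
      then have "is_zero A (Cmp A (Cmp A u (coprod_in A I E i)) (f i))"
        using chain_trans(4)[OF i] u chain_trans coprod_in[OF I(2) i] f fA i by simp
      then show "is_zero A (Cmp A u (coprod_in A I E i))"
        using epi_zero[OF f(1)[OF i], of "Cmp A u (coprod_in A I E i)"] u chain_trans coprod_in[OF I(2) i] f i by simp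
    qed
  qed (rule chain_trans)
qed

text \<open>Formal from the universal property: an arrow that kills the image of every f i factors
  on each summand, and the factors are copaired.\<close>

lemma coprod_map_cokernel:
  assumes I: "fam I D" "fam I D'" "fam I D''"
    and f: "\<And>i. i \<in> I \<Longrightarrow> Dom A (f i) = D i" "\<And>i. i \<in> I \<Longrightarrow> Cod A (f i) = D' i"
    and g: "\<And>i. i \<in> I \<Longrightarrow> Cod A (g i) = D'' i" and c: "\<And>i. i \<in> I \<Longrightarrow> is_cokernel A (f i) (g i)"
  shows "is_cokernel A (coprod_map A I D D' f) (coprod_map A I D' D'' g)"
proof -
  have a: "f i \<in> Arr A" "g i \<in> Arr A" "Dom A (g i) = D' i" "is_epi A (g i)" if "i \<in> I" for i
    using cokernelD[OF c[OF that]] f that by simp_all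
  have "\<forall>i\<in>I. f i \<in> Hom A (D i) (D' i)" "\<forall>i\<in>I. g i \<in> Hom A (D' i) (D'' i)" using a f g by (simp_all add: Hom_iff)
  note F = coprod_map[OF I(1,2) this(1)] and G = coprod_map[OF I(2,3) this(2)]
  show ?thesis
  proof (rule cokernelI)
    show "is_epi A (coprod_map A I D' D'' g)" by (rule coprod_map_epi[OF I(2,3) a(4,3) g])
    show "is_zero A (Cmp A (coprod_map A I D' D'' g) (coprod_map A I D D' f))"
    proof (rule coprod_zero[OF I(1)])
      fix i assume i: "i \<in> I"
      have "is_zero A (Cmp A (coprod_in A I D'' i) (Cmp A (g i) (f i)))"
        by (rule is_zero_Cmp_right[OF cokernelD(4)[OF c[OF i]]]) (use coprod_in[OF I(3) i] a i f g in simp_all)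
      then show "is_zero A (Cmp A (Cmp A (coprod_map A I D' D'' g) (coprod_map A I D D' f)) (coprod_in A I D i))"
        using F G Cmp_eq_extend[OF G(4)[OF i], of "f i"] coprod_in[OF I(1) i] coprod_in[OF I(2) i] coprod_in[OF I(3) i] a i f g by simp
    qed (use F G in simp_all)
    fix h assume h: "h \<in> Arr A" "Dom A h = Cod A (coprod_map A I D D' f)" "is_zero A (Cmp A h (coprod_map A I D D' f))"
    have "\<exists>u. u \<in> Arr A \<and> Dom A u = D'' i \<and> Cod A u = Cod A h \<and> Cmp A u (g i) = Cmp A h (coprod_in A I D' i)" if i: "i \<in> I" for i
    proof -
      have "is_zero A (Cmp A h (Cmp A (coprod_map A I D D' f) (coprod_in A I D i)))"
        by (rule zero_extend[OF h(3)]) (use h F coprod_in[OF I(1) i] in simp_all)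
      then have "is_zero A (Cmp A (Cmp A h (coprod_in A I D' i)) (f i))"
        using F h coprod_in[OF I(2) i] a i f by simp
      then obtain u where "u \<in> Arr A" "Dom A u = Cod A (g i)" "Cod A u = Cod A (Cmp A h (coprod_in A I D' i))" "Cmp A u (g i) = Cmp A h (coprod_in A I D' i)"
        using cokernel_desc[OF c[OF i], of "Cmp A h (coprod_in A I D' i)"] F h coprod_in[OF I(2) i] a i f by auto
      then show ?thesis using F h coprod_in[OF I(2) i] g[OF i] by auto
    qed
    then obtain u where u: "\<And>i. i \<in> I \<Longrightarrow> u i \<in> Arr A" "\<And>i. i \<in> I \<Longrightarrow> Dom A (u i) = D'' i" "\<And>i. i \<in> I \<Longrightarrow> Cod A (u i) = Cod A h"
       "\<And>i. i \<in> I \<Longrightarrow> Cmp A (u i) (g i) = Cmp A h (coprod_in A I D' i)" by metis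
    have "\<forall>i\<in>I. u i \<in> Hom A (D'' i) (Cod A h)" using u by (simp add: Hom_iff)
    note U = copair[OF I(3) Obj_Cod[OF h(1)] this]
    have "Cmp A (copair A I D'' (Cod A h) u) (coprod_map A I D' D'' g) = h"
    proof (rule coprod_ext[OF I(2)])
      fix i assume i: "i \<in> I"
      show "Cmp A (Cmp A (copair A I D'' (Cod A h) u) (coprod_map A I D' D'' g)) (coprod_in A I D' i) = Cmp A h (coprod_in A I D' i)"
        using U G i a u g coprod_in[OF I(2) i] coprod_in[OF I(3) i] Cmp_eq_extend[OF U(4)[OF i], of "g i"] by simp
    qed (use U h G F in simp_all)
    then show "\<exists>u. u \<in> Arr A \<and> Dom A u = Cod A (coprod_map A I D' D'' g) \<and> Cod A u = Cod A h \<and> Cmp A u (coprod_map A I D' D'' g) = h"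
      using U G by (intro exI[of _ "copair A I D'' (Cod A h) u"]) simp
  qed (use F G in simp_all)
qed

lemma mono_left: "f \<in> Arr A \<Longrightarrow> g \<in> Arr A \<Longrightarrow> Cod A f = Dom A g \<Longrightarrow> is_mono A (Cmp A g f) \<Longrightarrow> is_mono A f"
proof (rule monoI)
  fix u assume a: "f \<in> Arr A" "g \<in> Arr A" "Cod A f = Dom A g" "is_mono A (Cmp A g f)"
    and u: "u \<in> Arr A" "Cod A u = Dom A f" "is_zero A (Cmp A f u)"
  have "is_zero A (Cmp A (Cmp A g f) u)"
    using is_zero_Cmp_right[OF u(3), of g] a u by simp
  then show "is_zero A u" using mono_zero[OF a(4), of u] a u by simp
qed

text \<open>The exactness axiom enters here. It speaks of index sets inside 's, so the family is
  moved there along an injection; the comparison \<open>?tD\<close> is a split monomorphism, so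
  monicity comes back through the commuting square.\<close>

lemma coprod_map_mono:
  assumes I: "fam I D" "fam I E"
    and f: "\<And>i. i \<in> I \<Longrightarrow> is_mono A (f i)" "\<And>i. i \<in> I \<Longrightarrow> Dom A (f i) = D i" "\<And>i. i \<in> I \<Longrightarrow> Cod A (f i) = E i"
  shows "is_mono A (coprod_map A I D E f)"
proof -
  have fA: "f i \<in> Arr A" if "i \<in> I" for i using f(1)[OF that] by (rule mono_Arr)
  obtain c :: "'a \<Rightarrow> 's" where c: "inj_on c I" using I by (auto simp: fam_def small_def)
  define J where "J = c ` I"
  define D' where "D' = D \<circ> inv_into I c"
  define E' where "E' = E \<circ> inv_into I c"
  define f' where "f' = f \<circ> inv_into I c"
  have J: "fam J D'" "fam J E'" using I c by (auto simp: J_def D'_def E'_def fam_def intro!: small_self)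
  have cI: "c i \<in> J" "D' (c i) = D i" "E' (c i) = E i" "f' (c i) = f i" if "i \<in> I" for i
    using that c by (auto simp: J_def D'_def E'_def f'_def)
  have f'm: "is_mono A (f' j)" "f' j \<in> Arr A" "Dom A (f' j) = D' j" "Cod A (f' j) = E' j" if "j \<in> J" for j
    using that c f fA by (auto simp: J_def D'_def E'_def f'_def)
  have "is_mono A (coprod_map A J D' E' f')"
  proof -
    \<comment> \<open>AB4 is about short exact sequences; each monomorphism is completed to one by
      its cokernel.\<close>
    define g where "g j = cokernel_choice A (f' j)" for j
    have g: "is_cokernel A (f' j) (g j)" if "j \<in> J" for j
      unfolding g_def by (rule cokernel_choice[OF f'm(2)[OF that]])
    have "\<forall>j\<in>J. f' j \<in> Hom A (D' j) (E' j) \<and> g j \<in> Hom A (E' j) (Cod A (g j)) \<and> short_exact A (f' j) (g j)"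
      using f'm g cokernelD[OF g] mono_kernel_of_cokernel[OF f'm(1) g] by (simp add: short_exact_def Hom_iff)
    then have "short_exact A (coprod_map A J D' E' f') (coprod_map A J E' (\<lambda>j. Cod A (g j)) g)"
      using AB4 unfolding AB4_category_def by metis
    then show ?thesis unfolding short_exact_def using kernelD(5) by blast
  qed
  have "\<forall>i\<in>I. f i \<in> Hom A (D i) (E i)" "\<forall>j\<in>J. f' j \<in> Hom A (D' j) (E' j)" using fA f f'm by (simp_all add: Hom_iff)
  note F = coprod_map[OF I this(1)] and F' = coprod_map[OF J this(2)]
  note in1 = coprod_in[OF I(1)] and in2 = coprod_in[OF I(2)] and in1' = coprod_in[OF J(1)] and in2' = coprod_in[OF J(2)]
  note tD = copair[OF I(1) coprod_Obj[OF J(1)], of "\<lambda>i. coprod_in A J D' (c i)"]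
  note tE = copair[OF I(2) coprod_Obj[OF J(2)], of "\<lambda>i. coprod_in A J E' (c i)"]
  note tI = copair[OF J(1) coprod_Obj[OF I(1)], of "\<lambda>j. coprod_in A I D (inv_into I c j)"]
  let ?tD = "copair A I D (coprod A J D') (\<lambda>i. coprod_in A J D' (c i))"
  let ?tE = "copair A I E (coprod A J E') (\<lambda>i. coprod_in A J E' (c i))"
  let ?tI = "copair A J D' (coprod A I D) (\<lambda>j. coprod_in A I D (inv_into I c j))"
  have TD: "?tD \<in> Arr A" "Dom A ?tD = coprod A I D" "Cod A ?tD = coprod A J D'" "\<And>i. i \<in> I \<Longrightarrow> Cmp A ?tD (coprod_in A I D i) = coprod_in A J D' (c i)"
    using tD in1' cI by (simp_all add: Hom_iff)
  have TE: "?tE \<in> Arr A" "Dom A ?tE = coprod A I E" "Cod A ?tE = coprod A J E'" "\<And>i. i \<in> I \<Longrightarrow> Cmp A ?tE (coprod_in A I E i) = coprod_in A J E' (c i)"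
    using tE in2' cI by (simp_all add: Hom_iff)
  have invJ: "inv_into I c j \<in> I" "c (inv_into I c j) = j" "D (inv_into I c j) = D' j" if "j \<in> J" for j
    using that by (auto simp: J_def inv_into_into f_inv_into_f D'_def)
  have TI: "?tI \<in> Arr A" "Dom A ?tI = coprod A J D'" "Cod A ?tI = coprod A I D" "\<And>i. i \<in> J \<Longrightarrow> Cmp A ?tI (coprod_in A J D' i) = coprod_in A I D (inv_into I c i)"
    using tI in1 invJ by (simp_all add: Hom_iff)
  have "Cmp A ?tI ?tD = Ide A (coprod A I D)"
    by (rule coprod_ext[OF I(1)]) (use TI TD in1 in1' cI c coprod_Obj[OF I(1)] in \<open>simp_all add: inv_into_f_f\<close>)
  moreover have "is_mono A (Ide A (coprod A I D))"
    by (rule monoI) (use coprod_Obj[OF I(1)] in simp_all)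
  ultimately have tDm: "is_mono A ?tD" using mono_left[of ?tD ?tI] TD TI by simp
  have eq: "Cmp A ?tE (coprod_map A I D E f) = Cmp A (coprod_map A J D' E' f') ?tD"
  proof (rule coprod_ext[OF I(1)])
    fix i assume i: "i \<in> I"
    have "Cmp A (Cmp A ?tE (coprod_map A I D E f)) (coprod_in A I D i) = Cmp A ?tE (Cmp A (coprod_in A I E i) (f i))"
      using F(1-4) TE(1-3) in1[OF i] i by simp
    also have "\<dots> = Cmp A (coprod_in A J E' (c i)) (f i)"
      using Cmp_eq_extend[OF TE(4)[OF i], of "f i"] TE(1-3) in2[OF i] f(2,3)[OF i] fA[OF i] by simp
    also have "\<dots> = Cmp A (coprod_map A J D' E' f') (coprod_in A J D' (c i))"
      using F'(4)[OF cI(1)[OF i]] cI[OF i] by simp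
    also have "\<dots> = Cmp A (Cmp A (coprod_map A J D' E' f') ?tD) (coprod_in A I D i)"
      using TD F' in1[OF i] i by simp
    finally show "Cmp A (Cmp A ?tE (coprod_map A I D E f)) (coprod_in A I D i) = Cmp A (Cmp A (coprod_map A J D' E' f') ?tD) (coprod_in A I D i)" .
  qed (use F F' TD TE in simp_all)
  show ?thesis
  proof (rule mono_left[of _ ?tE])
    show "is_mono A (Cmp A ?tE (coprod_map A I D E f))"
      unfolding eq
    proof (rule monoI)
      fix u assume u: "u \<in> Arr A" "Cod A u = Dom A (Cmp A (coprod_map A J D' E' f') ?tD)" "is_zero A (Cmp A (Cmp A (coprod_map A J D' E' f') ?tD) u)"
      then have "is_zero A (Cmp A (coprod_map A J D' E' f') (Cmp A ?tD u))" using F' TD by simp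
      then have "is_zero A (Cmp A ?tD u)" using mono_zero[OF \<open>is_mono A (coprod_map A J D' E' f')\<close>, of "Cmp A ?tD u"] u F' TD by simp
      then show "is_zero A u" using mono_zero[OF tDm, of u] u F' TD by simp
    qed (use F' TD in simp)
  qed (use F TE in simp_all)
qed

lemma coprod_map_short_exact:
  assumes I: "fam I D" "fam I D'" "fam I D''"
    and f: "\<And>i. i \<in> I \<Longrightarrow> Dom A (f i) = D i" "\<And>i. i \<in> I \<Longrightarrow> Cod A (f i) = D' i"
    and g: "\<And>i. i \<in> I \<Longrightarrow> Cod A (g i) = D'' i" and c: "\<And>i. i \<in> I \<Longrightarrow> short_exact A (f i) (g i)"
  shows "short_exact A (coprod_map A I D D' f) (coprod_map A I D' D'' g)"
proof -
  have "is_cokernel A (coprod_map A I D D' f) (coprod_map A I D' D'' g)"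
    by (rule coprod_map_cokernel[OF I f g]) (use c in \<open>simp_all add: short_exact_def\<close>)
  moreover have "is_mono A (coprod_map A I D D' f)"
    by (rule coprod_map_mono[OF I(1,2) _ f]) (use c kernelD(5) in \<open>auto simp: short_exact_def\<close>)
  ultimately show ?thesis by (simp add: short_exact_def mono_kernel_of_cokernel)
qed

end

section \<open>Kernels and cokernels in functor categories\<close>

lemma functorD:
  assumes "is_functor C A F"
  shows "c \<in> Obj C \<Longrightarrow> fob F c \<in> Obj A"
    "f \<in> Arr C \<Longrightarrow> far F f \<in> Arr A" "f \<in> Arr C \<Longrightarrow> Dom A (far F f) = fob F (Dom C f)"
    "f \<in> Arr C \<Longrightarrow> Cod A (far F f) = fob F (Cod C f)"
    "c \<in> Obj C \<Longrightarrow> far F (Ide C c) = Ide A (fob F c)"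
    "f \<in> Arr C \<Longrightarrow> g \<in> Arr C \<Longrightarrow> Cod C f = Dom C g \<Longrightarrow> far F (Cmp C g f) = Cmp A (far F g) (far F f)"
  using assms by (simp_all add: is_functor_def Hom_iff)

lemma nat_transD:
  assumes "is_nat_trans C A F G \<tau>"
  shows "is_functor C A F" "is_functor C A G"
    "c \<in> Obj C \<Longrightarrow> \<tau> c \<in> Arr A" "c \<in> Obj C \<Longrightarrow> Dom A (\<tau> c) = fob F c" "c \<in> Obj C \<Longrightarrow> Cod A (\<tau> c) = fob G c"
    "f \<in> Arr C \<Longrightarrow> Cmp A (far G f) (\<tau> (Dom C f)) = Cmp A (\<tau> (Cod C f)) (far F f)"
    "\<tau> \<in> extensional (Obj C)"
  using assms by (simp_all add: is_nat_trans_def Hom_iff)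

lemma is_functorI:
  assumes "fob F \<in> extensional (Obj C)" "far F \<in> extensional (Arr C)"
    "\<And>c. c \<in> Obj C \<Longrightarrow> fob F c \<in> Obj A"
    "\<And>f. f \<in> Arr C \<Longrightarrow> far F f \<in> Arr A" "\<And>f. f \<in> Arr C \<Longrightarrow> Dom A (far F f) = fob F (Dom C f)"
    "\<And>f. f \<in> Arr C \<Longrightarrow> Cod A (far F f) = fob F (Cod C f)"
    "\<And>c. c \<in> Obj C \<Longrightarrow> far F (Ide C c) = Ide A (fob F c)"
    "\<And>f g. f \<in> Arr C \<Longrightarrow> g \<in> Arr C \<Longrightarrow> Cod C f = Dom C g \<Longrightarrow> far F (Cmp C g f) = Cmp A (far F g) (far F f)"
  shows "is_functor C A F"
  using assms by (simp add: is_functor_def Hom_iff)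

lemma is_nat_transI:
  assumes "is_functor C A F" "is_functor C A G" "\<tau> \<in> extensional (Obj C)"
    "\<And>c. c \<in> Obj C \<Longrightarrow> \<tau> c \<in> Arr A" "\<And>c. c \<in> Obj C \<Longrightarrow> Dom A (\<tau> c) = fob F c" "\<And>c. c \<in> Obj C \<Longrightarrow> Cod A (\<tau> c) = fob G c"
    "\<And>f. f \<in> Arr C \<Longrightarrow> Cmp A (far G f) (\<tau> (Dom C f)) = Cmp A (\<tau> (Cod C f)) (far F f)"
  shows "is_nat_trans C A F G \<tau>"
  using assms by (simp add: is_nat_trans_def Hom_iff)

lemma Fun_simps [simp]:
  "F \<in> Obj (Fun C A) \<longleftrightarrow> is_functor C A F"
  "(F, G, \<tau>) \<in> Arr (Fun C A) \<longleftrightarrow> is_nat_trans C A F G \<tau>"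
  "Dom (Fun C A) (F, G, \<tau>) = F" "Cod (Fun C A) (F, G, \<tau>) = G"
  "Ide (Fun C A) F = (F, F, \<lambda>c\<in>Obj C. Ide A (fob F c))"
  "Cmp (Fun C A) (G, H, \<sigma>) (F, G', \<tau>) = (F, H, \<lambda>c\<in>Obj C. Cmp A (\<sigma> c) (\<tau> c))"
  "Add (Fun C A) (F, G, \<sigma>) (F', G', \<tau>) = (F, G, \<lambda>c\<in>Obj C. Add A (\<sigma> c) (\<tau> c))"
  "Zer (Fun C A) F G = (F, G, \<lambda>c\<in>Obj C. Zer A (fob F c) (fob G c))"
  by (simp_all add: Fun_def)

lemma is_kernelD:
  assumes "is_kernel B g k" "h \<in> Arr B" "Cod B h = Dom B g" "Cmp B g h = Zer B (Dom B h) (Cod B g)"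
  shows "\<exists>!u. u \<in> Hom B (Dom B h) (Dom B k) \<and> Cmp B k u = h"
proof -
  have "\<forall>h\<in>Arr B. Cod B h = Dom B g \<and> Cmp B g h = Zer B (Dom B h) (Cod B g) \<longrightarrow>
      (\<exists>!u. u \<in> Hom B (Dom B h) (Dom B k) \<and> Cmp B k u = h)"
    using assms(1) unfolding is_kernel_def by (elim conjE)
  then show ?thesis using assms(2-) by (elim ballE[of _ _ h] mp) (rule conjI, simp_all)
qed

lemma is_cokernelD:
  assumes "is_cokernel B f q" "h \<in> Arr B" "Dom B h = Cod B f" "Cmp B h f = Zer B (Dom B f) (Cod B h)"
  shows "\<exists>!u. u \<in> Hom B (Cod B q) (Cod B h) \<and> Cmp B u q = h"
proof -
  have "\<forall>h\<in>Arr B. Dom B h = Cod B f \<and> Cmp B h f = Zer B (Dom B f) (Cod B h) \<longrightarrow>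
      (\<exists>!u. u \<in> Hom B (Cod B q) (Cod B h) \<and> Cmp B u q = h)"
    using assms(1) unfolding is_cokernel_def by (elim conjE)
  then show ?thesis using assms(2-) by (elim ballE[of _ _ h] mp) (rule conjI, simp_all)
qed

lemma Ex1_unique: "\<exists>!x. P x \<Longrightarrow> P a \<Longrightarrow> P b \<Longrightarrow> b = a"
  by blast

lemma Fun_arrow_cases:
  assumes "w \<in> Hom (Fun C A) F G"
  obtains \<tau> where "w = (F, G, \<tau>)" "is_nat_trans C A F G \<tau>"
  using assms by (cases w) (auto simp: Hom_iff)

locale functor_category = C: category C + abelian_category A
  for C :: "('c, 'f, 'y) cat_scheme" and A :: "('o, 'm, 'z) pcat_scheme"
begin

lemma nat_trans_extend:
  assumes t: "is_nat_trans C A F G \<tau>" and f: "f \<in> Arr C"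
    and x: "x \<in> Arr A" "Cod A x = fob F (Dom C f)"
  shows "Cmp A (far G f) (Cmp A (\<tau> (Dom C f)) x) = Cmp A (\<tau> (Cod C f)) (Cmp A (far F f) x)"
  using Cmp_eq_extend[OF nat_transD(6)[OF t f], of x] nat_transD(3-5)[OF t] f x
    functorD[OF nat_transD(1)[OF t]] functorD[OF nat_transD(2)[OF t]] by simp

lemma Cmp_nat_trans:
  assumes t: "is_nat_trans C A F G \<tau>" and u: "is_nat_trans C A G H \<sigma>"
  shows "is_nat_trans C A F H (\<lambda>c\<in>Obj C. Cmp A (\<sigma> c) (\<tau> c))"
proof (rule is_nat_transI)
  show "is_functor C A F" "is_functor C A H" using t u nat_transD by blast+
  note F = functorD[OF nat_transD(1)[OF t]] and G = functorD[OF nat_transD(2)[OF t]] and H = functorD[OF nat_transD(2)[OF u]]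
  note T = nat_transD(3-6)[OF t] and U = nat_transD(3-6)[OF u]
  fix f assume f: "f \<in> Arr C"
  show "Cmp A (far H f) ((\<lambda>c\<in>Obj C. Cmp A (\<sigma> c) (\<tau> c)) (Dom C f)) = Cmp A ((\<lambda>c\<in>Obj C. Cmp A (\<sigma> c) (\<tau> c)) (Cod C f)) (far F f)"
    using nat_trans_extend[OF u f, of "\<tau> (Dom C f)"] T U F G H f by simp
qed (use nat_transD(3-6)[OF t] nat_transD(3-6)[OF u] in simp_all)

lemma Ide_nat_trans: "is_functor C A F \<Longrightarrow> is_nat_trans C A F F (\<lambda>c\<in>Obj C. Ide A (fob F c))"
  by (rule is_nat_transI) (use functorD[of C A F] in simp_all)

text \<open>The arrows induced between the subobjects are determined because each
  \<open>\<kappa> c\<close> is monic, and for the same reason they inherit identities and composites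
  from F.\<close>

lemma subfunctor:
  assumes F: "is_functor C A F"
    and m: "\<And>c. c \<in> Obj C \<Longrightarrow> is_mono A (\<kappa> c)" "\<And>c. c \<in> Obj C \<Longrightarrow> Cod A (\<kappa> c) = fob F c"
    and l: "\<And>f. f \<in> Arr C \<Longrightarrow> \<exists>u. u \<in> Arr A \<and> Dom A u = Dom A (\<kappa> (Dom C f)) \<and> Cod A u = Dom A (\<kappa> (Cod C f)) \<and>
          Cmp A (\<kappa> (Cod C f)) u = Cmp A (far F f) (\<kappa> (Dom C f))"
  obtains K where "is_nat_trans C A K F (restrict \<kappa> (Obj C))"
proof -
  note F' = functorD[OF F]
  obtain u where u: "\<And>f. f \<in> Arr C \<Longrightarrow> u f \<in> Arr A" "\<And>f. f \<in> Arr C \<Longrightarrow> Dom A (u f) = Dom A (\<kappa> (Dom C f))"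
    "\<And>f. f \<in> Arr C \<Longrightarrow> Cod A (u f) = Dom A (\<kappa> (Cod C f))"
    "\<And>f. f \<in> Arr C \<Longrightarrow> Cmp A (\<kappa> (Cod C f)) (u f) = Cmp A (far F f) (\<kappa> (Dom C f))"
    using l by metis
  have k: "\<kappa> c \<in> Arr A" if "c \<in> Obj C" for c using m(1)[OF that] by (rule mono_Arr)
  define K where "K = \<lparr>fob = \<lambda>c\<in>Obj C. Dom A (\<kappa> c), far = restrict u (Arr C)\<rparr>"
  have "is_functor C A K"
  proof (rule is_functorI)
    fix c assume c: "c \<in> Obj C"
    have "u (Ide C c) = Ide A (Dom A (\<kappa> c))"
      by (rule mono_cancel[OF m(1)[OF c]])
         (use u[of "Ide C c"] k[OF c] c m(2)[OF c] F' in simp_all)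
    then show "far K (Ide C c) = Ide A (fob K c)" using c by (simp add: K_def)
  next
    fix f g assume f: "f \<in> Arr C" and g: "g \<in> Arr C" and fg: "Cod C f = Dom C g"
    have fgA: "Cmp C g f \<in> Arr C" using f g fg by simp
    have 1: "Cmp A (\<kappa> (Cod C g)) (Cmp A (u g) (u f)) = Cmp A (far F g) (Cmp A (\<kappa> (Dom C g)) (u f))"
      using Cmp_eq_extend[OF u(4)[OF g], of "u f"] u(1-3)[OF f] u(1-3)[OF g] f g fg k m(2) F' by simp
    have 2: "Cmp A (\<kappa> (Dom C g)) (u f) = Cmp A (far F f) (\<kappa> (Dom C f))"
      using u(4)[OF f] fg by simp
    have "u (Cmp C g f) = Cmp A (u g) (u f)"
      by (rule mono_cancel[OF m(1)[OF C.Obj_Cod[OF g]]])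
         (use u[OF fgA] u(1-3)[OF f] u(1-3)[OF g] k f g fg m(2) F' 1 2 in simp_all)
    then show "far K (Cmp C g f) = Cmp A (far K g) (far K f)" using f g fg by (simp add: K_def)
  qed (use u k in \<open>simp_all add: K_def\<close>)
  then have "is_nat_trans C A K F (restrict \<kappa> (Obj C))"
    by (rule is_nat_transI) (use F k m u in \<open>simp_all add: K_def\<close>)
  then show ?thesis by (rule that)
qed

lemma quotient_functor:
  assumes F: "is_functor C A F"
    and m: "\<And>c. c \<in> Obj C \<Longrightarrow> is_epi A (\<kappa> c)" "\<And>c. c \<in> Obj C \<Longrightarrow> Dom A (\<kappa> c) = fob F c"
    and l: "\<And>f. f \<in> Arr C \<Longrightarrow> \<exists>u. u \<in> Arr A \<and> Dom A u = Cod A (\<kappa> (Dom C f)) \<and> Cod A u = Cod A (\<kappa> (Cod C f)) \<and>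
          Cmp A u (\<kappa> (Dom C f)) = Cmp A (\<kappa> (Cod C f)) (far F f)"
  obtains K where "is_nat_trans C A F K (restrict \<kappa> (Obj C))"
proof -
  note F' = functorD[OF F]
  obtain u where u: "\<And>f. f \<in> Arr C \<Longrightarrow> u f \<in> Arr A" "\<And>f. f \<in> Arr C \<Longrightarrow> Dom A (u f) = Cod A (\<kappa> (Dom C f))"
    "\<And>f. f \<in> Arr C \<Longrightarrow> Cod A (u f) = Cod A (\<kappa> (Cod C f))"
    "\<And>f. f \<in> Arr C \<Longrightarrow> Cmp A (u f) (\<kappa> (Dom C f)) = Cmp A (\<kappa> (Cod C f)) (far F f)"
    using l by metis
  have k: "\<kappa> c \<in> Arr A" if "c \<in> Obj C" for c using m(1)[OF that] by (rule epi_Arr)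
  define K where "K = \<lparr>fob = \<lambda>c\<in>Obj C. Cod A (\<kappa> c), far = restrict u (Arr C)\<rparr>"
  have "is_functor C A K"
  proof (rule is_functorI)
    fix c assume c: "c \<in> Obj C"
    have "u (Ide C c) = Ide A (Cod A (\<kappa> c))"
      by (rule epi_cancel[OF m(1)[OF c]])
         (use u[of "Ide C c"] k[OF c] c m(2)[OF c] F' in simp_all)
    then show "far K (Ide C c) = Ide A (fob K c)" using c by (simp add: K_def)
  next
    fix f g assume f: "f \<in> Arr C" and g: "g \<in> Arr C" and fg: "Cod C f = Dom C g"
    have fgA: "Cmp C g f \<in> Arr C" using f g fg by simp
    have 1: "Cmp A (Cmp A (u g) (u f)) (\<kappa> (Dom C f)) = Cmp A (u g) (Cmp A (\<kappa> (Dom C g)) (far F f))"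
      using u[OF f] u(1-3)[OF g] f g fg k m(2) F' by simp
    also have "\<dots> = Cmp A (\<kappa> (Cod C g)) (Cmp A (far F g) (far F f))"
      using Cmp_eq_extend[OF u(4)[OF g], of "far F f"] u(1-3)[OF g] f g fg k m(2) F' by simp
    finally have 2: "Cmp A (Cmp A (u g) (u f)) (\<kappa> (Dom C f)) = Cmp A (u (Cmp C g f)) (\<kappa> (Dom C f))"
      using u[OF fgA] f g fg F' by simp
    have "u (Cmp C g f) = Cmp A (u g) (u f)"
      by (rule epi_cancel[OF m(1)[OF C.Obj_Dom[OF f]]])
         (use u(1-3)[OF fgA] u(1-3)[OF f] u(1-3)[OF g] k f g fg m(2) F' 2 in simp_all)
    then show "far K (Cmp C g f) = Cmp A (far K g) (far K f)" using f g fg by (simp add: K_def)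
  qed (use u k in \<open>simp_all add: K_def\<close>)
  then have "is_nat_trans C A F K (restrict \<kappa> (Obj C))"
    by (intro is_nat_transI) (use F k m u in \<open>simp_all add: K_def\<close>)
  then show ?thesis by (rule that)
qed

lemma pointwise_kernel_ex:
  assumes t: "is_nat_trans C A F G \<epsilon>"
  obtains K \<kappa> where "is_nat_trans C A K F \<kappa>" "\<And>c. c \<in> Obj C \<Longrightarrow> is_kernel A (\<epsilon> c) (\<kappa> c)"
proof -
  note T = nat_transD(3-6)[OF t] and F = functorD[OF nat_transD(1)[OF t]] and G = functorD[OF nat_transD(2)[OF t]]
  define \<kappa> where "\<kappa> c = kernel_choice A (\<epsilon> c)" for c
  have k: "is_kernel A (\<epsilon> c) (\<kappa> c)" if "c \<in> Obj C" for c
    unfolding \<kappa>_def by (rule kernel_choice) (rule T(1)[OF that])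
  note dk = kernelD[OF k]
  obtain K where "is_nat_trans C A K F (restrict \<kappa> (Obj C))"
  proof (rule subfunctor[OF nat_transD(1)[OF t], of \<kappa>])
    fix f assume f: "f \<in> Arr C"
    have d: "Dom C f \<in> Obj C" "Cod C f \<in> Obj C" using f by simp_all
    have "is_zero A (Cmp A (far G f) (Cmp A (\<epsilon> (Dom C f)) (\<kappa> (Dom C f))))"
      by (rule is_zero_Cmp_right[OF dk(4)]) (use d dk T G f in simp_all)
    then have "is_zero A (Cmp A (\<epsilon> (Cod C f)) (Cmp A (far F f) (\<kappa> (Dom C f))))"
      using nat_trans_extend[OF t f, of "\<kappa> (Dom C f)"] d dk T by simp
    then show "\<exists>u. u \<in> Arr A \<and> Dom A u = Dom A (\<kappa> (Dom C f)) \<and> Cod A u = Dom A (\<kappa> (Cod C f)) \<and>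
          Cmp A (\<kappa> (Cod C f)) u = Cmp A (far F f) (\<kappa> (Dom C f))"
      using kernel_lift[OF k[OF d(2)], of "Cmp A (far F f) (\<kappa> (Dom C f))"] d dk(2,3)[OF d(1)] T F f by (auto; metis)
  qed (use dk T in simp_all)
  then show ?thesis by (rule that) (use k in simp)
qed

lemma pointwise_cokernel_ex:
  assumes t: "is_nat_trans C A F G \<epsilon>"
  obtains K \<kappa> where "is_nat_trans C A G K \<kappa>" "\<And>c. c \<in> Obj C \<Longrightarrow> is_cokernel A (\<epsilon> c) (\<kappa> c)"
proof -
  note T = nat_transD(3-6)[OF t] and F = functorD[OF nat_transD(1)[OF t]] and G = functorD[OF nat_transD(2)[OF t]]
  define \<kappa> where "\<kappa> c = cokernel_choice A (\<epsilon> c)" for c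
  have k: "is_cokernel A (\<epsilon> c) (\<kappa> c)" if "c \<in> Obj C" for c
    unfolding \<kappa>_def by (rule cokernel_choice) (rule T(1)[OF that])
  note dk = cokernelD[OF k]
  obtain K where "is_nat_trans C A G K (restrict \<kappa> (Obj C))"
  proof (rule quotient_functor[OF nat_transD(2)[OF t], of \<kappa>])
    fix f assume f: "f \<in> Arr C"
    have d: "Dom C f \<in> Obj C" "Cod C f \<in> Obj C" using f by simp_all
    have "is_zero A (Cmp A (\<kappa> (Cod C f)) (Cmp A (\<epsilon> (Cod C f)) (far F f)))"
      by (rule zero_extend[OF dk(4)]) (use d dk T F f in simp_all)
    then have "is_zero A (Cmp A (Cmp A (\<kappa> (Cod C f)) (far G f)) (\<epsilon> (Dom C f)))"
      using T(4)[OF f] d dk T G f by simp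
    then show "\<exists>u. u \<in> Arr A \<and> Dom A u = Cod A (\<kappa> (Dom C f)) \<and> Cod A u = Cod A (\<kappa> (Cod C f)) \<and>
          Cmp A u (\<kappa> (Dom C f)) = Cmp A (\<kappa> (Cod C f)) (far G f)"
      using cokernel_desc[OF k[OF d(1)], of "Cmp A (\<kappa> (Cod C f)) (far G f)"] d dk(2,3)[OF d(2)] T G f by (auto; metis)
  qed (use dk T in simp_all)
  then show ?thesis by (rule that) (use k in simp)
qed

section \<open>Kernels, cokernels and exact sequences of functors are pointwise\<close>

lemma Fun_zero_iff:
  assumes t: "is_nat_trans C A F G \<tau>" and u: "is_nat_trans C A G H \<sigma>"
  shows "Cmp (Fun C A) (G, H, \<sigma>) (F, G, \<tau>) = Zer (Fun C A) F H \<longleftrightarrow> (\<forall>c\<in>Obj C. is_zero A (Cmp A (\<sigma> c) (\<tau> c)))"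
  using nat_transD(3-5)[OF t] nat_transD(3-5)[OF u] by (auto simp: is_zero_def restrict_def fun_eq_iff)

lemma Fun_kernelI:
  assumes t: "is_nat_trans C A F G \<epsilon>" and k: "is_nat_trans C A K F \<kappa>" and ker: "\<And>c. c \<in> Obj C \<Longrightarrow> is_kernel A (\<epsilon> c) (\<kappa> c)"
  shows "is_kernel (Fun C A) (F, G, \<epsilon>) (K, F, \<kappa>)"
  unfolding is_kernel_def
proof (intro conjI ballI impI)
  note d = kernelD[OF ker]
  note K = nat_transD(3-6)[OF k] and T = nat_transD(3-6)[OF t]
  note Fk = functorD[OF nat_transD(1)[OF k]] and F = functorD[OF nat_transD(1)[OF t]] and G = functorD[OF nat_transD(2)[OF t]]
  show "Cmp (Fun C A) (F, G, \<epsilon>) (K, F, \<kappa>) = Zer (Fun C A) (Dom (Fun C A) (K, F, \<kappa>)) (Cod (Fun C A) (F, G, \<epsilon>))"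
    using Fun_zero_iff[OF k t] d by simp
  fix h assume h: "h \<in> Arr (Fun C A)" "Cod (Fun C A) h = Dom (Fun C A) (F, G, \<epsilon>) \<and>
     Cmp (Fun C A) (F, G, \<epsilon>) h = Zer (Fun C A) (Dom (Fun C A) h) (Cod (Fun C A) (F, G, \<epsilon>))"
  obtain H F' \<eta> where h': "h = (H, F', \<eta>)" by (cases h)
  then have F'F: "F' = F" using h by simp
  have n: "is_nat_trans C A H F \<eta>" using h h' F'F by simp
  note N = nat_transD(3-6)[OF n] and H = functorD[OF nat_transD(1)[OF n]]
  have z: "\<forall>c\<in>Obj C. is_zero A (Cmp A (\<epsilon> c) (\<eta> c))" using Fun_zero_iff[OF n t] h h' F'F by simp
  have "\<exists>u. u \<in> Arr A \<and> Dom A u = fob H c \<and> Cod A u = fob K c \<and> Cmp A (\<kappa> c) u = \<eta> c" if c: "c \<in> Obj C" for c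
    using kernel_lift[OF ker[OF c], of "\<eta> c"] N c z T K by metis
  then obtain u where u: "\<And>c. c \<in> Obj C \<Longrightarrow> u c \<in> Arr A" "\<And>c. c \<in> Obj C \<Longrightarrow> Dom A (u c) = fob H c" "\<And>c. c \<in> Obj C \<Longrightarrow> Cod A (u c) = fob K c"
     "\<And>c. c \<in> Obj C \<Longrightarrow> Cmp A (\<kappa> c) (u c) = \<eta> c" by metis
  have U: "is_nat_trans C A H K (restrict u (Obj C))"
  proof (rule is_nat_transI)
    fix f assume f: "f \<in> Arr C"
    have dd: "Dom C f \<in> Obj C" "Cod C f \<in> Obj C" using f by simp_all
    have "Cmp A (far K f) (u (Dom C f)) = Cmp A (u (Cod C f)) (far H f)"
    proof (rule mono_cancel[OF d(5)[OF dd(2)]])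
      have "Cmp A (\<kappa> (Cod C f)) (Cmp A (far K f) (u (Dom C f))) = Cmp A (far F f) (\<eta> (Dom C f))"
        using nat_trans_extend[OF k f, of "u (Dom C f)"] u dd by simp
      also have "\<dots> = Cmp A (\<kappa> (Cod C f)) (Cmp A (u (Cod C f)) (far H f))"
        using N(4)[OF f] Cmp_eq_extend[OF u(4)[OF dd(2)], of "far H f"] u dd K H f by simp
      finally show "Cmp A (\<kappa> (Cod C f)) (Cmp A (far K f) (u (Dom C f))) = Cmp A (\<kappa> (Cod C f)) (Cmp A (u (Cod C f)) (far H f))" .
    qed (use u dd K Fk H f in simp_all)
    then show "Cmp A (far K f) (restrict u (Obj C) (Dom C f)) = Cmp A (restrict u (Obj C) (Cod C f)) (far H f)"
      using dd by simp
  qed (use u nat_transD(1)[OF n] nat_transD(1)[OF k] in simp_all)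
  show "\<exists>!u. u \<in> Hom (Fun C A) (Dom (Fun C A) h) (Dom (Fun C A) (K, F, \<kappa>)) \<and> Cmp (Fun C A) (K, F, \<kappa>) u = h"
  proof (rule ex1I[of _ "(H, K, restrict u (Obj C))"])
    show "(H, K, restrict u (Obj C)) \<in> Hom (Fun C A) (Dom (Fun C A) h) (Dom (Fun C A) (K, F, \<kappa>)) \<and>
       Cmp (Fun C A) (K, F, \<kappa>) (H, K, restrict u (Obj C)) = h"
      using U u h' F'F nat_transD(7)[OF n] by (auto simp: Hom_iff extensional_def fun_eq_iff)
    fix v assume v: "v \<in> Hom (Fun C A) (Dom (Fun C A) h) (Dom (Fun C A) (K, F, \<kappa>)) \<and> Cmp (Fun C A) (K, F, \<kappa>) v = h"
    obtain H' K' \<nu> where v': "v = (H', K', \<nu>)" by (cases v)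
    have v1: "H' = H" "K' = K" "is_nat_trans C A H K \<nu>" using v v' h' by (auto simp: Hom_iff)
    have v2: "Cmp A (\<kappa> c) (\<nu> c) = \<eta> c" if "c \<in> Obj C" for c
      using v that unfolding v' h' by (auto simp: fun_eq_iff restrict_def split: if_splits)
    have "\<nu> c = u c" if c: "c \<in> Obj C" for c
      by (rule mono_cancel[OF d(5)[OF c]]) (use nat_transD(3-5)[OF v1(3) c] u[OF c] v2[OF c] K(1-3)[OF c] c in simp_all)
    then have "\<nu> = restrict u (Obj C)" using nat_transD(7)[OF v1(3)] by (auto simp: extensional_def restrict_def fun_eq_iff)
    then show "v = (H, K, restrict u (Obj C))" using v' v1 by simp
  qed
qed (use t k in simp_all)

lemma Fun_cokernelI:
  assumes t: "is_nat_trans C A F G \<epsilon>" and k: "is_nat_trans C A G K \<kappa>" and ker: "\<And>c. c \<in> Obj C \<Longrightarrow> is_cokernel A (\<epsilon> c) (\<kappa> c)"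
  shows "is_cokernel (Fun C A) (F, G, \<epsilon>) (G, K, \<kappa>)"
  unfolding is_cokernel_def
proof (intro conjI ballI impI)
  note d = cokernelD[OF ker]
  note K = nat_transD(3-6)[OF k] and T = nat_transD(3-6)[OF t]
  note Fk = functorD[OF nat_transD(2)[OF k]] and F = functorD[OF nat_transD(1)[OF t]] and G = functorD[OF nat_transD(2)[OF t]]
  show "Cmp (Fun C A) (G, K, \<kappa>) (F, G, \<epsilon>) = Zer (Fun C A) (Dom (Fun C A) (F, G, \<epsilon>)) (Cod (Fun C A) (G, K, \<kappa>))"
    using Fun_zero_iff[OF t k] d by simp
  fix h assume h: "h \<in> Arr (Fun C A)" "Dom (Fun C A) h = Cod (Fun C A) (F, G, \<epsilon>) \<and>
     Cmp (Fun C A) h (F, G, \<epsilon>) = Zer (Fun C A) (Dom (Fun C A) (F, G, \<epsilon>)) (Cod (Fun C A) h)"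
  obtain G' H \<eta> where h': "h = (G', H, \<eta>)" by (cases h)
  then have F'F: "G' = G" using h by simp
  have n: "is_nat_trans C A G H \<eta>" using h h' F'F by simp
  note N = nat_transD(3-6)[OF n] and H = functorD[OF nat_transD(2)[OF n]]
  have z: "\<forall>c\<in>Obj C. is_zero A (Cmp A (\<eta> c) (\<epsilon> c))" using Fun_zero_iff[OF t n] h h' F'F by simp
  have "\<exists>u. u \<in> Arr A \<and> Dom A u = fob K c \<and> Cod A u = fob H c \<and> Cmp A u (\<kappa> c) = \<eta> c" if c: "c \<in> Obj C" for c
    using cokernel_desc[OF ker[OF c], of "\<eta> c"] N c z T K by metis
  then obtain u where u: "\<And>c. c \<in> Obj C \<Longrightarrow> u c \<in> Arr A" "\<And>c. c \<in> Obj C \<Longrightarrow> Dom A (u c) = fob K c" "\<And>c. c \<in> Obj C \<Longrightarrow> Cod A (u c) = fob H c"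
     "\<And>c. c \<in> Obj C \<Longrightarrow> Cmp A (u c) (\<kappa> c) = \<eta> c" by metis
  have U: "is_nat_trans C A K H (restrict u (Obj C))"
  proof (rule is_nat_transI)
    fix f assume f: "f \<in> Arr C"
    have dd: "Dom C f \<in> Obj C" "Cod C f \<in> Obj C" using f by simp_all
    have "Cmp A (far H f) (u (Dom C f)) = Cmp A (u (Cod C f)) (far K f)"
    proof (rule epi_cancel[OF d(5)[OF dd(1)]])
      have "Cmp A (Cmp A (u (Cod C f)) (far K f)) (\<kappa> (Dom C f)) = Cmp A (u (Cod C f)) (Cmp A (\<kappa> (Cod C f)) (far G f))"
        using K(4)[OF f] u dd K Fk f by simp
      also have "\<dots> = Cmp A (\<eta> (Cod C f)) (far G f)"
        using Cmp_eq_extend[OF u(4)[OF dd(2)], of "far G f"] u dd K G f by simp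
      also have "\<dots> = Cmp A (Cmp A (far H f) (u (Dom C f))) (\<kappa> (Dom C f))"
        using N(4)[OF f] u dd K H f by simp
      finally show "Cmp A (Cmp A (far H f) (u (Dom C f))) (\<kappa> (Dom C f)) = Cmp A (Cmp A (u (Cod C f)) (far K f)) (\<kappa> (Dom C f))" by simp
    qed (use u dd K Fk H f in simp_all)
    then show "Cmp A (far H f) (restrict u (Obj C) (Dom C f)) = Cmp A (restrict u (Obj C) (Cod C f)) (far K f)"
      using dd by simp
  qed (use u nat_transD(2)[OF n] nat_transD(2)[OF k] in simp_all)
  show "\<exists>!u. u \<in> Hom (Fun C A) (Cod (Fun C A) (G, K, \<kappa>)) (Cod (Fun C A) h) \<and> Cmp (Fun C A) u (G, K, \<kappa>) = h"
  proof (rule ex1I[of _ "(K, H, restrict u (Obj C))"])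
    show "(K, H, restrict u (Obj C)) \<in> Hom (Fun C A) (Cod (Fun C A) (G, K, \<kappa>)) (Cod (Fun C A) h) \<and>
       Cmp (Fun C A) (K, H, restrict u (Obj C)) (G, K, \<kappa>) = h"
      using U u h' F'F nat_transD(7)[OF n] by (auto simp: Hom_iff extensional_def fun_eq_iff)
    fix v assume v: "v \<in> Hom (Fun C A) (Cod (Fun C A) (G, K, \<kappa>)) (Cod (Fun C A) h) \<and> Cmp (Fun C A) v (G, K, \<kappa>) = h"
    obtain K' H' \<nu> where v': "v = (K', H', \<nu>)" by (cases v)
    have v1: "H' = H" "K' = K" "is_nat_trans C A K H \<nu>" using v v' h' by (auto simp: Hom_iff)
    have v2: "Cmp A (\<nu> c) (\<kappa> c) = \<eta> c" if "c \<in> Obj C" for c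
      using v that unfolding v' h' by (auto simp: fun_eq_iff restrict_def split: if_splits)
    have "\<nu> c = u c" if c: "c \<in> Obj C" for c
      by (rule epi_cancel[OF d(5)[OF c]]) (use nat_transD(3-5)[OF v1(3) c] u[OF c] v2[OF c] K(1-3)[OF c] c in simp_all)
    then have "\<nu> = restrict u (Obj C)" using nat_transD(7)[OF v1(3)] by (auto simp: extensional_def restrict_def fun_eq_iff)
    then show "v = (K, H, restrict u (Obj C))" using v' v1 by simp
  qed
qed (use t k in simp_all)

lemma Fun_short_exactI:
  assumes "is_nat_trans C A F G \<phi>" "is_nat_trans C A G H \<gamma>" "\<And>c. c \<in> Obj C \<Longrightarrow> short_exact A (\<phi> c) (\<gamma> c)"
  shows "short_exact (Fun C A) (F, G, \<phi>) (G, H, \<gamma>)"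
  unfolding short_exact_def
proof
  show "is_kernel (Fun C A) (G, H, \<gamma>) (F, G, \<phi>)"
    by (rule Fun_kernelI[OF assms(2,1)]) (use assms(3) in \<open>simp add: short_exact_def\<close>)
  show "is_cokernel (Fun C A) (F, G, \<phi>) (G, H, \<gamma>)"
    by (rule Fun_cokernelI[OF assms(1,2)]) (use assms(3) in \<open>simp add: short_exact_def\<close>)
qed

text \<open>Exactness in \<open>Fun C A\<close> is given by universal properties, whereas the
  constructions below work at each object. A kernel in \<open>Fun C A\<close> is compared with the
  pointwise one, and the components of the comparison transfer the property.\<close>

lemma Fun_kernelD:
  assumes "is_kernel (Fun C A) (F, G, \<epsilon>) (K, F, \<phi>)" and c: "c \<in> Obj C"
  shows "is_kernel A (\<epsilon> c) (\<phi> c)"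
proof -
  have t: "is_nat_trans C A F G \<epsilon>" and p: "is_nat_trans C A K F \<phi>"
    using assms by (auto simp: is_kernel_def)
  obtain L \<kappa> where l: "is_nat_trans C A L F \<kappa>" and k: "\<And>c. c \<in> Obj C \<Longrightarrow> is_kernel A (\<epsilon> c) (\<kappa> c)"
    using pointwise_kernel_ex[OF t] by metis
  note d = kernelD[OF k]
  have kz: "Cmp (Fun C A) (F, G, \<epsilon>) (L, F, \<kappa>) = Zer (Fun C A) L G" unfolding Fun_zero_iff[OF l t] using d by simp
  have pz: "Cmp (Fun C A) (F, G, \<epsilon>) (K, F, \<phi>) = Zer (Fun C A) K G" using assms(1) by (simp add: is_kernel_def)
  obtain w where w: "w \<in> Hom (Fun C A) L K" "Cmp (Fun C A) (K, F, \<phi>) w = (L, F, \<kappa>)"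
    using is_kernelD[OF assms(1), of "(L, F, \<kappa>)"] l kz by auto
  obtain \<upsilon> where w': "w = (L, K, \<upsilon>)" and u: "is_nat_trans C A L K \<upsilon>" by (rule Fun_arrow_cases[OF w(1)])
  have u1: "\<And>c. c \<in> Obj C \<Longrightarrow> Cmp A (\<phi> c) (\<upsilon> c) = \<kappa> c"
    using w(2) unfolding w' by (auto dest: fun_cong)
  obtain z where z: "z \<in> Hom (Fun C A) K L" "Cmp (Fun C A) (L, F, \<kappa>) z = (K, F, \<phi>)"
    using is_kernelD[OF Fun_kernelI[OF t l k], of "(K, F, \<phi>)"] p pz by auto
  obtain \<nu> where z': "z = (K, L, \<nu>)" and v: "is_nat_trans C A K L \<nu>" by (rule Fun_arrow_cases[OF z(1)])
  have v1: "\<And>c. c \<in> Obj C \<Longrightarrow> Cmp A (\<kappa> c) (\<nu> c) = \<phi> c"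
    using z(2) unfolding z' by (auto dest: fun_cong)
  note V = nat_transD(3-5)[OF v] and U = nat_transD(3-5)[OF u] and P = nat_transD(3-5)[OF p] and L = nat_transD(3-5)[OF l] and T = nat_transD(3-5)[OF t]
  have pe: "restrict \<phi> (Obj C) = \<phi>" using nat_transD(7)[OF p] by (rule extensional_restrict)
  \<comment> \<open>The identity and \<open>\<upsilon>\<close> after \<open>\<nu>\<close> both lift
    \<open>\<phi>\<close> through itself, so uniqueness of lifts identifies them.\<close>
  have "\<exists>!w. w \<in> Hom (Fun C A) K K \<and> Cmp (Fun C A) (K, F, \<phi>) w = (K, F, \<phi>)"
    using is_kernelD[OF assms(1), of "(K, F, \<phi>)"] p pz by simp
  moreover have "(K, K, \<lambda>c\<in>Obj C. Ide A (fob K c)) \<in> Hom (Fun C A) K K \<and>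
      Cmp (Fun C A) (K, F, \<phi>) (K, K, \<lambda>c\<in>Obj C. Ide A (fob K c)) = (K, F, \<phi>)"
    using Ide_nat_trans[OF nat_transD(1)[OF p]] P pe by (simp add: Hom_iff cong: restrict_cong)
  moreover have "(K, K, \<lambda>c\<in>Obj C. Cmp A (\<upsilon> c) (\<nu> c)) \<in> Hom (Fun C A) K K \<and>
      Cmp (Fun C A) (K, F, \<phi>) (K, K, \<lambda>c\<in>Obj C. Cmp A (\<upsilon> c) (\<nu> c)) = (K, F, \<phi>)"
    using Cmp_nat_trans[OF v u] P pe U V v1 Cmp_eq_extend[OF u1] by (simp add: Hom_iff cong: restrict_cong)
  ultimately have "(K, K, \<lambda>c\<in>Obj C. Cmp A (\<upsilon> c) (\<nu> c)) = (K, K, \<lambda>c\<in>Obj C. Ide A (fob K c))"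
    by (rule Ex1_unique)
  then have "(\<lambda>c\<in>Obj C. Cmp A (\<upsilon> c) (\<nu> c)) c = (\<lambda>c\<in>Obj C. Ide A (fob K c)) c" by (elim Pair_inject) (rule fun_cong)
  then have uv: "Cmp A (\<upsilon> c) (\<nu> c) = Ide A (fob K c)" using c by simp
  show ?thesis
  proof (rule kernelI)
    show "is_zero A (Cmp A (\<epsilon> c) (\<phi> c))" using pz c unfolding Fun_zero_iff[OF p t] by simp
    show "is_mono A (\<phi> c)"
    proof (rule monoI)
      fix w assume w: "w \<in> Arr A" "Cod A w = Dom A (\<phi> c)" "is_zero A (Cmp A (\<phi> c) w)"
      have "is_zero A (Cmp A (\<kappa> c) (Cmp A (\<nu> c) w))"
        using Cmp_eq_extend[OF v1[OF c], of w] w V P L c by simp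
      then have "is_zero A (Cmp A (\<nu> c) w)" using mono_zero[OF d(5)[OF c], of "Cmp A (\<nu> c) w"] w V P L c by simp
      then have "is_zero A (Cmp A (\<upsilon> c) (Cmp A (\<nu> c) w))" by (rule is_zero_Cmp_right) (use w V P U c in simp_all)
      then show "is_zero A w" using Cmp_eq_extend[OF uv, of w] w V P U c by simp
    qed (use P c in simp)
    fix h assume h: "h \<in> Arr A" "Cod A h = Dom A (\<epsilon> c)" "is_zero A (Cmp A (\<epsilon> c) h)"
    obtain w where w: "w \<in> Arr A" "Dom A w = Dom A h" "Cod A w = Dom A (\<kappa> c)" "Cmp A (\<kappa> c) w = h"
      using kernel_lift[OF k[OF c] h] by metis
    show "\<exists>u. u \<in> Arr A \<and> Dom A u = Dom A h \<and> Cod A u = Dom A (\<phi> c) \<and> Cmp A (\<phi> c) u = h"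
      by (rule exI[of _ "Cmp A (\<upsilon> c) w"]) (use w U P L c Cmp_eq_extend[OF u1[OF c], of w] in simp)
  qed (use P T c in simp_all)
qed

lemma Fun_cokernelD:
  assumes "is_cokernel (Fun C A) (F, G, \<epsilon>) (G, K, \<phi>)" and c: "c \<in> Obj C"
  shows "is_cokernel A (\<epsilon> c) (\<phi> c)"
proof -
  have t: "is_nat_trans C A F G \<epsilon>" and p: "is_nat_trans C A G K \<phi>"
    using assms by (auto simp: is_cokernel_def)
  obtain L \<kappa> where l: "is_nat_trans C A G L \<kappa>" and k: "\<And>c. c \<in> Obj C \<Longrightarrow> is_cokernel A (\<epsilon> c) (\<kappa> c)"
    using pointwise_cokernel_ex[OF t] by metis
  note d = cokernelD[OF k]
  have kz: "Cmp (Fun C A) (G, L, \<kappa>) (F, G, \<epsilon>) = Zer (Fun C A) F L" unfolding Fun_zero_iff[OF t l] using d by simp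
  have pz: "Cmp (Fun C A) (G, K, \<phi>) (F, G, \<epsilon>) = Zer (Fun C A) F K" using assms(1) by (simp add: is_cokernel_def)
  obtain w where w: "w \<in> Hom (Fun C A) K L" "Cmp (Fun C A) w (G, K, \<phi>) = (G, L, \<kappa>)"
    using is_cokernelD[OF assms(1), of "(G, L, \<kappa>)"] l kz by auto
  obtain \<upsilon> where w': "w = (K, L, \<upsilon>)" and u: "is_nat_trans C A K L \<upsilon>" by (rule Fun_arrow_cases[OF w(1)])
  have u1: "\<And>c. c \<in> Obj C \<Longrightarrow> Cmp A (\<upsilon> c) (\<phi> c) = \<kappa> c"
    using w(2) unfolding w' by (auto dest: fun_cong)
  obtain z where z: "z \<in> Hom (Fun C A) L K" "Cmp (Fun C A) z (G, L, \<kappa>) = (G, K, \<phi>)"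
    using is_cokernelD[OF Fun_cokernelI[OF t l k], of "(G, K, \<phi>)"] p pz by auto
  obtain \<nu> where z': "z = (L, K, \<nu>)" and v: "is_nat_trans C A L K \<nu>" by (rule Fun_arrow_cases[OF z(1)])
  have v1: "\<And>c. c \<in> Obj C \<Longrightarrow> Cmp A (\<nu> c) (\<kappa> c) = \<phi> c"
    using z(2) unfolding z' by (auto dest: fun_cong)
  note V = nat_transD(3-5)[OF v] and U = nat_transD(3-5)[OF u] and P = nat_transD(3-5)[OF p] and L = nat_transD(3-5)[OF l] and T = nat_transD(3-5)[OF t]
  have pe: "restrict \<phi> (Obj C) = \<phi>" using nat_transD(7)[OF p] by (rule extensional_restrict)
  have "\<exists>!w. w \<in> Hom (Fun C A) K K \<and> Cmp (Fun C A) w (G, K, \<phi>) = (G, K, \<phi>)"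
    using is_cokernelD[OF assms(1), of "(G, K, \<phi>)"] p pz by simp
  moreover have "(K, K, \<lambda>c\<in>Obj C. Ide A (fob K c)) \<in> Hom (Fun C A) K K \<and>
      Cmp (Fun C A) (K, K, \<lambda>c\<in>Obj C. Ide A (fob K c)) (G, K, \<phi>) = (G, K, \<phi>)"
    using Ide_nat_trans[OF nat_transD(2)[OF p]] P pe by (simp add: Hom_iff cong: restrict_cong)
  moreover have "(K, K, \<lambda>c\<in>Obj C. Cmp A (\<nu> c) (\<upsilon> c)) \<in> Hom (Fun C A) K K \<and>
      Cmp (Fun C A) (K, K, \<lambda>c\<in>Obj C. Cmp A (\<nu> c) (\<upsilon> c)) (G, K, \<phi>) = (G, K, \<phi>)"
    using Cmp_nat_trans[OF u v] P pe U V v1 u1 by (simp add: Hom_iff cong: restrict_cong)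
  ultimately have "(K, K, \<lambda>c\<in>Obj C. Cmp A (\<nu> c) (\<upsilon> c)) = (K, K, \<lambda>c\<in>Obj C. Ide A (fob K c))"
    by (rule Ex1_unique)
  then have "(\<lambda>c\<in>Obj C. Cmp A (\<nu> c) (\<upsilon> c)) c = (\<lambda>c\<in>Obj C. Ide A (fob K c)) c" by (elim Pair_inject) (rule fun_cong)
  then have uv: "Cmp A (\<nu> c) (\<upsilon> c) = Ide A (fob K c)" using c by simp
  show ?thesis
  proof (rule cokernelI)
    show "is_zero A (Cmp A (\<phi> c) (\<epsilon> c))" using pz c unfolding Fun_zero_iff[OF t p] by simp
    show "is_epi A (\<phi> c)"
    proof (rule epiI)
      fix w assume w: "w \<in> Arr A" "Dom A w = Cod A (\<phi> c)" "is_zero A (Cmp A w (\<phi> c))"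
      have "is_zero A (Cmp A (Cmp A w (\<nu> c)) (\<kappa> c))"
        using v1[OF c] w V P L c by simp
      then have "is_zero A (Cmp A w (\<nu> c))" using epi_zero[OF d(5)[OF c], of "Cmp A w (\<nu> c)"] w V P L c by simp
      then have "is_zero A (Cmp A (Cmp A w (\<nu> c)) (\<upsilon> c))" by (rule is_zero_Cmp_left) (use w V P U c in simp_all)
      then show "is_zero A w" using uv w V P U c by simp
    qed (use P c in simp)
    fix h assume h: "h \<in> Arr A" "Dom A h = Cod A (\<epsilon> c)" "is_zero A (Cmp A h (\<epsilon> c))"
    obtain w where w: "w \<in> Arr A" "Dom A w = Cod A (\<kappa> c)" "Cod A w = Cod A h" "Cmp A w (\<kappa> c) = h"
      using cokernel_desc[OF k[OF c] h] by metis
    show "\<exists>u. u \<in> Arr A \<and> Dom A u = Cod A (\<phi> c) \<and> Cod A u = Cod A h \<and> Cmp A u (\<phi> c) = h"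
      by (rule exI[of _ "Cmp A w (\<upsilon> c)"]) (use w U P L c u1[OF c] in simp)
  qed (use P T c in simp_all)
qed

lemma Fun_short_exactD:
  assumes "short_exact (Fun C A) \<phi> \<gamma>"
  obtains F G H f g where "\<phi> = (F, G, f)" "\<gamma> = (G, H, g)" "is_nat_trans C A F G f" "is_nat_trans C A G H g"
    "\<And>c. c \<in> Obj C \<Longrightarrow> short_exact A (f c) (g c)"
proof -
  obtain F G f where p: "\<phi> = (F, G, f)" by (cases \<phi>)
  obtain G' H g where g: "\<gamma> = (G', H, g)" by (cases \<gamma>)
  have k: "is_kernel (Fun C A) \<gamma> \<phi>" and q: "is_cokernel (Fun C A) \<phi> \<gamma>" using assms by (auto simp: short_exact_def)
  have G: "G' = G" using k p g by (simp add: is_kernel_def)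
  show ?thesis
  proof (rule that[OF p g[unfolded G]])
    show "is_nat_trans C A F G f" "is_nat_trans C A G H g" using k p g G by (auto simp: is_kernel_def)
    show "short_exact A (f c) (g c)" if "c \<in> Obj C" for c
      unfolding short_exact_def using Fun_kernelD[of G H g F f c] Fun_cokernelD[of F G f H g c] k q p g G that by simp
  qed
qed

end

section \<open>The canonical effacement in a functor category\<close>

lemma small_inj: "small s J \<Longrightarrow> inj_on h I \<Longrightarrow> h ` I \<subseteq> J \<Longrightarrow> small s I"
  unfolding small_def by (metis comp_inj_on inj_on_subset)

lemma small_subset: "small s J \<Longrightarrow> I \<subseteq> J \<Longrightarrow> small s I"
  using small_inj[of s J id I] by simp

lemma delta_functorD:
  assumes "is_homological_delta_functor B A T \<delta>"
  shows "is_functor B A (T n)" "is_additive B A (T n)"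
    "short_exact B f g \<Longrightarrow> \<delta> n f g \<in> Hom A (fob (T (Suc n)) (Cod B g)) (fob (T n) (Dom B f))"
    "short_exact B f g \<Longrightarrow> short_exact B f' g' \<Longrightarrow> u \<in> Hom B (Dom B f) (Dom B f') \<Longrightarrow>
       v \<in> Hom B (Cod B f) (Cod B f') \<Longrightarrow> w \<in> Hom B (Cod B g) (Cod B g') \<Longrightarrow>
       Cmp B v f = Cmp B f' u \<Longrightarrow> Cmp B w g = Cmp B g' v \<Longrightarrow>
       Cmp A (far (T n) u) (\<delta> n f g) = Cmp A (\<delta> n f' g') (far (T (Suc n)) w)"
    "short_exact B f g \<Longrightarrow> exact_at A (far (T n) f) (far (T n) g)"
    "short_exact B f g \<Longrightarrow> exact_at A (far (T (Suc n)) g) (\<delta> n f g)"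
    "short_exact B f g \<Longrightarrow> exact_at A (\<delta> n f g) (far (T n) f)"
    "short_exact B f g \<Longrightarrow> is_epi A (far (T 0) g)"
  using assms unfolding is_homological_delta_functor_def by (blast, blast, blast, metis, blast+)

locale small_functor_category = functor_category C A + AB4 A s
  for C :: "('c, 'f, 'y) cat_scheme" and A :: "('o, 'm, 'z) pcat_scheme" and s :: "'s itself" +
  assumes small_Arr: "small s (Arr C)"
begin

lemma small_Obj: "small s (Obj C)"
  by (rule small_inj[OF small_Arr, of "Ide C"]) (auto intro: inj_on_inverseI[of _ "Dom C"])

section \<open>The functor \<open>Pf F\<close> and its counit\<close>

definition into :: "'c \<Rightarrow> 'f set" where
  "into c = {f \<in> Arr C. Cod C f = c}"

lemma into_iff [simp]: "f \<in> into c \<longleftrightarrow> f \<in> Arr C \<and> Cod C f = c"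
  by (simp add: into_def)

definition free :: "('c, 'f, 'o, 'm) fct \<Rightarrow> 'c \<Rightarrow> 'o" where
  "free F c = coprod A (into c) (\<lambda>f. fob F (Dom C f))"

definition free_in :: "('c, 'f, 'o, 'm) fct \<Rightarrow> 'f \<Rightarrow> 'm" where
  "free_in F f = coprod_in A (into (Cod C f)) (\<lambda>f. fob F (Dom C f)) f"

definition fcopair :: "('c, 'f, 'o, 'm) fct \<Rightarrow> 'c \<Rightarrow> 'o \<Rightarrow> ('f \<Rightarrow> 'm) \<Rightarrow> 'm" where
  "fcopair F c Q h = copair A (into c) (\<lambda>f. fob F (Dom C f)) Q h"

lemma fam_into: "is_functor C A F \<Longrightarrow> fam (into c) (\<lambda>f. fob F (Dom C f))"
  unfolding fam_def by (intro conjI ballI small_subset[OF small_Arr]) (auto intro: functorD(1))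

lemma free_Obj: "is_functor C A F \<Longrightarrow> free F c \<in> Obj A"
  unfolding free_def by (rule coprod_Obj[OF fam_into])

lemma free_in:
  assumes "is_functor C A F" "f \<in> Arr C"
  shows "free_in F f \<in> Arr A" "Dom A (free_in F f) = fob F (Dom C f)" "Cod A (free_in F f) = free F (Cod C f)"
  using coprod_in[OF fam_into[OF assms(1)], of f "Cod C f"] assms by (simp_all add: free_in_def free_def)

lemma fcopair:
  assumes F: "is_functor C A F" and Q: "Q \<in> Obj A"
    and h: "\<And>f. f \<in> Arr C \<Longrightarrow> Cod C f = c \<Longrightarrow> h f \<in> Hom A (fob F (Dom C f)) Q"
  shows "fcopair F c Q h \<in> Arr A" "Dom A (fcopair F c Q h) = free F c" "Cod A (fcopair F c Q h) = Q"
    "f \<in> Arr C \<Longrightarrow> Cod C f = c \<Longrightarrow> Cmp A (fcopair F c Q h) (free_in F f) = h f"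
proof -
  have "\<forall>f\<in>into c. h f \<in> Hom A (fob F (Dom C f)) Q" using h by simp
  note c = copair[OF fam_into[OF F] Q this]
  show "fcopair F c Q h \<in> Arr A" "Dom A (fcopair F c Q h) = free F c" "Cod A (fcopair F c Q h) = Q"
    "f \<in> Arr C \<Longrightarrow> Cod C f = c \<Longrightarrow> Cmp A (fcopair F c Q h) (free_in F f) = h f"
    using c by (simp_all add: fcopair_def free_def free_in_def)
qed

lemma free_ext:
  assumes F: "is_functor C A F" and u: "u \<in> Arr A" "v \<in> Arr A" "Dom A u = free F c" "Dom A v = free F c" "Cod A u = Cod A v"
    and eq: "\<And>f. f \<in> Arr C \<Longrightarrow> Cod C f = c \<Longrightarrow> Cmp A u (free_in F f) = Cmp A v (free_in F f)"
  shows "u = v"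
  by (rule coprod_ext[OF fam_into[OF F], of u v c]) (use u eq in \<open>auto simp: free_def free_in_def\<close>)

text \<open>This is the comonad of the adjunction between functors on C and families of objects
  indexed by the objects of C. Only the objects of F enter; its arrows appear first in the counit
  \<open>eps\<close>.\<close>

definition Pf :: "('c, 'f, 'o, 'm) fct \<Rightarrow> ('c, 'f, 'o, 'm) fct" where
  "Pf F = \<lparr>fob = \<lambda>c\<in>Obj C. free F c,
     far = \<lambda>g\<in>Arr C. fcopair F (Dom C g) (free F (Cod C g)) (\<lambda>f. free_in F (Cmp C g f))\<rparr>"

lemma fob_Pf [simp]: "c \<in> Obj C \<Longrightarrow> fob (Pf F) c = free F c"
  by (simp add: Pf_def)

lemma far_Pf:
  assumes F: "is_functor C A F" and g: "g \<in> Arr C"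
  shows "far (Pf F) g \<in> Arr A" "Dom A (far (Pf F) g) = free F (Dom C g)" "Cod A (far (Pf F) g) = free F (Cod C g)"
    "f \<in> Arr C \<Longrightarrow> Cod C f = Dom C g \<Longrightarrow> Cmp A (far (Pf F) g) (free_in F f) = free_in F (Cmp C g f)"
proof -
  have "free_in F (Cmp C g f) \<in> Hom A (fob F (Dom C f)) (free F (Cod C g))" if "f \<in> Arr C" "Cod C f = Dom C g" for f
    using free_in[OF F, of "Cmp C g f"] that g by (simp add: Hom_iff)
  note c = fcopair[OF F free_Obj[OF F] this]
  show "far (Pf F) g \<in> Arr A" "Dom A (far (Pf F) g) = free F (Dom C g)" "Cod A (far (Pf F) g) = free F (Cod C g)"
    "f \<in> Arr C \<Longrightarrow> Cod C f = Dom C g \<Longrightarrow> Cmp A (far (Pf F) g) (free_in F f) = free_in F (Cmp C g f)"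
    using c g by (simp_all add: Pf_def)
qed

lemma Pf_functor: assumes F: "is_functor C A F" shows "is_functor C A (Pf F)"
proof (rule is_functorI)
  fix c assume c: "c \<in> Obj C"
  show "far (Pf F) (Ide C c) = Ide A (fob (Pf F) c)"
    by (rule free_ext[OF F, of _ _ c]) (use far_Pf[OF F, of "Ide C c"] free_in[OF F] free_Obj[OF F] c in simp_all)
next
  fix f g assume f: "f \<in> Arr C" and g: "g \<in> Arr C" and fg: "Cod C f = Dom C g"
  show "far (Pf F) (Cmp C g f) = Cmp A (far (Pf F) g) (far (Pf F) f)"
    by (rule free_ext[OF F, of _ _ "Dom C f"])
       (use far_Pf[OF F, of "Cmp C g f"] far_Pf[OF F f] far_Pf[OF F g] free_in[OF F] f g fg in simp_all)
qed (use far_Pf[OF F] free_Obj[OF F] in \<open>simp_all add: Pf_def\<close>)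

definition eps :: "('c, 'f, 'o, 'm) fct \<Rightarrow> 'c \<Rightarrow> 'm" where
  "eps F = (\<lambda>c\<in>Obj C. fcopair F c (fob F c) (far F))"

lemma eps:
  assumes F: "is_functor C A F" and c: "c \<in> Obj C"
  shows "eps F c \<in> Arr A" "Dom A (eps F c) = free F c" "Cod A (eps F c) = fob F c"
    "f \<in> Arr C \<Longrightarrow> Cod C f = c \<Longrightarrow> Cmp A (eps F c) (free_in F f) = far F f"
proof -
  have "far F f \<in> Hom A (fob F (Dom C f)) (fob F c)" if "f \<in> Arr C" "Cod C f = c" for f
    using functorD[OF F] that by (simp add: Hom_iff)
  note e = fcopair[OF F functorD(1)[OF F c] this]
  show "eps F c \<in> Arr A" "Dom A (eps F c) = free F c" "Cod A (eps F c) = fob F c"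
    "f \<in> Arr C \<Longrightarrow> Cod C f = c \<Longrightarrow> Cmp A (eps F c) (free_in F f) = far F f"
    using e c by (simp_all add: eps_def)
qed

lemma eps_nat_trans:
  assumes F: "is_functor C A F" shows "is_nat_trans C A (Pf F) F (eps F)"
proof (rule is_nat_transI[OF Pf_functor[OF F] F])
  fix f assume f: "f \<in> Arr C"
  show "Cmp A (far F f) (eps F (Dom C f)) = Cmp A (eps F (Cod C f)) (far (Pf F) f)"
    by (rule free_ext[OF F, of _ _ "Dom C f"])
       (use f eps[OF F C.Obj_Dom[OF f]] eps[OF F C.Obj_Cod[OF f]] functorD[OF F] far_Pf[OF F f] free_in[OF F] in simp_all)
qed (use eps[OF F] in \<open>simp_all add: eps_def\<close>)

text \<open>The summand at the identity of c provides a section of the component at c.\<close>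

lemma eps_epi:
  assumes F: "is_functor C A F" and c: "c \<in> Obj C" shows "is_epi A (eps F c)"
proof (rule epi_left[of _ "free_in F (Ide C c)"])
  show "is_epi A (Cmp A (eps F c) (free_in F (Ide C c)))"
    using eps(4)[OF F c, of "Ide C c"] functorD[OF F] c epi_Ide by simp
qed (use eps[OF F c] free_in[OF F] c in simp_all)

section \<open>Functoriality and exactness of \<open>Pf\<close>\<close>

definition Pf_map where
  "Pf_map = (\<lambda>(F, G, \<tau>). (Pf F, Pf G, \<lambda>c\<in>Obj C. coprod_map A (into c) (\<lambda>f. fob F (Dom C f)) (\<lambda>f. fob G (Dom C f)) (\<lambda>f. \<tau> (Dom C f))))"

lemma Pf_map_comp:
  assumes t: "is_nat_trans C A F G \<tau>" and c: "c \<in> Obj C"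
  defines "p \<equiv> coprod_map A (into c) (\<lambda>f. fob F (Dom C f)) (\<lambda>f. fob G (Dom C f)) (\<lambda>f. \<tau> (Dom C f))"
  shows "p \<in> Arr A" "Dom A p = free F c" "Cod A p = free G c"
    "f \<in> Arr C \<Longrightarrow> Cod C f = c \<Longrightarrow> Cmp A p (free_in F f) = Cmp A (free_in G f) (\<tau> (Dom C f))"
proof -
  have "\<forall>f\<in>into c. \<tau> (Dom C f) \<in> Hom A (fob F (Dom C f)) (fob G (Dom C f))"
    using nat_transD(3-5)[OF t] by (simp add: Hom_iff)
  note m = coprod_map[OF fam_into[OF nat_transD(1)[OF t]] fam_into[OF nat_transD(2)[OF t]] this]
  show "p \<in> Arr A" "Dom A p = free F c" "Cod A p = free G c"
    "f \<in> Arr C \<Longrightarrow> Cod C f = c \<Longrightarrow> Cmp A p (free_in F f) = Cmp A (free_in G f) (\<tau> (Dom C f))"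
    using m by (simp_all add: p_def free_in_def free_def)
qed

lemma Pf_map_nat_trans:
  assumes t: "is_nat_trans C A F G \<tau>"
  shows "Pf_map (F, G, \<tau>) \<in> Hom (Fun C A) (Pf F) (Pf G)"
proof -
  note F = nat_transD(1)[OF t] and G = nat_transD(2)[OF t]
  let ?p = "\<lambda>c. coprod_map A (into c) (\<lambda>f. fob F (Dom C f)) (\<lambda>f. fob G (Dom C f)) (\<lambda>f. \<tau> (Dom C f))"
  have "is_nat_trans C A (Pf F) (Pf G) (\<lambda>c\<in>Obj C. ?p c)"
  proof (rule is_nat_transI[OF Pf_functor[OF F] Pf_functor[OF G]])
    fix f assume f: "f \<in> Arr C"
    have d: "Dom C f \<in> Obj C" "Cod C f \<in> Obj C" using f by simp_all
    note p1 = Pf_map_comp[OF t d(1)] and p2 = Pf_map_comp[OF t d(2)]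
    note S = far_Pf(1-3)[OF F f] far_Pf(1-3)[OF G f] free_in[OF F] free_in[OF G] nat_transD(3-5)[OF t]
    have "Cmp A (far (Pf G) f) (?p (Dom C f)) = Cmp A (?p (Cod C f)) (far (Pf F) f)"
    proof (rule free_ext[OF F, of _ _ "Dom C f"])
      fix g assume g: "g \<in> Arr C" "Cod C g = Dom C f"
      have "Cmp A (far (Pf G) f) (Cmp A (free_in G g) (\<tau> (Dom C g))) = Cmp A (free_in G (Cmp C f g)) (\<tau> (Dom C g))"
        using Cmp_eq_extend[OF far_Pf(4)[OF G f g], of "\<tau> (Dom C g)"] S f g by simp
      then show "Cmp A (Cmp A (far (Pf G) f) (?p (Dom C f))) (free_in F g) = Cmp A (Cmp A (?p (Cod C f)) (far (Pf F) f)) (free_in F g)"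
        using p1(1-3) p2(1-3) p1(4)[OF g] p2(4)[of "Cmp C f g"] far_Pf(4)[OF F f g] S f g by simp
    qed (use p1 p2 S in simp_all)
    then show "Cmp A (far (Pf G) f) ((\<lambda>c\<in>Obj C. ?p c) (Dom C f)) = Cmp A ((\<lambda>c\<in>Obj C. ?p c) (Cod C f)) (far (Pf F) f)"
      using d by simp
  qed (use Pf_map_comp[OF t] in simp_all)
  then show ?thesis by (simp add: Pf_map_def Hom_iff)
qed

lemma Pf_map_Hom: "u \<in> Hom (Fun C A) F G \<Longrightarrow> Pf_map u \<in> Hom (Fun C A) (Pf F) (Pf G)"
  by (erule Fun_arrow_cases) (simp add: Pf_map_nat_trans)

lemma Pf_map_Ide:
  assumes F: "is_functor C A F"
  shows "Pf_map (Ide (Fun C A) F) = Ide (Fun C A) (Pf F)"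
proof -
  note t = Ide_nat_trans[OF F]
  have "coprod_map A (into c) (\<lambda>f. fob F (Dom C f)) (\<lambda>f. fob F (Dom C f)) (\<lambda>f. (\<lambda>c\<in>Obj C. Ide A (fob F c)) (Dom C f)) = Ide A (free F c)"
    (is "?p = _") if c: "c \<in> Obj C" for c
    by (rule free_ext[OF F, of _ _ c]) (use Pf_map_comp[OF t c] free_in[OF F] free_Obj[OF F] c in simp_all)
  then show ?thesis by (simp add: Pf_map_def cong: restrict_cong)
qed

lemma Pf_map_Cmp:
  assumes u: "u \<in> Hom (Fun C A) F G" and v: "v \<in> Hom (Fun C A) G H"
  shows "Pf_map (Cmp (Fun C A) v u) = Cmp (Fun C A) (Pf_map v) (Pf_map u)"
proof -
  obtain \<tau> where u': "u = (F, G, \<tau>)" and t: "is_nat_trans C A F G \<tau>" by (rule Fun_arrow_cases[OF u])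
  obtain \<sigma> where v': "v = (G, H, \<sigma>)" and r: "is_nat_trans C A G H \<sigma>" by (rule Fun_arrow_cases[OF v])
  note F = nat_transD(1)[OF t] and G = nat_transD(2)[OF t] and H = nat_transD(2)[OF r]
  note tr = Cmp_nat_trans[OF t r]
  have "coprod_map A (into c) (\<lambda>f. fob F (Dom C f)) (\<lambda>f. fob H (Dom C f)) (\<lambda>f. (\<lambda>c\<in>Obj C. Cmp A (\<sigma> c) (\<tau> c)) (Dom C f)) =
     Cmp A (coprod_map A (into c) (\<lambda>f. fob G (Dom C f)) (\<lambda>f. fob H (Dom C f)) (\<lambda>f. \<sigma> (Dom C f)))
       (coprod_map A (into c) (\<lambda>f. fob F (Dom C f)) (\<lambda>f. fob G (Dom C f)) (\<lambda>f. \<tau> (Dom C f)))"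
    (is "?p = Cmp A ?q ?r") if c: "c \<in> Obj C" for c
  proof (rule free_ext[OF F, of _ _ c])
    note p = Pf_map_comp[OF tr c] and q = Pf_map_comp[OF r c] and rr = Pf_map_comp[OF t c]
    fix f assume f: "f \<in> Arr C" "Cod C f = c"
    show "Cmp A ?p (free_in F f) = Cmp A (Cmp A ?q ?r) (free_in F f)"
      using p(4)[OF f] Cmp_eq_extend[OF q(4)[OF f], of "\<tau> (Dom C f)"] q(1-3) rr(1-3) rr(4)[OF f] f
        free_in[OF F] free_in[OF G] free_in[OF H] nat_transD(3-5)[OF t] nat_transD(3-5)[OF r] by simp
  qed (use Pf_map_comp[OF tr c] Pf_map_comp[OF r c] Pf_map_comp[OF t c] in simp_all)
  then show ?thesis unfolding u' v' by (simp add: Pf_map_def cong: restrict_cong)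
qed

lemma Add_nat_trans:
  assumes t: "is_nat_trans C A F G \<tau>" and u: "is_nat_trans C A F G \<sigma>"
  shows "is_nat_trans C A F G (\<lambda>c\<in>Obj C. Add A (\<tau> c) (\<sigma> c))"
proof (rule is_nat_transI)
  note F = functorD[OF nat_transD(1)[OF t]] and G = functorD[OF nat_transD(2)[OF t]]
  note T = nat_transD(3-6)[OF t] and U = nat_transD(3-6)[OF u]
  fix f assume f: "f \<in> Arr C"
  show "Cmp A (far G f) ((\<lambda>c\<in>Obj C. Add A (\<tau> c) (\<sigma> c)) (Dom C f)) = Cmp A ((\<lambda>c\<in>Obj C. Add A (\<tau> c) (\<sigma> c)) (Cod C f)) (far F f)"
    using T U F G f by (simp add: Cmp_AddL Cmp_AddR)
qed (use nat_transD[OF t] nat_transD(3-6)[OF u] in simp_all)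

lemma Fun_Add_Arr:
  assumes u: "u \<in> Hom (Fun C A) F G" and v: "v \<in> Hom (Fun C A) F G"
  shows "Add (Fun C A) u v \<in> Arr (Fun C A)"
proof -
  obtain \<tau> where u': "u = (F, G, \<tau>)" and t: "is_nat_trans C A F G \<tau>" by (rule Fun_arrow_cases[OF u])
  obtain \<sigma> where v': "v = (F, G, \<sigma>)" and r: "is_nat_trans C A F G \<sigma>" by (rule Fun_arrow_cases[OF v])
  show ?thesis using Add_nat_trans[OF t r] by (simp add: u' v')
qed

lemma Pf_map_Add:
  assumes u: "u \<in> Hom (Fun C A) F G" and v: "v \<in> Hom (Fun C A) F G"
  shows "Pf_map (Add (Fun C A) u v) = Add (Fun C A) (Pf_map u) (Pf_map v)"
proof -
  obtain \<tau> where u': "u = (F, G, \<tau>)" and t: "is_nat_trans C A F G \<tau>" by (rule Fun_arrow_cases[OF u])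
  obtain \<sigma> where v': "v = (F, G, \<sigma>)" and r: "is_nat_trans C A F G \<sigma>" by (rule Fun_arrow_cases[OF v])
  note F = nat_transD(1)[OF t] and G = nat_transD(2)[OF t]
  note tr = Add_nat_trans[OF t r]
  have "coprod_map A (into c) (\<lambda>f. fob F (Dom C f)) (\<lambda>f. fob G (Dom C f)) (\<lambda>f. (\<lambda>c\<in>Obj C. Add A (\<tau> c) (\<sigma> c)) (Dom C f)) =
     Add A (coprod_map A (into c) (\<lambda>f. fob F (Dom C f)) (\<lambda>f. fob G (Dom C f)) (\<lambda>f. \<tau> (Dom C f)))
       (coprod_map A (into c) (\<lambda>f. fob F (Dom C f)) (\<lambda>f. fob G (Dom C f)) (\<lambda>f. \<sigma> (Dom C f)))"
    (is "?p = Add A ?q ?r") if c: "c \<in> Obj C" for c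
    by (rule free_ext[OF F, of _ _ c])
       (use Pf_map_comp[OF tr c] Pf_map_comp[OF r c] Pf_map_comp[OF t c] free_in[OF F] free_in[OF G] nat_transD(3-5)[OF t] nat_transD(3-5)[OF r]
        in \<open>simp_all add: Cmp_AddL Cmp_AddR\<close>)
  then show ?thesis unfolding u' v' by (simp add: Pf_map_def cong: restrict_cong)
qed

text \<open>At each c this is a coproduct of the given sequences, taken at the domains of the arrows
  into c, and AB4 applies.\<close>

lemma Pf_map_short_exact:
  assumes "short_exact (Fun C A) \<phi> \<gamma>"
  shows "short_exact (Fun C A) (Pf_map \<phi>) (Pf_map \<gamma>)"
proof -
  obtain F G H f g where p: "\<phi> = (F, G, f)" "\<gamma> = (G, H, g)" and t: "is_nat_trans C A F G f" "is_nat_trans C A G H g"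
    and e: "\<And>c. c \<in> Obj C \<Longrightarrow> short_exact A (f c) (g c)" using Fun_short_exactD[OF assms] by metis
  note T = nat_transD(3-5)[OF t(1)] nat_transD(3-5)[OF t(2)]
  show ?thesis unfolding p Pf_map_def prod.case
  proof (rule Fun_short_exactI)
    fix c assume c: "c \<in> Obj C"
    show "short_exact A ((\<lambda>c\<in>Obj C. coprod_map A (into c) (\<lambda>fa. fob F (Dom C fa)) (\<lambda>f. fob G (Dom C f)) (\<lambda>fa. f (Dom C fa))) c)
          ((\<lambda>c\<in>Obj C. coprod_map A (into c) (\<lambda>f. fob G (Dom C f)) (\<lambda>f. fob H (Dom C f)) (\<lambda>f. g (Dom C f))) c)"
      using c by (simp, intro coprod_map_short_exact)
        (use nat_transD(1,2)[OF t(1)] nat_transD(2)[OF t(2)] T e in \<open>simp_all add: fam_into\<close>)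
  qed (use Pf_map_nat_trans[OF t(1)] Pf_map_nat_trans[OF t(2)] in \<open>simp_all add: Pf_map_def Hom_iff\<close>)
qed

lemma eps_natural:
  assumes u: "u \<in> Hom (Fun C A) F G"
  shows "Cmp (Fun C A) u (Pf F, F, eps F) = Cmp (Fun C A) (Pf G, G, eps G) (Pf_map u)"
proof -
  obtain \<tau> where u': "u = (F, G, \<tau>)" and t: "is_nat_trans C A F G \<tau>" by (rule Fun_arrow_cases[OF u])
  note F = nat_transD(1)[OF t] and G = nat_transD(2)[OF t]
  have "Cmp A (\<tau> c) (eps F c) = Cmp A (eps G c) (coprod_map A (into c) (\<lambda>f. fob F (Dom C f)) (\<lambda>f. fob G (Dom C f)) (\<lambda>f. \<tau> (Dom C f)))"
    (is "_ = Cmp A _ ?p") if c: "c \<in> Obj C" for c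
  proof (rule free_ext[OF F, of _ _ c])
    note p = Pf_map_comp[OF t c]
    fix f assume f: "f \<in> Arr C" "Cod C f = c"
    show "Cmp A (Cmp A (\<tau> c) (eps F c)) (free_in F f) = Cmp A (Cmp A (eps G c) ?p) (free_in F f)"
      using p(1-3) p(4)[OF f] eps(1-3)[OF F c] eps(1-3)[OF G c] eps(4)[OF F c f] Cmp_eq_extend[OF eps(4)[OF G c f], of "\<tau> (Dom C f)"]
        free_in[OF F] free_in[OF G] nat_transD(3-5)[OF t] nat_transD(6)[OF t f(1)] functorD[OF G] f c by simp
  qed (use Pf_map_comp[OF t c] eps[OF F c] eps[OF G c] nat_transD(3-5)[OF t] c in simp_all)
  then show ?thesis unfolding u' by (simp add: Pf_map_def cong: restrict_cong)
qed

text \<open>The section is the comultiplication of the comonad. The summand of f enters the summand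
  of f in the outer coproduct through the identity of its domain; the counit then composes f with
  this identity and returns f.\<close>

lemma eps_split:
  assumes F: "is_functor C A F"
  obtains \<sigma> where "is_nat_trans C A (Pf F) (Pf (Pf F)) \<sigma>"
    "Cmp (Fun C A) (Pf (Pf F), Pf F, eps (Pf F)) (Pf F, Pf (Pf F), \<sigma>) = Ide (Fun C A) (Pf F)"
proof -
  note P = Pf_functor[OF F] and PP = Pf_functor[OF Pf_functor[OF F]]
  define h where "h f = Cmp A (free_in (Pf F) f) (free_in F (Ide C (Dom C f)))" for f
  have h: "h f \<in> Hom A (fob F (Dom C f)) (free (Pf F) c)" if "f \<in> Arr C" "Cod C f = c" for f c
    using free_in[OF F, of "Ide C (Dom C f)"] free_in[OF P, of f] that by (simp add: h_def Hom_iff)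
  define \<sigma> where "\<sigma> = (\<lambda>c\<in>Obj C. fcopair F c (free (Pf F) c) h)"
  have s: "\<sigma> c \<in> Arr A" "Dom A (\<sigma> c) = free F c" "Cod A (\<sigma> c) = free (Pf F) c"
    "\<And>f. f \<in> Arr C \<Longrightarrow> Cod C f = c \<Longrightarrow> Cmp A (\<sigma> c) (free_in F f) = h f" if "c \<in> Obj C" for c
    using fcopair[OF F free_Obj[OF P] h, of c] that by (simp_all add: \<sigma>_def)
  have 1: "is_nat_trans C A (Pf F) (Pf (Pf F)) \<sigma>"
  proof (rule is_nat_transI[OF P PP])
    fix g assume g: "g \<in> Arr C"
    note s1 = s[OF C.Obj_Dom[OF g]] and s2 = s[OF C.Obj_Cod[OF g]]
    show "Cmp A (far (Pf (Pf F)) g) (\<sigma> (Dom C g)) = Cmp A (\<sigma> (Cod C g)) (far (Pf F) g)"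
    proof (rule free_ext[OF F, of _ _ "Dom C g"])
      fix f assume f: "f \<in> Arr C" "Cod C f = Dom C g"
      show "Cmp A (Cmp A (far (Pf (Pf F)) g) (\<sigma> (Dom C g))) (free_in F f) = Cmp A (Cmp A (\<sigma> (Cod C g)) (far (Pf F) g)) (free_in F f)"
        using s1(1-3) s2(1-3) s1(4)[OF f] s2(4)[of "Cmp C g f"] far_Pf(1-3)[OF P g] far_Pf(1-3)[OF F g] far_Pf(4)[OF F g f]
          Cmp_eq_extend[OF far_Pf(4)[OF P g f], of "free_in F (Ide C (Dom C f))"] free_in[OF F] free_in[OF P] f g by (simp add: h_def)
    qed (use s1 s2 far_Pf[OF P g] far_Pf[OF F g] in simp_all)
  qed (use s in \<open>simp_all add: \<sigma>_def\<close>)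
  have 2: "Cmp A (eps (Pf F) c) (\<sigma> c) = Ide A (free F c)" if c: "c \<in> Obj C" for c
  proof (rule free_ext[OF F, of _ _ c])
    fix f assume f: "f \<in> Arr C" "Cod C f = c"
    show "Cmp A (Cmp A (eps (Pf F) c) (\<sigma> c)) (free_in F f) = Cmp A (Ide A (free F c)) (free_in F f)"
      using s(1-3)[OF c] s(4)[OF c f] eps(1-3)[OF P c] Cmp_eq_extend[OF eps(4)[OF P c f], of "free_in F (Ide C (Dom C f))"]
        far_Pf(1-3)[OF F f(1)] far_Pf(4)[OF F f(1), of "Ide C (Dom C f)"] free_in[OF F] free_in[OF P] f c by (simp add: h_def)
  qed (use s[OF c] eps[OF P c] free_Obj[OF F] c in simp_all)
  show ?thesis by (rule that[OF 1]) (use 2 in \<open>simp cong: restrict_cong\<close>)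
qed

text \<open>The counit on colimits factors through the exact functor \<open>F \<mapsto> \<Coprod>\<^sub>c F c\<close>; hence the connecting
  morphism of \<open>T \<circ> Pf\<close> in degree zero dies in \<open>T 0\<close>.\<close>

lemma colimit_eps_zero:
  assumes L: "is_colimit_functor C A L" and t: "is_nat_trans C A F G \<tau>" and m: "\<And>c. c \<in> Obj C \<Longrightarrow> is_mono A (\<tau> c)"
    and x: "x \<in> Arr A" "Cod A x = fob L (Pf F)" and z: "is_zero A (Cmp A (far L (Pf_map (F, G, \<tau>))) x)"
  shows "is_zero A (Cmp A (far L (Pf F, F, eps F)) x)"
proof -
  note F = nat_transD(1)[OF t] and G = nat_transD(2)[OF t]
  have Lf: "is_functor (Fun C A) A L" using L by (simp add: is_colimit_functor_def)
  obtain \<eta> where eta0: "\<forall>F\<in>Obj (Fun C A). is_colimit C A F (fob L F) (\<eta> F)"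
    and nat0: "\<forall>F G \<tau>. (F, G, \<tau>) \<in> Arr (Fun C A) \<longrightarrow> (\<forall>c\<in>Obj C. Cmp A (far L (F, G, \<tau>)) (\<eta> F c) = Cmp A (\<eta> G c) (\<tau> c))"
    using L unfolding is_colimit_functor_def by (elim conjE exE)
  have eta: "is_colimit C A F (fob L F) (\<eta> F)" if "is_functor C A F" for F
    using bspec[OF eta0, of F] that by simp
  have nat: "Cmp A (far L (F, G, \<tau>)) (\<eta> F c) = Cmp A (\<eta> G c) (\<tau> c)" if "is_nat_trans C A F G \<tau>" "c \<in> Obj C" for F G \<tau> c
    using nat0 that by simp
  have co: "is_cocone C A F (fob L F) (\<eta> F)" if "is_functor C A F" for F
    using eta[OF that] by (simp add: is_colimit_def)
  have e: "\<eta> F c \<in> Arr A" "Dom A (\<eta> F c) = fob F c" "Cod A (\<eta> F c) = fob L F" if "is_functor C A F" "c \<in> Obj C" for F c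
    using co[OF that(1)] that(2) by (simp_all add: is_cocone_def Hom_iff)
  have ec: "Cmp A (\<eta> F (Cod C f)) (far F f) = \<eta> F (Dom C f)" if "is_functor C A F" "f \<in> Arr C" for F f
    using co[OF that(1)] that(2) by (simp add: is_cocone_def)
  have LO: "fob L F \<in> Obj A" if "is_functor C A F" for F using functorD(1)[OF Lf] that by simp
  have famO: "fam (Obj C) (fob F)" if "is_functor C A F" for F
    using functorD(1)[OF that] small_Obj by (simp add: fam_def)
  define E where "E F = coprod A (Obj C) (fob F)" for F :: "('c, 'f, 'o, 'm) fct"
  define ein where "ein F = coprod_in A (Obj C) (fob F)" for F :: "('c, 'f, 'o, 'm) fct"
  have ein: "ein F c \<in> Arr A" "Dom A (ein F c) = fob F c" "Cod A (ein F c) = E F" if "is_functor C A F" "c \<in> Obj C" for F c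
    using coprod_in[OF famO[OF that(1)] that(2)] by (simp_all add: ein_def E_def)
  have EO: "E F \<in> Obj A" if "is_functor C A F" for F unfolding E_def by (rule coprod_Obj[OF famO[OF that]])
  \<comment> \<open>Forgets an arrow into c and keeps only its domain. Composition at the codomain
    does not change the domain, so these arrows form a cocone, which induces
    \<open>\<theta>\<close>.\<close>
  define \<mu> where "\<mu> F c = fcopair F c (E F) (\<lambda>f. ein F (Dom C f))" for F c
  have mu: "\<mu> F c \<in> Arr A" "Dom A (\<mu> F c) = free F c" "Cod A (\<mu> F c) = E F"
    "\<And>f. f \<in> Arr C \<Longrightarrow> Cod C f = c \<Longrightarrow> Cmp A (\<mu> F c) (free_in F f) = ein F (Dom C f)" if "is_functor C A F" for F c
    using fcopair[OF that EO[OF that], of c "\<lambda>f. ein F (Dom C f)"] ein[OF that] by (simp_all add: \<mu>_def Hom_iff)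
  have "\<exists>\<theta>. \<theta> \<in> Hom A (fob L (Pf F)) (E F) \<and> (\<forall>c\<in>Obj C. Cmp A \<theta> (\<eta> (Pf F) c) = \<mu> F c)" if F: "is_functor C A F" for F
  proof -
    have "is_cocone C A (Pf F) (E F) (\<mu> F)"
      unfolding is_cocone_def
    proof (intro conjI ballI)
      fix f assume f: "f \<in> Arr C"
      show "Cmp A (\<mu> F (Cod C f)) (far (Pf F) f) = \<mu> F (Dom C f)"
        by (rule free_ext[OF F, of _ _ "Dom C f"]) (use mu[OF F] far_Pf[OF F f] free_in[OF F] f in simp_all)
    qed (use mu[OF F] EO[OF F] in \<open>simp_all add: Hom_iff\<close>)
    then show ?thesis using eta[OF Pf_functor[OF F]] unfolding is_colimit_def by blast
  qed
  then obtain \<theta> where th: "\<And>F. is_functor C A F \<Longrightarrow> \<theta> F \<in> Arr A" "\<And>F. is_functor C A F \<Longrightarrow> Dom A (\<theta> F) = fob L (Pf F)"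
    "\<And>F. is_functor C A F \<Longrightarrow> Cod A (\<theta> F) = E F"
    "\<And>F c. is_functor C A F \<Longrightarrow> c \<in> Obj C \<Longrightarrow> Cmp A (\<theta> F) (\<eta> (Pf F) c) = \<mu> F c"
    unfolding Hom_iff by metis
  have colim_ext: "u = v" if F: "is_functor C A F" and u: "u \<in> Arr A" "v \<in> Arr A" "Dom A u = fob L F" "Dom A v = fob L F" "Cod A u = Cod A v"
    and eq: "\<And>c. c \<in> Obj C \<Longrightarrow> Cmp A u (\<eta> F c) = Cmp A v (\<eta> F c)" for F u v
  proof -
    have "is_cocone C A F (Cod A u) (\<lambda>c. Cmp A u (\<eta> F c))"
      unfolding is_cocone_def using u e[OF F] ec[OF F] functorD[OF F] by (simp add: Hom_iff)
    then have "\<exists>!h. h \<in> Hom A (fob L F) (Cod A u) \<and> (\<forall>c\<in>Obj C. Cmp A h (\<eta> F c) = Cmp A u (\<eta> F c))"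
      using eta[OF F] unfolding is_colimit_def by blast
    then show ?thesis
      by (rule Ex1_unique[rotated 2, THEN sym, rotated]) (use u eq in \<open>simp_all add: Hom_iff\<close>)
  qed
  have "\<forall>c\<in>Obj C. \<eta> F c \<in> Hom A (fob F c) (fob L F)" using e[OF F] by (simp add: Hom_iff)
  note om = copair[OF famO[OF F] LO[OF F] this]
  define \<omega> where "\<omega> = copair A (Obj C) (fob F) (fob L F) (\<eta> F)"
  note om = om[folded \<omega>_def E_def]
  have om4: "Cmp A \<omega> (ein F c) = \<eta> F c" if "c \<in> Obj C" for c using om(4)[OF that] by (simp add: ein_def)
  note epsA = eps_nat_trans[OF F]
  have Le: "far L (Pf F, F, eps F) \<in> Arr A" "Dom A (far L (Pf F, F, eps F)) = fob L (Pf F)" "Cod A (far L (Pf F, F, eps F)) = fob L F"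
    using functorD(2-4)[OF Lf, of "(Pf F, F, eps F)"] epsA by simp_all
  \<comment> \<open>On the summand of f : c' \<rightarrow> c both sides are the colimit injection at
    c', on the left because the injections absorb F f.\<close>
  have fact: "far L (Pf F, F, eps F) = Cmp A \<omega> (\<theta> F)"
  proof (rule colim_ext[OF Pf_functor[OF F]])
    fix c assume c: "c \<in> Obj C"
    have "Cmp A \<omega> (\<mu> F c) = Cmp A (\<eta> F c) (eps F c)"
    proof (rule free_ext[OF F, of _ _ c])
      fix f assume f: "f \<in> Arr C" "Cod C f = c"
      show "Cmp A (Cmp A \<omega> (\<mu> F c)) (free_in F f) = Cmp A (Cmp A (\<eta> F c) (eps F c)) (free_in F f)"
        using om(1-3) om4[of "Dom C f"] mu(1-3)[OF F] mu(4)[OF F f] e[OF F] eps(1-3)[OF F c] eps(4)[OF F c f] ec[OF F f(1)] free_in[OF F] f c by simp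
    qed (use om mu[OF F] e[OF F] eps[OF F c] c in simp_all)
    then show "Cmp A (far L (Pf F, F, eps F)) (\<eta> (Pf F) c) = Cmp A (Cmp A \<omega> (\<theta> F)) (\<eta> (Pf F) c)"
      using nat[OF epsA c] om(1-3) th[OF F] e[OF Pf_functor[OF F] c] c by simp
  qed (use Le om th[OF F] in simp_all)
  define Em where "Em = coprod_map A (Obj C) (fob F) (fob G) \<tau>"
  have "\<forall>c\<in>Obj C. \<tau> c \<in> Hom A (fob F c) (fob G c)" using nat_transD(3-5)[OF t] by (simp add: Hom_iff)
  note Em = coprod_map[OF famO[OF F] famO[OF G] this, folded Em_def E_def]
  have Em4: "Cmp A Em (ein F c) = Cmp A (ein G c) (\<tau> c)" if "c \<in> Obj C" for c using Em(4)[OF that] by (simp add: ein_def)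
  \<comment> \<open>The payoff of the factorization: AB4 keeps this coproduct map monic, whereas the
    colimit need not preserve monomorphisms.\<close>
  have Emm: "is_mono A Em" unfolding Em_def
    by (rule coprod_map_mono[OF famO[OF F] famO[OF G]]) (use m nat_transD(3-5)[OF t] in simp_all)
  note PAt = Pf_map_nat_trans[OF t]
  obtain \<pi> where PA': "Pf_map (F, G, \<tau>) = (Pf F, Pf G, \<pi>)" and pn: "is_nat_trans C A (Pf F) (Pf G) \<pi>" by (rule Fun_arrow_cases[OF PAt])
  have pi: "\<pi> c = coprod_map A (into c) (\<lambda>f. fob F (Dom C f)) (\<lambda>f. fob G (Dom C f)) (\<lambda>f. \<tau> (Dom C f))" if "c \<in> Obj C" for c
    using PA' that by (auto simp: Pf_map_def)
  have LP: "far L (Pf_map (F, G, \<tau>)) \<in> Arr A" "Dom A (far L (Pf_map (F, G, \<tau>))) = fob L (Pf F)" "Cod A (far L (Pf_map (F, G, \<tau>))) = fob L (Pf G)"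
    using functorD(2-4)[OF Lf, of "Pf_map (F, G, \<tau>)"] pn PA' by simp_all
  have sq: "Cmp A Em (\<theta> F) = Cmp A (\<theta> G) (far L (Pf_map (F, G, \<tau>)))"
  proof (rule colim_ext[OF Pf_functor[OF F]])
    fix c assume c: "c \<in> Obj C"
    note p = Pf_map_comp[OF t c, folded pi[OF c]]
    have "Cmp A Em (\<mu> F c) = Cmp A (\<mu> G c) (\<pi> c)"
    proof (rule free_ext[OF F, of _ _ c])
      fix f assume f: "f \<in> Arr C" "Cod C f = c"
      show "Cmp A (Cmp A Em (\<mu> F c)) (free_in F f) = Cmp A (Cmp A (\<mu> G c) (\<pi> c)) (free_in F f)"
        using Em(1-3) Em4[of "Dom C f"] mu(1-3)[OF F] mu(1-3)[OF G] mu(4)[OF F f] Cmp_eq_extend[OF mu(4)[OF G f], of "\<tau> (Dom C f)"]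
          p(1-3) p(4)[OF f] free_in[OF F] free_in[OF G] nat_transD(3-5)[OF t] f by simp
    qed (use Em mu[OF F] mu[OF G] p in simp_all)
    moreover have "Cmp A (\<theta> G) (Cmp A (far L (Pf_map (F, G, \<tau>))) (\<eta> (Pf F) c)) = Cmp A (\<mu> G c) (\<pi> c)"
      using nat[OF pn c] PA' Cmp_eq_extend[OF th(4)[OF G c], of "\<pi> c"] th(1-3)[OF G] e[OF Pf_functor[OF G] c] p(1-3) c by simp
    ultimately show "Cmp A (Cmp A Em (\<theta> F)) (\<eta> (Pf F) c) = Cmp A (Cmp A (\<theta> G) (far L (Pf_map (F, G, \<tau>)))) (\<eta> (Pf F) c)"
      using Em(1-3) th(1-3)[OF F] th(1-3)[OF G] th(4)[OF F c] LP e[OF Pf_functor[OF F] c] c by simp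
  qed (use Em th(1-3)[OF F] th(1-3)[OF G] LP in simp_all)
  have "is_zero A (Cmp A (\<theta> G) (Cmp A (far L (Pf_map (F, G, \<tau>))) x))"
    by (rule is_zero_Cmp_right[OF z]) (use th(1-3)[OF G] LP x in simp_all)
  then have "is_zero A (Cmp A Em (Cmp A (\<theta> F) x))"
    using Cmp_eq_extend[OF sq, of x] Em(1-3) th(1-3)[OF F] th(1-3)[OF G] LP x by simp
  then have "is_zero A (Cmp A (\<theta> F) x)"
    using mono_zero[OF Emm, of "Cmp A (\<theta> F) x"] Em(1-3) th(1-3)[OF F] x by simp
  then have "is_zero A (Cmp A \<omega> (Cmp A (\<theta> F) x))"
    by (rule is_zero_Cmp_right) (use om(1-3) th(1-3)[OF F] x in simp_all)
  then show ?thesis unfolding fact using om(1-3) th(1-3)[OF F] x by simp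
qed

lemma category_Fun: "category (Fun C A)"
proof
  fix f assume "f \<in> Arr (Fun C A)"
  then show "Dom (Fun C A) f \<in> Obj (Fun C A)" "Cod (Fun C A) f \<in> Obj (Fun C A)"
    by (cases f; simp add: nat_transD(1,2))+
next
  fix F assume "F \<in> Obj (Fun C A)"
  then show "Ide (Fun C A) F \<in> Hom (Fun C A) F F" using Ide_nat_trans by (simp add: Hom_iff)
next
  fix f g F G H assume f: "f \<in> Hom (Fun C A) F G" and g: "g \<in> Hom (Fun C A) G H"
  show "Cmp (Fun C A) g f \<in> Hom (Fun C A) F H"
    by (rule Fun_arrow_cases[OF f], rule Fun_arrow_cases[OF g]) (simp add: Hom_iff Cmp_nat_trans)
next
  fix f F G assume f: "f \<in> Hom (Fun C A) F G"
  obtain \<tau> where f': "f = (F, G, \<tau>)" and t: "is_nat_trans C A F G \<tau>" by (rule Fun_arrow_cases[OF f])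
  show "Cmp (Fun C A) f (Ide (Fun C A) F) = f" "Cmp (Fun C A) (Ide (Fun C A) G) f = f"
    using nat_transD(3-5)[OF t] extensional_restrict[OF nat_transD(7)[OF t]] unfolding f' by (simp_all cong: restrict_cong)
next
  fix f g h F G H K assume f: "f \<in> Hom (Fun C A) F G" and g: "g \<in> Hom (Fun C A) G H" and h: "h \<in> Hom (Fun C A) H K"
  obtain \<tau> where f': "f = (F, G, \<tau>)" and t: "is_nat_trans C A F G \<tau>" by (rule Fun_arrow_cases[OF f])
  obtain \<sigma> where g': "g = (G, H, \<sigma>)" and u: "is_nat_trans C A G H \<sigma>" by (rule Fun_arrow_cases[OF g])
  obtain \<rho> where h': "h = (H, K, \<rho>)" and v: "is_nat_trans C A H K \<rho>" by (rule Fun_arrow_cases[OF h])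
  show "Cmp (Fun C A) h (Cmp (Fun C A) g f) = Cmp (Fun C A) (Cmp (Fun C A) h g) f"
    unfolding f' g' h' using nat_transD(3-5)[OF t] nat_transD(3-5)[OF u] nat_transD(3-5)[OF v] by (simp cong: restrict_cong)
qed

lemma short_exact_Arr: "short_exact B f g \<Longrightarrow> f \<in> Arr B \<and> g \<in> Arr B \<and> Cod B f = Dom B g"
  by (simp add: short_exact_def is_kernel_def)

section \<open>Satellites vanish on the effacement\<close>

lemma satellites_Pf_zero:
  assumes L: "is_colimit_functor C A L" and sat: "are_left_satellites (Fun C A) A L T \<delta>"
    and F: "is_functor C A F" and n: "n > 0"
  shows "is_zero A (Ide A (fob (T n) (Pf F)))"
proof -
  interpret B: category "Fun C A" by (rule category_Fun)
  let ?B = "Fun C A"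
  \<comment> \<open>Arrows of the functor category stay opaque here: the argument uses the category
    laws, not components.\<close>
  note [simp del] = Fun_simps
  have d: "is_homological_delta_functor ?B A T \<delta>" and T0: "T 0 = L"
    using sat by (simp_all add: are_left_satellites_def is_universal_delta_functor_def)
  note D = delta_functorD[OF d]
  note Tn = functorD[OF D(1)]
  define TP where "TP n = \<lparr>fob = \<lambda>F\<in>Obj ?B. fob (T n) (Pf F), far = \<lambda>u\<in>Arr ?B. far (T n) (Pf_map u)\<rparr>" for n
  define dP where "dP n f g = \<delta> n (Pf_map f) (Pf_map g)" for n f g
  define epsA where "epsA F = (Pf F, F, eps F)" for F
  have PO: "Pf F \<in> Obj ?B" if "F \<in> Obj ?B" for F using Pf_functor that by (simp add: Fun_simps)
  have PH: "Pf_map u \<in> Arr ?B" "Dom ?B (Pf_map u) = Pf (Dom ?B u)" "Cod ?B (Pf_map u) = Pf (Cod ?B u)" if "u \<in> Arr ?B" for u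
    using Pf_map_Hom[of u "Dom ?B u" "Cod ?B u"] that by (simp_all add: Hom_iff)
  have eH: "epsA F \<in> Arr ?B" "Dom ?B (epsA F) = Pf F" "Cod ?B (epsA F) = F" if "F \<in> Obj ?B" for F
    using eps_nat_trans[of F] that by (simp_all add: Fun_simps epsA_def)
  have PC: "Pf_map (Cmp ?B v u) = Cmp ?B (Pf_map v) (Pf_map u)" if "u \<in> Arr ?B" "v \<in> Arr ?B" "Cod ?B u = Dom ?B v" for u v
    by (rule Pf_map_Cmp[of u "Dom ?B u" "Cod ?B u" v "Cod ?B v"]) (use that in \<open>simp_all add: Hom_iff\<close>)
  have PI: "Pf_map (Ide ?B F) = Ide ?B (Pf F)" if "F \<in> Obj ?B" for F using Pf_map_Ide that by (simp add: Fun_simps(1))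
  have en: "Cmp ?B u (epsA (Dom ?B u)) = Cmp ?B (epsA (Cod ?B u)) (Pf_map u)" if "u \<in> Arr ?B" for u
    using eps_natural[of u "Dom ?B u" "Cod ?B u"] that by (simp add: Hom_iff epsA_def)
  have TPf: "is_functor ?B A (TP n)" for n
    by (rule is_functorI) (simp_all add: TP_def PO PH PC PI Tn)
  have TPfar: "far (TP n) u = far (T n) (Pf_map u)" if "u \<in> Arr ?B" for n u using that by (simp add: TP_def)
  have TPfob: "fob (TP n) F = fob (T n) (Pf F)" if "F \<in> Obj ?B" for n F using that by (simp add: TP_def)
  have sA: "f \<in> Arr ?B" "g \<in> Arr ?B" "Cod ?B f = Dom ?B g" if "short_exact ?B f g" for f g using short_exact_Arr[OF that] by auto
  \<comment> \<open>Exactness of \<open>Pf\<close> turns a short exact sequence into another one,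
    whose connecting morphisms serve for the composite.\<close>
  have TPd: "is_homological_delta_functor ?B A TP dP"
    unfolding is_homological_delta_functor_def
  proof (intro conjI allI impI)
    fix n show "is_functor ?B A (TP n)" by (rule TPf)
    show "is_additive ?B A (TP n)"
      unfolding is_additive_def
    proof (intro ballI impI)
      fix f g assume f: "f \<in> Arr ?B" "g \<in> Arr ?B" "Dom ?B f = Dom ?B g \<and> Cod ?B f = Cod ?B g"
      then have h: "f \<in> Hom ?B (Dom ?B g) (Cod ?B g)" "g \<in> Hom ?B (Dom ?B g) (Cod ?B g)" by (simp_all add: Hom_iff)
      have "Add ?B f g \<in> Arr ?B" by (rule Fun_Add_Arr[OF h])
      then show "far (TP n) (Add ?B f g) = Add A (far (TP n) f) (far (TP n) g)"
        using D(2)[of n] f Pf_map_Add[OF h] by (simp add: TPfar is_additive_def PH)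
    qed
  next
    fix n f g assume s: "short_exact ?B f g"
    note s' = sA[OF s]
    show "dP n f g \<in> Hom A (fob (TP (Suc n)) (Cod ?B g)) (fob (TP n) (Dom ?B f))"
      using D(3)[OF Pf_map_short_exact[OF s], of n] s' by (simp add: dP_def PH TPfob)
  next
    fix n f g f' g' u v w
    assume "short_exact ?B f g \<and> short_exact ?B f' g' \<and> u \<in> Hom ?B (Dom ?B f) (Dom ?B f') \<and>
       v \<in> Hom ?B (Cod ?B f) (Cod ?B f') \<and> w \<in> Hom ?B (Cod ?B g) (Cod ?B g') \<and>
       Cmp ?B v f = Cmp ?B f' u \<and> Cmp ?B w g = Cmp ?B g' v"
    then have h: "short_exact ?B f g" "short_exact ?B f' g'" "u \<in> Hom ?B (Dom ?B f) (Dom ?B f')"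
       "v \<in> Hom ?B (Cod ?B f) (Cod ?B f')" "w \<in> Hom ?B (Cod ?B g) (Cod ?B g')"
       "Cmp ?B v f = Cmp ?B f' u" "Cmp ?B w g = Cmp ?B g' v" by simp_all
    note a = sA[OF h(1)] sA[OF h(2)]
    have a': "u \<in> Arr ?B" "Dom ?B u = Dom ?B f" "Cod ?B u = Dom ?B f'" "v \<in> Arr ?B" "Dom ?B v = Cod ?B f" "Cod ?B v = Cod ?B f'"
      "w \<in> Arr ?B" "Dom ?B w = Cod ?B g" "Cod ?B w = Cod ?B g'" using h by (simp_all add: Hom_iff)
    have "Cmp ?B (Pf_map v) (Pf_map f) = Cmp ?B (Pf_map f') (Pf_map u)"
      using a a' h(6) by (simp flip: PC)
    moreover have "Cmp ?B (Pf_map w) (Pf_map g) = Cmp ?B (Pf_map g') (Pf_map v)"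
      using a a' h(7) by (simp flip: PC)
    ultimately show "Cmp A (far (TP n) u) (dP n f g) = Cmp A (dP n f' g') (far (TP (Suc n)) w)"
      using D(4)[OF Pf_map_short_exact[OF h(1)] Pf_map_short_exact[OF h(2)], of "Pf_map u" "Pf_map v" "Pf_map w" n] a a'
      by (simp add: dP_def TPfar Hom_iff PH)
  next
    fix f g n assume s: "short_exact ?B f g"
    note s' = sA[OF s] and P = Pf_map_short_exact[OF s]
    show "exact_at A (far (TP n) f) (far (TP n) g)" "exact_at A (far (TP (Suc n)) g) (dP n f g)"
      "exact_at A (dP n f g) (far (TP n) f)" "is_epi A (far (TP 0) g)"
      using D(5-8)[OF P] s' by (simp_all add: TPfar dP_def)
  qed
  define \<phi> where "\<phi> n = (\<lambda>F\<in>Obj ?B. far (T n) (epsA F))" for n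
  define \<psi> where "\<psi> n = (if n = 0 then \<phi> 0 else (\<lambda>F\<in>Obj ?B. Zer A (fob (TP n) F) (fob (T n) F)))" for n
  have TO: "fob (T n) F \<in> Obj A" if "F \<in> Obj ?B" for n F using Tn(1)[OF that] .
  have eA: "far (T n) (epsA F) \<in> Arr A" "Dom A (far (T n) (epsA F)) = fob (T n) (Pf F)" "Cod A (far (T n) (epsA F)) = fob (T n) F"
    if "F \<in> Obj ?B" for n F using Tn(2-4)[OF eH(1)[OF that]] eH[OF that] by simp_all
  have phi_nat: "is_nat_trans ?B A (TP n) (T n) (\<phi> n)" for n
  proof (rule is_nat_transI[OF TPf D(1)])
    fix u assume u: "u \<in> Arr ?B"
    have "far (T n) (Cmp ?B u (epsA (Dom ?B u))) = far (T n) (Cmp ?B (epsA (Cod ?B u)) (Pf_map u))" using en[OF u] by simp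
    then show "Cmp A (far (T n) u) (\<phi> n (Dom ?B u)) = Cmp A (\<phi> n (Cod ?B u)) (far (TP n) u)"
      using u by (simp add: \<phi>_def TPfar Tn(6) eH PH)
  qed (simp_all add: \<phi>_def eA TPfob)
  have psi_nat: "is_nat_trans ?B A (TP n) (T n) (\<psi> n)" for n
  proof (cases "n = 0")
    case False
    show ?thesis
    proof (rule is_nat_transI[OF TPf D(1)])
      fix u assume u: "u \<in> Arr ?B"
      show "Cmp A (far (T n) u) (\<psi> n (Dom ?B u)) = Cmp A (\<psi> n (Cod ?B u)) (far (TP n) u)"
        using False u by (simp add: \<psi>_def Tn TPfar TPfob PH PO TO)
    qed (use False in \<open>simp_all add: \<psi>_def TPfob TO PO\<close>)
  qed (use phi_nat in \<open>simp add: \<psi>_def\<close>)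
  have phi_delta: "is_delta_morphism ?B A TP dP T \<delta> \<phi>"
    unfolding is_delta_morphism_def
  proof (intro conjI allI impI phi_nat)
    fix n f g assume s: "short_exact ?B f g"
    note s' = sA[OF s]
    have "Cmp A (far (T n) (epsA (Dom ?B f))) (\<delta> n (Pf_map f) (Pf_map g)) = Cmp A (\<delta> n f g) (far (T (Suc n)) (epsA (Cod ?B g)))"
      by (rule D(4)[OF Pf_map_short_exact[OF s] s, of _ "epsA (Cod ?B f)"])
         (use en[OF s'(1)] en[OF s'(2)] s' in \<open>simp_all add: Hom_iff eH PH\<close>)
    then show "Cmp A (\<delta> n f g) (\<phi> (Suc n) (Cod ?B g)) = Cmp A (\<phi> n (Dom ?B f)) (dP n f g)"
      using s' by (simp add: \<phi>_def dP_def)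
  qed
  have psi_delta: "is_delta_morphism ?B A TP dP T \<delta> \<psi>"
    unfolding is_delta_morphism_def
  proof (intro conjI allI impI psi_nat)
    fix n f g assume s: "short_exact ?B f g"
    note s' = sA[OF s] and P = Pf_map_short_exact[OF s]
    have dd: "\<delta> n f g \<in> Arr A" "Dom A (\<delta> n f g) = fob (T (Suc n)) (Cod ?B g)" "Cod A (\<delta> n f g) = fob (T n) (Dom ?B f)"
      using D(3)[OF s] by (simp_all add: Hom_iff)
    have dd': "dP n f g \<in> Arr A" "Dom A (dP n f g) = fob (T (Suc n)) (Pf (Cod ?B g))" "Cod A (dP n f g) = fob (T n) (Pf (Dom ?B f))"
      using D(3)[OF P] s' by (simp_all add: Hom_iff dP_def PH)
    have z1: "Cmp A (\<delta> n f g) (\<psi> (Suc n) (Cod ?B g)) = Zer A (fob (T (Suc n)) (Pf (Cod ?B g))) (fob (T n) (Dom ?B f))"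
      using s' dd by (simp add: \<psi>_def TPfob TO PO)
    have "Cmp A (\<psi> n (Dom ?B f)) (dP n f g) = Zer A (fob (T (Suc n)) (Pf (Cod ?B g))) (fob (T n) (Dom ?B f))"
    proof (cases "n = 0")
      \<comment> \<open>In degree 0 the family \<open>\<psi>\<close> is not zero but the arrow
        L(\<open>eps\<close>). The connecting morphism into degree 0 of the sequence after
        \<open>Pf\<close> is killed by L of its first arrow, by exactness, and this is what
        \<open>colimit_eps_zero\<close> requires.\<close>
      case True
      obtain F' G' H' f1 g1 where fg: "f = (F', G', f1)" "g = (G', H', g1)" "is_nat_trans C A F' G' f1" "is_nat_trans C A G' H' g1"
        and se: "\<And>c. c \<in> Obj C \<Longrightarrow> short_exact A (f1 c) (g1 c)" using Fun_short_exactD[OF s] by metis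
      have "is_zero A (Cmp A (far (T 0) (Pf_map f)) (\<delta> 0 (Pf_map f) (Pf_map g)))"
        using exact_at_pair[OF D(7)[OF P, of 0]] by (simp add: exact_pair_def)
      then have "is_zero A (Cmp A (far L (Pf_map (F', G', f1))) (dP 0 f g))" using fg T0 by (simp add: dP_def)
      moreover have Df: "Dom ?B f = F'" using fg by (simp add: Fun_simps)
      ultimately have "is_zero A (Cmp A (far L (Pf F', F', eps F')) (dP 0 f g))"
        by (intro colimit_eps_zero[OF L fg(3)])
           (use se kernelD(5) dd' True T0 in \<open>auto simp: short_exact_def\<close>)
      then show ?thesis
        using True T0 s' Df dd' eA[of F' 0] B.Obj_Dom[OF s'(1)] by (simp add: \<psi>_def \<phi>_def epsA_def is_zero_def)
    next
      case False
      then show ?thesis using s' dd' by (simp add: \<psi>_def TPfob TO PO)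
    qed
    then show "Cmp A (\<delta> n f g) (\<psi> (Suc n) (Cod ?B g)) = Cmp A (\<psi> n (Dom ?B f)) (dP n f g)" using z1 by simp
  qed
  have univ: "\<forall>S \<delta>S \<psi>. is_homological_delta_functor ?B A S \<delta>S \<and> is_nat_trans ?B A (S 0) (T 0) \<psi> \<longrightarrow>
        (\<exists>!\<phi>. is_delta_morphism ?B A S \<delta>S T \<delta> \<phi> \<and> \<phi> 0 = \<psi>)"
    using sat unfolding are_left_satellites_def is_universal_delta_functor_def by (elim conjE)
  have "\<exists>!\<chi>. is_delta_morphism ?B A TP dP T \<delta> \<chi> \<and> \<chi> 0 = \<phi> 0"
    using univ[THEN spec[of _ TP], THEN spec[of _ dP], THEN spec[of _ "\<phi> 0"]] TPd phi_nat by (elim mp) (rule conjI)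
  then have "\<psi> = \<phi>"
    by (rule Ex1_unique) (simp_all add: phi_delta psi_delta \<psi>_def)
  then have "\<phi> n (Pf F) = \<psi> n (Pf F)" by simp
  moreover have FO: "Pf F \<in> Obj ?B" using Pf_functor[OF F] by (simp add: Fun_simps)
  ultimately have "\<phi> n (Pf F) = Zer A (fob (T n) (Pf (Pf F))) (fob (T n) (Pf F))"
    using n FO by (simp add: \<psi>_def TPfob)
  then have z: "is_zero A (far (T n) (epsA (Pf F)))"
    using FO TO[OF FO] TO[OF PO[OF FO]] by (simp add: \<phi>_def)
  \<comment> \<open>\<open>T n\<close> sends the counit at \<open>Pf F\<close> to zero, yet composed
    with the image of a section it gives an identity; so that identity is zero.\<close>
  obtain \<sigma> where sg: "is_nat_trans C A (Pf F) (Pf (Pf F)) \<sigma>"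
    "Cmp ?B (Pf (Pf F), Pf F, eps (Pf F)) (Pf F, Pf (Pf F), \<sigma>) = Ide ?B (Pf F)" by (rule eps_split[OF F])
  have sgA: "(Pf F, Pf (Pf F), \<sigma>) \<in> Arr ?B" "Dom ?B (Pf F, Pf (Pf F), \<sigma>) = Pf F" "Cod ?B (Pf F, Pf (Pf F), \<sigma>) = Pf (Pf F)"
    using sg by (simp_all add: Fun_simps)
  have "is_zero A (Cmp A (far (T n) (epsA (Pf F))) (far (T n) (Pf F, Pf (Pf F), \<sigma>)))"
    by (rule is_zero_Cmp_left[OF z]) (use Tn(2-4)[OF sgA(1)] eA[OF FO] sgA in simp_all)
  moreover have "Cmp A (far (T n) (epsA (Pf F))) (far (T n) (Pf F, Pf (Pf F), \<sigma>)) = Ide A (fob (T n) (Pf F))"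
    using Tn(6)[OF sgA(1) eH(1)[OF FO], of n] sgA eH[OF FO] sg(2) Tn(5)[OF FO, of n] by (simp add: epsA_def)
  ultimately show ?thesis by simp
qed

section \<open>Dimension shifting for the satellites\<close>

lemma zero_object_is_zero:
  assumes "is_zero A (Ide A a)" "a \<in> Obj A" "x \<in> Arr A" "Dom A x = a \<or> Cod A x = a"
  shows "is_zero A x"
  using assms(4)
proof
  assume "Dom A x = a"
  then show ?thesis using is_zero_Cmp_right[OF assms(1), of x] assms by simp
next
  assume "Cod A x = a"
  then show ?thesis using is_zero_Cmp_left[OF assms(1), of x] assms by simp
qed

text \<open>Vanishing on \<open>Pf F\<close> in degree n + 1 makes the connecting morphism monic,
  and exactness at its target then makes it the kernel of the arrow induced by
  \<open>\<iota>\<close>. The case n = 0 is included; it links the first satellite to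
  colimits.\<close>

lemma satellite_kernel:
  assumes L: "is_colimit_functor C A L" and sat: "are_left_satellites (Fun C A) A L T \<delta>"
    and F: "is_functor C A F" and k: "is_nat_trans C A K (Pf F) \<iota>" and ker: "\<And>c. c \<in> Obj C \<Longrightarrow> is_kernel A (eps F c) (\<iota> c)"
  shows "short_exact (Fun C A) (K, Pf F, \<iota>) (Pf F, F, eps F)"
    "\<exists>d. is_kernel A (far (T n) (K, Pf F, \<iota>)) d \<and> Dom A d = fob (T (Suc n)) F"
proof -
  let ?f = "(K, Pf F, \<iota>)" and ?g = "(Pf F, F, eps F)"
  have d: "is_homological_delta_functor (Fun C A) A T \<delta>"
    using sat by (simp_all add: are_left_satellites_def is_universal_delta_functor_def)
  note D = delta_functorD[OF d]
  have e: "is_nat_trans C A (Pf F) F (eps F)" by (rule eps_nat_trans[OF F])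
  show s: "short_exact (Fun C A) ?f ?g"
    by (rule Fun_short_exactI[OF k e]) (use ker epi_cokernel_of_kernel[OF eps_epi[OF F]] in \<open>simp add: short_exact_def\<close>)
  note x1 = exact_at_pair[OF D(6)[OF s, of n]] and x2 = exact_at_pair[OF D(7)[OF s, of n]]
  have dl: "\<delta> n ?f ?g \<in> Arr A" "Dom A (\<delta> n ?f ?g) = fob (T (Suc n)) F" using D(3)[OF s, of n] by (simp_all add: Hom_iff)
  have z: "is_zero A (Ide A (fob (T (Suc n)) (Pf F)))" by (rule satellites_Pf_zero[OF L sat F]) simp
  have PO: "fob (T (Suc n)) (Pf F) \<in> Obj A" using functorD(1)[OF D(1)] Pf_functor[OF F] by simp
  have Tg: "far (T (Suc n)) ?g \<in> Arr A" "Dom A (far (T (Suc n)) ?g) = fob (T (Suc n)) (Pf F)" "Cod A (far (T (Suc n)) ?g) = fob (T (Suc n)) F"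
    using functorD(2-4)[OF D(1), of ?g] e by simp_all
  have "is_mono A (\<delta> n ?f ?g)"
  proof (rule monoI[OF dl(1)])
    fix x assume x: "x \<in> Arr A" "Cod A x = Dom A (\<delta> n ?f ?g)" "is_zero A (Cmp A (\<delta> n ?f ?g) x)"
    then have "in_image A (far (T (Suc n)) ?g) x" using x1 by (simp add: exact_pair_def)
    then obtain p y where p: "is_epi A p" "p \<in> Arr A" "Cod A p = Dom A x" "y \<in> Arr A" "Dom A y = Dom A p"
      "Cod A y = Dom A (far (T (Suc n)) ?g)" "Cmp A (far (T (Suc n)) ?g) y = Cmp A x p" by (rule in_imageE)
    have "is_zero A y" by (rule zero_object_is_zero[OF z PO p(4)]) (use p Tg in simp)
    then have "is_zero A (Cmp A (far (T (Suc n)) ?g) y)" by (rule is_zero_Cmp_right) (use p Tg in simp_all)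
    then show "is_zero A x" using p epi_zero[OF p(1), of x] x by simp
  qed
  then have "is_kernel A (far (T n) ?f) (\<delta> n ?f ?g)" by (rule exact_mono_kernel[OF x2])
  then show "\<exists>d. is_kernel A (far (T n) ?f) d \<and> Dom A d = fob (T (Suc n)) F" using dl by blast
qed

text \<open>For n > 0 the target of the arrow induced by \<open>\<iota>\<close> vanishes as well, so
  the kernel is the whole of \<open>T n K\<close>.\<close>

lemma satellite_shift:
  assumes L: "is_colimit_functor C A L" and sat: "are_left_satellites (Fun C A) A L T \<delta>"
    and F: "is_functor C A F" and k: "is_nat_trans C A K (Pf F) \<iota>" and ker: "\<And>c. c \<in> Obj C \<Longrightarrow> is_kernel A (eps F c) (\<iota> c)"
    and n: "n > 0"
  shows "isomorphic A (fob (T (Suc n)) F) (fob (T n) K)"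
proof -
  have d: "is_homological_delta_functor (Fun C A) A T \<delta>"
    using sat by (simp_all add: are_left_satellites_def is_universal_delta_functor_def)
  note Tn = functorD[OF delta_functorD(1)[OF d, of n]]
  obtain e where e: "is_kernel A (far (T n) (K, Pf F, \<iota>)) e" "Dom A e = fob (T (Suc n)) F"
    using satellite_kernel(2)[OF L sat F k ker] by metis
  have z: "is_zero A (Ide A (fob (T n) (Pf F)))" by (rule satellites_Pf_zero[OF L sat F n])
  have PO: "fob (T n) (Pf F) \<in> Obj A" "fob (T n) K \<in> Obj A" using Tn(1) Pf_functor[OF F] nat_transD(1)[OF k] by simp_all
  have a: "far (T n) (K, Pf F, \<iota>) \<in> Arr A" "Dom A (far (T n) (K, Pf F, \<iota>)) = fob (T n) K" "Cod A (far (T n) (K, Pf F, \<iota>)) = fob (T n) (Pf F)"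
    using Tn(2-4)[of "(K, Pf F, \<iota>)"] k by simp_all
  have az: "is_zero A (far (T n) (K, Pf F, \<iota>))" by (rule zero_object_is_zero[OF z PO(1) a(1)]) (simp add: a)
  have "is_kernel A (far (T n) (K, Pf F, \<iota>)) (Ide A (fob (T n) K))"
  proof (rule kernelI)
    show "is_mono A (Ide A (fob (T n) K))" by (rule monoI) (use PO in simp_all)
    fix h assume h: "h \<in> Arr A" "Cod A h = Dom A (far (T n) (K, Pf F, \<iota>))"
    show "\<exists>u. u \<in> Arr A \<and> Dom A u = Dom A h \<and> Cod A u = Dom A (Ide A (fob (T n) K)) \<and> Cmp A (Ide A (fob (T n) K)) u = h"
      by (rule exI[of _ h]) (use h a PO in simp)
  qed (use a az PO in simp_all)
  from kernel_iso[OF e(1) this] show ?thesis using e(2) PO by simp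
qed

end

section \<open>Structure of the cube category\<close>

lemma cube_iff [simp]: "xs \<in> cube n \<longleftrightarrow> length xs = n"
  by (simp add: cube_def)

text \<open>Restriction to the cube makes any function on lists a legitimate representative; two of
  them give the same map as soon as they agree on lists of length m.\<close>

definition cmap :: "nat \<Rightarrow> nat \<Rightarrow> (bool list \<Rightarrow> bool list) \<Rightarrow> cube_map" where
  "cmap m n f = (m, n, restrict f (cube m))"

lemma cmap_simps [simp]: "fst (cmap m n f) = m" "fst (snd (cmap m n f)) = n"
  by (simp_all add: cmap_def)

lemma cmap_eq_iff: "cmap m n f = cmap m' n' g \<longleftrightarrow> m = m' \<and> n = n' \<and> (\<forall>xs. length xs = m \<longrightarrow> f xs = g xs)"
  by (auto simp: cmap_def fun_eq_iff restrict_def)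

lemma cmap_cong: "(\<And>xs. length xs = m \<Longrightarrow> f xs = g xs) \<Longrightarrow> cmap m n f = cmap m n g"
  by (simp add: cmap_eq_iff)

lemma cube_comp_cmap:
  "(\<And>xs. length xs = l \<Longrightarrow> length (f xs) = m) \<Longrightarrow> cube_comp (cmap m n g) (cmap l m f) = cmap l n (\<lambda>xs. g (f xs))"
  by (auto simp: cmap_def cube_comp_def compose_def fun_eq_iff restrict_def)

text \<open>Positions count from 0, whereas \<open>face\<close> and \<open>degen\<close> count
  coordinates from 1.\<close>

definition ins :: "nat \<Rightarrow> 'a \<Rightarrow> 'a list \<Rightarrow> 'a list" where
  "ins j b xs = take j xs @ b # drop j xs"

definition del :: "nat \<Rightarrow> 'a list \<Rightarrow> 'a list" where
  "del j xs = take j xs @ drop (Suc j) xs"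

lemma length_ins [simp]: "length (ins j b xs) = Suc (length xs)"
  by (simp add: ins_def)

lemma length_del [simp]: "j < length xs \<Longrightarrow> length (del j xs) = length xs - 1"
  by (simp add: del_def)

lemma nth_ins: "j \<le> length xs \<Longrightarrow> p \<le> length xs \<Longrightarrow>
    ins j b xs ! p = (if p < j then xs ! p else if p = j then b else xs ! (p - 1))"
  by (auto simp: ins_def nth_append nth_Cons' min_def)

lemma nth_del: "j < length xs \<Longrightarrow> p < length xs - 1 \<Longrightarrow> del j xs ! p = (if p < j then xs ! p else xs ! Suc p)"
  by (auto simp: del_def nth_append min_def)

lemma ins_0 [simp]: "ins 0 b xs = b # xs"
  by (simp add: ins_def)

lemma ins_Suc_Cons [simp]: "ins (Suc j) b (x # xs) = x # ins j b xs"
  by (simp add: ins_def)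

lemma del_0 [simp]: "del 0 xs = tl xs"
  by (simp add: del_def drop_Suc)

lemma del_Suc_Cons [simp]: "del (Suc j) (x # xs) = x # del j xs"
  by (simp add: del_def)

text \<open>The cubical identity between two faces, from which d d = 0 will follow.\<close>

lemma ins_ins: "j \<le> i \<Longrightarrow> i \<le> length xs \<Longrightarrow> ins j b (ins i c xs) = ins (Suc i) c (ins j b xs)"
  by (rule nth_equalityI) (auto simp: nth_ins)

lemma ins_update:
  "i < j \<Longrightarrow> j \<le> length xs \<Longrightarrow> (ins j b xs)[i := c] = ins j b (xs[i := c])"
  "j \<le> length xs \<Longrightarrow> (ins j b xs)[j := c] = ins j c xs"
  "j < i \<Longrightarrow> i \<le> length xs \<Longrightarrow> (ins j b xs)[i := c] = ins j b (xs[i - 1 := c])"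
  by (rule nth_equalityI; auto simp: nth_ins nth_list_update)+

lemma ins_del: "j < length xs \<Longrightarrow> ins j b (del j xs) = xs[j := b]"
  by (rule nth_equalityI) (auto simp: nth_ins nth_del nth_list_update)

lemma del_update: "j < length xs \<Longrightarrow> del j (xs[j := b]) = del j xs"
  by (rule nth_equalityI) (auto simp: nth_del nth_list_update)

lemma face_cmap: "face k i b = cmap (k - 1) k (ins (i - 1) b)"
  by (simp add: face_def cmap_def ins_def[abs_def])

lemma degen_cmap: "1 \<le> i \<Longrightarrow> degen k i = cmap k (k - 1) (del (i - 1))"
  by (simp add: degen_def cmap_def del_def[abs_def])

lemma cube_id_cmap: "cube_id n = cmap n n (\<lambda>xs. xs)"
  by (simp add: cube_id_def cmap_def)

text \<open>Every coordinate of a cube map is constant or a variable, and the variables occur in increasing order.\<close>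

inductive cubical :: "nat \<Rightarrow> nat \<Rightarrow> (bool list \<Rightarrow> bool list) \<Rightarrow> bool" where
  nil: "cubical 0 0 (\<lambda>xs. [])"
| drop: "cubical m n f \<Longrightarrow> cubical (Suc m) n (\<lambda>xs. f (tl xs))"
| const: "cubical m n f \<Longrightarrow> cubical m (Suc n) (\<lambda>xs. b # f xs)"
| var: "cubical m n f \<Longrightarrow> cubical (Suc m) (Suc n) (\<lambda>xs. hd xs # f (tl xs))"

lemma length_cubical: "cubical m n f \<Longrightarrow> length xs = m \<Longrightarrow> length (f xs) = n"
  by (induction arbitrary: xs rule: cubical.induct) auto

text \<open>Here the outer map reads the first coordinate delivered by g. The induction runs over g,
  since that coordinate may be a constant, the first variable, or a variable reached after dropping
  some.\<close>

lemma cubical_comp_var: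
  assumes "cubical l m' g" "m' = Suc m"
    and f: "\<And>l g. cubical l m g \<Longrightarrow> \<exists>h. cubical l n h \<and> (\<forall>xs. length xs = l \<longrightarrow> h xs = f (g xs))"
  shows "\<exists>h. cubical l (Suc n) h \<and> (\<forall>xs. length xs = l \<longrightarrow> h xs = hd (g xs) # f (tl (g xs)))"
  using assms(1,2)
proof (induction rule: cubical.induct)
  case (drop l m' g)
  then obtain h where "cubical l (Suc n) h" "\<forall>xs. length xs = l \<longrightarrow> h xs = hd (g xs) # f (tl (g xs))" by auto
  then show ?case by (intro exI[of _ "\<lambda>xs. h (tl xs)"]) (auto intro: cubical.drop)
next
  case (const l m' g b)
  then obtain h where "cubical l n h" "\<forall>xs. length xs = l \<longrightarrow> h xs = f (g xs)" using f[of l g] by auto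
  then show ?case by (intro exI[of _ "\<lambda>xs. b # h xs"]) (auto intro: cubical.const)
next
  case (var l m' g)
  then obtain h where "cubical l n h" "\<forall>xs. length xs = l \<longrightarrow> h xs = f (g xs)" using f[of l g] by auto
  then show ?case by (intro exI[of _ "\<lambda>xs. hd xs # h (tl xs)"]) (auto intro: cubical.var)
qed simp

lemma cubical_tl:
  assumes "cubical l m' g" "m' = Suc m"
  shows "\<exists>h. cubical l m h \<and> (\<forall>xs. length xs = l \<longrightarrow> h xs = tl (g xs))"
  using assms
proof (induction rule: cubical.induct)
  case (drop l m' g)
  then obtain h where "cubical l m h" "\<forall>xs. length xs = l \<longrightarrow> h xs = tl (g xs)" by auto
  then show ?case by (intro exI[of _ "\<lambda>xs. h (tl xs)"]) (auto intro: cubical.drop)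
next
  case (const l m' g b)
  then show ?case by (intro exI[of _ g]) auto
next
  case (var l m' g)
  then show ?case by (intro exI[of _ "\<lambda>xs. g (tl xs)"]) (auto intro: cubical.drop)
qed simp

text \<open>The composite is described only by its values on lists of length l, because
  \<open>cubical\<close> constrains a function on all lists.\<close>

lemma cubical_comp:
  assumes "cubical m n f" "cubical l m g"
  shows "\<exists>h. cubical l n h \<and> (\<forall>xs. length xs = l \<longrightarrow> h xs = f (g xs))"
  using assms
proof (induction arbitrary: l g rule: cubical.induct)
  case nil
  have "cubical l m (\<lambda>xs. []) \<and> m = 0" if "cubical l m g" "m = 0" for m
    using that
  proof (induction rule: cubical.induct)
    case nil show ?case by (simp add: cubical.nil)
  next
    case (drop l m g) then show ?case using cubical.drop[of l m "\<lambda>xs. []"] by simp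
  qed simp_all
  then show ?case using nil by blast
next
  case (drop m n f)
  obtain g' where g': "cubical l m g'" "\<forall>xs. length xs = l \<longrightarrow> g' xs = tl (g xs)" using cubical_tl[OF drop.prems] by auto
  then show ?case using drop.IH[OF g'(1)] by auto
next
  case (const m n f b)
  then obtain h where "cubical l n h" "\<forall>xs. length xs = l \<longrightarrow> h xs = f (g xs)" by blast
  then show ?case by (intro exI[of _ "\<lambda>xs. b # h xs"]) (auto intro: cubical.const)
next
  case (var m n f)
  show ?case by (rule cubical_comp_var[OF var.prems refl var.IH])
qed

section \<open>Generators of the cube category against the coordinatewise description\<close>

lemma cubical_cong_ex: "\<exists>g. cubical m n g \<and> (\<forall>xs. length xs = m \<longrightarrow> g xs = f xs) \<Longrightarrow> \<exists>g. cmap m n f = cmap m n g \<and> cubical m n g"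
  by (auto simp: cmap_eq_iff) metis

lemma cubical_id: "\<exists>g. cubical n n g \<and> (\<forall>xs. length xs = n \<longrightarrow> g xs = xs)"
proof (induction n)
  case 0 show ?case by (intro exI[of _ "\<lambda>xs. []"]) (simp add: cubical.nil)
next
  case (Suc n)
  then obtain g where "cubical n n g" "\<forall>xs. length xs = n \<longrightarrow> g xs = xs" by blast
  then show ?case by (intro exI[of _ "\<lambda>xs. hd xs # g (tl xs)"]) (auto intro: cubical.var simp: length_Suc_conv)
qed

lemma cubical_ins: "j \<le> n \<Longrightarrow> \<exists>g. cubical n (Suc n) g \<and> (\<forall>xs. length xs = n \<longrightarrow> g xs = ins j b xs)"
proof (induction j arbitrary: n)
  case 0
  obtain g where "cubical n n g" "\<forall>xs. length xs = n \<longrightarrow> g xs = xs" using cubical_id by blast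
  then show ?case by (intro exI[of _ "\<lambda>xs. b # g xs"]) (auto intro: cubical.const)
next
  case (Suc j)
  then obtain n' where n: "n = Suc n'" by (cases n) auto
  then obtain g where "cubical n' n g" "\<forall>xs. length xs = n' \<longrightarrow> g xs = ins j b xs" using Suc by force
  then show ?case unfolding n by (intro exI[of _ "\<lambda>xs. hd xs # g (tl xs)"]) (auto intro: cubical.var simp: length_Suc_conv)
qed

lemma cubical_del: "j \<le> n \<Longrightarrow> \<exists>g. cubical (Suc n) n g \<and> (\<forall>xs. length xs = Suc n \<longrightarrow> g xs = del j xs)"
proof (induction j arbitrary: n)
  case 0
  obtain g where "cubical n n g" "\<forall>xs. length xs = n \<longrightarrow> g xs = xs" using cubical_id by blast
  then show ?case by (intro exI[of _ "\<lambda>xs. g (tl xs)"]) (auto intro: cubical.drop)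
next
  case (Suc j)
  then obtain n' where n: "n = Suc n'" by (cases n) auto
  then obtain g where "cubical n n' g" "\<forall>xs. length xs = n \<longrightarrow> g xs = del j xs" using Suc by force
  then show ?case unfolding n by (intro exI[of _ "\<lambda>xs. hd xs # g (tl xs)"]) (auto intro: cubical.var simp: length_Suc_conv)
qed

lemma cube_maps_cubical: "\<alpha> \<in> cube_maps \<Longrightarrow> \<exists>m n f. \<alpha> = cmap m n f \<and> cubical m n f"
proof (induction rule: cube_maps.induct)
  case (id n)
  show ?case unfolding cube_id_cmap using cubical_cong_ex[OF cubical_id[of n]] by blast
next
  case (face i k b)
  then have "\<exists>g. cmap (k - 1) (Suc (k - 1)) (ins (i - 1) b) = cmap (k - 1) (Suc (k - 1)) g \<and> cubical (k - 1) (Suc (k - 1)) g"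
    by (intro cubical_cong_ex cubical_ins) simp
  moreover have "Suc (k - 1) = k" using face by simp
  ultimately show ?case unfolding face_cmap by metis
next
  case (degen i k)
  then have "\<exists>g. cmap (Suc (k - 1)) (k - 1) (del (i - 1)) = cmap (Suc (k - 1)) (k - 1) g \<and> cubical (Suc (k - 1)) (k - 1) g"
    by (intro cubical_cong_ex cubical_del) simp
  moreover have "Suc (k - 1) = k" using degen by simp
  ultimately show ?case unfolding degen_cmap[OF degen(1)] by metis
next
  case (comp l m f n g)
  then obtain f' g' where f': "(l, m, f) = cmap l m f'" "cubical l m f'" and g': "(m, n, g) = cmap m n g'" "cubical m n g'"
    by (metis cmap_simps fst_conv snd_conv)
  have "cube_comp (m, n, g) (l, m, f) = cmap l n (\<lambda>xs. g' (f' xs))"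
    unfolding f' g' by (rule cube_comp_cmap) (rule length_cubical[OF f'(2)])
  then show ?case using cubical_cong_ex[OF cubical_comp[OF g'(2) f'(2)]] by metis
qed

lemma cmap_comp_cube_maps:
  assumes "cmap m n g \<in> cube_maps" "cmap l m f \<in> cube_maps" "\<And>xs. length xs = l \<Longrightarrow> length (f xs) = m"
  shows "cmap l n (\<lambda>xs. g (f xs)) \<in> cube_maps"
proof -
  have "cube_comp (cmap m n g) (cmap l m f) \<in> cube_maps"
    using assms(1,2) unfolding cmap_def by (intro cube_maps.comp)
  moreover have "cube_comp (cmap m n g) (cmap l m f) = cmap l n (\<lambda>xs. g (f xs))"
    by (rule cube_comp_cmap) (rule assms(3))
  ultimately show ?thesis by simp
qed

lemma cubical_cube_maps: "cubical m n f \<Longrightarrow> cmap m n f \<in> cube_maps"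
proof -
  \<comment> \<open>Adding an untouched first coordinate raises the index of a face or degeneracy by
    one and commutes with composition, so it can be followed through the generators.\<close>
  have var_closed: "cmap (Suc m) (Suc n) (\<lambda>xs. hd xs # f (tl xs)) \<in> cube_maps" if "\<alpha> \<in> cube_maps" "\<alpha> = cmap m n f" for \<alpha> m n f
    using that
  proof (induction arbitrary: m n f rule: cube_maps.induct)
    case (id k)
    then have "cmap (Suc m) (Suc n) (\<lambda>xs. hd xs # f (tl xs)) = cube_id (Suc k)"
      by (auto simp: cube_id_cmap cmap_eq_iff length_Suc_conv)
    then show ?case by (simp add: cube_maps.id)
  next
    case (face i k b)
    then have "cmap (Suc m) (Suc n) (\<lambda>xs. hd xs # f (tl xs)) = face (Suc k) (Suc i) b"
      by (cases i) (auto simp: face_cmap cmap_eq_iff length_Suc_conv)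
    then show ?case using face cube_maps.face[of "Suc i" "Suc k" b] by simp
  next
    case (degen i k)
    then have "cmap (Suc m) (Suc n) (\<lambda>xs. hd xs # f (tl xs)) = degen (Suc k) (Suc i)"
      by (cases i) (auto simp: degen_cmap cmap_eq_iff length_Suc_conv)
    then show ?case using degen cube_maps.degen[of "Suc i" "Suc k"] by simp
  next
    case (comp l p f' q g')
    obtain f1 g1 where f1: "(l, p, f') = cmap l p f1" "cubical l p f1" and g1: "(p, q, g') = cmap p q g1" "cubical p q g1"
      using cube_maps_cubical[OF comp.hyps(1)] cube_maps_cubical[OF comp.hyps(2)] by (metis cmap_simps fst_conv snd_conv)
    have eq: "cmap m n f = cmap l q (\<lambda>xs. g1 (f1 xs))"
      using comp.prems cube_comp_cmap[OF length_cubical[OF f1(2)]] unfolding f1 g1 by simp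
    have "cmap (Suc l) (Suc q) (\<lambda>xs. (\<lambda>xs. hd xs # g1 (tl xs)) ((\<lambda>xs. hd xs # f1 (tl xs)) xs)) \<in> cube_maps"
      by (rule cmap_comp_cube_maps[OF comp.IH(2)[OF g1(1)] comp.IH(1)[OF f1(1)]]) (use length_cubical[OF f1(2)] in simp)
    moreover have "cmap (Suc m) (Suc n) (\<lambda>xs. hd xs # f (tl xs)) = cmap (Suc l) (Suc q) (\<lambda>xs. (\<lambda>xs. hd xs # g1 (tl xs)) ((\<lambda>xs. hd xs # f1 (tl xs)) xs))"
      using eq by (auto simp: cmap_eq_iff)
    ultimately show ?case by simp
  qed
  show "cubical m n f \<Longrightarrow> cmap m n f \<in> cube_maps"
  proof (induction rule: cubical.induct)
    case nil
    have "cmap 0 0 (\<lambda>xs. []) = cube_id 0" by (auto simp: cube_id_cmap cmap_eq_iff)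
    then show ?case by (simp add: cube_maps.id)
  next
    case (drop m n f)
    have "cmap (Suc m) m tl \<in> cube_maps" using cube_maps.degen[of 1 "Suc m"] by (simp add: degen_cmap del_def[abs_def] drop_Suc)
    from cmap_comp_cube_maps[OF drop.IH this] show ?case by simp
  next
    case (const m n f b)
    have "cmap n (Suc n) (\<lambda>xs. b # xs) \<in> cube_maps" using cube_maps.face[of 1 "Suc n" b] by (simp add: face_cmap ins_def[abs_def])
    from cmap_comp_cube_maps[OF this const.IH] show ?case using length_cubical[OF const.hyps] by simp
  next
    case (var m n f) then show ?case using var_closed by simp
  qed
qed

section \<open>The cube category\<close>

lemma Box_simps [simp]: "Obj Box = UNIV" "Arr Box = cube_maps" "Dom Box = fst" "Cod Box \<alpha> = fst (snd \<alpha>)"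
  "Ide Box = cube_id" "Cmp Box = cube_comp"
  by (simp_all add: Box_def)

lemma Box_Hom_cases:
  assumes "\<alpha> \<in> Hom Box m n"
  obtains f where "\<alpha> = cmap m n f" "cubical m n f"
  using assms cube_maps_cubical[of \<alpha>] by (auto simp: Hom_iff)

lemma cubical_Hom: "cubical m n f \<Longrightarrow> cmap m n f \<in> Hom Box m n"
  by (simp add: Hom_iff cubical_cube_maps)

lemma category_Box: "category Box"
proof
  fix a show "Ide Box a \<in> Hom Box a a" by (simp add: Hom_iff cube_maps.id) (simp add: cube_id_cmap)
next
  fix f g a b c assume f: "f \<in> Hom Box a b" and g: "g \<in> Hom Box b c"
  obtain f' where f': "f = cmap a b f'" "cubical a b f'" by (rule Box_Hom_cases[OF f])
  obtain g' where g': "g = cmap b c g'" "cubical b c g'" by (rule Box_Hom_cases[OF g])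
  show "Cmp Box g f \<in> Hom Box a c"
    using cmap_comp_cube_maps[OF cubical_cube_maps[OF g'(2)] cubical_cube_maps[OF f'(2)] length_cubical[OF f'(2)]]
    by (simp add: f' g' cube_comp_cmap[OF length_cubical[OF f'(2)]] Hom_iff)
next
  fix f a b assume f: "f \<in> Hom Box a b"
  obtain f' where f': "f = cmap a b f'" "cubical a b f'" by (rule Box_Hom_cases[OF f])
  show "Cmp Box f (Ide Box a) = f" "Cmp Box (Ide Box b) f = f"
    using length_cubical[OF f'(2)] by (simp_all add: f' cube_id_cmap cube_comp_cmap)
next
  fix f g h a b c d assume f: "f \<in> Hom Box a b" and g: "g \<in> Hom Box b c" and h: "h \<in> Hom Box c d"
  obtain f' where f': "f = cmap a b f'" "cubical a b f'" by (rule Box_Hom_cases[OF f])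
  obtain g' where g': "g = cmap b c g'" "cubical b c g'" by (rule Box_Hom_cases[OF g])
  obtain h' where h': "h = cmap c d h'" "cubical c d h'" by (rule Box_Hom_cases[OF h])
  show "Cmp Box h (Cmp Box g f) = Cmp Box (Cmp Box h g) f"
    using length_cubical[OF f'(2)] length_cubical[OF g'(2)] by (simp add: f' g' h' cube_comp_cmap)
qed auto

text \<open>Comparing with the value at \<open>False\<close> is enough: it overwrites every other
  update of coordinate i, so two points differing only there have a common value.\<close>

definition indep :: "nat \<Rightarrow> (bool list \<Rightarrow> 'a) \<Rightarrow> nat \<Rightarrow> bool" where
  "indep n f i \<longleftrightarrow> (\<forall>xs. length xs = n \<longrightarrow> f (xs[i := False]) = f xs)"

lemma indepD: "indep n f i \<Longrightarrow> length xs = n \<Longrightarrow> f (xs[i := b]) = f xs"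
  unfolding indep_def by (metis length_list_update list_update_overwrite)

text \<open>Because variables occur in increasing order, a first coordinate equal to variable p
  leaves only later variables for the other coordinates. Replacing it by a constant then produces a
  degenerate map.\<close>

lemma cubical_hd:
  assumes "cubical n k' f" "k' = Suc k"
  shows "(\<exists>b. \<forall>xs. length xs = n \<longrightarrow> hd (f xs) = b) \<or>
     (\<exists>p<n. (\<forall>xs. length xs = n \<longrightarrow> hd (f xs) = xs ! p) \<and> (\<forall>i\<le>p. indep n (\<lambda>xs. tl (f xs)) i))"
  using assms
proof (induction rule: cubical.induct)
  case (drop m n f)
  then consider b where "\<forall>xs. length xs = m \<longrightarrow> hd (f xs) = b"
    | p where "p < m" "\<forall>xs. length xs = m \<longrightarrow> hd (f xs) = xs ! p" "\<forall>i\<le>p. indep m (\<lambda>xs. tl (f xs)) i" by blast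
  then show ?case
  proof cases
    case 1 then show ?thesis by auto
  next
    case 2
    have "indep (Suc m) (\<lambda>xs. tl (f (tl xs))) i" if "i \<le> Suc p" for i
    proof (cases i)
      case 0 then show ?thesis by (auto simp: indep_def length_Suc_conv)
    next
      case (Suc i')
      then show ?thesis using 2(3) that by (auto simp: indep_def length_Suc_conv)
    qed
    moreover have "\<forall>xs. length xs = Suc m \<longrightarrow> hd (f (tl xs)) = xs ! Suc p" using 2 by (auto simp: length_Suc_conv)
    ultimately show ?thesis using 2(1) by (intro disjI2 exI[of _ "Suc p"]) auto
  qed
next
  case (var m n f)
  have "indep (Suc m) (\<lambda>xs. f (tl xs)) 0" by (auto simp: indep_def length_Suc_conv)
  then show ?case by (intro disjI2 exI[of _ 0]) (auto simp: hd_conv_nth length_Suc_conv)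
qed auto

section \<open>Integral combinations of cube maps\<close>

type_synonym chain = "cube_map \<Rightarrow>\<^sub>0 int"

definition precomp :: "cube_map \<Rightarrow> chain \<Rightarrow> chain" where
  "precomp \<beta> = frag_extend (\<lambda>\<alpha>. frag_of (cube_comp \<alpha> \<beta>))"

definition postcomp :: "cube_map \<Rightarrow> chain \<Rightarrow> chain" where
  "postcomp \<beta> = frag_extend (\<lambda>\<alpha>. frag_of (cube_comp \<beta> \<alpha>))"

definition bterm :: "cube_map \<Rightarrow> nat \<Rightarrow> chain" where
  "bterm \<alpha> j = frag_of (cube_comp \<alpha> (face (fst \<alpha>) (Suc j) False)) - frag_of (cube_comp \<alpha> (face (fst \<alpha>) (Suc j) True))"

text \<open>A cube map from n to k is an n-cube of the standard k-cube, so this is the boundary of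
  the chains of standard cubes. The sign is that of the coordinate counted from 1, hence the
  exponent \<open>Suc j\<close>.\<close>

definition bd :: "chain \<Rightarrow> chain" where
  "bd = frag_extend (\<lambda>\<alpha>. \<Sum>j<fst \<alpha>. frag_cmul ((-1) ^ Suc j) (bterm \<alpha> j))"

lemma frag_simps: "precomp \<beta> (frag_of \<alpha>) = frag_of (cube_comp \<alpha> \<beta>)" "postcomp \<beta> (frag_of \<alpha>) = frag_of (cube_comp \<beta> \<alpha>)"
  "bd (frag_of \<alpha>) = (\<Sum>j<fst \<alpha>. frag_cmul ((-1) ^ Suc j) (bterm \<alpha> j))"
  "precomp \<beta> 0 = 0" "postcomp \<beta> 0 = 0" "bd 0 = 0"
  "precomp \<beta> (a - b) = precomp \<beta> a - precomp \<beta> b" "postcomp \<beta> (a - b) = postcomp \<beta> a - postcomp \<beta> b" "bd (a - b) = bd a - bd b"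
  "precomp \<beta> (a + b) = precomp \<beta> a + precomp \<beta> b" "postcomp \<beta> (a + b) = postcomp \<beta> a + postcomp \<beta> b" "bd (a + b) = bd a + bd b"
  "precomp \<beta> (frag_cmul k a) = frag_cmul k (precomp \<beta> a)" "postcomp \<beta> (frag_cmul k a) = frag_cmul k (postcomp \<beta> a)" "bd (frag_cmul k a) = frag_cmul k (bd a)"
  "precomp \<beta> (- a) = - precomp \<beta> a" "postcomp \<beta> (- a) = - postcomp \<beta> a" "bd (- a) = - bd a"
  by (simp_all add: precomp_def postcomp_def bd_def frag_extend_diff frag_extend_add frag_extend_cmul frag_extend_minus)

lemma bd_sum: "finite I \<Longrightarrow> bd (sum g I) = (\<Sum>i\<in>I. bd (g i))"
  by (simp add: bd_def frag_extend_sum comp_def)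

lemma postcomp_sum: "finite I \<Longrightarrow> postcomp \<beta> (sum g I) = (\<Sum>i\<in>I. postcomp \<beta> (g i))"
  by (simp add: postcomp_def frag_extend_sum comp_def)

lemma frag_cmul_diff2: "frag_cmul c (a - b) = frag_cmul c a - frag_cmul c b"
  by (metis add_diff_cancel diff_add_cancel frag_cmul_distrib2)

lemma frag_cmul_minus2: "frag_cmul c (- a) = frag_cmul (- c) a"
  using frag_cmul_diff2[of c 0 a] by simp

lemma face_comp: "j < n \<Longrightarrow> cube_comp (cmap n k f) (face n (Suc j) b) = cmap (n - 1) k (\<lambda>xs. f (ins j b xs))"
  unfolding face_cmap by (subst cube_comp_cmap) auto

lemma bterm_cmap: "j < n \<Longrightarrow> bterm (cmap n k f) j =
    frag_of (cmap (n - 1) k (\<lambda>xs. f (ins j False xs))) - frag_of (cmap (n - 1) k (\<lambda>xs. f (ins j True xs)))"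
  by (simp add: bterm_def face_comp)

lemma bd_cmap: "bd (frag_of (cmap n k f)) = (\<Sum>j<n. frag_cmul ((-1) ^ Suc j)
    (frag_of (cmap (n - 1) k (\<lambda>xs. f (ins j False xs))) - frag_of (cmap (n - 1) k (\<lambda>xs. f (ins j True xs)))))"
  by (simp add: frag_simps bterm_cmap)

lemma bd_bd_cmap: "bd (bd (frag_of (cmap n k f))) = 0"
proof (cases "n \<le> 1")
  case True
  then show ?thesis by (cases n) (auto simp: bd_cmap bd_sum frag_simps(4-) lessThan_Suc)
next
  case False
  then obtain m where n: "n = Suc (Suc m)" by (metis One_nat_def Suc_le_eq not_less_eq_eq not0_implies_Suc less_Suc0 linorder_not_less)
  define t where "t i j b c = frag_of (cmap m k (\<lambda>xs. f (ins j c (ins i b xs))))" for i j b c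
  define u where "u i j = frag_cmul ((-1) ^ (i + j)) (t i j False False - t i j True False - t i j False True + t i j True True)" for i j
  have "bd (bd (frag_of (cmap n k f))) = (\<Sum>j<n. \<Sum>i<Suc m. u i j)"
    unfolding n bd_cmap[of "Suc (Suc m)"]
    by (simp add: bd_sum frag_simps(4-) bd_cmap sum_subtractf[symmetric] frag_cmul_sum del: sum.lessThan_Suc)
       (auto simp: u_def t_def frag_cmul_diff2 frag_cmul_distrib2 power_add algebra_simps intro!: sum.cong simp del: sum.lessThan_Suc)
  also have "\<dots> = (\<Sum>(j, i)\<in>{..<n} \<times> {..<Suc m}. u i j)" by (rule sum.cartesian_product)
  also have "{..<n} \<times> {..<Suc m} = {(j, i). j \<le> i \<and> i < Suc m} \<union> {(j, i). i < j \<and> j < n}" by (auto simp: n)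
  also have "(\<Sum>(j, i)\<in>\<dots>. u i j) = (\<Sum>(j, i)\<in>{(j, i). j \<le> i \<and> i < Suc m}. u i j) + (\<Sum>(j, i)\<in>{(j, i). i < j \<and> j < n}. u i j)"
    by (rule sum.union_disjoint) (auto intro: finite_subset[of _ "{..<n} \<times> {..<n}"] simp: n)
  \<comment> \<open>The same two coordinates can be fixed in either order. Exchanging the order
    lowers the larger index by one, so the matching terms carry opposite signs.\<close>
  also have "(\<Sum>(j, i)\<in>{(j, i). i < j \<and> j < n}. u i j) = (\<Sum>(j, i)\<in>{(j, i). j \<le> i \<and> i < Suc m}. u j (Suc i))"
    by (rule sum.reindex_bij_witness[of _ "\<lambda>(j, i). (Suc i, j)" "\<lambda>(j, i). (i, j - 1)"]) (auto simp: n)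
  also have "(\<Sum>(j, i)\<in>{(j, i). j \<le> i \<and> i < Suc m}. u j (Suc i)) = (\<Sum>(j, i)\<in>{(j, i). j \<le> i \<and> i < Suc m}. - u i j)"
  proof (rule sum.cong[OF refl], clarify)
    fix i j :: nat assume ij: "j \<le> i" "i < Suc m"
    have "t j (Suc i) b c = t i j c b" for b c
      unfolding t_def using ij by (intro arg_cong[where f=frag_of] cmap_cong) (simp add: ins_ins)
    then show "u j (Suc i) = - u i j" by (simp add: u_def frag_cmul_diff2 frag_cmul_distrib2 minus_frag_cmul[symmetric] algebra_simps del: minus_frag_cmul)
  qed
  finally show ?thesis by (simp add: sum_negf split_def)
qed

subsection \<open>Degenerate chains\<close>

text \<open>The projection off a coordinate followed by the face where that coordinate is 0: an
  idempotent of the cube.\<close>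

definition tau :: "nat \<Rightarrow> nat \<Rightarrow> cube_map" where
  "tau n i = cmap n n (\<lambda>xs. xs[i := False])"

text \<open>A cube map factors through the projection off coordinate i precisely when the idempotent
  \<open>tau\<close> for i fixes it; stated this way, degeneracy mentions no factor.\<close>

definition dgn :: "cube_map \<Rightarrow> bool" where
  "dgn \<alpha> \<longleftrightarrow> (\<exists>i<fst \<alpha>. cube_comp \<alpha> (tau (fst \<alpha>) i) = \<alpha>)"

definition Deg :: "chain \<Rightarrow> bool" where
  "Deg c \<longleftrightarrow> (\<forall>\<alpha>\<in>Poly_Mapping.keys c. dgn \<alpha>)"

lemma tau_comp: "cube_comp (cmap n k f) (tau n i) = cmap n k (\<lambda>xs. f (xs[i := False]))"
  unfolding tau_def by (rule cube_comp_cmap) simp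

lemma tau_comp_eq: "cube_comp (cmap n k f) (tau n i) = cmap n k f \<longleftrightarrow> indep n f i"
  by (simp add: tau_comp cmap_eq_iff indep_def)

lemma dgn_cmap: "dgn (cmap n k f) \<longleftrightarrow> (\<exists>i<n. indep n f i)"
  by (simp add: dgn_def tau_comp_eq)

lemma Deg_simps: "Deg 0" "Deg a \<Longrightarrow> Deg b \<Longrightarrow> Deg (a + b)" "Deg a \<Longrightarrow> Deg b \<Longrightarrow> Deg (a - b)" "Deg a \<Longrightarrow> Deg (- a)"
  "Deg a \<Longrightarrow> Deg (frag_cmul k a)" "Deg (frag_of \<alpha>) \<longleftrightarrow> dgn \<alpha>"
  using keys_add[of a b] keys_diff[of a b] by (auto simp: Deg_def dest: subsetD)

lemma Deg_sum: "(\<And>i. i \<in> I \<Longrightarrow> Deg (g i)) \<Longrightarrow> Deg (sum g I)"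
  by (induction I rule: infinite_finite_induct) (auto simp: Deg_simps)

lemma Deg_frag_extend: "(\<And>\<alpha>. \<alpha> \<in> Poly_Mapping.keys c \<Longrightarrow> Deg (f \<alpha>)) \<Longrightarrow> Deg (frag_extend f c)"
  unfolding frag_extend_def by (intro Deg_sum Deg_simps(5))

text \<open>The factor is the restriction to the face where the redundant coordinate is 0.\<close>

lemma dgn_factor:
  assumes "\<alpha> \<in> Hom Box n k" "dgn \<alpha>"
  obtains i \<beta> where "i \<in> {1..n}" "\<beta> \<in> Hom Box (n - 1) k" "\<alpha> = cube_comp \<beta> (degen n i)"
proof -
  interpret Box: category Box by (rule category_Box)
  obtain f where f: "\<alpha> = cmap n k f" "cubical n k f" by (rule Box_Hom_cases[OF assms(1)])
  obtain i where i: "i < n" "indep n f i" using assms(2) f by (auto simp: dgn_cmap)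
  have "face n (Suc i) False \<in> Hom Box (n - 1) n" using i by (simp add: Hom_iff cube_maps.face) (simp add: face_cmap)
  then have "cube_comp \<alpha> (face n (Suc i) False) \<in> Hom Box (n - 1) k"
    using Box.Cmp_Hom[OF _ assms(1)] by simp
  moreover have "cube_comp (cube_comp \<alpha> (face n (Suc i) False)) (degen n (Suc i)) = \<alpha>"
    unfolding f(1) face_comp[OF i(1)] using i
    by (simp add: degen_cmap, subst cube_comp_cmap) (auto simp: cmap_eq_iff ins_del indepD)
  ultimately show ?thesis using that[of "Suc i"] i by simp
qed

lemma degen_comp_dgn:
  assumes "\<beta> \<in> Hom Box (n - 1) k" "i \<in> {1..n}"
  shows "dgn (cube_comp \<beta> (degen n i))"
proof -
  obtain f where f: "\<beta> = cmap (n - 1) k f" "cubical (n - 1) k f" by (rule Box_Hom_cases[OF assms(1)])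
  have "cube_comp \<beta> (degen n i) = cmap n k (\<lambda>xs. f (del (i - 1) xs))"
    unfolding f(1) using assms(2) by (simp add: degen_cmap, subst cube_comp_cmap) auto
  moreover have "indep n (\<lambda>xs. f (del (i - 1) xs)) (i - 1)" using assms(2) by (auto simp: indep_def del_update)
  ultimately show ?thesis using assms(2) by (auto simp: dgn_cmap intro!: exI[of _ "i - 1"])
qed

text \<open>The two faces in the redundant direction coincide and cancel. Every other face still
  ignores that coordinate, whose index drops by one if it lies after the removed one.\<close>

lemma Deg_bd_cmap: assumes "i < n" "indep n f i" shows "Deg (bd (frag_of (cmap n k f)))"
  unfolding bd_cmap
proof (intro Deg_sum Deg_simps(5))
  fix j assume j: "j \<in> {..<n}"
  have d: "Deg (frag_of (cmap (n - 1) k (\<lambda>xs. f (ins j b xs))))" if "i \<noteq> j" for b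
  proof -
    have "indep (n - 1) (\<lambda>xs. f (ins j b xs)) (if i < j then i else i - 1)"
      unfolding indep_def
    proof (intro allI impI)
      fix xs :: "bool list" assume xs: "length xs = n - 1"
      have "ins j b (xs[(if i < j then i else i - 1) := False]) = (ins j b xs)[i := False]"
        using that xs j assms(1) ins_update(1)[of i j xs b False] ins_update(3)[of j i xs b False] by auto
      then show "f (ins j b (xs[(if i < j then i else i - 1) := False])) = f (ins j b xs)"
        using indepD[OF assms(2), of "ins j b xs"] xs j by simp
    qed
    moreover have "(if i < j then i else i - 1) < n - 1" using j that assms(1) by auto
    ultimately show ?thesis by (auto simp: Deg_simps dgn_cmap)
  qed
  have "cmap (n - 1) k (\<lambda>xs. f (ins j False xs)) = cmap (n - 1) k (\<lambda>xs. f (ins j True xs))" if "i = j"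
  proof (rule cmap_cong)
    fix xs :: "bool list" assume xs: "length xs = n - 1"
    have "ins j False xs = (ins j True xs)[i := False]" using that xs j by (simp add: ins_update(2))
    then show "f (ins j False xs) = f (ins j True xs)" using indepD[OF assms(2), of "ins j True xs" False] xs j by simp
  qed
  then show "Deg (frag_of (cmap (n - 1) k (\<lambda>xs. f (ins j False xs))) - frag_of (cmap (n - 1) k (\<lambda>xs. f (ins j True xs))))"
    using d by (cases "i = j") (auto simp: Deg_simps)
qed

subsection \<open>The normalizing operator\<close>

text \<open>Precomposition with the commuting idempotents \<open>1 - tau n i\<close> for \<open>i < m\<close>.  For \<open>m = n\<close> it kills
  the degenerate maps and is the identity modulo them, so it splits the projection onto the normalized
  chains.\<close>

fun nrm :: "nat \<Rightarrow> nat \<Rightarrow> chain \<Rightarrow> chain" where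
  "nrm n 0 c = c"
| "nrm n (Suc m) c = nrm n m (c - precomp (tau n m) c)"

lemma nrm_0: "nrm n m 0 = 0"
  by (induction m) (simp_all add: frag_simps)

lemma comp_tau: "cube_comp (m, k, f) (tau n i) = cmap n k (\<lambda>xs. f (xs[i := False]))"
  by (auto simp: tau_def cmap_def cube_comp_def compose_def fun_eq_iff restrict_def)

lemma precomp_tau_tau: "precomp (tau n i) (precomp (tau n j) c) = precomp (tau n j) (precomp (tau n i) c)"
proof (rule frag_induction[of c UNIV])
  fix \<alpha> :: cube_map
  obtain m k f where a: "\<alpha> = (m, k, f)" by (cases \<alpha>)
  have "xs[i := False, j := False] = xs[j := False, i := False]" for xs :: "bool list"
    by (cases "i = j") (simp_all add: list_update_swap)
  then show "precomp (tau n i) (precomp (tau n j) (frag_of \<alpha>)) = precomp (tau n j) (precomp (tau n i) (frag_of \<alpha>))"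
    by (simp only: a frag_simps(1) comp_tau tau_comp)
qed (simp_all add: frag_simps)

text \<open>The idempotents commute, so invariance under \<open>tau n i\<close> survives the other
  factors until the factor for i annihilates the chain.\<close>

lemma nrm_fixed: "precomp (tau n i) c = c \<Longrightarrow> i < m \<Longrightarrow> nrm n m c = 0"
proof (induction m arbitrary: c)
  case (Suc m)
  show ?case
  proof (cases "i = m")
    case True
    then show ?thesis using Suc.prems by (simp add: nrm_0)
  next
    case False
    have "precomp (tau n i) (c - precomp (tau n m) c) = c - precomp (tau n m) c"
      using Suc.prems precomp_tau_tau[of n i m c] by (simp add: frag_simps)
    then show ?thesis using Suc.IH[of "c - precomp (tau n m) c"] False Suc.prems by simp
  qed
qed simp

lemma nrm_dgn:
  assumes "dgn \<alpha>" "fst \<alpha> = n" shows "nrm n n (frag_of \<alpha>) = 0"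
proof -
  obtain i where "i < n" "cube_comp \<alpha> (tau n i) = \<alpha>" using assms by (auto simp: dgn_def)
  then show ?thesis by (intro nrm_fixed[of n i]) (simp_all add: frag_simps)
qed

lemma Deg_precomp_tau: "i < n \<Longrightarrow> Deg (precomp (tau n i) c)"
  unfolding precomp_def
proof (intro Deg_frag_extend)
  fix \<alpha> :: cube_map assume i: "i < n"
  obtain m k f where a: "\<alpha> = (m, k, f)" by (cases \<alpha>)
  have "cube_comp \<alpha> (tau n i) = cmap n k (\<lambda>xs. f (xs[i := False]))"
    by (simp add: a comp_tau)
  then show "Deg (frag_of (cube_comp \<alpha> (tau n i)))" using i by (auto simp: Deg_simps dgn_cmap indep_def)
qed

text \<open>Each factor subtracts a chain precomposed with some \<open>tau\<close>, and such chains
  are degenerate.\<close>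

lemma Deg_nrm: "m \<le> n \<Longrightarrow> Deg (nrm n m c - c)"
proof (induction m arbitrary: c)
  case (Suc m)
  have "Deg (nrm n m (c - precomp (tau n m) c) - (c - precomp (tau n m) c) - precomp (tau n m) c)"
    by (rule Deg_simps(3)[OF Suc.IH Deg_precomp_tau]; use Suc.prems in simp)
  then show ?case by simp
qed (simp add: Deg_simps)

subsection \<open>Contraction of the standard cubes\<close>

text \<open>The contraction moves the coordinates of a map to \<open>0\<close> one after another.  Without connections
  only a coordinate that is constantly \<open>1\<close> can be moved; if the first coordinate is a variable or
  constantly \<open>0\<close>, the zero chain satisfies the homotopy identity modulo degenerate maps.\<close>

definition vadd :: "cube_map \<Rightarrow> chain" where
  "vadd = (\<lambda>(n, k, f). if \<forall>xs\<in>cube n. hd (f xs) then frag_of (cmap (Suc n) k (\<lambda>xs. hd xs # tl (f (tl xs)))) else 0)"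

lemma vadd_cmap: "vadd (cmap n k f) = (if \<forall>xs. length xs = n \<longrightarrow> hd (f xs)
    then frag_of (cmap (Suc n) k (\<lambda>xs. hd xs # tl (f (tl xs)))) else 0)"
  by (auto simp: vadd_def cmap_def fun_eq_iff restrict_def intro!: arg_cong[where f=frag_of])

text \<open>\<open>vadd\<close> moves the first coordinate from 1 to 0. Afterwards that coordinate
  is 0, and the remaining ones are contracted in a smaller cube, which sits in the given one as the
  face where the first coordinate is 0.\<close>

fun contr :: "nat \<Rightarrow> cube_map \<Rightarrow> chain" where
  "contr 0 \<alpha> = 0"
| "contr (Suc k) \<alpha> = vadd \<alpha> + postcomp (face (Suc k) (Suc 0) False) (contr k (cube_comp (degen (Suc k) (Suc 0)) \<alpha>))"

lemma degen1_comp: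
  assumes "\<And>xs. length xs = n \<Longrightarrow> length (f xs) = Suc k"
  shows "cube_comp (degen (Suc k) (Suc 0)) (cmap n (Suc k) f) = cmap n k (\<lambda>xs. tl (f xs))"
  using assms by (simp add: degen_cmap cube_comp_cmap)

lemma face1_comp:
  assumes "\<And>xs. length xs = n \<Longrightarrow> length (f xs) = k"
  shows "cube_comp (face (Suc k) (Suc 0) b) (cmap n k f) = cmap n (Suc k) (\<lambda>xs. b # f xs)"
  using assms by (simp add: face_cmap cube_comp_cmap)

lemma degen1_cubical: "cubical n (Suc k) f \<Longrightarrow> cube_comp (degen (Suc k) (Suc 0)) (cmap n (Suc k) f) = cmap n k (\<lambda>xs. tl (f xs))"
  by (rule degen1_comp) (rule length_cubical)

lemma face1_cubical: "cubical n k f \<Longrightarrow> cube_comp (face (Suc k) (Suc 0) b) (cmap n k f) = cmap n (Suc k) (\<lambda>xs. b # f xs)"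
  by (rule face1_comp) (rule length_cubical)

text \<open>A homotopy from the identity to the operation that sets the first coordinate to 0. The
  three possible shapes of this coordinate behave quite differently; only a variable one requires
  working modulo degenerate maps.\<close>

lemma vadd_homotopy:
  assumes f: "cubical n (Suc k) f" and n: "n > 0"
  shows "Deg (bd (vadd (cmap n (Suc k) f)) + frag_extend vadd (bd (frag_of (cmap n (Suc k) f)))
    - (frag_of (cmap n (Suc k) f) - frag_of (cmap n (Suc k) (\<lambda>xs. False # tl (f xs)))))"
proof -
  let ?a = "cmap n (Suc k) f" and ?r = "cmap n (Suc k) (\<lambda>xs. False # tl (f xs))"
  note lf = length_cubical[OF f]
  have fne: "f xs \<noteq> []" if "length xs = n" for xs using lf[OF that] by auto
  define D where "D j b = cmap (n - 1) (Suc k) (\<lambda>xs. f (ins j b xs))" for j b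
  have vbd: "frag_extend vadd (bd (frag_of ?a)) = (\<Sum>j<n. frag_cmul ((-1) ^ Suc j) (vadd (D j False) - vadd (D j True)))"
    unfolding bd_cmap by (simp add: frag_extend_sum comp_def frag_extend_cmul frag_extend_diff D_def)
  consider (T) "\<forall>xs. length xs = n \<longrightarrow> hd (f xs) = True" | (F) "\<forall>xs. length xs = n \<longrightarrow> hd (f xs) = False"
    | (V) p where "p < n" "\<forall>xs. length xs = n \<longrightarrow> hd (f xs) = xs ! p" "\<forall>i\<le>p. indep n (\<lambda>xs. tl (f xs)) i"
    using cubical_hd[OF f refl] by (metis (full_types))
  then show ?thesis
  proof cases
    case T
    \<comment> \<open>Constantly 1: the identity is exact. The two faces of the added variable give
      the map itself and its modification; the other faces are those of the map with a variable
      added, their sign reversed by the index shift.\<close>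
    have v: "vadd (D j b) = frag_of (cmap n (Suc k) (\<lambda>xs. hd xs # tl (f (ins j b (tl xs)))))" if "j < n" for j b
      unfolding D_def vadd_cmap using T n by simp
    let ?g = "\<lambda>xs. hd xs # tl (f (tl xs))"
    have va: "vadd ?a = frag_of (cmap (Suc n) (Suc k) ?g)" unfolding vadd_cmap using T by simp
    have g0: "cmap n (Suc k) (\<lambda>xs. ?g (ins 0 False xs)) = ?r" "cmap n (Suc k) (\<lambda>xs. ?g (ins 0 True xs)) = ?a"
      using T fne by (auto simp: cmap_eq_iff) (metis (full_types) list.collapse)
    have gS: "cmap n (Suc k) (\<lambda>xs. ?g (ins (Suc j) b xs)) = cmap n (Suc k) (\<lambda>xs. hd xs # tl (f (ins j b (tl xs))))" for j b
      using n by (intro cmap_cong) (auto simp: neq_Nil_conv[symmetric] length_Suc_conv gr0_conv_Suc)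
    have "bd (vadd ?a) = (\<Sum>j<Suc n. frag_cmul ((-1) ^ Suc j) (frag_of (cmap n (Suc k) (\<lambda>xs. ?g (ins j False xs))) - frag_of (cmap n (Suc k) (\<lambda>xs. ?g (ins j True xs)))))"
      unfolding va bd_cmap by simp
    also have "\<dots> = - (frag_of ?r - frag_of ?a) + (\<Sum>j<n. frag_cmul ((-1) ^ Suc (Suc j)) (vadd (D j False) - vadd (D j True)))"
      unfolding sum.lessThan_Suc_shift g0 gS by (simp add: v)
    also have "\<dots> = frag_of ?a - frag_of ?r - frag_extend vadd (bd (frag_of ?a))"
      unfolding vbd by (simp add: algebra_simps) (simp add: sum.distrib[symmetric] frag_cmul_distrib[symmetric])
    finally show ?thesis by (simp add: Deg_simps)
  next
    case F
    \<comment> \<open>Constantly 0: nothing has to be moved, and all \<open>vadd\<close> terms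
      vanish because the first coordinate is false at the point with all coordinates
      \<open>False\<close>.\<close>
    have "vadd (D j b) = 0" if "j < n" for j b
      unfolding D_def vadd_cmap using F n length_replicate[of "n - 1" False] by (auto intro!: exI[of _ "replicate (n - 1) False"])
    then have "frag_extend vadd (bd (frag_of ?a)) = 0" unfolding vbd by simp
    moreover have "vadd ?a = 0" unfolding vadd_cmap using F by (auto intro!: exI[of _ "replicate n False"])
    moreover have "?r = ?a" using F fne by (auto simp: cmap_eq_iff) (metis list.collapse)
    ultimately show ?thesis by (simp add: frag_simps Deg_simps)
  next
    case V
    have "vadd ?a = 0" unfolding vadd_cmap using V(1,2) by (auto intro!: exI[of _ "replicate n False"])
    \<comment> \<open>Variable p: the face x_p = 1 is the only one with a first coordinate
      constantly 1. For all others the point with the free coordinates \<open>False\<close> refutes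
      this.\<close>
    have vz: "vadd (D j b) = 0" if "j < n" "j \<noteq> p \<or> b = False" for j b
    proof -
      have "\<not> hd (f (ins j b (replicate (n - 1) False)))"
        using V(1,2) that n by (auto simp: nth_ins)
      then show ?thesis unfolding D_def vadd_cmap by (auto intro!: exI[of _ "replicate (n - 1) False"])
    qed
    have "frag_extend vadd (bd (frag_of ?a)) = (\<Sum>j<n. if j = p then - frag_cmul ((-1) ^ Suc p) (vadd (D p True)) else 0)"
      unfolding vbd by (rule sum.cong) (auto simp: vz frag_cmul_minus2)
    also have "\<dots> = frag_cmul ((-1) ^ p) (vadd (D p True))" using V(1) by simp
    also have "vadd (D p True) = frag_of (cmap n (Suc k) (\<lambda>xs. hd xs # tl (f (ins p True (tl xs)))))"
      unfolding D_def vadd_cmap using V n by (simp add: nth_ins)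
    finally have vv: "frag_extend vadd (bd (frag_of ?a)) = frag_cmul ((-1) ^ p) (frag_of (cmap n (Suc k) (\<lambda>xs. hd xs # tl (f (ins p True (tl xs))))))" .
    \<comment> \<open>Without its first coordinate the map uses only variables after p, so it
      ignores coordinate 0.\<close>
    have r: "Deg (frag_of ?r)" using V(3) n by (auto simp: Deg_simps dgn_cmap indep_def)
    show ?thesis
    proof (cases p)
      case 0
      \<comment> \<open>With p = 0 the variable removed by the face is put back at its place, and
        the surviving term is the original map with sign +1.\<close>
      have "cmap n (Suc k) (\<lambda>xs. hd xs # tl (f (ins p True (tl xs)))) = ?a"
      proof (rule cmap_cong)
        fix xs :: "bool list" assume xs: "length xs = n"
        have "True # tl xs = xs[0 := True]" using xs n by (cases xs) auto
        then have "tl (f (True # tl xs)) = tl (f xs)" using indepD[OF V(3)[rule_format, of 0], of xs] xs by simp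
        moreover have "hd (f xs) = hd xs" using V(2) 0 xs n by (cases xs) auto
        ultimately show "hd xs # tl (f (ins p True (tl xs))) = f xs" using 0 fne[OF xs] by (metis ins_0 list.collapse)
      qed
      then show ?thesis using r \<open>vadd ?a = 0\<close> vv 0 by (simp add: frag_simps)
    next
      case (Suc p')
      have i0: "indep n f 0"
        unfolding indep_def
      proof (intro allI impI)
        fix xs :: "bool list" assume xs: "length xs = n"
        have "tl (f (xs[0 := False])) = tl (f xs)" using indepD[OF V(3)[rule_format, of 0], of xs] xs by simp
        moreover have "hd (f (xs[0 := False])) = hd (f xs)" using V(2) Suc xs by simp
        ultimately show "f (xs[0 := False]) = f xs" using fne[of "xs[0 := False]"] fne[of xs] xs by (metis length_list_update list.collapse)
      qed
      have "indep n (\<lambda>xs. hd xs # tl (f (ins p True (tl xs)))) 1"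
        unfolding indep_def
      proof (intro allI impI)
        fix xs :: "bool list" assume xs: "length xs = n"
        obtain x y ys where xy: "xs = x # y # ys" using xs V(1) Suc by (cases xs; cases "tl xs") auto
        have "ins p True (False # ys) = (ins p True (y # ys))[0 := False]" using Suc by simp
        moreover have "length (ins p True (y # ys)) = n" using xs xy by simp
        ultimately have "f (ins p True (False # ys)) = f (ins p True (y # ys))" using indepD[OF i0] by metis
        then show "hd (xs[1 := False]) # tl (f (ins p True (tl (xs[1 := False])))) = hd xs # tl (f (ins p True (tl xs)))"
          using xy by simp
      qed
      then have "Deg (frag_of (cmap n (Suc k) (\<lambda>xs. hd xs # tl (f (ins p True (tl xs))))))"
        using V(1) Suc by (auto simp: Deg_simps dgn_cmap intro!: exI[of _ 1])
      moreover have "Deg (frag_of ?a)" using i0 n by (auto simp: Deg_simps dgn_cmap)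
      ultimately show ?thesis unfolding vv \<open>vadd ?a = 0\<close> using r by (auto simp: frag_simps intro!: Deg_simps)
    qed
  qed
qed

lemma vadd_keys: "cubical n (Suc k) f \<Longrightarrow> Poly_Mapping.keys (vadd (cmap n (Suc k) f)) \<subseteq> Hom Box (Suc n) (Suc k)"
proof -
  assume f: "cubical n (Suc k) f"
  obtain g where g: "cubical n k g" "\<forall>xs. length xs = n \<longrightarrow> g xs = tl (f xs)" using cubical_tl[OF f refl] by auto
  have "cmap (Suc n) (Suc k) (\<lambda>xs. hd xs # tl (f (tl xs))) = cmap (Suc n) (Suc k) (\<lambda>xs. hd xs # g (tl xs))"
    using g by (auto simp: cmap_eq_iff)
  then show ?thesis using cubical_Hom[OF cubical.var[OF g(1)]] by (auto simp: vadd_cmap)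
qed

lemma vadd_dgn: "indep n f i \<Longrightarrow> i < n \<Longrightarrow> Deg (vadd (cmap n k f))"
proof -
  assume f: "indep n f i" and i: "i < n"
  have "indep (Suc n) (\<lambda>xs. hd xs # tl (f (tl xs))) (Suc i)"
    using f by (auto simp: indep_def length_Suc_conv)
  then show ?thesis using i by (auto simp: vadd_cmap Deg_simps dgn_cmap)
qed

lemma cmap_tl_Hom: "cubical n (Suc k) f \<Longrightarrow> cmap n k (\<lambda>xs. tl (f xs)) \<in> Hom Box n k"
  using cubical_tl[of n "Suc k" f k] cubical_Hom[of n k] cmap_cong[of n "\<lambda>xs. tl (f xs)"] by metis

lemma contr_keys: "\<alpha> \<in> Hom Box n k \<Longrightarrow> Poly_Mapping.keys (contr k \<alpha>) \<subseteq> Hom Box (Suc n) k"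
proof (induction k arbitrary: \<alpha>)
  case (Suc k)
  interpret Box: category Box by (rule category_Box)
  obtain f where f: "\<alpha> = cmap n (Suc k) f" "cubical n (Suc k) f" by (rule Box_Hom_cases[OF Suc.prems])
  have s: "cube_comp (degen (Suc k) (Suc 0)) \<alpha> \<in> Hom Box n k"
    unfolding f(1) using degen1_cubical[OF f(2)] cmap_tl_Hom[OF f(2)] by simp
  have fc: "face (Suc k) (Suc 0) False \<in> Hom Box k (Suc k)" using cube_maps.face[of "Suc 0" "Suc k" False] by (simp add: Hom_iff) (simp add: face_cmap)
  have "Poly_Mapping.keys (postcomp (face (Suc k) (Suc 0) False) (contr k (cube_comp (degen (Suc k) (Suc 0)) \<alpha>))) \<subseteq> Hom Box (Suc n) (Suc k)"
    unfolding postcomp_def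
  proof (rule subset_trans[OF keys_frag_extend], clarify)
    fix \<alpha>' \<beta> assume b: "\<beta> \<in> Poly_Mapping.keys (contr k (cube_comp (degen (Suc k) (Suc 0)) \<alpha>))"
      and a: "\<alpha>' \<in> Poly_Mapping.keys (frag_of (cube_comp (face (Suc k) (Suc 0) False) \<beta>))"
    have "\<beta> \<in> Hom Box (Suc n) k" using Suc.IH[OF s] b by blast
    then have "cube_comp (face (Suc k) (Suc 0) False) \<beta> \<in> Hom Box (Suc n) (Suc k)" using Box.Cmp_Hom[OF _ fc] by simp
    then show "\<alpha>' \<in> Hom Box (Suc n) (Suc k)" using a by simp
  qed
  then show ?case using vadd_keys[OF f(2)] keys_add unfolding f(1) by (fastforce)
qed simp

lemma Deg_postcomp:
  assumes "Deg c" "Poly_Mapping.keys c \<subseteq> Hom Box n k"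
  shows "Deg (postcomp (face (Suc k) (Suc 0) b) c)"
  unfolding postcomp_def
proof (rule Deg_frag_extend)
  fix \<alpha> assume a: "\<alpha> \<in> Poly_Mapping.keys c"
  then have "\<alpha> \<in> Hom Box n k" using assms(2) by blast
  then obtain f where f: "\<alpha> = cmap n k f" "cubical n k f" by (rule Box_Hom_cases)
  have "dgn \<alpha>" using assms(1) a by (simp add: Deg_def)
  then show "Deg (frag_of (cube_comp (face (Suc k) (Suc 0) b) \<alpha>))"
    unfolding f(1) face1_cubical[OF f(2)] Deg_simps by (auto simp: dgn_cmap indep_def)
qed

text \<open>The condition for the contraction to descend to normalized chains.\<close>

lemma contr_dgn: "\<alpha> \<in> Hom Box n k \<Longrightarrow> dgn \<alpha> \<Longrightarrow> Deg (contr k \<alpha>)"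
proof (induction k arbitrary: \<alpha>)
  case (Suc k)
  obtain f where f: "\<alpha> = cmap n (Suc k) f" "cubical n (Suc k) f" by (rule Box_Hom_cases[OF Suc.prems(1)])
  obtain i where i: "i < n" "indep n f i" using Suc.prems f by (auto simp: dgn_cmap)
  have s: "cube_comp (degen (Suc k) (Suc 0)) \<alpha> = cmap n k (\<lambda>xs. tl (f xs))" "cmap n k (\<lambda>xs. tl (f xs)) \<in> Hom Box n k"
    unfolding f(1) using degen1_cubical[OF f(2)] cmap_tl_Hom[OF f(2)] by simp_all
  have "dgn (cmap n k (\<lambda>xs. tl (f xs)))" using i by (auto simp: dgn_cmap indep_def)
  then have "Deg (contr k (cube_comp (degen (Suc k) (Suc 0)) \<alpha>))" using Suc.IH s by simp
  then have "Deg (postcomp (face (Suc k) (Suc 0) False) (contr k (cube_comp (degen (Suc k) (Suc 0)) \<alpha>)))"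
    by (rule Deg_postcomp[OF _ contr_keys]) (use s in simp)
  then show ?case using vadd_dgn[OF i(2,1)] unfolding f(1) by (simp add: Deg_simps)
qed (simp add: Deg_simps)

text \<open>Boundaries precompose with faces, which commutes with composition on the other
  side.\<close>

lemma bd_postcomp_face:
  assumes "Poly_Mapping.keys c \<subseteq> Hom Box n k"
  shows "bd (postcomp (face (Suc k) (Suc 0) b) c) = postcomp (face (Suc k) (Suc 0) b) (bd c)"
  using assms
proof (induction rule: frag_induction)
  case (one \<alpha>)
  then obtain f where f: "\<alpha> = cmap n k f" "cubical n k f" by (rule Box_Hom_cases)
  have L: "postcomp (face (Suc k) (Suc 0) b) (frag_of (cmap (n - 1) k (\<lambda>xs. f (ins j d xs)))) = frag_of (cmap (n - 1) (Suc k) (\<lambda>xs. b # f (ins j d xs)))"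
    if "j < n" for j d
    unfolding frag_simps using that length_cubical[OF f(2)] by (subst face1_comp) auto
  show ?case
    unfolding f(1) frag_simps(2) face1_cubical[OF f(2)] bd_cmap by (simp add: postcomp_sum frag_simps(8,14) L[unfolded One_nat_def] cong: sum.cong_simp)
qed (simp_all add: frag_simps)

lemma bd_postcomp_degen:
  assumes f: "cubical n (Suc k) f"
  shows "frag_extend (\<lambda>\<alpha>. frag_of (cube_comp (degen (Suc k) (Suc 0)) \<alpha>)) (bd (frag_of (cmap n (Suc k) f))) = bd (frag_of (cmap n k (\<lambda>xs. tl (f xs))))"
proof -
  have L: "postcomp (degen (Suc k) (Suc 0)) (frag_of (cmap (n - 1) (Suc k) (\<lambda>xs. f (ins j d xs)))) = frag_of (cmap (n - 1) k (\<lambda>xs. tl (f (ins j d xs))))"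
    if "j < n" for j d
    unfolding frag_simps using that length_cubical[OF f] by (subst degen1_comp) auto
  show ?thesis unfolding postcomp_def[symmetric] bd_cmap by (simp add: postcomp_sum frag_simps(8,14) L[unfolded One_nat_def] cong: sum.cong_simp)
qed

lemma frag_extend_fun_add: "frag_extend (\<lambda>x. f x + g x) c = frag_extend f c + frag_extend g c"
  by (rule frag_induction[of c UNIV]) (simp_all add: frag_extend_diff)

lemma bd_keys:
  assumes "Poly_Mapping.keys c \<subseteq> Hom Box n k"
  shows "Poly_Mapping.keys (bd c) \<subseteq> Hom Box (n - 1) k"
  unfolding bd_def
proof (rule subset_trans[OF keys_frag_extend], rule UN_least)
  interpret Box: category Box by (rule category_Box)
  fix \<alpha> assume "\<alpha> \<in> Poly_Mapping.keys c"
  then have a: "\<alpha> \<in> Hom Box n k" using assms by blast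
  have fa: "cube_comp \<alpha> (face n (Suc j) b) \<in> Hom Box (n - 1) k" if "j < n" for j b
    using Box.Cmp_Hom[OF _ a, of "face n (Suc j) b" "n - 1"] cube_maps.face[of "Suc j" n b] that by (simp add: Hom_iff) (simp add: face_cmap)
  have "fst \<alpha> = n" using a by (simp add: Hom_iff)
  have "Poly_Mapping.keys (bterm \<alpha> j) \<subseteq> Hom Box (n - 1) k" if "j < n" for j
    unfolding bterm_def \<open>fst \<alpha> = n\<close> by (rule subset_trans[OF keys_diff]) (use fa[OF that] in simp)
  then show "Poly_Mapping.keys (\<Sum>j<fst \<alpha>. frag_cmul ((- 1) ^ Suc j) (bterm \<alpha> j)) \<subseteq> Hom Box (n - 1) k"
    using \<open>fst \<alpha> = n\<close> by (intro subset_trans[OF keys_sum] UN_least subset_trans[OF keys_cmul]) auto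
qed

lemma frag_extend_keys:
  assumes "\<And>\<alpha>. \<alpha> \<in> Poly_Mapping.keys c \<Longrightarrow> Poly_Mapping.keys (f \<alpha>) \<subseteq> S"
  shows "Poly_Mapping.keys (frag_extend f c) \<subseteq> S"
  using keys_frag_extend[of f c] assms by blast

text \<open>\<open>vadd_homotopy\<close> brings the first coordinate to 0, and induction contracts
  the others inside that face. In degree 0 the vertex with all coordinates 0 would remain, hence n >
  0; for k = 0 every map of positive degree is degenerate.\<close>

theorem contr_homotopy:
  assumes "\<alpha> \<in> Hom Box n k" "n > 0"
  shows "Deg (bd (contr k \<alpha>) + frag_extend (contr k) (bd (frag_of \<alpha>)) - frag_of \<alpha>)"
  using assms(1)
proof (induction k arbitrary: \<alpha>)
  case 0
  obtain f where f: "\<alpha> = cmap n 0 f" "cubical n 0 f" by (rule Box_Hom_cases[OF 0])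
  have "f xs = []" if "length xs = n" for xs using length_cubical[OF f(2) that] by simp
  then have "indep n f 0" by (auto simp: indep_def)
  then have "Deg (frag_of \<alpha>)" using assms(2) by (auto simp: f(1) Deg_simps dgn_cmap)
  moreover have "frag_extend (\<lambda>\<beta>. 0 :: chain) c = 0" for c :: chain by (rule frag_extend_eq_0) simp
  ultimately show ?case by (simp add: frag_simps(6) Deg_simps)
next
  case (Suc k)
  obtain f where f: "\<alpha> = cmap n (Suc k) f" "cubical n (Suc k) f" by (rule Box_Hom_cases[OF Suc.prems])
  let ?s = "cmap n k (\<lambda>xs. tl (f xs))" and ?d = "face (Suc k) (Suc 0) False"
  have s: "cube_comp (degen (Suc k) (Suc 0)) \<alpha> = ?s" "?s \<in> Hom Box n k"
    unfolding f(1) using degen1_cubical[OF f(2)] cmap_tl_Hom[OF f(2)] by simp_all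
  have b: "bd (contr (Suc k) \<alpha>) = bd (vadd \<alpha>) + postcomp ?d (bd (contr k ?s))"
    using s bd_postcomp_face[OF contr_keys[OF s(2)]] by (simp add: frag_simps)
  have e: "contr (Suc k) = (\<lambda>\<alpha>. vadd \<alpha> + postcomp ?d (contr k (cube_comp (degen (Suc k) (Suc 0)) \<alpha>)))"
    by (rule ext) simp
  have "frag_extend (contr (Suc k)) (bd (frag_of \<alpha>)) = frag_extend vadd (bd (frag_of \<alpha>))
      + frag_extend (\<lambda>\<alpha>. postcomp ?d (contr k (cube_comp (degen (Suc k) (Suc 0)) \<alpha>))) (bd (frag_of \<alpha>))"
    unfolding e by (rule frag_extend_fun_add)
  also have "frag_extend (\<lambda>\<alpha>. postcomp ?d (contr k (cube_comp (degen (Suc k) (Suc 0)) \<alpha>))) c = postcomp ?d (frag_extend (contr k) (frag_extend (\<lambda>\<alpha>. frag_of (cube_comp (degen (Suc k) (Suc 0)) \<alpha>)) c))" for c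
    by (rule frag_induction[of c UNIV]) (simp_all add: frag_simps frag_extend_diff)
  finally have c: "frag_extend (contr (Suc k)) (bd (frag_of \<alpha>)) = frag_extend vadd (bd (frag_of \<alpha>)) + postcomp ?d (frag_extend (contr k) (bd (frag_of ?s)))"
    using bd_postcomp_degen[OF f(2)] by (simp add: f(1) del: contr.simps)
  have r: "postcomp ?d (frag_of ?s) = frag_of (cmap n (Suc k) (\<lambda>xs. False # tl (f xs)))"
    unfolding frag_simps by (subst face1_comp) (use length_cubical[OF f(2)] in auto)
  \<comment> \<open>The degenerate error of the induction hypothesis. Pushed into the face it stays
    degenerate, and it adds up with the error made at the first coordinate.\<close>
  define w where "w = bd (contr k ?s) + frag_extend (contr k) (bd (frag_of ?s)) - frag_of ?s"
  have "Poly_Mapping.keys (bd (contr k ?s)) \<subseteq> Hom Box n k"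
    using bd_keys[OF contr_keys[OF s(2)]] by simp
  moreover have "Poly_Mapping.keys (frag_extend (contr k) (bd (frag_of ?s))) \<subseteq> Hom Box n k"
  proof (rule frag_extend_keys)
    fix \<beta> assume "\<beta> \<in> Poly_Mapping.keys (bd (frag_of ?s))"
    then have "\<beta> \<in> Hom Box (n - 1) k" using bd_keys[of "frag_of ?s" n k] s(2) by auto
    from contr_keys[OF this] show "Poly_Mapping.keys (contr k \<beta>) \<subseteq> Hom Box n k" using assms(2) by simp
  qed
  ultimately have wk: "Poly_Mapping.keys w \<subseteq> Hom Box n k"
    unfolding w_def using s(2) by (intro subset_trans[OF keys_diff] Un_least subset_trans[OF keys_add]) auto
  have "Deg (postcomp ?d w)" by (rule Deg_postcomp[OF _ wk]) (use Suc.IH[OF s(2)] in \<open>simp add: w_def\<close>)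
  moreover have "Deg (bd (vadd \<alpha>) + frag_extend vadd (bd (frag_of \<alpha>)) - (frag_of \<alpha> - postcomp ?d (frag_of ?s)))"
    unfolding r unfolding f(1) by (rule vadd_homotopy[OF f(2) assms(2)])
  ultimately have "Deg (bd (vadd \<alpha>) + frag_extend vadd (bd (frag_of \<alpha>)) - (frag_of \<alpha> - postcomp ?d (frag_of ?s)) + postcomp ?d w)"
    by (intro Deg_simps(2))
  also have "bd (vadd \<alpha>) + frag_extend vadd (bd (frag_of \<alpha>)) - (frag_of \<alpha> - postcomp ?d (frag_of ?s)) + postcomp ?d w
     = bd (contr (Suc k) \<alpha>) + frag_extend (contr (Suc k)) (bd (frag_of \<alpha>)) - frag_of \<alpha>"
    unfolding b c w_def frag_simps(8,11) by (simp add: algebra_simps)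
  finally show ?case .
qed

section \<open>Linear extension\<close>

context preadditive
begin

text \<open>A homomorphism from the free abelian group on S to a group of arrows. Its values on
  chains with keys in S are unique by \<open>lin_eqI\<close>, so the choice does no harm.\<close>

definition lin :: "'x set \<Rightarrow> 'o \<Rightarrow> 'o \<Rightarrow> ('x \<Rightarrow> 'm) \<Rightarrow> ('x \<Rightarrow>\<^sub>0 int) \<Rightarrow> 'm" where
  "lin S a b v = (SOME h. h \<in> hom (free_Abelian_group S) (hom_group A a b) \<and> (\<forall>x\<in>S. h (frag_of x) = v x))"

lemma lin_hom:
  assumes "a \<in> Obj A" "b \<in> Obj A" "\<And>x. x \<in> S \<Longrightarrow> v x \<in> Hom A a b"
  shows "lin S a b v \<in> hom (free_Abelian_group S) (hom_group A a b)" "x \<in> S \<Longrightarrow> lin S a b v (frag_of x) = v x"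
proof -
  interpret G: comm_group "hom_group A a b" by (rule hom_comm_group[OF assms(1,2)])
  have "v ` S \<subseteq> carrier (hom_group A a b)" using assms(3) by auto
  then obtain h where "h \<in> hom (free_Abelian_group S) (hom_group A a b)" "\<And>x. x \<in> S \<Longrightarrow> h (frag_of x) = v x"
    by (rule G.free_Abelian_group_universal) blast
  then have "\<exists>h. h \<in> hom (free_Abelian_group S) (hom_group A a b) \<and> (\<forall>x\<in>S. h (frag_of x) = v x)" by blast
  from someI_ex[OF this] show "lin S a b v \<in> hom (free_Abelian_group S) (hom_group A a b)" "x \<in> S \<Longrightarrow> lin S a b v (frag_of x) = v x"
    unfolding lin_def by blast+
qed

lemma Sub_group: "f \<in> Hom A a b \<Longrightarrow> g \<in> Hom A a b \<Longrightarrow> Sub A f g = f \<otimes>\<^bsub>hom_group A a b\<^esub> inv\<^bsub>hom_group A a b\<^esub> g"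
  by (simp add: Sub_def Neg_def Hom_iff)

lemma
  assumes "a \<in> Obj A" "b \<in> Obj A" "\<And>x. x \<in> S \<Longrightarrow> v x \<in> Hom A a b"
  shows lin_Hom: "Poly_Mapping.keys c \<subseteq> S \<Longrightarrow> lin S a b v c \<in> Hom A a b"
    and lin_0: "lin S a b v 0 = Zer A a b"
    and lin_add: "Poly_Mapping.keys c \<subseteq> S \<Longrightarrow> Poly_Mapping.keys d \<subseteq> S \<Longrightarrow> lin S a b v (c + d) = Add A (lin S a b v c) (lin S a b v d)"
    and lin_uminus: "Poly_Mapping.keys c \<subseteq> S \<Longrightarrow> lin S a b v (- c) = inv\<^bsub>hom_group A a b\<^esub> (lin S a b v c)"
    and lin_diff: "Poly_Mapping.keys c \<subseteq> S \<Longrightarrow> Poly_Mapping.keys d \<subseteq> S \<Longrightarrow> lin S a b v (c - d) = Sub A (lin S a b v c) (lin S a b v d)"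
proof -
  interpret G: comm_group "hom_group A a b" by (rule hom_comm_group[OF assms(1,2)])
  interpret h: group_hom "free_Abelian_group S" "hom_group A a b" "lin S a b v"
    using lin_hom(1)[OF assms] by (simp add: group_hom_def group_hom_axioms_def)
  have H: "Poly_Mapping.keys c \<subseteq> S \<Longrightarrow> lin S a b v c \<in> Hom A a b" for c using h.hom_closed[of c] by simp
  then show "Poly_Mapping.keys c \<subseteq> S \<Longrightarrow> lin S a b v c \<in> Hom A a b" .
  show "lin S a b v 0 = Zer A a b" using h.hom_one by simp
  have ad: "Poly_Mapping.keys c \<subseteq> S \<Longrightarrow> Poly_Mapping.keys d \<subseteq> S \<Longrightarrow> lin S a b v (c + d) = Add A (lin S a b v c) (lin S a b v d)" for c d
    using h.hom_mult[of c d] by simp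
  then show "Poly_Mapping.keys c \<subseteq> S \<Longrightarrow> Poly_Mapping.keys d \<subseteq> S \<Longrightarrow> lin S a b v (c + d) = Add A (lin S a b v c) (lin S a b v d)" .
  have um: "Poly_Mapping.keys c \<subseteq> S \<Longrightarrow> lin S a b v (- c) = inv\<^bsub>hom_group A a b\<^esub> (lin S a b v c)" for c
    using h.hom_inv[of c] by simp
  then show "Poly_Mapping.keys c \<subseteq> S \<Longrightarrow> lin S a b v (- c) = inv\<^bsub>hom_group A a b\<^esub> (lin S a b v c)" .
  show "Poly_Mapping.keys c \<subseteq> S \<Longrightarrow> Poly_Mapping.keys d \<subseteq> S \<Longrightarrow> lin S a b v (c - d) = Sub A (lin S a b v c) (lin S a b v d)"
    using ad[of c "- d"] um[of d] H[of c] H[of d] by (simp add: Sub_group)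
qed

text \<open>Compatibility with differences is asked for, since generators and differences are what
  induction on a free abelian group offers.\<close>

lemma lin_eqI:
  assumes c: "Poly_Mapping.keys c \<subseteq> S" and ab: "a \<in> Obj A" "b \<in> Obj A" and v: "\<And>x. x \<in> S \<Longrightarrow> v x \<in> Hom A a b"
    and h0: "h 0 = Zer A a b" and hd: "\<And>x y. Poly_Mapping.keys x \<subseteq> S \<Longrightarrow> Poly_Mapping.keys y \<subseteq> S \<Longrightarrow> h (x - y) = Sub A (h x) (h y)"
    and ho: "\<And>x. x \<in> S \<Longrightarrow> h (frag_of x) = v x"
  shows "h c = lin S a b v c"
proof (rule free_Abelian_group_induct[OF c])
  show "h 0 = lin S a b v 0" using h0 lin_0[where S=S and v=v, OF ab v] by simp
  show "h (x - y) = lin S a b v (x - y)"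
    if "Poly_Mapping.keys x \<subseteq> S" "Poly_Mapping.keys y \<subseteq> S" "h x = lin S a b v x" "h y = lin S a b v y" for x y
    using hd[OF that(1,2)] lin_diff[OF ab v that(1,2)] that(3,4) by simp
  show "h (frag_of x) = lin S a b v (frag_of x)" if "x \<in> S" for x
    using ho[OF that] lin_hom(2)[OF ab v that] by simp
qed

lemma lin_cong:
  assumes "Poly_Mapping.keys c \<subseteq> S" "a \<in> Obj A" "b \<in> Obj A" "\<And>x. x \<in> S \<Longrightarrow> v x \<in> Hom A a b" "\<And>x. x \<in> S \<Longrightarrow> v' x = v x"
  shows "lin S a b v' c = lin S a b v c"
proof (rule lin_eqI[OF assms(1-4)])
  have v': "v' x \<in> Hom A a b" if "x \<in> S" for x using assms(4,5)[OF that] by simp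
  show "lin S a b v' 0 = Zer A a b" by (rule lin_0[OF assms(2,3) v'])
  show "lin S a b v' (x - y) = Sub A (lin S a b v' x) (lin S a b v' y)" if "Poly_Mapping.keys x \<subseteq> S" "Poly_Mapping.keys y \<subseteq> S" for x y
    by (rule lin_diff[OF assms(2,3) v' that])
  show "lin S a b v' (frag_of x) = v x" if "x \<in> S" for x
    using lin_hom(2)[OF assms(2,3) v' that] assms(5)[OF that] by simp
qed

lemma Cmp_lin:
  assumes c: "Poly_Mapping.keys c \<subseteq> S" and ab: "a \<in> Obj A" "b \<in> Obj A" and v: "\<And>x. x \<in> S \<Longrightarrow> v x \<in> Hom A a b"
    and g: "g \<in> Hom A b b'"
  shows "Cmp A g (lin S a b v c) = lin S a b' (\<lambda>x. Cmp A g (v x)) c"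
proof (rule lin_eqI[OF c ab(1)])
  have b': "b' \<in> Obj A" "g \<in> Arr A" "Dom A g = b" "Cod A g = b'" using g by (auto simp: Hom_iff)
  note H = lin_Hom[OF ab v, unfolded Hom_iff]
  show "b' \<in> Obj A" by (rule b')
  show "Cmp A g (v x) \<in> Hom A a b'" if "x \<in> S" for x using v[OF that] b' by (simp add: Hom_iff)
  show "Cmp A g (lin S a b v 0) = Zer A a b'" using lin_0[where S=S and v=v, OF ab v] b' ab by simp
  show "Cmp A g (lin S a b v (x - y)) = Sub A (Cmp A g (lin S a b v x)) (Cmp A g (lin S a b v y))"
    if "Poly_Mapping.keys x \<subseteq> S" "Poly_Mapping.keys y \<subseteq> S" for x y
    using lin_diff[OF ab v that] H[OF _ that(1)] H[OF _ that(2)] b' by (simp add: Cmp_Sub_right)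
  show "Cmp A g (lin S a b v (frag_of x)) = Cmp A g (v x)" if "x \<in> S" for x using lin_hom(2)[OF ab v that] by simp
qed

lemma lin_Cmp:
  assumes c: "Poly_Mapping.keys c \<subseteq> S" and ab: "a \<in> Obj A" "b \<in> Obj A" and v: "\<And>x. x \<in> S \<Longrightarrow> v x \<in> Hom A a b"
    and g: "g \<in> Hom A a' a"
  shows "Cmp A (lin S a b v c) g = lin S a' b (\<lambda>x. Cmp A (v x) g) c"
proof (rule lin_eqI[OF c _ ab(2)])
  have b': "a' \<in> Obj A" "g \<in> Arr A" "Dom A g = a'" "Cod A g = a" using g by (auto simp: Hom_iff)
  note H = lin_Hom[OF ab v, unfolded Hom_iff]
  show "a' \<in> Obj A" by (rule b')
  show "Cmp A (v x) g \<in> Hom A a' b" if "x \<in> S" for x using v[OF that] b' by (simp add: Hom_iff)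
  show "Cmp A (lin S a b v 0) g = Zer A a' b" using lin_0[where S=S and v=v, OF ab v] b' ab by simp
  show "Cmp A (lin S a b v (x - y)) g = Sub A (Cmp A (lin S a b v x) g) (Cmp A (lin S a b v y) g)"
    if "Poly_Mapping.keys x \<subseteq> S" "Poly_Mapping.keys y \<subseteq> S" for x y
    using lin_diff[OF ab v that] H[OF _ that(1)] H[OF _ that(2)] b' by (simp add: Cmp_Sub_left)
  show "Cmp A (lin S a b v (frag_of x)) g = Cmp A (v x) g" if "x \<in> S" for x using lin_hom(2)[OF ab v that] by simp
qed

lemma lin_frag_extend:
  assumes c: "Poly_Mapping.keys c \<subseteq> S" and ab: "a \<in> Obj A" "b \<in> Obj A" and v: "\<And>x. x \<in> S' \<Longrightarrow> v x \<in> Hom A a b"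
    and \<phi>: "\<And>x. x \<in> S \<Longrightarrow> Poly_Mapping.keys (\<phi> x) \<subseteq> S'"
  shows "lin S' a b v (frag_extend \<phi> c) = lin S a b (\<lambda>x. lin S' a b v (\<phi> x)) c"
proof (rule lin_eqI[OF c ab])
  have k: "Poly_Mapping.keys (frag_extend \<phi> x) \<subseteq> S'" if "Poly_Mapping.keys x \<subseteq> S" for x
    by (rule frag_extend_keys) (use that \<phi> in blast)
  show "lin S' a b v (\<phi> x) \<in> Hom A a b" if "x \<in> S" for x by (rule lin_Hom[OF ab v \<phi>[OF that]])
  show "lin S' a b v (frag_extend \<phi> 0) = Zer A a b" using lin_0[where S=S' and v=v, OF ab v] by simp
  show "lin S' a b v (frag_extend \<phi> (x - y)) = Sub A (lin S' a b v (frag_extend \<phi> x)) (lin S' a b v (frag_extend \<phi> y))"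
    if "Poly_Mapping.keys x \<subseteq> S" "Poly_Mapping.keys y \<subseteq> S" for x y
    unfolding frag_extend_diff by (rule lin_diff[OF ab v k[OF that(1)] k[OF that(2)]])
  show "lin S' a b v (frag_extend \<phi> (frag_of x)) = lin S' a b v (\<phi> x)" for x by simp
qed

lemma lin_sum:
  assumes ab: "a \<in> Obj A" "b \<in> Obj A" and v: "\<And>x. x \<in> S \<Longrightarrow> v x \<in> Hom A a b"
    and I: "finite I" and g: "\<And>i. i \<in> I \<Longrightarrow> Poly_Mapping.keys (g i) \<subseteq> S"
  shows "lin S a b v (sum g I) = (\<Otimes>\<^bsub>hom_group A a b\<^esub>i\<in>I. lin S a b v (g i))"
proof -
  interpret G: comm_group "hom_group A a b" by (rule hom_comm_group[OF ab])
  show ?thesis using I g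
proof (induction I)
  case empty
  then show ?case using lin_0[where S=S and v=v, OF ab v] by simp
next
  case (insert i I)
  have la: "Poly_Mapping.keys c \<subseteq> S \<Longrightarrow> Poly_Mapping.keys d \<subseteq> S \<Longrightarrow> lin S a b v (c + d) = Add A (lin S a b v c) (lin S a b v d)" for c d
    by (rule lin_add[OF ab v])
  have lh: "Poly_Mapping.keys c \<subseteq> S \<Longrightarrow> lin S a b v c \<in> Hom A a b" for c by (rule lin_Hom[OF ab v])
  have "Poly_Mapping.keys (sum g I) \<subseteq> S" using insert by (intro subset_trans[OF keys_sum]) blast
  moreover have "(\<lambda>i. lin S a b v (g i)) \<in> I \<rightarrow> carrier (hom_group A a b)" "lin S a b v (g i) \<in> carrier (hom_group A a b)"
    using insert.prems lh by auto
  ultimately show ?case using insert la[of "g i" "sum g I"] by simp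
qed
qed

text \<open>The signs in \<open>boundary\<close> are integer powers in a multiplicatively written
  group; only the exponents 1 and -1 occur.\<close>

lemma lin_sign:
  assumes ab: "a \<in> Obj A" "b \<in> Obj A" and v: "\<And>x. x \<in> S \<Longrightarrow> v x \<in> Hom A a b" and c: "Poly_Mapping.keys c \<subseteq> S"
  shows "lin S a b v (frag_cmul ((-1) ^ i) c) = lin S a b v c [^]\<^bsub>hom_group A a b\<^esub> ((-1::int) ^ i)"
proof -
  interpret G: comm_group "hom_group A a b" by (rule hom_comm_group[OF ab])
  have H: "lin S a b v c \<in> carrier (hom_group A a b)" using lin_Hom[OF ab v c] by simp
  show ?thesis
  proof (cases "even i")
    case True
    then show ?thesis using G.int_pow_1[OF H] by simp
  next
    case False
    then show ?thesis using lin_uminus[OF ab v c] G.int_pow_neg[OF H, of 1] G.int_pow_1[OF H] by simp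
  qed
qed

end

section \<open>The category of elements\<close>

lemma opc_simps [simp]: "Obj (opc C) = Obj C" "Arr (opc C) = Arr C" "Dom (opc C) = Cod C" "Cod (opc C) = Dom C"
  "Ide (opc C) = Ide C" "Cmp (opc C) g f = Cmp C f g"
  by (simp_all add: opc_def)

lemma elts_simps [simp]:
  "(n, x) \<in> Obj (elts X) \<longleftrightarrow> x \<in> cells X n"
  "((m, y), \<alpha>, (n, x)) \<in> Arr (elts X) \<longleftrightarrow> \<alpha> \<in> Hom Box m n \<and> x \<in> cells X n \<and> y = act X \<alpha> x"
  "Dom (elts X) (u, \<alpha>, w) = u" "Cod (elts X) (u, \<alpha>, w) = w"
  "Ide (elts X) (n, x) = ((n, x), cube_id n, (n, x))"
  "Cmp (elts X) (u', \<beta>, z) (u, \<alpha>, w) = (u, cube_comp \<beta> \<alpha>, z)"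
  by (simp_all add: elts_def)

lemma cubical_setD:
  assumes "is_cubical_set X"
  shows "\<alpha> \<in> Hom Box m n \<Longrightarrow> x \<in> cells X n \<Longrightarrow> act X \<alpha> x \<in> cells X m"
    "x \<in> cells X n \<Longrightarrow> act X (cube_id n) x = x"
    "\<alpha> \<in> Hom Box l m \<Longrightarrow> \<beta> \<in> Hom Box m n \<Longrightarrow> x \<in> cells X n \<Longrightarrow> act X (cube_comp \<beta> \<alpha>) x = act X \<alpha> (act X \<beta> x)"
  using assms by (auto simp: is_cubical_set_def Hom_iff Pi_iff)

lemma cube_id_Hom: "cube_id n \<in> Hom Box n n"
  using category.Ide_Hom[OF category_Box, of n] by simp

lemma cube_comp_Hom: "\<alpha> \<in> Hom Box l m \<Longrightarrow> \<beta> \<in> Hom Box m n \<Longrightarrow> cube_comp \<beta> \<alpha> \<in> Hom Box l n"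
  using category.Cmp_Hom[OF category_Box, of \<alpha> l m \<beta> n] by simp

lemma cube_comp_id: "\<alpha> \<in> Hom Box m n \<Longrightarrow> cube_comp \<alpha> (cube_id m) = \<alpha>" "\<alpha> \<in> Hom Box m n \<Longrightarrow> cube_comp (cube_id n) \<alpha> = \<alpha>"
  using category.Cmp_Ide[OF category_Box, of \<alpha> m n] category.Ide_Cmp[OF category_Box, of \<alpha> m n] by simp_all

lemma cube_comp_assoc: "\<alpha> \<in> Hom Box k l \<Longrightarrow> \<beta> \<in> Hom Box l m \<Longrightarrow> \<gamma> \<in> Hom Box m n \<Longrightarrow>
    cube_comp (cube_comp \<gamma> \<beta>) \<alpha> = cube_comp \<gamma> (cube_comp \<beta> \<alpha>)"
  using category.Cmp_assoc[OF category_Box, of \<alpha> k l \<beta> m \<gamma> n] by simp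

lemma face_Hom: "1 \<le> i \<Longrightarrow> i \<le> n \<Longrightarrow> face n i b \<in> Hom Box (n - 1) n"
  using cube_maps.face[of i n b] by (simp add: Hom_iff) (simp add: face_cmap)

lemma degen_Hom: "1 \<le> i \<Longrightarrow> i \<le> n \<Longrightarrow> degen n i \<in> Hom Box n (n - 1)"
  using cube_maps.degen[of i n] by (simp add: Hom_iff) (simp add: degen_cmap)

lemma elts_Hom_cases:
  assumes "f \<in> Hom (elts X) a b"
  obtains m n \<alpha> x where "a = (m, act X \<alpha> x)" "b = (n, x)" "f = ((m, act X \<alpha> x), \<alpha>, (n, x))" "\<alpha> \<in> Hom Box m n" "x \<in> cells X n"
proof -
  obtain m y \<alpha> n x where f: "f = ((m, y), \<alpha>, (n, x))" by (metis prod.collapse)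
  have "\<alpha> \<in> Hom Box m n" "x \<in> cells X n" "y = act X \<alpha> x" "a = (m, y)" "b = (n, x)"
    using assms unfolding f Hom_iff[of _ "elts X"] by auto
  then show ?thesis using that f by simp
qed

lemma elts_HomI: "\<alpha> \<in> Hom Box m n \<Longrightarrow> x \<in> cells X n \<Longrightarrow> y = act X \<alpha> x \<Longrightarrow>
    ((m, y), \<alpha>, (n, x)) \<in> Hom (elts X) (m, y) (n, x)"
  by (simp add: Hom_iff[of _ "elts X"])

lemma category_elts:
  assumes X: "is_cubical_set X" shows "category (elts X)"
proof
  fix f assume "f \<in> Arr (elts X)"
  then have "f \<in> Hom (elts X) (Dom (elts X) f) (Cod (elts X) f)" by (simp add: Hom_iff[of _ "elts X"])
  then show "Dom (elts X) f \<in> Obj (elts X)" "Cod (elts X) f \<in> Obj (elts X)"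
    using cubical_setD(1)[OF X] by (auto elim!: elts_Hom_cases)
next
  fix a assume a: "a \<in> Obj (elts X)"
  obtain n x where "a = (n, x)" by (cases a)
  then show "Ide (elts X) a \<in> Hom (elts X) a a"
    using a cubical_setD(2)[OF X] elts_HomI[OF cube_id_Hom, of x X n x] by simp
next
  fix f g a b c assume f: "f \<in> Hom (elts X) a b" and g: "g \<in> Hom (elts X) b c"
  show "Cmp (elts X) g f \<in> Hom (elts X) a c"
    using g by (rule elts_Hom_cases, use f in \<open>elim elts_Hom_cases\<close>)
      (auto intro!: elts_HomI cube_comp_Hom cubical_setD(3)[OF X, symmetric])
next
  fix f a b assume f: "f \<in> Hom (elts X) a b"
  show "Cmp (elts X) f (Ide (elts X) a) = f" "Cmp (elts X) (Ide (elts X) b) f = f"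
    using f by (auto elim!: elts_Hom_cases simp: cube_comp_id)
next
  fix f g h a b c d assume f: "f \<in> Hom (elts X) a b" and g: "g \<in> Hom (elts X) b c" and h: "h \<in> Hom (elts X) c d"
  show "Cmp (elts X) h (Cmp (elts X) g f) = Cmp (elts X) (Cmp (elts X) h g) f"
    using h by (rule elts_Hom_cases, use g in \<open>elim elts_Hom_cases\<close>, use f in \<open>elim elts_Hom_cases\<close>)
      (auto simp: cube_comp_assoc)
qed

section \<open>Smallness of the category of elements\<close>

definition cube_code :: "cube_map \<Rightarrow> nat" where
  "cube_code = (\<lambda>(m, n, f). to_nat (m, n, map f (List.n_lists m [False, True])))"

text \<open>The dimensions and the values on the finitely many points determine a cube map, so the
  cube category has countably many arrows.\<close>

lemma inj_on_cube_code: "inj_on cube_code cube_maps"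
proof (rule inj_onI)
  fix \<alpha> \<beta> assume a: "\<alpha> \<in> cube_maps" and b: "\<beta> \<in> cube_maps" and e: "cube_code \<alpha> = cube_code \<beta>"
  obtain m n f where f: "\<alpha> = cmap m n f" using cube_maps_cubical[OF a] by blast
  obtain m' n' g where g: "\<beta> = cmap m' n' g" using cube_maps_cubical[OF b] by blast
  have "(m, n, map (restrict f (cube m)) (List.n_lists m [False, True])) = (m', n', map (restrict g (cube m')) (List.n_lists m' [False, True]))"
    using e unfolding f g cube_code_def cmap_def prod.case by (rule injD[OF inj_to_nat])
  then have c: "m = m' \<and> n = n' \<and> map (restrict f (cube m)) (List.n_lists m [False, True]) = map (restrict g (cube m')) (List.n_lists m' [False, True])"
    unfolding prod.inject .
  note mn = c[THEN conjunct1] c[THEN conjunct2, THEN conjunct1] and mp' = c[THEN conjunct2, THEN conjunct2]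
  note mp = mp'[folded mn(1)]
  have "f xs = g xs" if "length xs = m" for xs
  proof -
    have "xs \<in> set (List.n_lists m [False, True])" using that by (auto simp: set_n_lists)
    then have "restrict f (cube m) xs = restrict g (cube m) xs" using mp unfolding map_eq_conv by blast
    then show ?thesis using that by simp
  qed
  then show "\<alpha> = \<beta>" using mn by (simp add: f g cmap_eq_iff)
qed

lemma inj_nat_times:
  assumes "infinite (UNIV :: 's set)"
  obtains g :: "nat \<times> 's \<Rightarrow> 's" where "inj g"
proof -
  have "(card_of (UNIV :: nat set), card_of (UNIV :: 's set)) \<in> ordLeq"
    using assms infinite_iff_card_of_nat by blast
  then have "(card_of ((UNIV :: nat set) \<times> (UNIV :: 's set)), card_of (UNIV :: 's set)) \<in> ordLeq"
    using assms by (intro card_of_Times_ordLeq_infinite) (auto intro: card_of_refl ordIso_imp_ordLeq)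
  then have "\<exists>g. inj_on g ((UNIV :: nat set) \<times> (UNIV :: 's set)) \<and> g ` ((UNIV :: nat set) \<times> (UNIV :: 's set)) \<subseteq> (UNIV :: 's set)"
    unfolding card_of_ordLeq .
  then show ?thesis using that by (auto simp: UNIV_Times_UNIV)
qed

text \<open>An arrow is determined by its cube map and its target element, hence by a natural number
  and an element of 's; an infinite type absorbs the factor \<open>nat\<close>.\<close>

lemma small_elts:
  fixes X :: "'s cset"
  assumes inf: "infinite (UNIV :: 's set)"
  shows "small (s :: 's itself) (Arr (elts X))"
proof -
  obtain g :: "nat \<times> 's \<Rightarrow> 's" where g: "inj g" by (rule inj_nat_times[OF inf])
  have "inj_on (\<lambda>(u, \<alpha>, (n, x)). g (cube_code \<alpha>, x)) (Arr (elts X))"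
  proof (rule inj_onI)
    fix p q assume p: "p \<in> Arr (elts X)" and q: "q \<in> Arr (elts X)"
      and e: "(\<lambda>(u, \<alpha>, (n, x)). g (cube_code \<alpha>, x)) p = (\<lambda>(u, \<alpha>, (n, x)). g (cube_code \<alpha>, x)) q"
    obtain m y \<alpha> n x where p': "p = ((m, y), \<alpha>, (n, x))" by (metis prod.collapse)
    obtain m' y' \<alpha>' n' x' where q': "q = ((m', y'), \<alpha>', (n', x'))" by (metis prod.collapse)
    have "cube_code \<alpha> = cube_code \<alpha>'" "x = x'" using e g by (auto simp: p' q' dest: injD)
    moreover have "\<alpha> \<in> cube_maps" "\<alpha>' \<in> cube_maps" using p q by (auto simp: p' q' Hom_iff)
    ultimately have "\<alpha> = \<alpha>'" using inj_on_cube_code by (auto dest: inj_onD)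
    then show "p = q" using p q \<open>x = x'\<close> by (auto simp: p' q' Hom_iff)
  qed
  then show ?thesis unfolding small_def by blast
qed

section \<open>Cubical chains with coefficients\<close>

locale cubical_coefficients = AB4 A s for A :: "('o, 'm, 'z) pcat_scheme" and s :: "'s itself" +
  fixes X :: "'s cset"
  assumes X: "is_cubical_set X"

text \<open>Coefficients are contravariant on the category of elements, so satellites and colimits
  are formed over its opposite.\<close>

sublocale cubical_coefficients \<subseteq> small_functor_category "opc (elts X)" A s
proof -
  interpret C: category "opc (elts X)" by (rule category_opc[OF category_elts[OF X]])
  show "small_functor_category (opc (elts X)) A s"
    by unfold_locales (use small_elts[OF infinite] in simp)
qed

context cubical_coefficients
begin

abbreviation CX where "CX \<equiv> opc (elts X)"

lemma lift_Arr:
  assumes "\<alpha> \<in> Hom Box m n" "x \<in> cells X n"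
  shows "lift X \<alpha> x \<in> Arr CX" "Dom CX (lift X \<alpha> x) = (n, x)" "Cod CX (lift X \<alpha> x) = (m, act X \<alpha> x)"
    "lift X \<alpha> x = ((m, act X \<alpha> x), \<alpha>, (n, x))"
  using assms by (auto simp: lift_def Hom_iff)

lemma far_lift:
  assumes F: "is_functor CX A F" and a: "\<alpha> \<in> Hom Box m n" "x \<in> cells X n"
  shows "far F (lift X \<alpha> x) \<in> Arr A" "Dom A (far F (lift X \<alpha> x)) = fob F (n, x)" "Cod A (far F (lift X \<alpha> x)) = fob F (m, act X \<alpha> x)"
  using functorD(2-4)[OF F lift_Arr(1)[OF a]] unfolding lift_Arr(2,3)[OF a] .

lemma lift_id: "x \<in> cells X n \<Longrightarrow> lift X (cube_id n) x = Ide CX (n, x)"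
  using cubical_setD(2)[OF X, of x n] by (simp add: lift_Arr(4)[OF cube_id_Hom])

lemma far_lift_id:
  assumes F: "is_functor CX A F" and x: "x \<in> cells X n"
  shows "far F (lift X (cube_id n) x) = Ide A (fob F (n, x))"
  unfolding lift_id[OF x] by (rule functorD(5)[OF F]) (use x in simp)

lemma lift_comp:
  assumes a: "\<alpha> \<in> Hom Box l m" and b: "\<beta> \<in> Hom Box m n" and x: "x \<in> cells X n"
  shows "lift X (cube_comp \<beta> \<alpha>) x = Cmp CX (lift X \<alpha> (act X \<beta> x)) (lift X \<beta> x)"
  using cubical_setD(1)[OF X b x] cubical_setD(3)[OF X a b x]
  by (simp add: lift_Arr(4)[OF cube_comp_Hom[OF a b] x] lift_Arr(4)[OF a] lift_Arr(4)[OF b x])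

lemma far_lift_comp:
  assumes F: "is_functor CX A F" and a: "\<alpha> \<in> Hom Box l m" and b: "\<beta> \<in> Hom Box m n" and x: "x \<in> cells X n"
  shows "far F (lift X (cube_comp \<beta> \<alpha>) x) = Cmp A (far F (lift X \<alpha> (act X \<beta> x))) (far F (lift X \<beta> x))"
proof -
  note lb = lift_Arr(1-3)[OF b x] and la = lift_Arr(1-3)[OF a cubical_setD(1)[OF X b x]]
  show ?thesis unfolding lift_comp[OF a b x] by (rule functorD(6)[OF F lb(1) la(1)]) (simp only: lb(3) la(2))
qed

section \<open>The cubical object of chains\<close>

lemma fam_cells: "is_functor CX A F \<Longrightarrow> fam (cells X n) (\<lambda>x. fob F (n, x))"
  by (rule fam_self) (simp add: functorD(1))

lemma chain_Obj: "is_functor CX A F \<Longrightarrow> chain A X F n \<in> Obj A"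
  unfolding chain_def by (rule coprod_Obj[OF fam_cells])

lemma chain_in:
  assumes "is_functor CX A F" "x \<in> cells X n"
  shows "chain_in A X F n x \<in> Arr A" "Dom A (chain_in A X F n x) = fob F (n, x)" "Cod A (chain_in A X F n x) = chain A X F n"
  using coprod_in[OF fam_cells[OF assms(1)] assms(2)] by (simp_all add: chain_in_def chain_def)

lemma chain_ext:
  assumes F: "is_functor CX A F" and u: "u \<in> Arr A" "v \<in> Arr A" "Dom A u = chain A X F n" "Dom A v = chain A X F n" "Cod A u = Cod A v"
    and eq: "\<And>x. x \<in> cells X n \<Longrightarrow> Cmp A u (chain_in A X F n x) = Cmp A v (chain_in A X F n x)"
  shows "u = v"
  by (rule coprod_ext[OF fam_cells[OF F], of u v n]) (use u eq in \<open>simp_all add: chain_def chain_in_def\<close>)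

lemma chain_map:
  assumes F: "is_functor CX A F" and a: "\<alpha> \<in> Hom Box m n"
  shows "chain_map A X F \<alpha> \<in> Arr A" "Dom A (chain_map A X F \<alpha>) = chain A X F n" "Cod A (chain_map A X F \<alpha>) = chain A X F m"
    "x \<in> cells X n \<Longrightarrow> Cmp A (chain_map A X F \<alpha>) (chain_in A X F n x) = Cmp A (chain_in A X F m (act X \<alpha> x)) (far F (lift X \<alpha> x))"
proof -
  have mn: "Dom Box \<alpha> = m" "Cod Box \<alpha> = n" using a by (simp_all add: Hom_iff)
  have "\<forall>x\<in>cells X n. Cmp A (chain_in A X F m (act X \<alpha> x)) (far F (lift X \<alpha> x)) \<in> Hom A (fob F (n, x)) (chain A X F m)"
    using far_lift[OF F a] chain_in[OF F cubical_setD(1)[OF X a]] by (simp add: Hom_iff)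
  note c = copair[OF fam_cells[OF F] chain_Obj[OF F] this]
  show "chain_map A X F \<alpha> \<in> Arr A" "Dom A (chain_map A X F \<alpha>) = chain A X F n" "Cod A (chain_map A X F \<alpha>) = chain A X F m"
    "x \<in> cells X n \<Longrightarrow> Cmp A (chain_map A X F \<alpha>) (chain_in A X F n x) = Cmp A (chain_in A X F m (act X \<alpha> x)) (far F (lift X \<alpha> x))"
    unfolding chain_map_def mn using c by (simp_all add: chain_def chain_in_def)
qed

lemma chain_map_Hom: "is_functor CX A F \<Longrightarrow> \<alpha> \<in> Hom Box m n \<Longrightarrow> chain_map A X F \<alpha> \<in> Hom A (chain A X F n) (chain A X F m)"
  using chain_map(1-3)[of F \<alpha> m n] by (simp add: Hom_iff[of _ A])

lemma chain_map_id: assumes F: "is_functor CX A F" shows "chain_map A X F (cube_id n) = Ide A (chain A X F n)"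
  by (rule chain_ext[OF F, of _ _ n])
     (use chain_map[OF F cube_id_Hom[of n]] chain_in[OF F] chain_Obj[OF F] far_lift_id[OF F] cubical_setD(2)[OF X] functorD(1)[OF F] in simp_all)

lemma chain_map_comp:
  assumes F: "is_functor CX A F" and a: "\<alpha> \<in> Hom Box l m" and b: "\<beta> \<in> Hom Box m n"
  shows "chain_map A X F (cube_comp \<beta> \<alpha>) = Cmp A (chain_map A X F \<alpha>) (chain_map A X F \<beta>)"
proof (rule chain_ext[OF F, of _ _ n])
  note ab = cube_comp_Hom[OF a b]
  note A1 = chain_map[OF F a] and B1 = chain_map[OF F b] and AB1 = chain_map[OF F ab]
  fix x assume x: "x \<in> cells X n"
  note bx = cubical_setD(1)[OF X b x] and e = cubical_setD(3)[OF X a b x]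
  note abx = cubical_setD(1)[OF X a bx]
  show "Cmp A (chain_map A X F (cube_comp \<beta> \<alpha>)) (chain_in A X F n x) = Cmp A (Cmp A (chain_map A X F \<alpha>) (chain_map A X F \<beta>)) (chain_in A X F n x)"
    using AB1(4)[OF x] A1(1-3) B1(1-3) B1(4)[OF x] Cmp_eq_extend[OF A1(4)[OF bx], of "far F (lift X \<beta> x)"]
      far_lift[OF F a bx] far_lift[OF F b x] far_lift_comp[OF F a b x] chain_in[OF F x] chain_in[OF F bx] chain_in[OF F abx] e by simp
qed (use chain_map(1-3)[OF F a] chain_map(1-3)[OF F b] chain_map(1-3)[OF F cube_comp_Hom[OF a b]] in simp_all)

text \<open>A natural family of arrows \<open>a \<rightarrow> C\<^sub>n(X,F)\<close> indexed by the cube maps \<open>\<alpha> : n \<rightarrow> k\<close> extends linearly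
  to integral combinations of such maps, and identities between these become identities of arrows.\<close>

definition natfam :: "('s, 'o, 'm) csystem \<Rightarrow> 'o \<Rightarrow> nat \<Rightarrow> (cube_map \<Rightarrow> 'm) \<Rightarrow> bool" where
  "natfam F a k v \<longleftrightarrow> is_functor CX A F \<and> a \<in> Obj A \<and>
     (\<forall>n. \<forall>\<alpha>\<in>Hom Box n k. v \<alpha> \<in> Hom A a (chain A X F n) \<and>
        (\<forall>m. \<forall>\<beta>\<in>Hom Box m n. Cmp A (chain_map A X F \<beta>) (v \<alpha>) = v (cube_comp \<alpha> \<beta>)))"

definition comb :: "('s, 'o, 'm) csystem \<Rightarrow> 'o \<Rightarrow> nat \<Rightarrow> (cube_map \<Rightarrow> 'm) \<Rightarrow> nat \<Rightarrow> (cube_map \<Rightarrow>\<^sub>0 int) \<Rightarrow> 'm" where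
  "comb F a k v n = lin (Hom Box n k) a (chain A X F n) v"

lemma natfamD:
  assumes "natfam F a k v"
  shows "is_functor CX A F" "a \<in> Obj A" "\<alpha> \<in> Hom Box n k \<Longrightarrow> v \<alpha> \<in> Hom A a (chain A X F n)"
    "\<alpha> \<in> Hom Box n k \<Longrightarrow> \<beta> \<in> Hom Box m n \<Longrightarrow> Cmp A (chain_map A X F \<beta>) (v \<alpha>) = v (cube_comp \<alpha> \<beta>)"
  using assms by (simp_all add: natfam_def)

text \<open>The family behind boundaries and normalization; the second one in use is
  \<open>chain_free_in\<close>.\<close>

lemma natfam_chain_map: "is_functor CX A F \<Longrightarrow> natfam F (chain A X F k) k (chain_map A X F)"
  unfolding natfam_def by (auto simp: chain_Obj chain_map_Hom chain_map_comp)

lemma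
  assumes v: "natfam F a k v"
  shows comb_Hom: "Poly_Mapping.keys c \<subseteq> Hom Box n k \<Longrightarrow> comb F a k v n c \<in> Hom A a (chain A X F n)"
    and comb_0: "comb F a k v n 0 = Zer A a (chain A X F n)"
    and comb_diff: "Poly_Mapping.keys c \<subseteq> Hom Box n k \<Longrightarrow> Poly_Mapping.keys d \<subseteq> Hom Box n k \<Longrightarrow> comb F a k v n (c - d) = Sub A (comb F a k v n c) (comb F a k v n d)"
    and comb_add: "Poly_Mapping.keys c \<subseteq> Hom Box n k \<Longrightarrow> Poly_Mapping.keys d \<subseteq> Hom Box n k \<Longrightarrow> comb F a k v n (c + d) = Add A (comb F a k v n c) (comb F a k v n d)"
    and comb_of: "\<alpha> \<in> Hom Box n k \<Longrightarrow> comb F a k v n (frag_of \<alpha>) = v \<alpha>"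
proof -
  note P = natfamD(2)[OF v] chain_Obj[OF natfamD(1)[OF v], of n]
  have V: "\<And>x. x \<in> Hom Box n k \<Longrightarrow> v x \<in> Hom A a (chain A X F n)" by (rule natfamD(3)[OF v])
  show "Poly_Mapping.keys c \<subseteq> Hom Box n k \<Longrightarrow> comb F a k v n c \<in> Hom A a (chain A X F n)"
    unfolding comb_def by (rule lin_Hom[OF P V])
  show "comb F a k v n 0 = Zer A a (chain A X F n)"
    unfolding comb_def by (rule lin_0[OF P V])
  show "Poly_Mapping.keys c \<subseteq> Hom Box n k \<Longrightarrow> Poly_Mapping.keys d \<subseteq> Hom Box n k \<Longrightarrow> comb F a k v n (c - d) = Sub A (comb F a k v n c) (comb F a k v n d)"
    unfolding comb_def by (rule lin_diff[OF P V])
  show "Poly_Mapping.keys c \<subseteq> Hom Box n k \<Longrightarrow> Poly_Mapping.keys d \<subseteq> Hom Box n k \<Longrightarrow> comb F a k v n (c + d) = Add A (comb F a k v n c) (comb F a k v n d)"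
    unfolding comb_def by (rule lin_add[OF P V])
  show "\<alpha> \<in> Hom Box n k \<Longrightarrow> comb F a k v n (frag_of \<alpha>) = v \<alpha>"
    unfolding comb_def by (rule lin_hom(2)[OF P V])
qed

text \<open>The bilinear form of naturality: composing with the arrow of a combination w replaces
  each cube map \<alpha> in c by the combination of its composites with the maps in w. The boundary
  and the normalizing idempotent are both arrows of this kind.\<close>

lemma lin_chain_map_comb:
  assumes v: "natfam F a k v" and w: "Poly_Mapping.keys w \<subseteq> Hom Box m n" and c: "Poly_Mapping.keys c \<subseteq> Hom Box n k"
  shows "Cmp A (comb F (chain A X F n) n (chain_map A X F) m w) (comb F a k v n c) = comb F a k v m (frag_extend (\<lambda>\<alpha>. postcomp \<alpha> w) c)"
proof -
  note F = natfamD(1)[OF v] and a = natfamD(2)[OF v]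
  note cO = chain_Obj[OF F]
  have V: "\<And>x. x \<in> Hom Box i k \<Longrightarrow> v x \<in> Hom A a (chain A X F i)" for i by (rule natfamD(3)[OF v])
  have k: "Poly_Mapping.keys (postcomp \<alpha> w) \<subseteq> Hom Box m k" if "\<alpha> \<in> Hom Box n k" for \<alpha>
    unfolding postcomp_def
  proof (rule frag_extend_keys)
    fix \<beta> assume "\<beta> \<in> Poly_Mapping.keys w"
    then have "\<beta> \<in> Hom Box m n" using w by blast
    from cube_comp_Hom[OF this that] show "Poly_Mapping.keys (frag_of (cube_comp \<alpha> \<beta>)) \<subseteq> Hom Box m k" by simp
  qed
  have 1: "Cmp A (comb F (chain A X F n) n (chain_map A X F) m w) (v \<alpha>) = comb F a k v m (postcomp \<alpha> w)" if al: "\<alpha> \<in> Hom Box n k" for \<alpha>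
  proof -
    have "Cmp A (comb F (chain A X F n) n (chain_map A X F) m w) (v \<alpha>) = lin (Hom Box m n) a (chain A X F m) (\<lambda>\<beta>. Cmp A (chain_map A X F \<beta>) (v \<alpha>)) w"
      unfolding comb_def by (rule lin_Cmp[OF w cO cO chain_map_Hom[OF F] V[OF al]])
    also have "\<dots> = lin (Hom Box m n) a (chain A X F m) (\<lambda>\<beta>. comb F a k v m (frag_of (cube_comp \<alpha> \<beta>))) w"
    proof (rule lin_cong[OF w a cO])
      fix \<beta> assume b: "\<beta> \<in> Hom Box m n"
      note ab = cube_comp_Hom[OF b al]
      show "comb F a k v m (frag_of (cube_comp \<alpha> \<beta>)) \<in> Hom A a (chain A X F m)" using comb_of[OF v ab] V[OF ab] by simp
      show "Cmp A (chain_map A X F \<beta>) (v \<alpha>) = comb F a k v m (frag_of (cube_comp \<alpha> \<beta>))" using comb_of[OF v ab] natfamD(4)[OF v al b] by simp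
    qed
    also have "\<dots> = comb F a k v m (postcomp \<alpha> w)"
      unfolding comb_def postcomp_def by (rule lin_frag_extend[OF w a cO V, symmetric], assumption, drule cube_comp_Hom[OF _ al], simp)
    finally show ?thesis .
  qed
  have "Cmp A (comb F (chain A X F n) n (chain_map A X F) m w) (comb F a k v n c) = lin (Hom Box n k) a (chain A X F m) (\<lambda>\<alpha>. Cmp A (comb F (chain A X F n) n (chain_map A X F) m w) (v \<alpha>)) c"
    unfolding comb_def[of F a] by (rule Cmp_lin[OF c a cO V comb_Hom[OF natfam_chain_map[OF F] w]])
  also have "\<dots> = lin (Hom Box n k) a (chain A X F m) (\<lambda>\<alpha>. comb F a k v m (postcomp \<alpha> w)) c"
    by (rule lin_cong[OF c a cO]) (use comb_Hom[OF v k] 1 in auto)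
  also have "\<dots> = comb F a k v m (frag_extend (\<lambda>\<alpha>. postcomp \<alpha> w) c)"
    unfolding comb_def by (rule lin_frag_extend[OF c a cO V k, symmetric])
  finally show ?thesis .
qed

text \<open>The boundary of the identity of the n-cube; the boundary of any other map is obtained
  from it by postcomposition.\<close>

definition bdw :: "nat \<Rightarrow> cube_map \<Rightarrow>\<^sub>0 int" where
  "bdw n = (\<Sum>j<n. frag_cmul ((-1) ^ Suc j) (frag_of (face n (Suc j) False) - frag_of (face n (Suc j) True)))"

lemma keys_face_diff:
  assumes "1 \<le> i" "i \<le> n"
  shows "Poly_Mapping.keys (frag_of (face n i False) - frag_of (face n i True)) \<subseteq> Hom Box (n - 1) n"
  by (rule subset_trans[OF keys_diff]) (use face_Hom[OF assms] in simp)

lemma keys_bdw: "Poly_Mapping.keys (bdw n) \<subseteq> Hom Box (n - 1) n"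
  unfolding bdw_def
  by (intro subset_trans[OF keys_sum] UN_least subset_trans[OF keys_cmul] keys_face_diff) auto

lemma postcomp_bdw: "fst \<alpha> = n \<Longrightarrow> postcomp \<alpha> (bdw n) = bd (frag_of \<alpha>)"
  by (simp add: bdw_def postcomp_sum frag_simps bterm_def)

text \<open>Turns the signed product in a group of arrows into the arrow of one universal chain;
  from here on boundaries are treated combinatorially.\<close>

lemma boundary_comb:
  assumes F: "is_functor CX A F"
  shows "boundary A X F n = comb F (chain A X F n) n (chain_map A X F) (n - 1) (bdw n)"
proof -
  let ?S = "Hom Box (n - 1) n" and ?a = "chain A X F n" and ?b = "chain A X F (n - 1)"
  let ?G = "hom_group A ?a ?b" and ?l = "lin (Hom Box (n - 1) n) (chain A X F n) (chain A X F (n - 1)) (chain_map A X F)"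
  note ab = chain_Obj[OF F, of n] chain_Obj[OF F, of "n - 1"]
  have v: "\<And>x. x \<in> ?S \<Longrightarrow> chain_map A X F x \<in> Hom A ?a ?b" by (rule chain_map_Hom[OF F])
  interpret G: comm_group ?G by (rule hom_comm_group[OF ab])
  define g where "g i = frag_cmul ((-1) ^ i) (frag_of (face n i False) - frag_of (face n i True))" for i
  have gk: "Poly_Mapping.keys (g i) \<subseteq> ?S" if "i \<in> {1..n}" for i
    unfolding g_def using that by (intro subset_trans[OF keys_cmul] keys_face_diff) auto
  have gl: "?l (g i) = (chain_map A X F (face n i False) \<otimes>\<^bsub>?G\<^esub> inv\<^bsub>?G\<^esub> chain_map A X F (face n i True)) [^]\<^bsub>?G\<^esub> ((-1::int) ^ i)"
    if i: "i \<in> {1..n}" for i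
  proof -
    have i': "1 \<le> i" "i \<le> n" using i by simp_all
    note fH = face_Hom[OF i']
    have fk: "Poly_Mapping.keys (frag_of (face n i b)) \<subseteq> ?S" for b using fH by simp
    have "?l (frag_of (face n i False) - frag_of (face n i True)) = chain_map A X F (face n i False) \<otimes>\<^bsub>?G\<^esub> inv\<^bsub>?G\<^esub> chain_map A X F (face n i True)"
      using lin_diff[OF ab v fk fk] lin_hom(2)[OF ab v fH] Sub_group[OF v[OF fH] v[OF fH]] by simp
    then show ?thesis unfolding g_def using lin_sign[OF ab v keys_face_diff[OF i'], where i=i] by simp
  qed
  \<comment> \<open>Passes from coordinates counted from 0 to coordinates counted from 1, which
    accounts for the \<open>Suc\<close> in the signs.\<close>
  have "bdw n = (\<Sum>i\<in>{1..n}. g i)" by (simp add: bdw_def g_def sum.atLeast1_atMost_eq)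
  then have "?l (bdw n) = (\<Otimes>\<^bsub>?G\<^esub>i\<in>{1..n}. ?l (g i))"
    using lin_sum[OF ab v, where g=g and I="{1..n}"] gk by simp
  also have "\<dots> = (\<Otimes>\<^bsub>?G\<^esub>i\<in>{1..n}. (chain_map A X F (face n i False) \<otimes>\<^bsub>?G\<^esub> inv\<^bsub>?G\<^esub> chain_map A X F (face n i True)) [^]\<^bsub>?G\<^esub> ((-1::int) ^ i))"
  proof (rule G.finprod_cong'[OF refl])
    show "(\<lambda>i. (chain_map A X F (face n i False) \<otimes>\<^bsub>?G\<^esub> inv\<^bsub>?G\<^esub> chain_map A X F (face n i True)) [^]\<^bsub>?G\<^esub> ((-1::int) ^ i)) \<in> {1..n} \<rightarrow> carrier ?G"
    proof
      fix i assume i: "i \<in> {1..n}"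
      show "(chain_map A X F (face n i False) \<otimes>\<^bsub>?G\<^esub> inv\<^bsub>?G\<^esub> chain_map A X F (face n i True)) [^]\<^bsub>?G\<^esub> ((-1::int) ^ i) \<in> carrier ?G"
        unfolding gl[OF i, symmetric] using lin_Hom[OF ab v gk[OF i]] by simp
    qed
  qed (rule gl)
  finally show ?thesis unfolding boundary_def Let_def comb_def ..
qed

lemma boundary_Hom: "is_functor CX A F \<Longrightarrow> boundary A X F n \<in> Hom A (chain A X F n) (chain A X F (n - 1))"
  using comb_Hom[OF natfam_chain_map keys_bdw] boundary_comb by simp

lemma boundary_comp_comb:
  assumes v: "natfam F a k v" and c: "Poly_Mapping.keys c \<subseteq> Hom Box n k"
  shows "Cmp A (boundary A X F n) (comb F a k v n c) = comb F a k v (n - 1) (bd c)"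
proof -
  have "frag_extend (\<lambda>\<alpha>. postcomp \<alpha> (bdw n)) c = frag_extend (\<lambda>\<alpha>. bd (frag_of \<alpha>)) c"
  proof (rule frag_extend_eq)
    fix \<alpha> assume "\<alpha> \<in> Poly_Mapping.keys c"
    then have "\<alpha> \<in> Hom Box n k" using c by blast
    then show "postcomp \<alpha> (bdw n) = bd (frag_of \<alpha>)" by (intro postcomp_bdw) (simp add: Hom_iff)
  qed
  also have "\<dots> = bd c" by (simp add: bd_def)
  finally show ?thesis
    unfolding boundary_comb[OF natfamD(1)[OF v]] lin_chain_map_comb[OF v keys_bdw c] by simp
qed

subsection \<open>Normalization\<close>

definition degmap :: "('s, 'o, 'm) csystem \<Rightarrow> nat \<Rightarrow> 'm" where
  "degmap F n = copair A {1..n} (\<lambda>_. chain A X F (n - 1)) (chain A X F n) (\<lambda>i. chain_map A X F (degen n i))"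

lemma degmap:
  assumes F: "is_functor CX A F"
  shows "degmap F n \<in> Arr A" "Cod A (degmap F n) = chain A X F n"
    "u \<in> Arr A \<Longrightarrow> Dom A u = chain A X F n \<Longrightarrow>
       is_zero A (Cmp A u (degmap F n)) \<longleftrightarrow> (\<forall>i\<in>{1..n}. is_zero A (Cmp A u (chain_map A X F (degen n i))))"
proof -
  \<comment> \<open>Finite coproducts are instances of small ones, as 's is infinite. For n = 0 the
    index set is empty.\<close>
  have I: "fam {1..n} (\<lambda>_. chain A X F (n - 1))" using chain_Obj[OF F] small_nat[OF infinite] by (simp add: fam_def)
  have d: "\<forall>i\<in>{1..n}. chain_map A X F (degen n i) \<in> Hom A (chain A X F (n - 1)) (chain A X F n)"
    using chain_map_Hom[OF F degen_Hom[of _ n]] by simp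
  note c' = copair[OF I chain_Obj[OF F, of n] d, folded degmap_def]
  show "degmap F n \<in> Arr A" "Cod A (degmap F n) = chain A X F n" by (rule c')+
  assume u: "u \<in> Arr A" "Dom A u = chain A X F n"
  show "is_zero A (Cmp A u (degmap F n)) \<longleftrightarrow> (\<forall>i\<in>{1..n}. is_zero A (Cmp A u (chain_map A X F (degen n i))))"
  proof
    assume z: "is_zero A (Cmp A u (degmap F n))"
    show "\<forall>i\<in>{1..n}. is_zero A (Cmp A u (chain_map A X F (degen n i)))"
    proof
      fix i assume i: "i \<in> {1..n}"
      have "is_zero A (Cmp A u (Cmp A (degmap F n) (coprod_in A {1..n} (\<lambda>_. chain A X F (n - 1)) i)))"
        by (rule zero_extend[OF z]) (use u c'(1-3) coprod_in[OF I i] in simp_all)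
      then show "is_zero A (Cmp A u (chain_map A X F (degen n i)))" unfolding c'(4)[OF i] .
    qed
  next
    assume z: "\<forall>i\<in>{1..n}. is_zero A (Cmp A u (chain_map A X F (degen n i)))"
    show "is_zero A (Cmp A u (degmap F n))"
    proof (rule coprod_zero[OF I])
      fix i assume i: "i \<in> {1..n}"
      have "Cmp A (Cmp A u (degmap F n)) (coprod_in A {1..n} (\<lambda>_. chain A X F (n - 1)) i) = Cmp A u (chain_map A X F (degen n i))"
        unfolding c'(4)[OF i, symmetric] by (rule assoc) (use c'(1-3) u coprod_in[OF I i] in simp_all)
      then show "is_zero A (Cmp A (Cmp A u (degmap F n)) (coprod_in A {1..n} (\<lambda>_. chain A X F (n - 1)) i))"
        using z i by metis
    qed (use u c'(1-3) in simp_all)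
  qed
qed

lemma norm_proj:
  assumes F: "is_functor CX A F"
  shows "is_cokernel A (degmap F n) (norm_proj A X F n)"
    "norm_proj A X F n \<in> Arr A" "Dom A (norm_proj A X F n) = chain A X F n" "Cod A (norm_proj A X F n) = norm_chain A X F n"
    "is_epi A (norm_proj A X F n)" "norm_chain A X F n \<in> Obj A"
proof -
  show k: "is_cokernel A (degmap F n) (norm_proj A X F n)"
    unfolding norm_proj_def degmap_def[symmetric] by (rule cokernel_choice[OF degmap(1)[OF F]])
  note d = cokernelD[OF k]
  show q: "norm_proj A X F n \<in> Arr A" "Dom A (norm_proj A X F n) = chain A X F n" "Cod A (norm_proj A X F n) = norm_chain A X F n"
    "is_epi A (norm_proj A X F n)" using d degmap(1,2)[OF F] by (simp_all add: norm_chain_def)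
  show "norm_chain A X F n \<in> Obj A" using Obj_Cod[OF q(1)] q(3) by simp
qed

lemma norm_proj_degen:
  assumes F: "is_functor CX A F" and i: "i \<in> {1..n}"
  shows "is_zero A (Cmp A (norm_proj A X F n) (chain_map A X F (degen n i)))"
  using cokernelD(4)[OF norm_proj(1)[OF F]] degmap(3)[OF F norm_proj(2,3)[OF F], of n] i by blast

lemma norm_desc:
  assumes F: "is_functor CX A F" and u: "u \<in> Arr A" "Dom A u = chain A X F n"
    and z: "\<And>i. i \<in> {1..n} \<Longrightarrow> is_zero A (Cmp A u (chain_map A X F (degen n i)))"
  obtains h where "h \<in> Arr A" "Dom A h = norm_chain A X F n" "Cod A h = Cod A u" "Cmp A h (norm_proj A X F n) = u"
proof -
  have "is_zero A (Cmp A u (degmap F n))" unfolding degmap(3)[OF F u] using z by blast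
  moreover have "Dom A u = Cod A (degmap F n)" using u degmap(2)[OF F] by simp
  ultimately obtain h where "h \<in> Arr A" "Dom A h = Cod A (norm_proj A X F n)" "Cod A h = Cod A u" "Cmp A h (norm_proj A X F n) = u"
    using cokernel_desc[OF norm_proj(1)[OF F] u(1)] by metis
  then show ?thesis using that norm_proj(4)[OF F] by simp
qed

lemma norm_ext:
  assumes F: "is_functor CX A F" and "u \<in> Arr A" "v \<in> Arr A" "Dom A u = norm_chain A X F n" "Dom A v = norm_chain A X F n" "Cod A u = Cod A v"
    "Cmp A u (norm_proj A X F n) = Cmp A v (norm_proj A X F n)"
  shows "u = v"
  by (rule epi_cancel[OF norm_proj(5)[OF F]]) (use assms norm_proj(4)[OF F] in simp_all)

text \<open>The bridge from combinatorics to arrows: a degenerate map factors through a degeneracy,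
  which the projection kills. Identities modulo \<open>Deg\<close> thereby become identities after
  \<open>norm_proj\<close>.\<close>

lemma norm_proj_comb:
  assumes v: "natfam F a k v" and c: "Poly_Mapping.keys c \<subseteq> Hom Box n k" and D: "Deg c"
  shows "is_zero A (Cmp A (norm_proj A X F n) (comb F a k v n c))"
proof -
  note F = natfamD(1)[OF v] and a = natfamD(2)[OF v] and q = norm_proj(2,3,4,6)[OF natfamD(1)[OF v]]
  let ?z = "\<lambda>c. Cmp A (norm_proj A X F n) (comb F a k v n c)"
  have L: "comb F a k v n c \<in> Arr A" "Dom A (comb F a k v n c) = a" "Cod A (comb F a k v n c) = chain A X F n" if "Poly_Mapping.keys c \<subseteq> Hom Box n k" for c
    using comb_Hom[OF v that] by (simp_all add: Hom_iff[of _ A])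
  have "Poly_Mapping.keys c \<subseteq> {\<alpha> \<in> Hom Box n k. dgn \<alpha>}" using c D by (auto simp: Deg_def)
  then show "is_zero A (?z c)"
  proof (rule free_Abelian_group_induct)
    show "is_zero A (?z 0)" using comb_0[OF v] q a chain_Obj[OF F] by simp
  next
    fix \<alpha> assume al: "\<alpha> \<in> {\<alpha> \<in> Hom Box n k. dgn \<alpha>}"
    then obtain i \<beta> where i: "i \<in> {1..n}" "\<beta> \<in> Hom Box (n - 1) k" "\<alpha> = cube_comp \<beta> (degen n i)"
      using dgn_factor[of \<alpha> n k] by blast
    have dH: "degen n i \<in> Hom Box n (n - 1)" using degen_Hom i by simp
    have e: "Cmp A (chain_map A X F (degen n i)) (v \<beta>) = v \<alpha>" using natfamD(4)[OF v i(2) dH] i by simp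
    have vb: "v \<beta> \<in> Arr A" "Dom A (v \<beta>) = a" "Cod A (v \<beta>) = chain A X F (n - 1)"
      using natfamD(3)[OF v i(2)] by (simp_all add: Hom_iff[of _ A])
    have "is_zero A (Cmp A (norm_proj A X F n) (Cmp A (chain_map A X F (degen n i)) (v \<beta>)))"
      by (rule zero_extend[OF norm_proj_degen[OF F i(1)]]) (use vb chain_map(1-3)[OF F dH] q in simp_all)
    then show "is_zero A (?z (frag_of \<alpha>))" using comb_of[OF v, of \<alpha> n] al e by simp
  next
    fix c d assume cd: "Poly_Mapping.keys c \<subseteq> {\<alpha> \<in> Hom Box n k. dgn \<alpha>}" "Poly_Mapping.keys d \<subseteq> {\<alpha> \<in> Hom Box n k. dgn \<alpha>}"
      "is_zero A (?z c)" "is_zero A (?z d)"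
    have k: "Poly_Mapping.keys c \<subseteq> Hom Box n k" "Poly_Mapping.keys d \<subseteq> Hom Box n k" using cd by auto
    have e: "?z c = ?z d" by (rule zero_eq[OF cd(3,4)]) (use L[OF k(1)] L[OF k(2)] q in simp_all)
    have "?z (c - d) = Sub A (?z c) (?z d)"
      using L[OF k(1)] L[OF k(2)] q by (simp add: comb_diff[OF v k] Cmp_Sub_right)
    also have "\<dots> = Sub A (?z d) (?z d)" using e by simp
    finally show "is_zero A (?z (c - d))" using L[OF k(2)] q a by simp
  qed
qed

lemma degen_dgn: "i \<in> {1..n} \<Longrightarrow> dgn (degen n i)"
  using degen_comp_dgn[of "cube_id (n - 1)" n "n - 1" i] cube_comp_id(2)[OF degen_Hom[of i n]] cube_id_Hom[of "n - 1"] by simp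

lemma dgn_Deg_bd: assumes "\<alpha> \<in> Hom Box n k" "dgn \<alpha>" shows "Deg (bd (frag_of \<alpha>))"
proof -
  obtain f where f: "\<alpha> = cmap n k f" by (rule Box_Hom_cases[OF assms(1)])
  then obtain i where "i < n" "indep n f i" using assms(2) unfolding f dgn_cmap by blast
  then show ?thesis unfolding f by (rule Deg_bd_cmap)
qed

lemma bd_bd:
  assumes "Poly_Mapping.keys c \<subseteq> Hom Box n k" shows "bd (bd c) = 0"
  using assms
proof (induction rule: frag_induction)
  case (one \<alpha>)
  then obtain f where "\<alpha> = cmap n k f" by (rule Box_Hom_cases)
  then show ?case using bd_bd_cmap by simp
qed (simp_all add: frag_simps)

lemma boundary_Arr:
  assumes F: "is_functor CX A F"
  shows "boundary A X F n \<in> Arr A" "Dom A (boundary A X F n) = chain A X F n" "Cod A (boundary A X F n) = chain A X F (n - 1)"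
  using boundary_Hom[OF F, of n] by (simp_all add: Hom_iff[of _ A])

text \<open>The boundary descends because the boundary of a degenerate map is a combination of
  degenerate maps; the definite description then denotes the descended arrow.\<close>

lemma norm_boundary:
  assumes F: "is_functor CX A F" and n: "n > 0"
  shows "norm_boundary A X F n \<in> Hom A (norm_chain A X F n) (norm_chain A X F (n - 1))"
    "Cmp A (norm_boundary A X F n) (norm_proj A X F n) = Cmp A (norm_proj A X F (n - 1)) (boundary A X F n)"
proof -
  note q = norm_proj(2,3,4,6)[OF F] and b = boundary_Arr[OF F]
  let ?u = "Cmp A (norm_proj A X F (n - 1)) (boundary A X F n)"
  have u: "?u \<in> Arr A" "Dom A ?u = chain A X F n" "Cod A ?u = norm_chain A X F (n - 1)" using q b by simp_all
  have z: "is_zero A (Cmp A ?u (chain_map A X F (degen n i)))" if i: "i \<in> {1..n}" for i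
  proof -
    have dH: "degen n i \<in> Hom Box n (n - 1)" using degen_Hom i by simp
    note v = natfam_chain_map[OF F, of "n - 1"]
    have k: "Poly_Mapping.keys (frag_of (degen n i)) \<subseteq> Hom Box n (n - 1)" using dH by simp
    have "Cmp A (boundary A X F n) (chain_map A X F (degen n i)) = comb F (chain A X F (n - 1)) (n - 1) (chain_map A X F) (n - 1) (bd (frag_of (degen n i)))"
      using boundary_comp_comb[OF v k] comb_of[OF v dH] by simp
    moreover have "is_zero A (Cmp A (norm_proj A X F (n - 1)) (comb F (chain A X F (n - 1)) (n - 1) (chain_map A X F) (n - 1) (bd (frag_of (degen n i)))))"
      by (rule norm_proj_comb[OF v bd_keys[OF k] dgn_Deg_bd[OF dH degen_dgn[OF i]]])
    ultimately show ?thesis using q b chain_map(1-3)[OF F dH] by simp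
  qed
  obtain h where h: "h \<in> Arr A" "Dom A h = norm_chain A X F n" "Cod A h = Cod A ?u" "Cmp A h (norm_proj A X F n) = ?u"
    by (rule norm_desc[OF F u(1,2) z])
  have "norm_boundary A X F n = (THE h. h \<in> Hom A (norm_chain A X F n) (norm_chain A X F (n - 1)) \<and> Cmp A h (norm_proj A X F n) = ?u)"
    using n by (simp add: norm_boundary_def)
  also have "\<dots> = h"
  proof (rule the_equality)
    show "h \<in> Hom A (norm_chain A X F n) (norm_chain A X F (n - 1)) \<and> Cmp A h (norm_proj A X F n) = ?u"
      using h u(3) by (simp add: Hom_iff[of _ A])
    fix h' assume h': "h' \<in> Hom A (norm_chain A X F n) (norm_chain A X F (n - 1)) \<and> Cmp A h' (norm_proj A X F n) = ?u"
    have e: "Cmp A h' (norm_proj A X F n) = Cmp A h (norm_proj A X F n)" unfolding h(4) using h' by (rule conjunct2)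
    have "h' \<in> Hom A (norm_chain A X F n) (norm_chain A X F (n - 1))" using h' by (rule conjunct1)
    then show "h' = h" by (intro norm_ext[OF F _ _ _ _ _ e]) (use h(1-3) u(3) in \<open>simp_all add: Hom_iff[of _ A]\<close>)
  qed
  finally show "norm_boundary A X F n \<in> Hom A (norm_chain A X F n) (norm_chain A X F (n - 1))"
    "Cmp A (norm_boundary A X F n) (norm_proj A X F n) = Cmp A (norm_proj A X F (n - 1)) (boundary A X F n)"
    using h u(3) by (simp_all add: Hom_iff[of _ A])
qed

text \<open>Reduced to d d = 0 for the identity of a single cube. For n = 0, truncated subtraction
  gives \<open>boundary A X F 0\<close> the codomain \<open>chain A X F 0\<close>; as an empty
  product it is the zero arrow.\<close>

lemma boundary_boundary:
  assumes F: "is_functor CX A F"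
  shows "is_zero A (Cmp A (boundary A X F n) (boundary A X F (Suc n)))"
proof -
  note v = natfam_chain_map[OF F, of "Suc n"]
  have k: "Poly_Mapping.keys (bdw (Suc n)) \<subseteq> Hom Box n (Suc n)" using keys_bdw[of "Suc n"] by simp
  have i: "fst (cube_id (Suc n)) = Suc n" by (simp add: cube_id_def)
  have "postcomp (cube_id (Suc n)) (bdw (Suc n)) = frag_extend frag_of (bdw (Suc n))"
    unfolding postcomp_def by (rule frag_extend_eq) (use k cube_comp_id(2) in auto)
  then have "bdw (Suc n) = bd (frag_of (cube_id (Suc n)))" using postcomp_bdw[OF i] frag_expansion[of "bdw (Suc n)"] by simp
  then have "bd (bdw (Suc n)) = 0" using bd_bd[of "frag_of (cube_id (Suc n))" "Suc n" "Suc n"] cube_id_Hom[of "Suc n"] by simp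
  then have "Cmp A (boundary A X F n) (boundary A X F (Suc n)) = Zer A (chain A X F (Suc n)) (chain A X F (n - 1))"
    using boundary_comp_comb[OF v k] comb_0[OF v] boundary_comb[OF F, of "Suc n"] by simp
  then show ?thesis using chain_Obj[OF F] by simp
qed

lemma norm_boundary_0:
  assumes F: "is_functor CX A F"
  shows "norm_boundary A X F 0 \<in> Arr A" "Dom A (norm_boundary A X F 0) = norm_chain A X F 0" "is_zero A (norm_boundary A X F 0)"
proof -
  have "is_zero_object A (zero_object A)" unfolding zero_object_def by (rule someI_ex) (rule ex_zero_object)
  then have "zero_object A \<in> Obj A" by (simp add: is_zero_object_def)
  then show "norm_boundary A X F 0 \<in> Arr A" "Dom A (norm_boundary A X F 0) = norm_chain A X F 0" "is_zero A (norm_boundary A X F 0)"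
    using norm_proj(6)[OF F, of 0] by (simp_all add: norm_boundary_def)
qed

lemma norm_boundary_Arr:
  assumes F: "is_functor CX A F"
  shows "norm_boundary A X F (Suc n) \<in> Arr A" "Dom A (norm_boundary A X F (Suc n)) = norm_chain A X F (Suc n)"
    "Cod A (norm_boundary A X F (Suc n)) = norm_chain A X F n"
    "Cmp A (norm_boundary A X F (Suc n)) (norm_proj A X F (Suc n)) = Cmp A (norm_proj A X F n) (boundary A X F (Suc n))"
  using norm_boundary[OF F, of "Suc n"] by (simp_all add: Hom_iff[of _ A])

lemma norm_boundary_boundary:
  assumes F: "is_functor CX A F"
  shows "is_zero A (Cmp A (norm_boundary A X F n) (norm_boundary A X F (Suc n)))"
proof (cases n)
  case 0
  show ?thesis unfolding 0 by (rule is_zero_Cmp_left) (use norm_boundary_0[OF F] norm_boundary_Arr[OF F] in simp_all)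
next
  case (Suc m)
  note q = norm_proj[OF F] and B = norm_boundary_Arr[OF F] and b = boundary_Arr[OF F]
  have "is_zero A (Cmp A (norm_proj A X F m) (Cmp A (boundary A X F (Suc m)) (boundary A X F (Suc (Suc m)))))"
    by (rule is_zero_Cmp_right[OF boundary_boundary[OF F]]) (use q b in simp_all)
  then have "is_zero A (Cmp A (Cmp A (norm_boundary A X F (Suc m)) (norm_boundary A X F (Suc (Suc m)))) (norm_proj A X F (Suc (Suc m))))"
    using q B b Cmp_eq_extend[OF B(4)[of m], of "boundary A X F (Suc (Suc m))"] by simp
  then show ?thesis using epi_zero[OF q(5), of "Cmp A (norm_boundary A X F (Suc m)) (norm_boundary A X F (Suc (Suc m)))" "Suc (Suc m)"] q(2-4,6) B Suc by simp
qed

end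

section \<open>The normalized complex is exact in the coefficients\<close>

lemma tau_Hom: "i < n \<Longrightarrow> tau n i \<in> Hom Box n n"
proof -
  assume i: "i < n"
  have "cube_comp (face n (Suc i) False) (degen n (Suc i)) = cmap n n (\<lambda>xs. ins i False (del i xs))"
    unfolding face_cmap using i by (simp add: degen_cmap cube_comp_cmap)
  also have "\<dots> = tau n i" unfolding tau_def using i by (intro cmap_cong) (simp add: ins_del)
  finally show ?thesis using cube_comp_Hom[OF degen_Hom[of "Suc i" n] face_Hom[of "Suc i" n False]] i by simp
qed

lemma keys_precomp:
  assumes "Poly_Mapping.keys c \<subseteq> Hom Box n k" "\<beta> \<in> Hom Box m n"
  shows "Poly_Mapping.keys (precomp \<beta> c) \<subseteq> Hom Box m k"
  unfolding precomp_def
proof (rule frag_extend_keys)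
  fix \<alpha> assume "\<alpha> \<in> Poly_Mapping.keys c"
  then have "\<alpha> \<in> Hom Box n k" using assms(1) by blast
  from cube_comp_Hom[OF assms(2) this] show "Poly_Mapping.keys (frag_of (cube_comp \<alpha> \<beta>)) \<subseteq> Hom Box m k" by simp
qed

lemma keys_nrm:
  "m \<le> n \<Longrightarrow> Poly_Mapping.keys c \<subseteq> Hom Box n k \<Longrightarrow> Poly_Mapping.keys (nrm n m c) \<subseteq> Hom Box n k"
proof (induction m arbitrary: c)
  case (Suc m)
  have "Poly_Mapping.keys (c - precomp (tau n m) c) \<subseteq> Hom Box n k"
    using Suc.prems keys_precomp[OF Suc.prems(2) tau_Hom[of m n]] by (intro subset_trans[OF keys_diff] Un_least) simp_all
  then show ?case using Suc by simp
qed simp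

lemma postcomp_precomp:
  assumes "Poly_Mapping.keys c \<subseteq> Hom Box n n'" "\<alpha> \<in> Hom Box n' k" "\<beta> \<in> Hom Box m n"
  shows "postcomp \<alpha> (precomp \<beta> c) = precomp \<beta> (postcomp \<alpha> c)"
  using assms(1)
proof (induction rule: frag_induction)
  case (one \<gamma>)
  then show ?case using cube_comp_assoc[OF assms(3) one assms(2)] by (simp add: frag_simps)
qed (simp_all add: frag_simps)

text \<open>Normalizing only precomposes, so its effect on every map follows from its effect on the
  identity of a cube.\<close>

lemma postcomp_nrm:
  assumes "\<alpha> \<in> Hom Box n k"
  shows "m \<le> n \<Longrightarrow> Poly_Mapping.keys c \<subseteq> Hom Box n n \<Longrightarrow> postcomp \<alpha> (nrm n m c) = nrm n m (postcomp \<alpha> c)"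
proof (induction m arbitrary: c)
  case (Suc m)
  note t = tau_Hom[of m n]
  have "Poly_Mapping.keys (c - precomp (tau n m) c) \<subseteq> Hom Box n n"
    using Suc.prems keys_precomp[OF Suc.prems(2) t] by (intro subset_trans[OF keys_diff] Un_least) simp_all
  then show ?case using Suc postcomp_precomp[OF Suc.prems(2) assms t] by (simp add: frag_simps)
qed simp

context cubical_coefficients
begin

text \<open>The product of the commuting idempotents 1 - \<open>tau n i\<close>, acting on chains.
  It kills degenerate chains and is the identity modulo them.\<close>

definition norm_idem :: "('s, 'o, 'm) csystem \<Rightarrow> nat \<Rightarrow> 'm" where
  "norm_idem F n = comb F (chain A X F n) n (chain_map A X F) n (nrm n n (frag_of (cube_id n)))"

lemma keys_nrm_id: "Poly_Mapping.keys (nrm n n (frag_of (cube_id n))) \<subseteq> Hom Box n n"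
  by (rule keys_nrm) (use cube_id_Hom[of n] in simp_all)

lemma norm_idem_Arr:
  assumes F: "is_functor CX A F"
  shows "norm_idem F n \<in> Arr A" "Dom A (norm_idem F n) = chain A X F n" "Cod A (norm_idem F n) = chain A X F n"
  using comb_Hom[OF natfam_chain_map[OF F] keys_nrm_id, of n] by (simp_all add: norm_idem_def Hom_iff[of _ A])

lemma norm_idem_natfam:
  assumes v: "natfam F a k v" and al: "\<alpha> \<in> Hom Box n k"
  shows "Cmp A (norm_idem F n) (v \<alpha>) = comb F a k v n (nrm n n (frag_of \<alpha>))"
proof -
  have k: "Poly_Mapping.keys (frag_of \<alpha>) \<subseteq> Hom Box n k" using al by simp
  have "postcomp \<alpha> (nrm n n (frag_of (cube_id n))) = nrm n n (postcomp \<alpha> (frag_of (cube_id n)))"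
    by (rule postcomp_nrm[OF al]) (use cube_id_Hom[of n] in simp_all)
  also have "\<dots> = nrm n n (frag_of \<alpha>)" using cube_comp_id(1)[OF al] by (simp add: frag_simps)
  finally show ?thesis
    using lin_chain_map_comb[OF v keys_nrm_id k] comb_of[OF v al] by (simp add: norm_idem_def)
qed

lemma norm_idem_degen:
  assumes F: "is_functor CX A F" and i: "i \<in> {1..n}"
  shows "is_zero A (Cmp A (norm_idem F n) (chain_map A X F (degen n i)))"
proof -
  have d: "degen n i \<in> Hom Box n (n - 1)" using degen_Hom i by simp
  have "nrm n n (frag_of (degen n i)) = 0"
    by (rule nrm_dgn[OF degen_dgn[OF i]]) (use d in \<open>simp add: Hom_iff\<close>)
  then have "Cmp A (norm_idem F n) (chain_map A X F (degen n i)) = Zer A (chain A X F (n - 1)) (chain A X F n)"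
    using norm_idem_natfam[OF natfam_chain_map[OF F] d] comb_0[OF natfam_chain_map[OF F]] by simp
  then show ?thesis using chain_Obj[OF F] by simp
qed

lemma norm_proj_norm_idem:
  assumes F: "is_functor CX A F"
  shows "Cmp A (norm_proj A X F n) (norm_idem F n) = norm_proj A X F n"
proof -
  note v = natfam_chain_map[OF F, of n] and q = norm_proj(2-4)[OF F] and e = norm_idem_Arr[OF F]
  let ?comb = "comb F (chain A X F n) n (chain_map A X F) n" and ?w = "nrm n n (frag_of (cube_id n))"
  have k: "Poly_Mapping.keys (frag_of (cube_id n)) \<subseteq> Hom Box n n" using cube_id_Hom[of n] by simp
  have i: "?comb (frag_of (cube_id n)) = Ide A (chain A X F n)"
    using comb_of[OF v cube_id_Hom] chain_map_id[OF F] by simp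
  have "is_zero A (Cmp A (norm_proj A X F n) (?comb (?w - frag_of (cube_id n))))"
    by (rule norm_proj_comb[OF v _ Deg_nrm])
      (use keys_nrm_id[of n] k in \<open>auto intro!: subset_trans[OF keys_diff] Un_least\<close>)
  moreover have "?comb (?w - frag_of (cube_id n)) = Sub A (norm_idem F n) (Ide A (chain A X F n))"
    using comb_diff[OF v keys_nrm_id k] i by (simp add: norm_idem_def)
  ultimately have "is_zero A (Sub A (Cmp A (norm_proj A X F n) (norm_idem F n)) (norm_proj A X F n))"
    using q e chain_Obj[OF F] by (simp add: Cmp_Sub_right)
  then show ?thesis using q e by (simp add: is_zero_Sub)
qed

text \<open>Killing degenerate chains, the idempotent factors through the projection; changing
  chains only by degenerate ones, it makes the factor a section. So the normalized chains are a
  direct summand.\<close>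

lemma norm_section:
  assumes F: "is_functor CX A F"
  obtains j where "j \<in> Arr A" "Dom A j = norm_chain A X F n" "Cod A j = chain A X F n"
    "Cmp A j (norm_proj A X F n) = norm_idem F n" "Cmp A (norm_proj A X F n) j = Ide A (norm_chain A X F n)"
proof -
  note q = norm_proj(2-4,6)[OF F] and e = norm_idem_Arr[OF F]
  obtain j where j: "j \<in> Arr A" "Dom A j = norm_chain A X F n" "Cod A j = Cod A (norm_idem F n)" "Cmp A j (norm_proj A X F n) = norm_idem F n"
    by (rule norm_desc[OF F e(1,2) norm_idem_degen[OF F]])
  have "Cmp A (norm_proj A X F n) j = Ide A (norm_chain A X F n)"
    by (rule norm_ext[OF F, of _ _ n]) (use j q e norm_proj_norm_idem[OF F, of n] in simp_all)
  then show ?thesis using that j e by simp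
qed

section \<open>Naturality in the coefficients\<close>

definition chain_trans :: "('s, 'o, 'm) csystem \<Rightarrow> ('s, 'o, 'm) csystem \<Rightarrow> (nat \<times> 's \<Rightarrow> 'm) \<Rightarrow> nat \<Rightarrow> 'm" where
  "chain_trans F G \<tau> n = coprod_map A (cells X n) (\<lambda>x. fob F (n, x)) (\<lambda>x. fob G (n, x)) (\<lambda>x. \<tau> (n, x))"

lemma chain_trans:
  assumes t: "is_nat_trans CX A F G \<tau>"
  shows "chain_trans F G \<tau> n \<in> Arr A" "Dom A (chain_trans F G \<tau> n) = chain A X F n" "Cod A (chain_trans F G \<tau> n) = chain A X G n"
    "x \<in> cells X n \<Longrightarrow> Cmp A (chain_trans F G \<tau> n) (chain_in A X F n x) = Cmp A (chain_in A X G n x) (\<tau> (n, x))"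
proof -
  have "\<forall>x\<in>cells X n. \<tau> (n, x) \<in> Hom A (fob F (n, x)) (fob G (n, x))"
    using nat_transD(3-5)[OF t] by (simp add: Hom_iff[of _ A])
  note c = coprod_map[OF fam_cells[OF nat_transD(1)[OF t]] fam_cells[OF nat_transD(2)[OF t]] this]
  show "chain_trans F G \<tau> n \<in> Arr A" "Dom A (chain_trans F G \<tau> n) = chain A X F n" "Cod A (chain_trans F G \<tau> n) = chain A X G n"
    "x \<in> cells X n \<Longrightarrow> Cmp A (chain_trans F G \<tau> n) (chain_in A X F n x) = Cmp A (chain_in A X G n x) (\<tau> (n, x))"
    using c by (simp_all add: chain_trans_def chain_def chain_in_def)
qed

lemma chain_trans_chain_map:
  assumes t: "is_nat_trans CX A F G \<tau>" and a: "\<alpha> \<in> Hom Box m n"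
  shows "Cmp A (chain_trans F G \<tau> m) (chain_map A X F \<alpha>) = Cmp A (chain_map A X G \<alpha>) (chain_trans F G \<tau> n)"
proof -
  note F = nat_transD(1)[OF t] and G = nat_transD(2)[OF t]
  note cF = chain_map(1-3)[OF F a] and cG = chain_map(1-3)[OF G a] and c = chain_trans(1-3)[OF t]
  show ?thesis
  proof (rule chain_ext[OF F])
    fix x assume x: "x \<in> cells X n"
    note ax = cubical_setD(1)[OF X a x]
    note lF = far_lift[OF F a x] and lG = far_lift[OF G a x]
    note tx = nat_transD(3-5)[OF t, of "(n, x)"] and tax = nat_transD(3-5)[OF t, of "(m, act X \<alpha> x)"]
    have n: "Cmp A (far G (lift X \<alpha> x)) (\<tau> (n, x)) = Cmp A (\<tau> (m, act X \<alpha> x)) (far F (lift X \<alpha> x))"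
      using nat_transD(6)[OF t lift_Arr(1)[OF a x]] unfolding lift_Arr(2,3)[OF a x] .
    have "Cmp A (Cmp A (chain_trans F G \<tau> m) (chain_map A X F \<alpha>)) (chain_in A X F n x) = Cmp A (chain_trans F G \<tau> m) (Cmp A (chain_in A X F m (act X \<alpha> x)) (far F (lift X \<alpha> x)))"
      using cF c chain_in[OF F x] chain_map(4)[OF F a x] by simp
    also have "\<dots> = Cmp A (chain_in A X G m (act X \<alpha> x)) (Cmp A (\<tau> (m, act X \<alpha> x)) (far F (lift X \<alpha> x)))"
      using Cmp_eq_extend[OF chain_trans(4)[OF t ax], of "far F (lift X \<alpha> x)"] c chain_in[OF F ax] chain_in[OF G ax] lF tax ax by simp
    also have "\<dots> = Cmp A (Cmp A (chain_in A X G m (act X \<alpha> x)) (far G (lift X \<alpha> x))) (\<tau> (n, x))"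
      using n chain_in[OF G ax] lG tx x by simp
    also have "\<dots> = Cmp A (Cmp A (chain_map A X G \<alpha>) (chain_in A X G n x)) (\<tau> (n, x))"
      using chain_map(4)[OF G a x] by simp
    also have "\<dots> = Cmp A (Cmp A (chain_map A X G \<alpha>) (chain_trans F G \<tau> n)) (chain_in A X F n x)"
      using cG c chain_in[OF F x] chain_in[OF G x] chain_trans(4)[OF t x] tx x by simp
    finally show "Cmp A (Cmp A (chain_trans F G \<tau> m) (chain_map A X F \<alpha>)) (chain_in A X F n x) = Cmp A (Cmp A (chain_map A X G \<alpha>) (chain_trans F G \<tau> n)) (chain_in A X F n x)" .
  qed (use cF cG c in simp_all)
qed

lemma chain_trans_comb:
  assumes t: "is_nat_trans CX A F G \<tau>" and k: "Poly_Mapping.keys c \<subseteq> Hom Box m n"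
  shows "Cmp A (chain_trans F G \<tau> m) (comb F (chain A X F n) n (chain_map A X F) m c) = Cmp A (comb G (chain A X G n) n (chain_map A X G) m c) (chain_trans F G \<tau> n)"
proof -
  note F = nat_transD(1)[OF t] and G = nat_transD(2)[OF t]
  have H: "chain_trans F G \<tau> i \<in> Hom A (chain A X F i) (chain A X G i)" for i using chain_trans(1-3)[OF t] by (simp add: Hom_iff[of _ A])
  note vF = chain_map_Hom[OF F] and vG = chain_map_Hom[OF G]
  have "Cmp A (chain_trans F G \<tau> m) (comb F (chain A X F n) n (chain_map A X F) m c) = lin (Hom Box m n) (chain A X F n) (chain A X G m) (\<lambda>\<alpha>. Cmp A (chain_trans F G \<tau> m) (chain_map A X F \<alpha>)) c"
    unfolding comb_def by (rule Cmp_lin[OF k chain_Obj[OF F] chain_Obj[OF F] vF H])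
  also have "\<dots> = lin (Hom Box m n) (chain A X F n) (chain A X G m) (\<lambda>\<alpha>. Cmp A (chain_map A X G \<alpha>) (chain_trans F G \<tau> n)) c"
  proof (rule lin_cong[OF k chain_Obj[OF F] chain_Obj[OF G]])
    fix \<alpha> assume a: "\<alpha> \<in> Hom Box m n"
    show "Cmp A (chain_map A X G \<alpha>) (chain_trans F G \<tau> n) \<in> Hom A (chain A X F n) (chain A X G m)" by (rule Cmp_Hom[OF H vG[OF a]])
    show "Cmp A (chain_trans F G \<tau> m) (chain_map A X F \<alpha>) = Cmp A (chain_map A X G \<alpha>) (chain_trans F G \<tau> n)" by (rule chain_trans_chain_map[OF t a])
  qed
  also have "\<dots> = Cmp A (comb G (chain A X G n) n (chain_map A X G) m c) (chain_trans F G \<tau> n)"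
    unfolding comb_def by (rule lin_Cmp[OF k chain_Obj[OF G] chain_Obj[OF G] vG H, symmetric])
  finally show ?thesis .
qed

lemma chain_trans_boundary:
  assumes t: "is_nat_trans CX A F G \<tau>"
  shows "Cmp A (chain_trans F G \<tau> (n - 1)) (boundary A X F n) = Cmp A (boundary A X G n) (chain_trans F G \<tau> n)"
  unfolding boundary_comb[OF nat_transD(1)[OF t]] boundary_comb[OF nat_transD(2)[OF t]] by (rule chain_trans_comb[OF t keys_bdw])

lemma chain_trans_norm_idem:
  assumes t: "is_nat_trans CX A F G \<tau>"
  shows "Cmp A (chain_trans F G \<tau> n) (norm_idem F n) = Cmp A (norm_idem G n) (chain_trans F G \<tau> n)"
  unfolding norm_idem_def by (rule chain_trans_comb[OF t keys_nrm_id])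

text \<open>There is only one candidate for the choice, by \<open>norm_ext\<close>.\<close>

definition norm_trans :: "('s, 'o, 'm) csystem \<Rightarrow> ('s, 'o, 'm) csystem \<Rightarrow> (nat \<times> 's \<Rightarrow> 'm) \<Rightarrow> nat \<Rightarrow> 'm" where
  "norm_trans F G \<tau> n = (SOME h. h \<in> Hom A (norm_chain A X F n) (norm_chain A X G n) \<and>
     Cmp A h (norm_proj A X F n) = Cmp A (norm_proj A X G n) (chain_trans F G \<tau> n))"

lemma norm_trans:
  assumes t: "is_nat_trans CX A F G \<tau>"
  shows "norm_trans F G \<tau> n \<in> Arr A" "Dom A (norm_trans F G \<tau> n) = norm_chain A X F n" "Cod A (norm_trans F G \<tau> n) = norm_chain A X G n"
    "Cmp A (norm_trans F G \<tau> n) (norm_proj A X F n) = Cmp A (norm_proj A X G n) (chain_trans F G \<tau> n)"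
proof -
  note F = nat_transD(1)[OF t] and G = nat_transD(2)[OF t]
  note qF = norm_proj(2-4)[OF F] and qG = norm_proj(2-4)[OF G] and c = chain_trans(1-3)[OF t]
  let ?u = "Cmp A (norm_proj A X G n) (chain_trans F G \<tau> n)"
  have u: "?u \<in> Arr A" "Dom A ?u = chain A X F n" "Cod A ?u = norm_chain A X G n" using c qG by simp_all
  have z: "is_zero A (Cmp A ?u (chain_map A X F (degen n i)))" if i: "i \<in> {1..n}" for i
  proof -
    have d: "degen n i \<in> Hom Box n (n - 1)" using degen_Hom i by simp
    have "is_zero A (Cmp A (norm_proj A X G n) (Cmp A (chain_map A X G (degen n i)) (chain_trans F G \<tau> (n - 1))))"
      by (rule zero_extend[OF norm_proj_degen[OF G i]]) (use c chain_map(1-3)[OF G d] qG in simp_all)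
    then show ?thesis using chain_trans_chain_map[OF t d] c qG chain_map(1-3)[OF F d] by simp
  qed
  obtain h where "h \<in> Arr A" "Dom A h = norm_chain A X F n" "Cod A h = Cod A ?u" "Cmp A h (norm_proj A X F n) = ?u"
    by (rule norm_desc[OF F u(1,2) z])
  then have "\<exists>h. h \<in> Hom A (norm_chain A X F n) (norm_chain A X G n) \<and> Cmp A h (norm_proj A X F n) = ?u"
    using u(3) by (auto simp: Hom_iff[of _ A])
  from someI_ex[OF this] show "norm_trans F G \<tau> n \<in> Arr A" "Dom A (norm_trans F G \<tau> n) = norm_chain A X F n" "Cod A (norm_trans F G \<tau> n) = norm_chain A X G n"
    "Cmp A (norm_trans F G \<tau> n) (norm_proj A X F n) = ?u"
    unfolding norm_trans_def[symmetric] by (simp_all add: Hom_iff[of _ A])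
qed

lemma norm_trans_norm_boundary:
  assumes t: "is_nat_trans CX A F G \<tau>"
  shows "Cmp A (norm_trans F G \<tau> n) (norm_boundary A X F (Suc n)) = Cmp A (norm_boundary A X G (Suc n)) (norm_trans F G \<tau> (Suc n))"
proof -
  note F = nat_transD(1)[OF t] and G = nat_transD(2)[OF t]
  note qF = norm_proj(2-4)[OF F] and qG = norm_proj(2-4)[OF G] and c = chain_trans(1-3)[OF t]
  note bF = norm_boundary_Arr(1-3)[OF F] and bG = norm_boundary_Arr(1-3)[OF G] and dF = boundary_Arr[OF F] and dG = boundary_Arr[OF G]
  note nA = norm_trans(1-3)[OF t]
  have e: "Cmp A (chain_trans F G \<tau> n) (boundary A X F (Suc n)) = Cmp A (boundary A X G (Suc n)) (chain_trans F G \<tau> (Suc n))"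
    using chain_trans_boundary[OF t, of "Suc n"] by simp
  have "Cmp A (norm_trans F G \<tau> n) (Cmp A (norm_boundary A X F (Suc n)) (norm_proj A X F (Suc n)))
     = Cmp A (norm_proj A X G n) (Cmp A (chain_trans F G \<tau> n) (boundary A X F (Suc n)))"
    unfolding norm_boundary_Arr(4)[OF F]
    using Cmp_eq_extend[OF norm_trans(4)[OF t, of n], of "boundary A X F (Suc n)"] dF qF qG nA c by simp
  also have "\<dots> = Cmp A (Cmp A (norm_boundary A X G (Suc n)) (norm_proj A X G (Suc n))) (chain_trans F G \<tau> (Suc n))"
    unfolding e norm_boundary_Arr(4)[OF G] using dG qG c by simp
  also have "\<dots> = Cmp A (norm_boundary A X G (Suc n)) (Cmp A (norm_trans F G \<tau> (Suc n)) (norm_proj A X F (Suc n)))"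
    unfolding norm_trans(4)[OF t] using bG qG c by simp
  finally have eq: "Cmp A (norm_trans F G \<tau> n) (Cmp A (norm_boundary A X F (Suc n)) (norm_proj A X F (Suc n))) = Cmp A (norm_boundary A X G (Suc n)) (Cmp A (norm_trans F G \<tau> (Suc n)) (norm_proj A X F (Suc n)))" .
  show ?thesis
    by (rule norm_ext[OF F, where n = "Suc n"]) (use bF bG nA qF eq in simp_all)
qed

text \<open>The sections are natural, so the normalized sequence is a retract of the sequence of
  coproducts, which is exact by AB4. Epimorphisms pass directly to the quotients; monicity and the
  lifting property of the kernel are carried over along the sections.\<close>

lemma norm_short_exact:
  assumes i: "is_nat_trans CX A K P \<iota>" and e: "is_nat_trans CX A P F \<epsilon>"
    and se: "\<And>c. c \<in> Obj CX \<Longrightarrow> short_exact A (\<iota> c) (\<epsilon> c)"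
  shows "is_kernel A (norm_trans P F \<epsilon> n) (norm_trans K P \<iota> n)" "is_epi A (norm_trans P F \<epsilon> n)"
proof -
  note FK = nat_transD(1)[OF i] and FP = nat_transD(2)[OF i] and FF = nat_transD(2)[OF e]
  note qK = norm_proj(2-4,6)[OF FK] and qP = norm_proj(2-4,6)[OF FP] and qF = norm_proj(2-4,6)[OF FF]
  note ci = chain_trans(1-3)[OF i] and ce = chain_trans(1-3)[OF e] and ni = norm_trans(1-3)[OF i] and ne = norm_trans(1-3)[OF e]
  have c: "short_exact A (chain_trans K P \<iota> n) (chain_trans P F \<epsilon> n)"
    unfolding chain_trans_def
    by (rule coprod_map_short_exact[OF fam_cells[OF FK] fam_cells[OF FP] fam_cells[OF FF]])
      (use nat_transD(3-5)[OF i] nat_transD(3-5)[OF e] se in simp_all)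
  then have ck: "is_kernel A (chain_trans P F \<epsilon> n) (chain_trans K P \<iota> n)" and cq: "is_cokernel A (chain_trans K P \<iota> n) (chain_trans P F \<epsilon> n)"
    by (simp_all add: short_exact_def)
  obtain jK where jK: "jK \<in> Arr A" "Dom A jK = norm_chain A X K n" "Cod A jK = chain A X K n"
    "Cmp A jK (norm_proj A X K n) = norm_idem K n" "Cmp A (norm_proj A X K n) jK = Ide A (norm_chain A X K n)" by (rule norm_section[OF FK])
  obtain jP where jP: "jP \<in> Arr A" "Dom A jP = norm_chain A X P n" "Cod A jP = chain A X P n"
    "Cmp A jP (norm_proj A X P n) = norm_idem P n" "Cmp A (norm_proj A X P n) jP = Ide A (norm_chain A X P n)" by (rule norm_section[OF FP])
  obtain jF where jF: "jF \<in> Arr A" "Dom A jF = norm_chain A X F n" "Cod A jF = chain A X F n"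
    "Cmp A jF (norm_proj A X F n) = norm_idem F n" "Cmp A (norm_proj A X F n) jF = Ide A (norm_chain A X F n)" by (rule norm_section[OF FF])
  \<comment> \<open>Naturality of the sections is tested after the projection, where it becomes
    naturality of the idempotent.\<close>
  have jn: "Cmp A (chain_trans H G \<tau> n) jH = Cmp A jG (norm_trans H G \<tau> n)"
    if t: "is_nat_trans CX A H G \<tau>" and jH: "jH \<in> Arr A" "Dom A jH = norm_chain A X H n" "Cod A jH = chain A X H n" "Cmp A jH (norm_proj A X H n) = norm_idem H n"
      and jG: "jG \<in> Arr A" "Dom A jG = norm_chain A X G n" "Cod A jG = chain A X G n" "Cmp A jG (norm_proj A X G n) = norm_idem G n" for H G \<tau> jH jG
  proof -
    note H = nat_transD(1)[OF t] and G = nat_transD(2)[OF t]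
    note qH = norm_proj(2-4)[OF H] and qG = norm_proj(2-4)[OF G] and c = chain_trans(1-3)[OF t] and nA = norm_trans(1-3)[OF t]
    have "Cmp A (Cmp A jG (norm_trans H G \<tau> n)) (norm_proj A X H n) = Cmp A jG (Cmp A (norm_proj A X G n) (chain_trans H G \<tau> n))"
      using norm_trans(4)[OF t, of n] jG(1-3) nA qH by simp
    also have "\<dots> = Cmp A (norm_idem G n) (chain_trans H G \<tau> n)"
      by (rule Cmp_eq_extend[OF jG(4)]) (use jG c qG in simp_all)
    also have "\<dots> = Cmp A (Cmp A (chain_trans H G \<tau> n) jH) (norm_proj A X H n)"
      unfolding chain_trans_norm_idem[OF t, symmetric] jH(4)[symmetric] by (rule assoc[symmetric]) (use jH(1-3) qH c in simp_all)
    finally have eq: "Cmp A (Cmp A jG (norm_trans H G \<tau> n)) (norm_proj A X H n) = Cmp A (Cmp A (chain_trans H G \<tau> n) jH) (norm_proj A X H n)" .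
    show ?thesis by (rule norm_ext[OF H _ _ _ _ _ eq[symmetric]]) (use jH jG nA c in simp_all)
  qed
  note jKP = jn[OF i jK(1-4) jP(1-4)] and jPF = jn[OF e jP(1-4) jF(1-4)]
  show "is_epi A (norm_trans P F \<epsilon> n)"
  proof (rule epi_left)
    show "is_epi A (Cmp A (norm_trans P F \<epsilon> n) (norm_proj A X P n))"
      unfolding norm_trans(4)[OF e] by (rule epi_Cmp[OF cokernelD(5)[OF cq] norm_proj(5)[OF FF]]) (use ce qF in simp)
  qed (use ne qP in simp_all)
  show "is_kernel A (norm_trans P F \<epsilon> n) (norm_trans K P \<iota> n)"
  proof (rule kernelI)
    have "is_zero A (Cmp A (norm_proj A X F n) (Cmp A (chain_trans P F \<epsilon> n) (chain_trans K P \<iota> n)))"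
      by (rule is_zero_Cmp_right[OF kernelD(4)[OF ck]]) (use ce ci qF in simp_all)
    then have "is_zero A (Cmp A (Cmp A (norm_trans P F \<epsilon> n) (norm_trans K P \<iota> n)) (norm_proj A X K n))"
      using Cmp_eq_extend[OF norm_trans(4)[OF e, of n], of "chain_trans K P \<iota> n"] norm_trans(4)[OF i, of n] ne ni qK qP qF ci ce by simp
    then show "is_zero A (Cmp A (norm_trans P F \<epsilon> n) (norm_trans K P \<iota> n))"
      using epi_zero[OF norm_proj(5)[OF FK], of "Cmp A (norm_trans P F \<epsilon> n) (norm_trans K P \<iota> n)" n] ne ni qK by simp
    show "is_mono A (norm_trans K P \<iota> n)"
    proof (rule monoI)
      fix u assume u: "u \<in> Arr A" "Cod A u = Dom A (norm_trans K P \<iota> n)" "is_zero A (Cmp A (norm_trans K P \<iota> n) u)"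
      have u': "Cod A u = norm_chain A X K n" using u ni by simp
      have "is_zero A (Cmp A jP (Cmp A (norm_trans K P \<iota> n) u))" by (rule is_zero_Cmp_right[OF u(3)]) (use u u' ni jP in simp_all)
      then have "is_zero A (Cmp A (chain_trans K P \<iota> n) (Cmp A jK u))"
        using Cmp_eq_extend[OF jKP, of u] u u' ni ci jK jP by simp
      then have "is_zero A (Cmp A jK u)" using mono_zero[OF kernelD(5)[OF ck], of "Cmp A jK u"] u u' ci jK by simp
      then have "is_zero A (Cmp A (norm_proj A X K n) (Cmp A jK u))" by (rule is_zero_Cmp_right) (use u u' jK qK in simp_all)
      then show "is_zero A u" using Cmp_eq_extend[OF jK(5), of u] u u' jK qK by simp
    qed (rule ni)
    fix h assume h: "h \<in> Arr A" "Cod A h = Dom A (norm_trans P F \<epsilon> n)" "is_zero A (Cmp A (norm_trans P F \<epsilon> n) h)"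
    have h': "Cod A h = norm_chain A X P n" using h ne by simp
    have "is_zero A (Cmp A jF (Cmp A (norm_trans P F \<epsilon> n) h))" by (rule is_zero_Cmp_right[OF h(3)]) (use h h' ne jF in simp_all)
    then have "is_zero A (Cmp A (chain_trans P F \<epsilon> n) (Cmp A jP h))"
      using Cmp_eq_extend[OF jPF, of h] h h' ne ce jF jP by simp
    \<comment> \<open>The lift is found among unnormalized chains, where the kernel is known, and
      then projected.\<close>
    then obtain w where w: "w \<in> Arr A" "Dom A w = Dom A h" "Cod A w = chain A X K n" "Cmp A (chain_trans K P \<iota> n) w = Cmp A jP h"
      using kernel_lift[OF ck, of "Cmp A jP h"] h h' ce ci jP by auto
    have "Cmp A (norm_trans K P \<iota> n) (Cmp A (norm_proj A X K n) w) = Cmp A (norm_proj A X P n) (Cmp A jP h)"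
      using Cmp_eq_extend[OF norm_trans(4)[OF i, of n], of w] w ni qK qP ci by simp
    also have "\<dots> = h" using Cmp_eq_extend[OF jP(5), of h] h h' jP qP by simp
    finally show "\<exists>u. u \<in> Arr A \<and> Dom A u = Dom A h \<and> Cod A u = Dom A (norm_trans K P \<iota> n) \<and> Cmp A (norm_trans K P \<iota> n) u = h"
      by (intro exI[of _ "Cmp A (norm_proj A X K n) w"]) (use w ni qK in simp)
  qed (use ne ni in simp_all)
qed

section \<open>Acyclicity of the effacement\<close>

text \<open>The chains of \<open>Pf F\<close> in degree n are a coproduct of copies of F(x), one for
  each cell x in X_k and each cube map \<alpha> from n to k; this is the injection of one copy. For
  fixed x the copies form the chains of the standard k-cube with coefficients in F(x).\<close>

definition chain_free_in :: "('s, 'o, 'm) csystem \<Rightarrow> 's \<Rightarrow> cube_map \<Rightarrow> 'm" where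
  "chain_free_in F x \<alpha> = Cmp A (chain_in A X (Pf F) (fst \<alpha>) (act X \<alpha> x)) (free_in F (lift X \<alpha> x))"

lemma chain_free_in:
  assumes F: "is_functor CX A F" and a: "\<alpha> \<in> Hom Box n k" and x: "x \<in> cells X k"
  shows "chain_free_in F x \<alpha> \<in> Arr A" "Dom A (chain_free_in F x \<alpha>) = fob F (k, x)" "Cod A (chain_free_in F x \<alpha>) = chain A X (Pf F) n"
    "chain_free_in F x \<alpha> = Cmp A (chain_in A X (Pf F) n (act X \<alpha> x)) (free_in F (lift X \<alpha> x))"
    "free_in F (lift X \<alpha> x) \<in> Arr A" "Dom A (free_in F (lift X \<alpha> x)) = fob F (k, x)" "Cod A (free_in F (lift X \<alpha> x)) = fob (Pf F) (n, act X \<alpha> x)"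
proof -
  have n: "fst \<alpha> = n" using a by (simp add: Hom_iff)
  note l = lift_Arr(1-3)[OF a x] and ax = cubical_setD(1)[OF X a x]
  have ob: "(n, act X \<alpha> x) \<in> Obj CX" using ax by simp
  note f = free_in[OF F l(1), unfolded l(2,3)] and i = chain_in[OF Pf_functor[OF F] ax]
  show e: "chain_free_in F x \<alpha> = Cmp A (chain_in A X (Pf F) n (act X \<alpha> x)) (free_in F (lift X \<alpha> x))" by (simp add: chain_free_in_def n)
  show f': "free_in F (lift X \<alpha> x) \<in> Arr A" "Dom A (free_in F (lift X \<alpha> x)) = fob F (k, x)" "Cod A (free_in F (lift X \<alpha> x)) = fob (Pf F) (n, act X \<alpha> x)"
    using f fob_Pf[OF ob, of F] by simp_all
  show "chain_free_in F x \<alpha> \<in> Arr A" "Dom A (chain_free_in F x \<alpha>) = fob F (k, x)" "Cod A (chain_free_in F x \<alpha>) = chain A X (Pf F) n"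
    unfolding e using f' i by simp_all
qed

text \<open>Cube maps act on the label \<alpha> by precomposition and leave x alone. This is what
  splits the chains of \<open>Pf F\<close> into chains of standard cubes.\<close>

lemma natfam_chain_free_in:
  assumes F: "is_functor CX A F" and x: "x \<in> cells X k"
  shows "natfam (Pf F) (fob F (k, x)) k (chain_free_in F x)"
  unfolding natfam_def
proof (intro conjI allI ballI)
  note P = Pf_functor[OF F]
  show "is_functor CX A (Pf F)" by (rule P)
  show "fob F (k, x) \<in> Obj A" using functorD(1)[OF F] x by simp
  fix n \<alpha> assume a: "\<alpha> \<in> Hom Box n k"
  note p = chain_free_in[OF F a x]
  show "chain_free_in F x \<alpha> \<in> Hom A (fob F (k, x)) (chain A X (Pf F) n)" using p by (simp add: Hom_iff[of _ A])
  fix m \<beta> assume b: "\<beta> \<in> Hom Box m n"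
  note ab = cube_comp_Hom[OF b a] and ax = cubical_setD(1)[OF X a x]
  note bax = cubical_setD(1)[OF X b ax] and la = lift_Arr(1-3)[OF a x] and lb = lift_Arr(1-3)[OF b ax]
  note cb = chain_map(1-3)[OF P b] and ia = chain_in[OF P ax] and ib = chain_in[OF P bax] and fl = far_lift[OF P b ax]
  have "Cmp A (chain_map A X (Pf F) \<beta>) (chain_free_in F x \<alpha>) = Cmp A (Cmp A (chain_map A X (Pf F) \<beta>) (chain_in A X (Pf F) n (act X \<alpha> x))) (free_in F (lift X \<alpha> x))"
    unfolding p(4) by (rule assoc[symmetric]) (use p(5-7) ia cb in simp_all)
  also have "\<dots> = Cmp A (chain_in A X (Pf F) m (act X \<beta> (act X \<alpha> x))) (Cmp A (far (Pf F) (lift X \<beta> (act X \<alpha> x))) (free_in F (lift X \<alpha> x)))"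
    unfolding chain_map(4)[OF P b ax] by (rule assoc) (use p(5-7) ib fl in simp_all)
  also have "Cmp A (far (Pf F) (lift X \<beta> (act X \<alpha> x))) (free_in F (lift X \<alpha> x)) = free_in F (Cmp CX (lift X \<beta> (act X \<alpha> x)) (lift X \<alpha> x))"
    by (rule far_Pf(4)[OF F lb(1) la(1)]) (simp only: la(3) lb(2))
  also have "\<dots> = free_in F (lift X (cube_comp \<alpha> \<beta>) x)" unfolding lift_comp[OF b a x] ..
  also have "Cmp A (chain_in A X (Pf F) m (act X \<beta> (act X \<alpha> x))) (free_in F (lift X (cube_comp \<alpha> \<beta>) x)) = chain_free_in F x (cube_comp \<alpha> \<beta>)"
    unfolding chain_free_in(4)[OF F ab x] cubical_setD(3)[OF X b a x] ..
  finally show "Cmp A (chain_map A X (Pf F) \<beta>) (chain_free_in F x \<alpha>) = chain_free_in F x (cube_comp \<alpha> \<beta>)" .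
qed

lemma CX_arrow_lift:
  assumes "f \<in> Arr CX" "Cod CX f = (n, y)"
  obtains k \<alpha> x where "\<alpha> \<in> Hom Box n k" "x \<in> cells X k" "f = lift X \<alpha> x" "y = act X \<alpha> x" "f = ((n, y), \<alpha>, (k, x))"
proof -
  obtain m z \<alpha> k x where f: "f = ((m, z), \<alpha>, (k, x))" by (metis prod.collapse)
  have "m = n" "z = y" "\<alpha> \<in> Hom Box n k" "x \<in> cells X k" "y = act X \<alpha> x" using assms by (auto simp: f)
  then show ?thesis using that[of \<alpha> k x] f lift_Arr(4)[of \<alpha> n k x] by simp
qed

lemma chain_free_in_ext:
  assumes F: "is_functor CX A F" and u: "u \<in> Arr A" "v \<in> Arr A" "Dom A u = chain A X (Pf F) n" "Dom A v = chain A X (Pf F) n" "Cod A u = Cod A v"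
    and eq: "\<And>k x \<alpha>. x \<in> cells X k \<Longrightarrow> \<alpha> \<in> Hom Box n k \<Longrightarrow> Cmp A u (chain_free_in F x \<alpha>) = Cmp A v (chain_free_in F x \<alpha>)"
  shows "u = v"
proof (rule chain_ext[OF Pf_functor[OF F] u])
  fix y assume y: "y \<in> cells X n"
  note i = chain_in[OF Pf_functor[OF F] y]
  have ob: "(n, y) \<in> Obj CX" using y by simp
  show "Cmp A u (chain_in A X (Pf F) n y) = Cmp A v (chain_in A X (Pf F) n y)"
  proof (rule free_ext[OF F, where c = "(n, y)"])
    fix f assume f: "f \<in> Arr CX" "Cod CX f = (n, y)"
    obtain k \<alpha> x where a: "\<alpha> \<in> Hom Box n k" "x \<in> cells X k" "f = lift X \<alpha> x" "y = act X \<alpha> x" by (rule CX_arrow_lift[OF f]) blast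
    note p = chain_free_in[OF F a(1,2)]
    show "Cmp A (Cmp A u (chain_in A X (Pf F) n y)) (free_in F f) = Cmp A (Cmp A v (chain_in A X (Pf F) n y)) (free_in F f)"
      using eq[OF a(2,1)] p i u a(3,4) by simp
  qed (use i u fob_Pf[OF ob, of F] in simp_all)
qed

lemma chain_free_in_desc:
  assumes F: "is_functor CX A F" and Q: "Q \<in> Obj A"
    and w: "\<And>k x \<alpha>. x \<in> cells X k \<Longrightarrow> \<alpha> \<in> Hom Box n k \<Longrightarrow> w k x \<alpha> \<in> Hom A (fob F (k, x)) Q"
  obtains h where "h \<in> Arr A" "Dom A h = chain A X (Pf F) n" "Cod A h = Q"
    "\<And>k x \<alpha>. x \<in> cells X k \<Longrightarrow> \<alpha> \<in> Hom Box n k \<Longrightarrow> Cmp A h (chain_free_in F x \<alpha>) = w k x \<alpha>"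
proof -
  note P = Pf_functor[OF F]
  \<comment> \<open>Arrows into (n, y) are the triples ((n, y), \<alpha>, (k, x)), from which k, x
    and \<alpha> can be read off.\<close>
  define g where "g = (\<lambda>(u :: nat \<times> 's, \<alpha>, (k, x)). w k x \<alpha>)"
  have gH: "g f \<in> Hom A (fob F (Dom CX f)) Q" if f: "f \<in> Arr CX" "Cod CX f = (n, y)" for f y
  proof -
    obtain k \<alpha> x where a: "\<alpha> \<in> Hom Box n k" "x \<in> cells X k" "f = ((n, y), \<alpha>, (k, x))" by (rule CX_arrow_lift[OF f]) blast
    then show ?thesis using w[OF a(2,1)] by (simp add: g_def)
  qed
  define hc where "hc y = fcopair F (n, y) Q g" for y
  have hc: "hc y \<in> Arr A" "Dom A (hc y) = fob (Pf F) (n, y)" "Cod A (hc y) = Q" if "y \<in> cells X n" for y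
    using fcopair(1-3)[OF F Q gH] that by (simp_all add: hc_def)
  have hf: "Cmp A (hc y) (free_in F f) = g f" if "f \<in> Arr CX" "Cod CX f = (n, y)" for f y
    unfolding hc_def by (rule fcopair(4)[OF F Q gH that])
  have "\<forall>y\<in>cells X n. hc y \<in> Hom A (fob (Pf F) (n, y)) Q" using hc by (simp add: Hom_iff[of _ A])
  note c = copair[OF fam_cells[OF P] Q this]
  let ?h = "copair A (cells X n) (\<lambda>y. fob (Pf F) (n, y)) Q hc"
  show ?thesis
  proof (rule that[of ?h])
    show h: "?h \<in> Arr A" "Dom A ?h = chain A X (Pf F) n" "Cod A ?h = Q" using c by (simp_all add: chain_def)
    fix k x \<alpha> assume x: "x \<in> cells X k" and a: "\<alpha> \<in> Hom Box n k"
    note ax = cubical_setD(1)[OF X a x] and p = chain_free_in[OF F a x] and l = lift_Arr[OF a x]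
    note i = chain_in[OF P ax]
    have hi: "Cmp A ?h (chain_in A X (Pf F) n (act X \<alpha> x)) = hc (act X \<alpha> x)" using c(4)[OF ax] by (simp add: chain_in_def)
    have "Cmp A ?h (chain_free_in F x \<alpha>) = Cmp A (hc (act X \<alpha> x)) (free_in F (lift X \<alpha> x))"
      unfolding p(4) by (rule Cmp_eq_extend[OF hi]) (use p(5-7) i h in simp_all)
    also have "\<dots> = g (lift X \<alpha> x)" by (rule hf[OF l(1,3)])
    also have "\<dots> = w k x \<alpha>" unfolding l(4) by (simp add: g_def)
    finally show "Cmp A ?h (chain_free_in F x \<alpha>) = w k x \<alpha>" .
  qed
qed

text \<open>The contraction of the standard cube acts on the label \<alpha>, separately for each x,
  and descends because it sends degenerate maps to degenerate chains.\<close>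

lemma norm_contraction:
  assumes F: "is_functor CX A F"
  obtains h where "h \<in> Arr A" "Dom A h = norm_chain A X (Pf F) n" "Cod A h = norm_chain A X (Pf F) (Suc n)"
    "\<And>k x c. x \<in> cells X k \<Longrightarrow> Poly_Mapping.keys c \<subseteq> Hom Box n k \<Longrightarrow>
       Cmp A h (Cmp A (norm_proj A X (Pf F) n) (comb (Pf F) (fob F (k, x)) k (chain_free_in F x) n c)) =
       Cmp A (norm_proj A X (Pf F) (Suc n)) (comb (Pf F) (fob F (k, x)) k (chain_free_in F x) (Suc n) (frag_extend (contr k) c))"
proof -
  note P = Pf_functor[OF F]
  note q = norm_proj(2-4)[OF P]
  define w where "w k x \<alpha> = comb (Pf F) (fob F (k, x)) k (chain_free_in F x) (Suc n) (contr k \<alpha>)" for k x \<alpha>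
  have wH: "w k x \<alpha> \<in> Hom A (fob F (k, x)) (chain A X (Pf F) (Suc n))" if "x \<in> cells X k" "\<alpha> \<in> Hom Box n k" for k x \<alpha>
    unfolding w_def by (rule comb_Hom[OF natfam_chain_free_in[OF F that(1)] contr_keys[OF that(2)]])
  obtain g where g: "g \<in> Arr A" "Dom A g = chain A X (Pf F) n" "Cod A g = chain A X (Pf F) (Suc n)"
    and gp: "\<And>k x \<alpha>. x \<in> cells X k \<Longrightarrow> \<alpha> \<in> Hom Box n k \<Longrightarrow> Cmp A g (chain_free_in F x \<alpha>) = w k x \<alpha>"
    by (rule chain_free_in_desc[OF F chain_Obj[OF P] wH], assumption, assumption, rule that)
  have gl: "Cmp A g (comb (Pf F) (fob F (k, x)) k (chain_free_in F x) n c) = comb (Pf F) (fob F (k, x)) k (chain_free_in F x) (Suc n) (frag_extend (contr k) c)"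
    if x: "x \<in> cells X k" and c: "Poly_Mapping.keys c \<subseteq> Hom Box n k" for k x c
  proof -
    note v = natfam_chain_free_in[OF F x]
    note a = natfamD(2)[OF v]
    have V: "\<And>\<alpha>. \<alpha> \<in> Hom Box i k \<Longrightarrow> chain_free_in F x \<alpha> \<in> Hom A (fob F (k, x)) (chain A X (Pf F) i)" for i by (rule natfamD(3)[OF v])
    have gH: "g \<in> Hom A (chain A X (Pf F) n) (chain A X (Pf F) (Suc n))" using g by (simp add: Hom_iff[of _ A])
    have "Cmp A g (comb (Pf F) (fob F (k, x)) k (chain_free_in F x) n c) = lin (Hom Box n k) (fob F (k, x)) (chain A X (Pf F) (Suc n)) (\<lambda>\<alpha>. Cmp A g (chain_free_in F x \<alpha>)) c"
      unfolding comb_def by (rule Cmp_lin[OF c a chain_Obj[OF P] V gH])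
    also have "\<dots> = lin (Hom Box n k) (fob F (k, x)) (chain A X (Pf F) (Suc n)) (w k x) c"
      by (rule lin_cong[OF c a chain_Obj[OF P] wH[OF x] gp[OF x]])
    also have "\<dots> = comb (Pf F) (fob F (k, x)) k (chain_free_in F x) (Suc n) (frag_extend (contr k) c)"
      unfolding w_def[abs_def] comb_def by (rule lin_frag_extend[OF c a chain_Obj[OF P] V contr_keys, symmetric])
    finally show ?thesis .
  qed
  let ?u = "Cmp A (norm_proj A X (Pf F) (Suc n)) g"
  have u: "?u \<in> Arr A" "Dom A ?u = chain A X (Pf F) n" "Cod A ?u = norm_chain A X (Pf F) (Suc n)" using g q by simp_all
  \<comment> \<open>A degeneracy turns the label \<alpha> into a degenerate one, whose contraction
    the projection kills.\<close>
  have z: "is_zero A (Cmp A ?u (chain_map A X (Pf F) (degen n i)))" if i: "i \<in> {1..n}" for i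
  proof -
    have d: "degen n i \<in> Hom Box n (n - 1)" using degen_Hom i by simp
    note cd = chain_map(1-3)[OF P d]
    have uz: "Cmp A ?u (chain_map A X (Pf F) (degen n i)) = Zer A (chain A X (Pf F) (n - 1)) (norm_chain A X (Pf F) (Suc n))"
    proof (rule chain_free_in_ext[OF F, of _ _ "n - 1"])
      fix k x \<alpha> assume x: "x \<in> cells X k" and a: "\<alpha> \<in> Hom Box (n - 1) k"
      note v = natfam_chain_free_in[OF F x] and ad = cube_comp_Hom[OF d a] and p = chain_free_in(1-3)[OF F a x]
      have "is_zero A (Cmp A (norm_proj A X (Pf F) (Suc n)) (w k x (cube_comp \<alpha> (degen n i))))"
        unfolding w_def by (rule norm_proj_comb[OF v contr_keys[OF ad] contr_dgn[OF ad degen_comp_dgn[OF a i]]])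
      then have "is_zero A (Cmp A (norm_proj A X (Pf F) (Suc n)) (Cmp A g (Cmp A (chain_map A X (Pf F) (degen n i)) (chain_free_in F x \<alpha>))))"
        unfolding natfamD(4)[OF v a d] gp[OF x ad] .
      then have "is_zero A (Cmp A (Cmp A ?u (chain_map A X (Pf F) (degen n i))) (chain_free_in F x \<alpha>))" using g q cd p by simp
      then show "Cmp A (Cmp A ?u (chain_map A X (Pf F) (degen n i))) (chain_free_in F x \<alpha>) = Cmp A (Zer A (chain A X (Pf F) (n - 1)) (norm_chain A X (Pf F) (Suc n))) (chain_free_in F x \<alpha>)"
        by (rule zero_eq) (use g q cd p norm_proj(6)[OF P] Obj_Dom[OF p(1)] in simp_all)
    qed (use u cd chain_Obj[OF P] norm_proj(6)[OF P] in simp_all)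
    show ?thesis unfolding uz using chain_Obj[OF P] norm_proj(6)[OF P] by simp
  qed
  obtain h where h: "h \<in> Arr A" "Dom A h = norm_chain A X (Pf F) n" "Cod A h = Cod A ?u" "Cmp A h (norm_proj A X (Pf F) n) = ?u"
    by (rule norm_desc[OF P u(1,2) z])
  show ?thesis
  proof (rule that[of h])
    show "h \<in> Arr A" "Dom A h = norm_chain A X (Pf F) n" "Cod A h = norm_chain A X (Pf F) (Suc n)" using h u by simp_all
    fix k x and c :: "cube_map \<Rightarrow>\<^sub>0 int" assume x: "x \<in> cells X k" and c: "Poly_Mapping.keys c \<subseteq> Hom Box n k"
    have l: "comb (Pf F) (fob F (k, x)) k (chain_free_in F x) n c \<in> Arr A" "Cod A (comb (Pf F) (fob F (k, x)) k (chain_free_in F x) n c) = chain A X (Pf F) n"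
      using comb_Hom[OF natfam_chain_free_in[OF F x] c] by (simp_all add: Hom_iff[of _ A])
    show "Cmp A h (Cmp A (norm_proj A X (Pf F) n) (comb (Pf F) (fob F (k, x)) k (chain_free_in F x) n c)) =
       Cmp A (norm_proj A X (Pf F) (Suc n)) (comb (Pf F) (fob F (k, x)) k (chain_free_in F x) (Suc n) (frag_extend (contr k) c))"
      unfolding gl[OF x c, symmetric] using Cmp_eq_extend[OF h(4), of "comb (Pf F) (fob F (k, x)) k (chain_free_in F x) n c"] l h(1,2) q g by simp
  qed
qed

text \<open>Contractions out of degrees n and n + 1 give d h + h d = 1 in degree n + 1: the error in
  \<open>contr_homotopy\<close> is degenerate and disappears in normalized chains. The degree is
  positive, as that homotopy requires.\<close>

lemma Pf_acyclic:
  assumes F: "is_functor CX A F"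
  shows "exact_pair A (norm_boundary A X (Pf F) (Suc (Suc n))) (norm_boundary A X (Pf F) (Suc n))"
proof -
  note P = Pf_functor[OF F]
  note q = norm_proj(2-4)[OF P] and qO = norm_proj(6)[OF P] and b = norm_boundary_Arr(1-3)[OF P] and d = boundary_Arr[OF P]
  obtain h0 where h0: "h0 \<in> Arr A" "Dom A h0 = norm_chain A X (Pf F) n" "Cod A h0 = norm_chain A X (Pf F) (Suc n)"
    and h0e: "\<And>k x c. x \<in> cells X k \<Longrightarrow> Poly_Mapping.keys c \<subseteq> Hom Box n k \<Longrightarrow>
       Cmp A h0 (Cmp A (norm_proj A X (Pf F) n) (comb (Pf F) (fob F (k, x)) k (chain_free_in F x) n c)) =
       Cmp A (norm_proj A X (Pf F) (Suc n)) (comb (Pf F) (fob F (k, x)) k (chain_free_in F x) (Suc n) (frag_extend (contr k) c))"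
    by (rule norm_contraction[OF F, of n]) blast
  obtain h1 where h1: "h1 \<in> Arr A" "Dom A h1 = norm_chain A X (Pf F) (Suc n)" "Cod A h1 = norm_chain A X (Pf F) (Suc (Suc n))"
    and h1e: "\<And>k x c. x \<in> cells X k \<Longrightarrow> Poly_Mapping.keys c \<subseteq> Hom Box (Suc n) k \<Longrightarrow>
       Cmp A h1 (Cmp A (norm_proj A X (Pf F) (Suc n)) (comb (Pf F) (fob F (k, x)) k (chain_free_in F x) (Suc n) c)) =
       Cmp A (norm_proj A X (Pf F) (Suc (Suc n))) (comb (Pf F) (fob F (k, x)) k (chain_free_in F x) (Suc (Suc n)) (frag_extend (contr k) c))"
    by (rule norm_contraction[OF F, of "Suc n"]) blast
  let ?q = "\<lambda>n. norm_proj A X (Pf F) n" and ?b = "\<lambda>n. norm_boundary A X (Pf F) n"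
  let ?S = "Add A (Cmp A (?b (Suc (Suc n))) h1) (Cmp A h0 (?b (Suc n)))"
  have S: "?S \<in> Arr A" "Dom A ?S = norm_chain A X (Pf F) (Suc n)" "Cod A ?S = norm_chain A X (Pf F) (Suc n)" using h0 h1 b by simp_all
  have hom: "?S = Ide A (norm_chain A X (Pf F) (Suc n))"
  proof (rule norm_ext[OF P, of _ _ "Suc n"])
    show "Cmp A ?S (?q (Suc n)) = Cmp A (Ide A (norm_chain A X (Pf F) (Suc n))) (?q (Suc n))"
    proof (rule chain_free_in_ext[OF F, of _ _ "Suc n"])
      fix k x \<alpha> assume x: "x \<in> cells X k" and a: "\<alpha> \<in> Hom Box (Suc n) k"
      note v = natfam_chain_free_in[OF F x]
      let ?l = "comb (Pf F) (fob F (k, x)) k (chain_free_in F x)"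
      note p = chain_free_in(1-3)[OF F a x]
      have ka: "Poly_Mapping.keys (frag_of \<alpha>) \<subseteq> Hom Box (Suc n) k" using a by simp
      have la: "?l (Suc n) (frag_of \<alpha>) = chain_free_in F x \<alpha>" by (rule comb_of[OF v a])
      note kc = contr_keys[OF a]
      have kb: "Poly_Mapping.keys (bd (frag_of \<alpha>)) \<subseteq> Hom Box n k" using bd_keys[OF ka] by simp
      have kbc: "Poly_Mapping.keys (bd (contr k \<alpha>)) \<subseteq> Hom Box (Suc n) k" using bd_keys[OF kc] by simp
      have kcb: "Poly_Mapping.keys (frag_extend (contr k) (bd (frag_of \<alpha>))) \<subseteq> Hom Box (Suc n) k"
        by (rule frag_extend_keys) (use kb contr_keys in blast)
      have L: "?l i c \<in> Arr A" "Dom A (?l i c) = fob F (k, x)" "Cod A (?l i c) = chain A X (Pf F) i" if "Poly_Mapping.keys c \<subseteq> Hom Box i k" for i c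
        using comb_Hom[OF v that] by (simp_all add: Hom_iff[of _ A])
      \<comment> \<open>On classes of combinations the normalized boundary is computed by
        \<open>bd\<close>.\<close>
      have bq: "Cmp A (?b (Suc i)) (Cmp A (?q (Suc i)) (?l (Suc i) c)) = Cmp A (?q i) (?l i (bd c))" if c: "Poly_Mapping.keys c \<subseteq> Hom Box (Suc i) k" for i c
      proof -
        have "Cmp A (?b (Suc i)) (Cmp A (?q (Suc i)) (?l (Suc i) c)) = Cmp A (Cmp A (?q i) (boundary A X (Pf F) (Suc i))) (?l (Suc i) c)"
          by (rule Cmp_eq_extend[OF norm_boundary_Arr(4)[OF P]]) (use L[OF c] b q in simp_all)
        also have "\<dots> = Cmp A (?q i) (Cmp A (boundary A X (Pf F) (Suc i)) (?l (Suc i) c))"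
          by (rule assoc) (use L[OF c] d q in simp_all)
        also have "Cmp A (boundary A X (Pf F) (Suc i)) (?l (Suc i) c) = ?l i (bd c)" using boundary_comp_comb[OF v c] by simp
        finally show ?thesis .
      qed
      have t1: "Cmp A (?b (Suc (Suc n))) (Cmp A h1 (Cmp A (?q (Suc n)) (chain_free_in F x \<alpha>))) = Cmp A (?q (Suc n)) (?l (Suc n) (bd (contr k \<alpha>)))"
        using h1e[OF x ka] bq[OF kc] by (simp add: la)
      have t2: "Cmp A h0 (Cmp A (?b (Suc n)) (Cmp A (?q (Suc n)) (chain_free_in F x \<alpha>))) = Cmp A (?q (Suc n)) (?l (Suc n) (frag_extend (contr k) (bd (frag_of \<alpha>))))"
        using bq[OF ka] h0e[OF x kb] by (simp add: la)
      let ?c = "bd (contr k \<alpha>) + frag_extend (contr k) (bd (frag_of \<alpha>))"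
      have kC: "Poly_Mapping.keys ?c \<subseteq> Hom Box (Suc n) k" by (rule subset_trans[OF keys_add Un_least[OF kbc kcb]])
      have "is_zero A (Cmp A (?q (Suc n)) (?l (Suc n) (?c - frag_of \<alpha>)))"
        by (rule norm_proj_comb[OF v subset_trans[OF keys_diff Un_least[OF kC ka]] contr_homotopy[OF a]]) simp
      then have "is_zero A (Sub A (Cmp A (?q (Suc n)) (?l (Suc n) ?c)) (Cmp A (?q (Suc n)) (chain_free_in F x \<alpha>)))"
        unfolding comb_diff[OF v kC ka] la using L[OF kC] p q by (simp add: Cmp_Sub_right)
      then have "Cmp A (?q (Suc n)) (?l (Suc n) ?c) = Cmp A (?q (Suc n)) (chain_free_in F x \<alpha>)"
        using L[OF kC] p q by (simp add: is_zero_Sub)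
      moreover have "Cmp A (?q (Suc n)) (?l (Suc n) ?c) = Add A (Cmp A (?q (Suc n)) (?l (Suc n) (bd (contr k \<alpha>)))) (Cmp A (?q (Suc n)) (?l (Suc n) (frag_extend (contr k) (bd (frag_of \<alpha>)))))"
        unfolding comb_add[OF v kbc kcb] using L[OF kbc] L[OF kcb] q by (simp add: Cmp_AddR)
      ultimately have e: "Add A (Cmp A (?b (Suc (Suc n))) (Cmp A h1 (Cmp A (?q (Suc n)) (chain_free_in F x \<alpha>)))) (Cmp A h0 (Cmp A (?b (Suc n)) (Cmp A (?q (Suc n)) (chain_free_in F x \<alpha>)))) = Cmp A (?q (Suc n)) (chain_free_in F x \<alpha>)"
        unfolding t1 t2 by simp
      have "Cmp A (Cmp A ?S (?q (Suc n))) (chain_free_in F x \<alpha>) = Cmp A ?S (Cmp A (?q (Suc n)) (chain_free_in F x \<alpha>))"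
        by (rule assoc) (use S q p in simp_all)
      also have "\<dots> = Add A (Cmp A (?b (Suc (Suc n))) (Cmp A h1 (Cmp A (?q (Suc n)) (chain_free_in F x \<alpha>)))) (Cmp A h0 (Cmp A (?b (Suc n)) (Cmp A (?q (Suc n)) (chain_free_in F x \<alpha>))))"
        using h0 h1 b q p by (simp add: Cmp_AddL)
      finally show "Cmp A (Cmp A ?S (?q (Suc n))) (chain_free_in F x \<alpha>) = Cmp A (Cmp A (Ide A (norm_chain A X (Pf F) (Suc n))) (?q (Suc n))) (chain_free_in F x \<alpha>)"
        unfolding e using q p qO by simp
    qed (use S q qO in simp_all)
  qed (use S qO in simp_all)
  show ?thesis unfolding exact_pair_def
  proof (intro conjI ballI impI)
    show "is_zero A (Cmp A (?b (Suc n)) (?b (Suc (Suc n))))" by (rule norm_boundary_boundary[OF P])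
    fix x assume x: "x \<in> Arr A" "Cod A x = Dom A (?b (Suc n)) \<and> is_zero A (Cmp A (?b (Suc n)) x)"
    then have x': "Cod A x = norm_chain A X (Pf F) (Suc n)" using b by simp
    have "is_zero A (Cmp A h0 (Cmp A (?b (Suc n)) x))" by (rule is_zero_Cmp_right) (use x x' b h0 in simp_all)
    then have z: "Cmp A h0 (Cmp A (?b (Suc n)) x) = Zer A (Dom A x) (norm_chain A X (Pf F) (Suc n))"
      using x x' b h0 by (simp add: is_zero_def)
    \<comment> \<open>On a cycle the summand h d vanishes, so x = d (h x).\<close>
    have "Cmp A ?S x = Cmp A (?b (Suc (Suc n))) (Cmp A h1 x)"
      using x(1) x' b h0 h1 z by (simp add: Cmp_AddL)
    then have "Cmp A (?b (Suc (Suc n))) (Cmp A h1 x) = x" unfolding hom using x x' by simp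
    then show "in_image A (?b (Suc (Suc n))) x"
      by (intro in_imageI[of A "Ide A (Dom A x)" x "Cmp A h1 x"]) (use x x' b h1 in \<open>simp_all add: epi_Ide\<close>)
  qed (use b in simp_all)
qed

end

section \<open>The colimit as homology in degree zero\<close>

lemma colimit_desc:
  assumes "is_colimit C A F L \<eta>" "is_cocone C A F M \<mu>"
  obtains h where "h \<in> Arr A" "Dom A h = L" "Cod A h = M" "\<And>c. c \<in> Obj C \<Longrightarrow> Cmp A h (\<eta> c) = \<mu> c"
proof -
  have "\<exists>!h. h \<in> Hom A L M \<and> (\<forall>c\<in>Obj C. Cmp A h (\<eta> c) = \<mu> c)" using assms by (simp add: is_colimit_def)
  then show ?thesis using that by (auto simp: Hom_iff)
qed

lemma cubical_vertex: "length w = n \<Longrightarrow> cubical 0 n (\<lambda>xs. w)"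
proof (induction w arbitrary: n)
  case Nil
  then show ?case by (simp add: cubical.nil)
next
  case (Cons b w)
  then show ?case using cubical.const[OF Cons.IH[OF refl], of b] by simp
qed

definition vertex :: "bool list \<Rightarrow> cube_map" where
  "vertex w = cmap 0 (length w) (\<lambda>xs. w)"

lemma vertex_Hom: "length w = n \<Longrightarrow> vertex w \<in> Hom Box 0 n"
  using cubical_Hom[OF cubical_vertex[of w n]] by (simp add: vertex_def)

lemma Hom_vertex: assumes "\<alpha> \<in> Hom Box 0 n" obtains w where "length w = n" "\<alpha> = vertex w"
proof -
  obtain f where f: "\<alpha> = cmap 0 n f" "cubical 0 n f" by (rule Box_Hom_cases[OF assms])
  have "length (f []) = n" using length_cubical[OF f(2), of "[]"] by simp
  moreover have "\<alpha> = vertex (f [])" using f(1) calculation by (simp add: vertex_def cmap_eq_iff)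
  ultimately show ?thesis by (rule that)
qed

context cubical_coefficients
begin

lemma cocone:
  assumes "is_cocone CX A F L \<eta>"
  shows "L \<in> Obj A" "c \<in> Obj CX \<Longrightarrow> \<eta> c \<in> Arr A" "c \<in> Obj CX \<Longrightarrow> Dom A (\<eta> c) = fob F c" "c \<in> Obj CX \<Longrightarrow> Cod A (\<eta> c) = L"
    "f \<in> Arr CX \<Longrightarrow> Cmp A (\<eta> (Cod CX f)) (far F f) = \<eta> (Dom CX f)"
  using assms unfolding is_cocone_def by (simp_all add: Hom_iff[of _ A])

lemma colimit_ext:
  assumes L: "is_colimit CX A F L \<eta>" and u: "u \<in> Arr A" "v \<in> Arr A" "Dom A u = L" "Dom A v = L" "Cod A u = Cod A v"
    and eq: "\<And>c. c \<in> Obj CX \<Longrightarrow> Cmp A u (\<eta> c) = Cmp A v (\<eta> c)" and F: "is_functor CX A F"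
  shows "u = v"
proof -
  have co: "is_cocone CX A F L \<eta>" using L by (simp add: is_colimit_def)
  note c = cocone[OF co]
  have "is_cocone CX A F (Cod A u) (\<lambda>c. Cmp A u (\<eta> c))"
    unfolding is_cocone_def
  proof (intro conjI ballI)
    fix f assume f: "f \<in> Arr CX"
    have o: "Cod CX f \<in> Obj CX" using C.Obj_Cod[OF f] .
    show "Cmp A (Cmp A u (\<eta> (Cod CX f))) (far F f) = Cmp A u (\<eta> (Dom CX f))"
      unfolding c(5)[OF f, symmetric] by (rule assoc) (use c(2-4)[OF o] u functorD(2-4)[OF F f] in simp_all)
  qed (use c u in \<open>simp_all add: Hom_iff[of _ A]\<close>)
  then have "\<exists>!h. h \<in> Hom A L (Cod A u) \<and> (\<forall>c\<in>Obj CX. Cmp A h (\<eta> c) = Cmp A u (\<eta> c))"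
    using L by (simp only: is_colimit_def)
  from Ex1_unique[OF this, of v u] show ?thesis using u eq by (simp add: Hom_iff[of _ A])
qed

text \<open>The augmentation of the chain complex towards a cocone; only the components at 0-cells
  enter.\<close>

definition aug :: "('s, 'o, 'm) csystem \<Rightarrow> 'o \<Rightarrow> (nat \<times> 's \<Rightarrow> 'm) \<Rightarrow> 'm" where
  "aug F L \<eta> = copair A (cells X 0) (\<lambda>x. fob F (0, x)) L (\<lambda>x. \<eta> (0, x))"

lemma aug:
  assumes F: "is_functor CX A F" and co: "is_cocone CX A F L \<eta>"
  shows "aug F L \<eta> \<in> Arr A" "Dom A (aug F L \<eta>) = chain A X F 0" "Cod A (aug F L \<eta>) = L"
    "x \<in> cells X 0 \<Longrightarrow> Cmp A (aug F L \<eta>) (chain_in A X F 0 x) = \<eta> (0, x)"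
proof -
  have "\<forall>x\<in>cells X 0. \<eta> (0, x) \<in> Hom A (fob F (0, x)) L" using cocone[OF co] by (simp add: Hom_iff[of _ A])
  note c = copair[OF fam_cells[OF F] cocone(1)[OF co] this]
  show "aug F L \<eta> \<in> Arr A" "Dom A (aug F L \<eta>) = chain A X F 0" "Cod A (aug F L \<eta>) = L"
    "x \<in> cells X 0 \<Longrightarrow> Cmp A (aug F L \<eta>) (chain_in A X F 0 x) = \<eta> (0, x)"
    using c by (simp_all add: aug_def chain_def chain_in_def)
qed

text \<open>By the cocone identity the component at a cell is recovered from any vertex of that
  cell.\<close>

lemma aug_vertex:
  assumes F: "is_functor CX A F" and co: "is_cocone CX A F L \<eta>" and a: "\<alpha> \<in> Hom Box 0 n" and x: "x \<in> cells X n"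
  shows "Cmp A (aug F L \<eta>) (Cmp A (chain_map A X F \<alpha>) (chain_in A X F n x)) = \<eta> (n, x)"
proof -
  note ax = cubical_setD(1)[OF X a x] and l = lift_Arr[OF a x]
  note g = aug[OF F co]
  have "Cmp A (aug F L \<eta>) (Cmp A (chain_map A X F \<alpha>) (chain_in A X F n x)) = Cmp A (\<eta> (0, act X \<alpha> x)) (far F (lift X \<alpha> x))"
    unfolding chain_map(4)[OF F a x]
    by (rule Cmp_eq_extend[OF g(4)[OF ax]]) (use g(1-3) chain_in[OF F ax] far_lift[OF F a x] in simp_all)
  then show ?thesis using cocone(5)[OF co l(1)] unfolding l(2,3) by simp
qed

text \<open>The sign -1 of the only coordinate puts the face at 1 first.\<close>

lemma boundary_1:
  assumes F: "is_functor CX A F"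
  shows "boundary A X F (Suc 0) = Sub A (chain_map A X F (face (Suc 0) (Suc 0) True)) (chain_map A X F (face (Suc 0) (Suc 0) False))"
proof -
  have f: "face (Suc 0) (Suc 0) b \<in> Hom Box 0 (Suc 0)" for b using face_Hom[of "Suc 0" "Suc 0" b] by simp
  have "bdw (Suc 0) = frag_of (face (Suc 0) (Suc 0) True) - frag_of (face (Suc 0) (Suc 0) False)" by (simp add: bdw_def frag_cmul_diff2)
  then show ?thesis
    unfolding boundary_comb[OF F] using comb_diff[OF natfam_chain_map[OF F, of "Suc 0"], of "frag_of (face (Suc 0) (Suc 0) True)" 0 "frag_of (face (Suc 0) (Suc 0) False)"]
      comb_of[OF natfam_chain_map[OF F, of "Suc 0"] f] f by simp
qed

text \<open>Any two vertices of a cube are joined by a path of edges.\<close>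

lemma vertices_connected:
  assumes F: "is_functor CX A F" and h: "h \<in> Arr A" "Dom A h = chain A X F 0" and z: "is_zero A (Cmp A h (boundary A X F (Suc 0)))"
  shows "length w = n \<Longrightarrow> Cmp A h (chain_map A X F (vertex w)) = Cmp A h (chain_map A X F (vertex (replicate n False)))"
proof (induction n arbitrary: w)
  case (Suc n)
  obtain b u where w: "w = b # u" "length u = n" using Suc.prems by (cases w) auto
  have f: "face (Suc 0) (Suc 0) b \<in> Hom Box 0 (Suc 0)" for b using face_Hom[of "Suc 0" "Suc 0" b] by simp
  note cf = chain_map(1-3)[OF F f]
  have "is_zero A (Sub A (Cmp A h (chain_map A X F (face (Suc 0) (Suc 0) True))) (Cmp A h (chain_map A X F (face (Suc 0) (Suc 0) False))))"
    using z unfolding boundary_1[OF F] using Cmp_Sub_right[of "chain_map A X F (face (Suc 0) (Suc 0) True)" "chain_map A X F (face (Suc 0) (Suc 0) False)" h] cf h by simp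
  then have e: "Cmp A h (chain_map A X F (face (Suc 0) (Suc 0) True)) = Cmp A h (chain_map A X F (face (Suc 0) (Suc 0) False))"
    using is_zero_Sub cf h by simp
  then have e': "Cmp A h (chain_map A X F (face (Suc 0) (Suc 0) b)) = Cmp A h (chain_map A X F (face (Suc 0) (Suc 0) False))" by (cases b) simp_all
  \<comment> \<open>The edge along which only the first coordinate varies. Its two ends become equal
    under h; after that the first coordinate is 0 and induction applies in the corresponding
    face.\<close>
  define \<epsilon> where "\<epsilon> = cmap (Suc 0) (Suc n) (\<lambda>xs. hd xs # u)"
  have eH: "\<epsilon> \<in> Hom Box (Suc 0) (Suc n)"
    using cubical_Hom[OF cubical.var[OF cubical_vertex[OF w(2)]]] by (simp add: \<epsilon>_def)
  have ef: "cube_comp \<epsilon> (face (Suc 0) (Suc 0) b) = vertex (b # u)" for b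
    unfolding \<epsilon>_def face_cmap vertex_def by (simp add: cube_comp_cmap w(2))
  have step: "Cmp A h (chain_map A X F (vertex (b # u))) = Cmp A (Cmp A h (chain_map A X F (face (Suc 0) (Suc 0) b))) (chain_map A X F \<epsilon>)" for b
    unfolding ef[symmetric] chain_map_comp[OF F f eH] using cf chain_map(1-3)[OF F eH] h by simp
  have d: "face (Suc n) (Suc 0) False \<in> Hom Box n (Suc n)" using face_Hom[of "Suc 0" "Suc n" False] by simp
  note cd = chain_map(1-3)[OF F d]
  have g: "Cmp A h (chain_map A X F (vertex (False # v))) = Cmp A (Cmp A h (chain_map A X F (vertex v))) (chain_map A X F (face (Suc n) (Suc 0) False))"
    if v: "length v = n" for v
  proof -
    note vH = vertex_Hom[OF v]
    have "vertex (False # v) = cube_comp (face (Suc n) (Suc 0) False) (vertex v)"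
      unfolding vertex_def face_cmap by (simp add: cube_comp_cmap v)
    then show ?thesis using chain_map_comp[OF F vH d] chain_map(1-3)[OF F vH] cd h by simp
  qed
  show ?case
    unfolding w(1) step[of b] e' step[of False, symmetric] g[OF w(2)] Suc.IH[OF w(2)] using g[of "replicate n False"] by simp
qed simp

text \<open>An arrow out of the 0-chains that agrees at both ends of every edge amounts to a cocone:
  the component at a cell is read at one of its vertices, and the choice is immaterial because edges
  connect all vertices.\<close>

lemma aug_cokernel:
  assumes F: "is_functor CX A F" and L: "is_colimit CX A F L \<eta>"
  shows "is_cokernel A (boundary A X F (Suc 0)) (aug F L \<eta>)"
proof (rule cokernelI)
  have co: "is_cocone CX A F L \<eta>" using L by (simp add: is_colimit_def)
  note g = aug[OF F co] and b = boundary_Arr[OF F, of "Suc 0"]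
  show "boundary A X F (Suc 0) \<in> Arr A" "aug F L \<eta> \<in> Arr A" "Dom A (aug F L \<eta>) = Cod A (boundary A X F (Suc 0))"
    using g b by simp_all
  have v0: "vertex (replicate n False) \<in> Hom Box 0 n" for n by (simp add: vertex_Hom)
  have eta: "\<eta> (n, x) = Cmp A (aug F L \<eta>) (Cmp A (chain_map A X F (vertex (replicate n False))) (chain_in A X F n x))" if "x \<in> cells X n" for n x
    using aug_vertex[OF F co v0 that] by simp
  have f: "face (Suc 0) (Suc 0) b \<in> Hom Box 0 (Suc 0)" for b using face_Hom[of "Suc 0" "Suc 0" b] by simp
  note cf = chain_map(1-3)[OF F f]
  have "Cmp A (aug F L \<eta>) (chain_map A X F (face (Suc 0) (Suc 0) True)) = Cmp A (aug F L \<eta>) (chain_map A X F (face (Suc 0) (Suc 0) False))"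
  proof (rule chain_ext[OF F, of _ _ "Suc 0"])
    fix x assume x: "x \<in> cells X (Suc 0)"
    show "Cmp A (Cmp A (aug F L \<eta>) (chain_map A X F (face (Suc 0) (Suc 0) True))) (chain_in A X F (Suc 0) x)
      = Cmp A (Cmp A (aug F L \<eta>) (chain_map A X F (face (Suc 0) (Suc 0) False))) (chain_in A X F (Suc 0) x)"
      using aug_vertex[OF F co f x] cf chain_in[OF F x] g by simp
  qed (use cf g in simp_all)
  then show "is_zero A (Cmp A (aug F L \<eta>) (boundary A X F (Suc 0)))"
    unfolding boundary_1[OF F] using cf g cocone(1)[OF co] chain_Obj[OF F, of "Suc 0"] by (simp add: Cmp_Sub_right)
  show "is_epi A (aug F L \<eta>)"
  proof (unfold is_epi_def, intro conjI ballI impI)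
    fix u v assume u: "u \<in> Arr A" "v \<in> Arr A"
      "Cod A u = Cod A v \<and> Dom A u = Cod A (aug F L \<eta>) \<and> Dom A v = Cod A (aug F L \<eta>) \<and> Cmp A u (aug F L \<eta>) = Cmp A v (aug F L \<eta>)"
    have d: "Cod A u = Cod A v" "Dom A u = L" "Dom A v = L" and e: "Cmp A u (aug F L \<eta>) = Cmp A v (aug F L \<eta>)" using u(3) g by auto
    show "u = v"
    proof (rule colimit_ext[OF L u(1,2) d(2,3,1) _ F])
      fix c assume "c \<in> Obj CX"
      moreover obtain n x where c: "c = (n, x)" by (cases c)
      ultimately have x: "x \<in> cells X n" by simp
      let ?k = "Cmp A (chain_map A X F (vertex (replicate n False))) (chain_in A X F n x)"
      have k: "?k \<in> Arr A" "Cod A ?k = chain A X F 0" using chain_map(1-3)[OF F v0] chain_in[OF F x] by simp_all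
      have "Cmp A u (Cmp A (aug F L \<eta>) ?k) = Cmp A (Cmp A v (aug F L \<eta>)) ?k"
        by (rule Cmp_eq_extend[OF e k(1)]) (use g u d k in simp_all)
      also have "\<dots> = Cmp A v (Cmp A (aug F L \<eta>) ?k)" by (rule assoc) (use g u d k in simp_all)
      finally show "Cmp A u (\<eta> c) = Cmp A v (\<eta> c)" unfolding c eta[OF x] .
    qed
  qed (rule g)
  fix h assume h: "h \<in> Arr A" "Dom A h = Cod A (boundary A X F (Suc 0))" "is_zero A (Cmp A h (boundary A X F (Suc 0)))"
  have h0: "Dom A h = chain A X F 0" using h b by simp
  let ?k = "\<lambda>n. chain_map A X F (vertex (replicate n False))"
  note ck = chain_map(1-3)[OF F v0]
  \<comment> \<open>The vertex with all coordinates 0 is the base point of every cell.\<close>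
  define \<mu> where "\<mu> = (\<lambda>(n, x). Cmp A h (Cmp A (?k n) (chain_in A X F n x)))"
  have "is_cocone CX A F (Cod A h) \<mu>"
    unfolding is_cocone_def
  proof (intro conjI ballI)
    show "Cod A h \<in> Obj A" using h by simp
  next
    fix c assume "c \<in> Obj CX"
    moreover obtain n x where c: "c = (n, x)" by (cases c)
    ultimately have x: "x \<in> cells X n" by simp
    show "\<mu> c \<in> Hom A (fob F c) (Cod A h)" unfolding c \<mu>_def using ck chain_in[OF F x] h h0 by (simp add: Hom_iff[of _ A])
  next
    fix f assume fA: "f \<in> Arr CX"
    obtain m y where c: "Cod CX f = (m, y)" by (cases "Cod CX f")
    obtain n \<alpha> x where a: "\<alpha> \<in> Hom Box m n" "x \<in> cells X n" "f = lift X \<alpha> x" "y = act X \<alpha> x"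
      by (rule CX_arrow_lift[OF fA c]) blast
    note ax = cubical_setD(1)[OF X a(1,2)] and ca = chain_map(1-3)[OF F a(1)] and fl = far_lift[OF F a(1,2)]
    note va = cube_comp_Hom[OF v0 a(1)]
    \<comment> \<open>A cube map need not preserve base points; it takes the base point to some
      vertex w, which connectedness brings back.\<close>
    obtain w where w: "length w = n" "cube_comp \<alpha> (vertex (replicate m False)) = vertex w" by (rule Hom_vertex[OF va])
    have "Cmp A (\<mu> (m, y)) (far F f) = Cmp A h (Cmp A (?k m) (Cmp A (chain_in A X F m (act X \<alpha> x)) (far F (lift X \<alpha> x))))"
      unfolding \<mu>_def a(3,4) using ck chain_in[OF F ax] h h0 fl by simp
    also have "\<dots> = Cmp A h (Cmp A (Cmp A (?k m) (chain_map A X F \<alpha>)) (chain_in A X F n x))"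
      unfolding chain_map(4)[OF F a(1,2), symmetric] using ck ca chain_in[OF F a(2)] by simp
    also have "\<dots> = Cmp A (Cmp A h (chain_map A X F (vertex w))) (chain_in A X F n x)"
      unfolding w(2)[symmetric] chain_map_comp[OF F v0 a(1)] using ck ca chain_in[OF F a(2)] h h0 by simp
    also have "\<dots> = \<mu> (n, x)"
      unfolding vertices_connected[OF F h(1) h0 h(3) w(1)] \<mu>_def using ck chain_in[OF F a(2)] h h0 by simp
    finally show "Cmp A (\<mu> (Cod CX f)) (far F f) = \<mu> (Dom CX f)" unfolding c using lift_Arr(2)[OF a(1,2)] a(3) by simp
  qed
  then obtain t where t: "t \<in> Arr A" "Dom A t = L" "Cod A t = Cod A h" "\<And>c. c \<in> Obj CX \<Longrightarrow> Cmp A t (\<eta> c) = \<mu> c"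
    by (rule colimit_desc[OF L]) blast
  have "Cmp A t (aug F L \<eta>) = h"
  proof (rule chain_ext[OF F, of _ _ 0])
    fix x assume x: "x \<in> cells X 0"
    have v: "vertex (replicate 0 False) = cube_id 0" by (simp add: vertex_def cube_id_cmap cmap_eq_iff)
    have "Cmp A (Cmp A t (aug F L \<eta>)) (chain_in A X F 0 x) = Cmp A t (\<eta> (0, x))" using g g(4)[OF x] t(1-3) chain_in[OF F x] by simp
    also have "\<dots> = \<mu> (0, x)" using t(4) x by simp
    also have "\<dots> = Cmp A h (chain_in A X F 0 x)" unfolding \<mu>_def using v chain_map_id[OF F] chain_in[OF F x] by simp
    finally show "Cmp A (Cmp A t (aug F L \<eta>)) (chain_in A X F 0 x) = Cmp A h (chain_in A X F 0 x)" .
  qed (use g t(1-3) h h0 in simp_all)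
  then show "\<exists>u. u \<in> Arr A \<and> Dom A u = Cod A (aug F L \<eta>) \<and> Cod A u = Cod A h \<and> Cmp A u (aug F L \<eta>) = h" using t(1-3) g by auto
qed

text \<open>No degeneracies end in degree 0, so the augmentation factors through the projection
  there; the projection in degree 1 is epi, so normalizing does not change the cokernel.\<close>

lemma norm_aug:
  assumes F: "is_functor CX A F" and L: "is_colimit CX A F L \<eta>"
  obtains q where "is_cokernel A (norm_boundary A X F (Suc 0)) q" "Cod A q = L" "Cmp A q (norm_proj A X F 0) = aug F L \<eta>"
proof -
  note k = aug_cokernel[OF F L]
  note dk = cokernelD[OF k]
  have co: "is_cocone CX A F L \<eta>" using L by (simp add: is_colimit_def)
  note g = aug[OF F co] and p = norm_proj(2-5)[OF F] and b = boundary_Arr[OF F, of "Suc 0"] and nb = norm_boundary_Arr[OF F, of 0]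
  obtain q where q: "q \<in> Arr A" "Dom A q = norm_chain A X F 0" "Cod A q = Cod A (aug F L \<eta>)" "Cmp A q (norm_proj A X F 0) = aug F L \<eta>"
    by (rule norm_desc[OF F g(1,2)]) simp
  have shift: "Cmp A (Cmp A u (norm_boundary A X F (Suc 0))) (norm_proj A X F (Suc 0)) = Cmp A (Cmp A u (norm_proj A X F 0)) (boundary A X F (Suc 0))"
    if "u \<in> Arr A" "Dom A u = norm_chain A X F 0" for u
    using that nb p b by simp
  have "is_cokernel A (norm_boundary A X F (Suc 0)) q"
  proof (rule cokernelI)
    have "is_zero A (Cmp A (Cmp A q (norm_boundary A X F (Suc 0))) (norm_proj A X F (Suc 0)))"
      unfolding shift[OF q(1,2)] q(4) by (rule dk)
    then show "is_zero A (Cmp A q (norm_boundary A X F (Suc 0)))"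
      using epi_zero[OF p(4)[of "Suc 0"], of "Cmp A q (norm_boundary A X F (Suc 0))"] q nb p by simp
    show "is_epi A q" by (rule epi_left[OF q(1) p(1)[of 0]]) (use q p dk in simp_all)
    fix h assume h: "h \<in> Arr A" "Dom A h = Cod A (norm_boundary A X F (Suc 0))" "is_zero A (Cmp A h (norm_boundary A X F (Suc 0)))"
    have h0: "Dom A h = norm_chain A X F 0" using h nb by simp
    have z: "is_zero A (Cmp A (Cmp A h (norm_proj A X F 0)) (boundary A X F (Suc 0)))"
      unfolding shift[OF h(1) h0, symmetric] by (rule is_zero_Cmp_left[OF h(3)]) (use h h0 nb p in simp_all)
    obtain t where t: "t \<in> Arr A" "Dom A t = Cod A (aug F L \<eta>)" "Cod A t = Cod A (Cmp A h (norm_proj A X F 0))" "Cmp A t (aug F L \<eta>) = Cmp A h (norm_proj A X F 0)"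
      by (rule cokernel_desc[OF k _ _ z]) (use h h0 p b in simp_all)
    have "Cmp A t q = h"
      by (rule norm_ext[OF F, where n = 0]) (use t q h h0 p in simp_all)
    then show "\<exists>u. u \<in> Arr A \<and> Dom A u = Cod A q \<and> Cod A u = Cod A h \<and> Cmp A u q = h" using t q h h0 p by auto
  qed (use q nb in simp_all)
  then show ?thesis using that q g by simp
qed

lemma aug_natural:
  assumes t: "is_nat_trans CX A F G \<tau>" and F: "is_cocone CX A F L \<eta>" and G: "is_cocone CX A G M \<theta>"
    and l: "l \<in> Hom A L M" "\<And>c. c \<in> Obj CX \<Longrightarrow> Cmp A l (\<eta> c) = Cmp A (\<theta> c) (\<tau> c)"
  shows "Cmp A l (aug F L \<eta>) = Cmp A (aug G M \<theta>) (chain_trans F G \<tau> 0)"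
proof -
  note gF = aug[OF nat_transD(1)[OF t] F] and gG = aug[OF nat_transD(2)[OF t] G] and c = chain_trans[OF t]
  show ?thesis
  proof (rule chain_ext[OF nat_transD(1)[OF t], of _ _ 0])
    fix x assume x: "x \<in> cells X 0"
    note iF = chain_in[OF nat_transD(1)[OF t] x] and iG = chain_in[OF nat_transD(2)[OF t] x]
    have tx: "\<tau> (0, x) \<in> Arr A" "Dom A (\<tau> (0, x)) = fob F (0, x)" "Cod A (\<tau> (0, x)) = fob G (0, x)"
      using nat_transD(3-5)[OF t, of "(0, x)"] x by simp_all
    have lA: "l \<in> Arr A" "Dom A l = L" "Cod A l = M" using l(1) by (simp_all add: Hom_iff[of _ A])
    have "Cmp A (Cmp A l (aug F L \<eta>)) (chain_in A X F 0 x) = Cmp A l (\<eta> (0, x))" using gF(1-3) gF(4)[OF x] lA iF by simp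
    also have "\<dots> = Cmp A (\<theta> (0, x)) (\<tau> (0, x))" by (rule l(2)) (use x in simp)
    also have "\<dots> = Cmp A (aug G M \<theta>) (Cmp A (chain_in A X G 0 x) (\<tau> (0, x)))"
      using Cmp_eq_extend[OF gG(4)[OF x] tx(1)] tx iG gG(1-3) by simp
    also have "\<dots> = Cmp A (Cmp A (aug G M \<theta>) (chain_trans F G \<tau> 0)) (chain_in A X F 0 x)"
      unfolding c(4)[OF x, symmetric] by (rule assoc[symmetric]) (use c(1-3) iF gG(1-3) in simp_all)
    finally show "Cmp A (Cmp A l (aug F L \<eta>)) (chain_in A X F 0 x) = Cmp A (Cmp A (aug G M \<theta>) (chain_trans F G \<tau> 0)) (chain_in A X F 0 x)" .
  qed (use gF(1-3) gG(1-3) c(1-3) l(1) in \<open>simp_all add: Hom_iff[of _ A]\<close>)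
qed

text \<open>Identifies the arrow between colimits with the one induced on cokernels of the
  normalized boundaries. This is the naturality used in the first induction step.\<close>

lemma norm_aug_natural:
  assumes t: "is_nat_trans CX A F G \<tau>" and F: "is_cocone CX A F L \<eta>" and G: "is_cocone CX A G M \<theta>"
    and l: "l \<in> Hom A L M" "\<And>c. c \<in> Obj CX \<Longrightarrow> Cmp A l (\<eta> c) = Cmp A (\<theta> c) (\<tau> c)"
    and q: "q \<in> Arr A" "Dom A q = norm_chain A X F 0" "Cod A q = L" "Cmp A q (norm_proj A X F 0) = aug F L \<eta>"
    and r: "r \<in> Arr A" "Dom A r = norm_chain A X G 0" "Cod A r = M" "Cmp A r (norm_proj A X G 0) = aug G M \<theta>"
  shows "Cmp A l q = Cmp A r (norm_trans F G \<tau> 0)"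
proof -
  note pF = norm_proj(2-4)[OF nat_transD(1)[OF t], of 0] and pG = norm_proj(2-4)[OF nat_transD(2)[OF t], of 0]
  note n = norm_trans[OF t, of 0] and c = chain_trans(1-3)[OF t, of 0]
  have lA: "l \<in> Arr A" "Dom A l = L" "Cod A l = M" using l(1) by (simp_all add: Hom_iff[of _ A])
  have "Cmp A (Cmp A l q) (norm_proj A X F 0) = Cmp A l (aug F L \<eta>)" using q lA pF by simp
  also have "\<dots> = Cmp A (Cmp A r (norm_proj A X G 0)) (chain_trans F G \<tau> 0)" unfolding r(4) by (rule aug_natural[OF t F G l])
  also have "\<dots> = Cmp A (Cmp A r (norm_trans F G \<tau> 0)) (norm_proj A X F 0)" using n c pG pF r(1-3) by simp
  finally have e: "Cmp A (Cmp A l q) (norm_proj A X F 0) = Cmp A (Cmp A r (norm_trans F G \<tau> 0)) (norm_proj A X F 0)" .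
  show ?thesis by (rule norm_ext[OF nat_transD(1)[OF t] _ _ _ _ _ e]) (use n q(1-3) r(1-3) lA in simp_all)
qed

end

context abelian_category
begin

text \<open>The identity lifts to the kernel of a zero arrow, so everything is a cycle, and
  composing with the kernel turns q into a quotient of the cycles by the boundaries.\<close>

lemma homology_zero_right:
  assumes q: "is_cokernel A f q" and g: "g \<in> Arr A" "Dom A g = Cod A f" "is_zero A g"
  shows "isomorphic A (homology_object A f g) (Cod A q)"
proof -
  note dq = cokernelD[OF q]
  have z: "is_zero A (Cmp A g f)" by (rule is_zero_Cmp_left[OF g(3)]) (use dq g in simp_all)
  obtain k \<pi> where k: "is_kernel A g k" and \<pi>: "is_epi A \<pi>" "Dom A \<pi> = Dom A k" "Cod A \<pi> = homology_object A f g"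
    and im: "\<And>u. u \<in> Arr A \<Longrightarrow> Cod A u = Dom A k \<Longrightarrow> is_zero A (Cmp A \<pi> u) \<longleftrightarrow> in_image A f (Cmp A k u)"
    by (rule homology_object[OF dq(1) g(1) g(2)[symmetric] z]) blast
  note dk = kernelD[OF k]
  obtain v where v: "v \<in> Arr A" "Dom A v = Dom A (Ide A (Dom A g))" "Cod A v = Dom A k" "Cmp A k v = Ide A (Dom A g)"
    by (rule kernel_lift[OF k, of "Ide A (Dom A g)"]) (use g Obj_Dom[OF g(1)] in simp_all)
  have ke: "is_epi A k" by (rule epi_left[OF dk(2) v(1,3)]) (use v epi_Ide g Obj_Dom[OF g(1)] in simp)
  have "isomorphic A (Cod A \<pi>) (Cod A (Cmp A q k))"
  proof (rule epis_same_kernel_iso[OF \<pi>(1)])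
    show "is_epi A (Cmp A q k)" by (rule epi_Cmp[OF ke dq(5)]) (use dq dk g in simp)
    show "Dom A \<pi> = Dom A (Cmp A q k)" using \<pi> dq dk g by simp
    fix u assume u: "u \<in> Arr A" "Cod A u = Dom A \<pi>"
    have "is_zero A (Cmp A q (Cmp A k u)) \<longleftrightarrow> in_image A f (Cmp A k u)"
      by (rule cokernel_in_image[OF q]) (use u \<pi> dk dq g in simp_all)
    then show "is_zero A (Cmp A \<pi> u) \<longleftrightarrow> is_zero A (Cmp A (Cmp A q k) u)" using im[OF u(1)] u \<pi> dk dq g by simp
  qed
  then show ?thesis using \<pi> dq dk g by simp
qed

end

section \<open>Comparison with the satellites\<close>

context cubical_coefficients
begin

text \<open>The induction is over all coefficient systems at once, as the step passes from F to the
  kernel K of its counit.\<close>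

lemma cubical_homology_iso_satellites:
  assumes L: "is_colimit_functor CX A L" and sat: "are_left_satellites (Fun CX A) A L T \<delta>"
  shows "is_functor CX A F \<Longrightarrow> isomorphic A (cubical_homology A X F n) (fob (T n) F)"
proof (induction n arbitrary: F)
  have T0: "T 0 = L" using sat by (simp add: are_left_satellites_def)
  have Lf: "is_functor (Fun CX A) A L" using L by (simp add: is_colimit_functor_def)
  obtain \<eta> where eta0: "\<forall>F\<in>Obj (Fun CX A). is_colimit CX A F (fob L F) (\<eta> F)"
    and nat0: "\<forall>F G \<tau>. (F, G, \<tau>) \<in> Arr (Fun CX A) \<longrightarrow> (\<forall>c\<in>Obj CX. Cmp A (far L (F, G, \<tau>)) (\<eta> F c) = Cmp A (\<eta> G c) (\<tau> c))"
    using L unfolding is_colimit_functor_def by (elim conjE exE)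
  have eta: "is_colimit CX A F (fob L F) (\<eta> F)" if "is_functor CX A F" for F
    using bspec[OF eta0, of F] that by simp
  have nat: "Cmp A (far L (F, G, \<tau>)) (\<eta> F c) = Cmp A (\<eta> G c) (\<tau> c)" if "is_nat_trans CX A F G \<tau>" "c \<in> Obj CX" for F G \<tau> c
    using nat0 that by simp
  have co: "is_cocone CX A F (fob L F) (\<eta> F)" if "is_functor CX A F" for F
    using eta[OF that] by (simp add: is_colimit_def)
  {
    case 0
    obtain q where q: "is_cokernel A (norm_boundary A X F (Suc 0)) q" "Cod A q = fob L F" by (rule norm_aug[OF 0 eta[OF 0]])
    show ?case
      using homology_zero_right[OF q(1) norm_boundary_0(1)[OF 0] _ norm_boundary_0(3)[OF 0]] norm_boundary_0(2)[OF 0] norm_boundary_Arr(3)[OF 0, of 0]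
      by (simp add: cubical_homology_def T0 q(2))
  next
    case (Suc n)
    note F = Suc.prems and IH = Suc.IH
    let ?P = "Pf F"
    note e = eps_nat_trans[OF F]
    obtain K \<iota> where i: "is_nat_trans CX A K ?P \<iota>" and ker: "\<And>c. c \<in> Obj CX \<Longrightarrow> is_kernel A (eps F c) (\<iota> c)"
      by (rule pointwise_kernel_ex[OF e]) blast
    have se: "short_exact A (\<iota> c) (eps F c)" if "c \<in> Obj CX" for c
      unfolding short_exact_def using ker[OF that] epi_cokernel_of_kernel[OF eps_epi[OF F that] ker[OF that]] by blast
    note K = nat_transD(1)[OF i] and P = Pf_functor[OF F]
    let ?f = "norm_trans K ?P \<iota>" and ?g = "norm_trans ?P F (eps F)"
    note nse = norm_short_exact[OF i e se]
    have fH: "?f i \<in> Hom A (norm_chain A X K i) (norm_chain A X ?P i)" and gH: "?g i \<in> Hom A (norm_chain A X ?P i) (norm_chain A X F i)" for i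
      using norm_trans(1-3)[OF i] norm_trans(1-3)[OF e] by (simp_all add: Hom_iff[of _ A])
    have bH: "norm_boundary A X H (Suc i) \<in> Hom A (norm_chain A X H (Suc i)) (norm_chain A X H i)" if "is_functor CX A H" for H i
      using norm_boundary_Arr(1-3)[OF that] by (simp add: Hom_iff[of _ A])
    \<comment> \<open>The cokernels are left free here: for n = 0 they will be colimits, for n > 0
      arbitrary ones.\<close>
    have conn: "isomorphic A (cubical_homology A X F (Suc n)) (Dom A \<kappa>)"
      if q': "is_cokernel A (norm_boundary A X K (Suc n)) q'" and q: "is_cokernel A (norm_boundary A X ?P (Suc n)) q"
        and m: "m \<in> Hom A (Cod A q') (Cod A q)" "Cmp A m q' = Cmp A q (?f n)" and k: "is_kernel A m \<kappa>" for q' q m \<kappa>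
      unfolding cubical_homology_def
      by (rule connecting_iso[OF fH fH gH gH gH bH[OF K] bH[OF P] bH[OF P] bH[OF F] bH[OF F]
            norm_trans_norm_boundary[OF i, symmetric] norm_trans_norm_boundary[OF e, symmetric] norm_trans_norm_boundary[OF e, symmetric]
            nse(2) nse(2) kernel_exact_pair[OF nse(1)] nse(1) Pf_acyclic[OF F] norm_boundary_boundary[OF F] q' q m k])
    show ?case
    proof (cases n)
      case 0
      obtain q' where q': "is_cokernel A (norm_boundary A X K (Suc 0)) q'" "Cod A q' = fob L K" "Cmp A q' (norm_proj A X K 0) = aug K (fob L K) (\<eta> K)"
        by (rule norm_aug[OF K eta[OF K]])
      obtain q where q: "is_cokernel A (norm_boundary A X ?P (Suc 0)) q" "Cod A q = fob L ?P" "Cmp A q (norm_proj A X ?P 0) = aug ?P (fob L ?P) (\<eta> ?P)"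
        by (rule norm_aug[OF P eta[OF P]])
      have m: "far L (K, ?P, \<iota>) \<in> Hom A (fob L K) (fob L ?P)"
        using functorD(2-4)[OF Lf, of "(K, ?P, \<iota>)"] i by (simp add: Hom_iff[of _ A])
      \<comment> \<open>The induced arrow is L applied to \<open>\<iota>\<close>, whose kernel is
        also the satellite in degree 1.\<close>
      have mq: "Cmp A (far L (K, ?P, \<iota>)) q' = Cmp A q (?f 0)"
        by (rule norm_aug_natural[OF i co[OF K] co[OF P] m nat[OF i]])
          (use q q' cokernelD(2,3)[OF q(1)] cokernelD(2,3)[OF q'(1)] norm_boundary_Arr(3)[OF K] norm_boundary_Arr(3)[OF P] in simp_all)
      obtain d where d: "is_kernel A (far (T 0) (K, ?P, \<iota>)) d" "Dom A d = fob (T (Suc 0)) F"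
        using satellite_kernel(2)[OF L sat F i ker, of 0] by blast
      show ?thesis using conn[unfolded 0, OF q'(1) q(1) _ mq d(1)[unfolded T0]] m unfolding q(2) q'(2) d(2) 0 by blast
    next
      case (Suc k)
      define q' where "q' = cokernel_choice A (norm_boundary A X K (Suc n))"
      define q where "q = cokernel_choice A (norm_boundary A X ?P (Suc n))"
      have q': "is_cokernel A (norm_boundary A X K (Suc n)) q'" unfolding q'_def by (rule cokernel_choice[OF norm_boundary_Arr(1)[OF K]])
      have q: "is_cokernel A (norm_boundary A X ?P (Suc n)) q" unfolding q_def by (rule cokernel_choice[OF norm_boundary_Arr(1)[OF P]])
      note dq' = cokernelD[OF q'] and dq = cokernelD[OF q]
      note bK = norm_boundary_Arr(1-3)[OF K] and bP = norm_boundary_Arr(1-3)[OF P] and fA = norm_trans(1-3)[OF i]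
      have "is_zero A (Cmp A q (Cmp A (norm_boundary A X ?P (Suc n)) (?f (Suc n))))"
        by (rule zero_extend[OF dq(4)]) (use dq bP fA in simp_all)
      then have z: "is_zero A (Cmp A (Cmp A q (?f n)) (norm_boundary A X K (Suc n)))"
        using norm_trans_norm_boundary[OF i, of n] dq bP bK fA by simp
      obtain m where m: "m \<in> Arr A" "Dom A m = Cod A q'" "Cod A m = Cod A (Cmp A q (?f n))" "Cmp A m q' = Cmp A q (?f n)"
        by (rule cokernel_desc[OF q' _ _ z]) (use dq bP bK fA in simp_all)
      have mH: "m \<in> Hom A (Cod A q') (Cod A q)" using m dq bP fA by (simp add: Hom_iff[of _ A])
      note k = kernel_choice[OF m(1)]
      \<comment> \<open>In positive degree acyclicity of \<open>Pf F\<close> identifies the same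
        kernel with the homology of K, so homology shifts exactly as the satellites do.\<close>
      have "isomorphic A (cubical_homology A X K n) (Dom A (kernel_choice A m))"
        unfolding cubical_homology_def Suc
        by (rule homology_iso_kernel[OF fH fH bH[OF K] bH[OF K] bH[OF P] bH[OF P] norm_trans_norm_boundary[OF i, symmetric]
              kernelD(5)[OF nse(1)] norm_boundary_boundary[OF K] Pf_acyclic[OF F] q'[unfolded Suc] q[unfolded Suc] mH m(4)[unfolded Suc] k])
      then have "isomorphic A (cubical_homology A X F (Suc n)) (cubical_homology A X K n)"
        by (rule iso_trans[OF conn[OF q' q mH m(4) k] iso_sym])
      from iso_trans[OF iso_trans[OF this IH[OF K]] iso_sym[OF satellite_shift[OF L sat F i ker]]] show ?thesis by (simp add: Suc)
    qed
  }
qed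

end

theorem theorem5p1:
  fixes A :: "('o, 'm) pcat"
    and X :: "'s cset"
    and F :: "('s, 'o, 'm) csystem"
  assumes "infinite (UNIV :: 's set)"
    and "AB4_category A TYPE('s)"
    and "is_cubical_set X"
    and "is_functor (opc (elts X)) A F"
    and "is_colimit_functor (opc (elts X)) A L"
    and "are_left_satellites (Fun (opc (elts X)) A) A L T \<delta>"
  shows "\<forall>n. isomorphic A (cubical_homology A X F n) (fob (T n) F)"
proof
  fix n
  interpret abelian_category A using assms(2) by (simp add: AB4_category_def)
  interpret cubical_coefficients A "TYPE('s)" X by unfold_locales (rule assms)+
  show "isomorphic A (cubical_homology A X F n) (fob (T n) F)"
    by (rule cubical_homology_iso_satellites[OF assms(5,6,4)])
qed

end
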